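(* Let $\rho:G\to\mathrm{GL}_F(V)$ be a finite dimensional $F$-linear representation of $G=G(L/K)$ and $n$ a positive integer. Then $$L(C^{\otimes n},\rho)=\prod_{\mathfrak p\in\mathrm{Max}(\mathcal O_K)}\det{}_{F[[t^{-1}]]}\Big(1-\frac{\rho(\mathrm{Frob}_{\mathfrak P})}{|\kappa_{\mathfrak p}|_{k[t]}^n},\ V_{I_{\mathfrak P}}[[t^{-1}]]\Big)^{-1}\in1+t^{-1}F[[t^{-1}]]$$ and $$\frac{L(n,\rho)}{L(C^{\otimes n},\rho)}\in F(t)^\times.$$
   Context: Let $k$ be a finite field with $q$ elements, $F$ a finite extension of $k$, $K$ a finite extension of $k(t)$, $L/K$ a finite Galois extension with group $G$; $\mathcal O_K,\mathcal O_L$ are the integral closures of $k[t]$ in $K,L$, and $z$ is the image of $t$ in $\mathcal O_K$ and $\mathcal O_L$. For each maximal ideal $\mathfrak p$ of $\mathcal O_K$ choose a prime $\mathfrak P$ of $\mathcal O_L$ above $\mathfrak p$, with residue fields $\kappa_{\mathfrak p},\kappa_{\mathfrak P}$, decomposition group $G_{\mathfrak P}$, inertia group $I_{\mathfrak P}$; $\mathrm{Frob}_{\mathfrak P}\in G_{\mathfrak P}/I_{\mathfrak P}\simeq G(\kappa_{\mathfrak P}/\kappa_{\mathfrak p})$ is the element acting as $x\mapsto x^{\#\kappa_{\mathfrak p}}$. For a finite $F[t]$-module $M$, $|M|_{F[t]}=\det_{F[t]}(1\otimes t-t\otimes1,\ M\otimes_FF[t])$ is the characteristic polynomial, in the variable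 $t$, of $t$ acting on $M$. In particular $|\kappa_{\mathfrak p}|_{k[t]}=\prod_{\delta\in G(\kappa_{\mathfrak p}/k)}(t-\delta(z))\in k[t]$. For a $k$-module $W$, $W[[t^{-1}]]=W\widehat\otimes_kk[[t^{-1}]]$. $V_{I_{\mathfrak P}}=V/{}_{I_{\mathfrak P}}V$ is the space of coinvariants, ${}_{I_{\mathfrak P}}V$ being the $F[G_{\mathfrak P}]$-submodule of $V$ generated by the $\rho(g)v-v$, $g\in I_{\mathfrak P}$, $v\in V$; $G_{\mathfrak P}/I_{\mathfrak P}$ acts on it. $C^{\otimes n}$ is the $n$-th tensor power of the Carlitz module: for an $\mathcal O_K$-algebra $B$, $C^{\otimes n}(B)$ is $B^n$ with $t$ acting by $(x_1,\dots,x_n)\mapsto(zx_1+x_2,\dots,zx_{n-1}+x_n,zx_n+x_1^q)$, and $\mathrm{Lie}(C^{\otimes n})(B)$ is $B^n$ with $t$ acting by $(x_1,\dots,x_n)\mapsto(zx_1+x_2,\dots,zx_{n-1}+x_n,zx_n)$. The $L$-values are the convergent products $$L(n,\rho)=\prod_{\mathfrak p\in\mathrm{Max}(\mathcal O_K)}\det{}_{F[[t^{-1}]]}\Big(1-\frac{\rho(\mathrm{Frob}_{\mathfrak P})}{|\kappa_{\mathfrak p}|_{k[t]}^n},\ V^{I_{\mathfrak P}}[[t^{-1}]]\Big)^{-1},$$ $$L(C^{\otimes n},\rho)=\prod_{\mathfrak p\in\mathrm{Max}(\mathcal O_K)}\frac{|\mathrm{Hom}_{k[G]}(V,\mathrm{Lie}(C^{\otimes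 n})(\mathcal O_L/\mathfrak p\mathcal O_L))|_{F[t]}}{|\mathrm{Hom}_{k[G]}(V,C^{\otimes n}(\mathcal O_L/\mathfrak p\mathcal O_L))|_{F[t]}},$$ where on $\mathrm{Hom}_{k[G]}(V,M)$ the field $F$ acts through $V$ and $t$ acts through $M$. *)

theory Defs
  imports
    "Jordan_Normal_Form.Char_Poly"
    "Jordan_Normal_Form.VS_Connect"
    "HOL-Algebra.QuotRing"
    "HOL-Algebra.Embedded_Algebras"
    "HOL-Computational_Algebra.Formal_Laurent_Series"
begin

text \<open>
  Conventions. The fields \<open>k\<close>, \<open>F\<close>, \<open>L\<close> are types \<open>'k\<close>, \<open>'f\<close>, \<open>'l\<close>, with embeddings
  \<open>iF :: 'k \<Rightarrow> 'f\<close> and \<open>iL :: 'k \<Rightarrow> 'l\<close>; \<open>K\<close> is a subfield of \<open>'l\<close>. Modules and quotient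
  rings are HOL-Algebra records.
  The field \<open>F((1/t))\<close> is \<open>'f fls\<close> with \<open>fls_X\<close> standing for \<open>1/t\<close>, hence \<open>fls_X_inv\<close> for \<open>t\<close>.
\<close>

section \<open>Endomorphisms of finite dimensional vector spaces\<close>

definition ordered_basis :: "('f::field, 'm) module \<Rightarrow> 'm list \<Rightarrow> bool" where
  "ordered_basis M bs \<longleftrightarrow> distinct bs \<and> vectorspace.basis class_ring M (set bs)"

definition basis_coeffs :: "('f::field, 'm) module \<Rightarrow> 'm set \<Rightarrow> 'm \<Rightarrow> 'm \<Rightarrow> 'f" where
  "basis_coeffs M B x = (THE a. a \<in> B \<rightarrow>\<^sub>E UNIV \<and> x = module.lincomb M a B)"

definition endo_mat_wrt :: "('f::field, 'm) module \<Rightarrow> 'm list \<Rightarrow> ('m \<Rightarrow> 'm) \<Rightarrow> 'f mat" where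
  "endo_mat_wrt M bs \<phi> =
     mat (length bs) (length bs) (\<lambda>(i, j). basis_coeffs M (set bs) (\<phi> (bs ! j)) (bs ! i))"

definition endo_mat :: "('f::field, 'm) module \<Rightarrow> ('m \<Rightarrow> 'm) \<Rightarrow> 'f mat" where
  "endo_mat M \<phi> = endo_mat_wrt M (SOME bs. ordered_basis M bs) \<phi>"

text \<open>\<open>|M|\<close> for a module over the polynomial ring in \<open>t\<close>, given as a vector space \<open>M\<close>
  together with the endomorphism \<open>\<tau>\<close> by which \<open>t\<close> acts.\<close>

definition mod_char_poly :: "('f::field, 'm) module \<Rightarrow> ('m \<Rightarrow> 'm) \<Rightarrow> 'f poly" where
  "mod_char_poly M \<tau> = char_poly (endo_mat M \<tau>)"

text \<open>The determinant of \<open>1 - c \<phi>\<close> on \<open>M[[1/t]]\<close>, which is free over \<open>F[[1/t]]\<close> on any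
  \<open>F\<close>-basis of \<open>M\<close>. For \<open>c\<close> in \<open>F[[1/t]]\<close> it makes no difference that the determinant is
  evaluated in the field \<open>F((1/t))\<close>.\<close>

definition det_one_minus :: "'f::field fls \<Rightarrow> ('f, 'm) module \<Rightarrow> ('m \<Rightarrow> 'm) \<Rightarrow> 'f fls" where
  "det_one_minus c M \<phi> =
     (let A = endo_mat M \<phi>
      in Determinant.det (1\<^sub>m (dim_row A) - c \<cdot>\<^sub>m map_mat fls_const A))"

section \<open>Laurent series in \<open>1/t\<close>\<close>

definition at_t :: "'f::field poly \<Rightarrow> 'f fls" where
  "at_t P = poly (map_poly fls_const P) fls_X_inv"

definition one_units :: "'f::field fls set" where
  "one_units = {1 + fls_X * fps_to_fls g | g. True}"

definition nonzero_ratfuns :: "'f::field fls set" where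
  "nonzero_ratfuns = {at_t P / at_t Q | P Q. P \<noteq> 0 \<and> Q \<noteq> 0}"

text \<open>Unordered infinite products, for the \<open>1/t\<close>-adic topology.\<close>

definition uprod_convergent :: "('i \<Rightarrow> 'f::field fls) \<Rightarrow> 'i set \<Rightarrow> bool" where
  "uprod_convergent f A \<longleftrightarrow> (\<exists>l. ((\<lambda>S. prod f S) \<longlongrightarrow> l) (finite_subsets_at_top A))"

definition uprod :: "('i \<Rightarrow> 'f::field fls) \<Rightarrow> 'i set \<Rightarrow> 'f fls" where
  "uprod f A = Lim (finite_subsets_at_top A) (\<lambda>S. prod f S)"

section \<open>The fields and their rings of integers\<close>

definition finite_extension :: "'a::field set \<Rightarrow> 'a set \<Rightarrow> bool" where
  "finite_extension A B \<longleftrightarrow> subfield A class_ring \<and> subfield B class_ring \<and> A \<subseteq> B \<and>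
     ring.finite_dimension class_ring A B"

definition eval_at :: "('k::field \<Rightarrow> 'l::field) \<Rightarrow> 'l \<Rightarrow> 'k poly \<Rightarrow> 'l" where
  "eval_at iL z a = poly (map_poly iL a) z"

definition poly_image :: "('k::field \<Rightarrow> 'l::field) \<Rightarrow> 'l \<Rightarrow> 'l set" where
  "poly_image iL z = range (eval_at iL z)"

definition ratfun_image :: "('k::field \<Rightarrow> 'l::field) \<Rightarrow> 'l \<Rightarrow> 'l set" where
  "ratfun_image iL z = {eval_at iL z a / eval_at iL z b | a b. b \<noteq> 0}"

definition integral_closure_in :: "'l::field set \<Rightarrow> 'l set \<Rightarrow> 'l set" where
  "integral_closure_in R E =
     {x \<in> E. \<exists>a. Polynomial.lead_coeff a = 1 \<and> (\<forall>i. Polynomial.coeff a i \<in> R) \<and> poly a x = 0}"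

text \<open>The integral closure of \<open>k[t]\<close> in \<open>E\<close>, as a ring: the ring of integers of \<open>K\<close> for \<open>E = K\<close>
  and that of \<open>L\<close> for \<open>E = UNIV\<close>.\<close>

definition ints :: "('k::field \<Rightarrow> 'l::field) \<Rightarrow> 'l \<Rightarrow> 'l set \<Rightarrow> 'l ring" where
  "ints iL z E = class_ring\<lparr>carrier := integral_closure_in (poly_image iL z) E\<rparr>"

definition max_ideals :: "'l ring \<Rightarrow> 'l set set" where
  "max_ideals A = {p. maximalideal p A}"

definition primes_above :: "'l ring \<Rightarrow> 'l ring \<Rightarrow> 'l set \<Rightarrow> 'l set set" where
  "primes_above A B p = {P. primeideal P B \<and> P \<inter> carrier A = p}"

definition Gal :: "'l::field set \<Rightarrow> ('l \<Rightarrow> 'l) set" where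
  "Gal K = {\<sigma>. field_hom \<sigma> \<and> bij \<sigma> \<and> (\<forall>x\<in>K. \<sigma> x = x)}"

definition finite_galois :: "'l::field set \<Rightarrow> bool" where
  "finite_galois K \<longleftrightarrow> finite_extension K UNIV \<and> {x. \<forall>\<sigma>\<in>Gal K. \<sigma> x = x} = K"

definition decomposition_group :: "'l::field set \<Rightarrow> 'l set \<Rightarrow> ('l \<Rightarrow> 'l) set" where
  "decomposition_group K P = {\<sigma> \<in> Gal K. \<sigma> ` P = P}"

definition inertia_group :: "'l::field ring \<Rightarrow> 'l set \<Rightarrow> 'l set \<Rightarrow> ('l \<Rightarrow> 'l) set" where
  "inertia_group B K P = {\<sigma> \<in> decomposition_group K P. \<forall>x\<in>carrier B. \<sigma> x - x \<in> P}"

text \<open>The Frobenius is a coset of the inertia group; its action on invariants and on coinvariants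
  under inertia is that of any element of this coset.\<close>

definition frobenius_coset ::
    "'l::field ring \<Rightarrow> 'l ring \<Rightarrow> 'l set \<Rightarrow> 'l set \<Rightarrow> 'l set \<Rightarrow> ('l \<Rightarrow> 'l) set" where
  "frobenius_coset A B K p P =
     {\<sigma> \<in> decomposition_group K P. \<forall>x\<in>carrier B. \<sigma> x - x ^ card (carrier (A Quot p)) \<in> P}"

definition frobenius ::
    "'l::field ring \<Rightarrow> 'l ring \<Rightarrow> 'l set \<Rightarrow> 'l set \<Rightarrow> 'l set \<Rightarrow> 'l \<Rightarrow> 'l" where
  "frobenius A B K p P = (SOME \<sigma>. \<sigma> \<in> frobenius_coset A B K p P)"

text \<open>A quotient of a ring of integers as a \<open>k\<close>-vector space.\<close>

definition quot_space ::
    "('k::field \<Rightarrow> 'l::field) \<Rightarrow> 'l ring \<Rightarrow> 'l set \<Rightarrow> ('k, 'l set) module" where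
  "quot_space iL A I =
     \<lparr>carrier = carrier (A Quot I), mult = mult (A Quot I), one = one (A Quot I),
      zero = zero (A Quot I), add = add (A Quot I),
      smult = (\<lambda>c x. (I +>\<^bsub>A\<^esub> iL c) \<otimes>\<^bsub>A Quot I\<^esub> x)\<rparr>"

text \<open>\<open>|\<kappa>\<^sub>p|\<close>, a polynomial over \<open>k\<close>.\<close>

definition residue_char_poly ::
    "('k::field \<Rightarrow> 'l::field) \<Rightarrow> 'l \<Rightarrow> 'l ring \<Rightarrow> 'l set \<Rightarrow> 'k poly" where
  "residue_char_poly iL z A p =
     mod_char_poly (quot_space iL A p) (\<lambda>x. (p +>\<^bsub>A\<^esub> z) \<otimes>\<^bsub>A Quot p\<^esub> x)"

section \<open>Representations, invariants and coinvariants\<close>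

definition representation ::
    "('l \<Rightarrow> 'l) set \<Rightarrow> ('f::field, 'v) module \<Rightarrow> (('l \<Rightarrow> 'l) \<Rightarrow> 'v \<Rightarrow> 'v) \<Rightarrow> bool" where
  "representation G V \<rho> \<longleftrightarrow>
     (\<forall>g\<in>G. \<rho> g \<in> LinearCombinations.module_hom class_ring V V) \<and>
     (\<forall>v\<in>carrier V. \<rho> id v = v) \<and>
     (\<forall>g\<in>G. \<forall>h\<in>G. \<forall>v\<in>carrier V. \<rho> (g \<circ> h) v = \<rho> g (\<rho> h v))"

definition invariants ::
    "('f::field, 'v) module \<Rightarrow> ('g \<Rightarrow> 'v \<Rightarrow> 'v) \<Rightarrow> 'g set \<Rightarrow> ('f, 'v) module" where
  "invariants V \<rho> I = V\<lparr>carrier := {v \<in> carrier V. \<forall>g\<in>I. \<rho> g v = v}\<rparr>"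

definition generated_submodule ::
    "('f::field, 'v) module \<Rightarrow> ('g \<Rightarrow> 'v \<Rightarrow> 'v) \<Rightarrow> 'g set \<Rightarrow> 'v set \<Rightarrow> 'v set" where
  "generated_submodule V \<rho> D S =
     \<Inter>{U. LinearCombinations.submodule class_ring U V \<and> (\<forall>g\<in>D. \<rho> g ` U \<subseteq> U) \<and> S \<subseteq> U}"

definition augmentation ::
    "('f::field, 'v) module \<Rightarrow> ('g \<Rightarrow> 'v \<Rightarrow> 'v) \<Rightarrow> 'g set \<Rightarrow> 'g set \<Rightarrow> 'v set" where
  "augmentation V \<rho> D I =
     generated_submodule V \<rho> D {\<rho> g v \<ominus>\<^bsub>V\<^esub> v | g v. g \<in> I \<and> v \<in> carrier V}"

text \<open>The quotient \<open>V/U\<close>. No products are used, so the ring fields of the record are arbitrary.\<close>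

definition quotient_module :: "('f, 'v) module \<Rightarrow> 'v set \<Rightarrow> ('f, 'v set) module" where
  "quotient_module V U =
     \<lparr>carrier = a_rcosets\<^bsub>V\<^esub> U, mult = undefined, one = undefined,
      zero = U, add = set_add V,
      smult = (\<lambda>c X. \<Union>x\<in>X. U +>\<^bsub>V\<^esub> (c \<odot>\<^bsub>V\<^esub> x))\<rparr>"

definition coinvariants ::
    "('f::field, 'v) module \<Rightarrow> ('g \<Rightarrow> 'v \<Rightarrow> 'v) \<Rightarrow> 'g set \<Rightarrow> 'g set \<Rightarrow> ('f, 'v set) module" where
  "coinvariants V \<rho> D I = quotient_module V (augmentation V \<rho> D I)"

section \<open>Tensor powers of the Carlitz module\<close>

text \<open>\<open>B\<close> is a ring, \<open>\<zeta>\<close> the image of \<open>z\<close> in it; elements of \<open>B\<^sup>n\<close> are functions on \<open>{1..n}\<close>.\<close>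

definition carlitz_t ::
    "('b, 'c) ring_scheme \<Rightarrow> 'b \<Rightarrow> nat \<Rightarrow> nat \<Rightarrow> (nat \<Rightarrow> 'b) \<Rightarrow> nat \<Rightarrow> 'b" where
  "carlitz_t B \<zeta> q n x =
     (\<lambda>i\<in>{1..n}. \<zeta> \<otimes>\<^bsub>B\<^esub> x i \<oplus>\<^bsub>B\<^esub> (if i < n then x (i + 1) else x 1 [^]\<^bsub>B\<^esub> q))"

definition lie_carlitz_t ::
    "('b, 'c) ring_scheme \<Rightarrow> 'b \<Rightarrow> nat \<Rightarrow> (nat \<Rightarrow> 'b) \<Rightarrow> nat \<Rightarrow> 'b" where
  "lie_carlitz_t B \<zeta> n x =
     (\<lambda>i\<in>{1..n}. \<zeta> \<otimes>\<^bsub>B\<^esub> x i \<oplus>\<^bsub>B\<^esub> (if i < n then x (i + 1) else \<zero>\<^bsub>B\<^esub>))"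

definition power_module :: "('k, 'b) module \<Rightarrow> nat \<Rightarrow> ('k, nat \<Rightarrow> 'b) module" where
  "power_module M n =
     \<lparr>carrier = {1..n} \<rightarrow>\<^sub>E carrier M, mult = undefined, one = undefined,
      zero = (\<lambda>i\<in>{1..n}. \<zero>\<^bsub>M\<^esub>),
      add = (\<lambda>x y. \<lambda>i\<in>{1..n}. x i \<oplus>\<^bsub>M\<^esub> y i),
      smult = (\<lambda>c x. \<lambda>i\<in>{1..n}. c \<odot>\<^bsub>M\<^esub> x i)\<rparr>"

text \<open>The \<open>F\<close>-vector space of \<open>k[G]\<close>-linear maps from \<open>V\<close> to a \<open>k\<close>-vector space \<open>M\<close> on which \<open>G\<close>
  acts by \<open>act\<close>. Maps are extensional; \<open>F\<close> acts through \<open>V\<close>.\<close>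

definition hom_space ::
    "('k \<Rightarrow> 'f) \<Rightarrow> 'g set \<Rightarrow> ('f, 'v) module \<Rightarrow> ('g \<Rightarrow> 'v \<Rightarrow> 'v) \<Rightarrow>
     ('k, 'm) module \<Rightarrow> ('g \<Rightarrow> 'm \<Rightarrow> 'm) \<Rightarrow> ('f, 'v \<Rightarrow> 'm) module" where
  "hom_space iF G V \<rho> M act =
     \<lparr>carrier = {f \<in> carrier V \<rightarrow>\<^sub>E carrier M.
         (\<forall>v\<in>carrier V. \<forall>w\<in>carrier V. f (v \<oplus>\<^bsub>V\<^esub> w) = f v \<oplus>\<^bsub>M\<^esub> f w) \<and>
         (\<forall>c. \<forall>v\<in>carrier V. f (iF c \<odot>\<^bsub>V\<^esub> v) = c \<odot>\<^bsub>M\<^esub> f v) \<and>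
         (\<forall>g\<in>G. \<forall>v\<in>carrier V. f (\<rho> g v) = act g (f v))},
      mult = undefined, one = undefined,
      zero = (\<lambda>v\<in>carrier V. \<zero>\<^bsub>M\<^esub>),
      add = (\<lambda>f h. \<lambda>v\<in>carrier V. f v \<oplus>\<^bsub>M\<^esub> h v),
      smult = (\<lambda>a f. \<lambda>v\<in>carrier V. f (a \<odot>\<^bsub>V\<^esub> v))\<rparr>"

text \<open>\<open>|Hom(V, M)|\<close>, where \<open>t\<close> acts on \<open>M\<close> by \<open>\<tau>\<close>.\<close>

definition hom_char_poly ::
    "('k \<Rightarrow> 'f::field) \<Rightarrow> 'g set \<Rightarrow> ('f, 'v) module \<Rightarrow> ('g \<Rightarrow> 'v \<Rightarrow> 'v) \<Rightarrow>
     ('k, 'm) module \<Rightarrow> ('g \<Rightarrow> 'm \<Rightarrow> 'm) \<Rightarrow> ('m \<Rightarrow> 'm) \<Rightarrow> 'f poly" where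
  "hom_char_poly iF G V \<rho> M act \<tau> =
     mod_char_poly (hom_space iF G V \<rho> M act) (\<lambda>f. \<lambda>v\<in>carrier V. \<tau> (f v))"

text \<open>An automorphism of \<open>L\<close> acts on a coset in the quotient of the ring of integers of \<open>L\<close> by
  taking images.\<close>

definition coset_act :: "nat \<Rightarrow> ('l \<Rightarrow> 'l) \<Rightarrow> (nat \<Rightarrow> 'l set) \<Rightarrow> nat \<Rightarrow> 'l set" where
  "coset_act n \<sigma> x = (\<lambda>i\<in>{1..n}. \<sigma> ` x i)"

section \<open>Euler factors and \<open>L\<close>-values\<close>

definition inv_factor ::
    "('k::field \<Rightarrow> 'f::field) \<Rightarrow> ('k \<Rightarrow> 'l::field) \<Rightarrow> 'l \<Rightarrow> 'l set \<Rightarrow> ('f, 'v) module \<Rightarrow>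
     (('l \<Rightarrow> 'l) \<Rightarrow> 'v \<Rightarrow> 'v) \<Rightarrow> ('l set \<Rightarrow> 'l set) \<Rightarrow> nat \<Rightarrow> 'l set \<Rightarrow> 'f fls" where
  "inv_factor iF iL z K V \<rho> PP n p =
     (let A = ints iL z K; B = ints iL z UNIV; P = PP p
      in inverse (det_one_minus
           (inverse (at_t (map_poly iF (residue_char_poly iL z A p)) ^ n))
           (invariants V \<rho> (inertia_group B K P))
           (\<rho> (frobenius A B K p P))))"

definition coinv_factor ::
    "('k::field \<Rightarrow> 'f::field) \<Rightarrow> ('k \<Rightarrow> 'l::field) \<Rightarrow> 'l \<Rightarrow> 'l set \<Rightarrow> ('f, 'v) module \<Rightarrow>
     (('l \<Rightarrow> 'l) \<Rightarrow> 'v \<Rightarrow> 'v) \<Rightarrow> ('l set \<Rightarrow> 'l set) \<Rightarrow> nat \<Rightarrow> 'l set \<Rightarrow> 'f fls" where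
  "coinv_factor iF iL z K V \<rho> PP n p =
     (let A = ints iL z K; B = ints iL z UNIV; P = PP p
      in inverse (det_one_minus
           (inverse (at_t (map_poly iF (residue_char_poly iL z A p)) ^ n))
           (coinvariants V \<rho> (decomposition_group K P) (inertia_group B K P))
           (\<lambda>X. \<rho> (frobenius A B K p P) ` X)))"

definition carlitz_factor ::
    "('k::{field, finite} \<Rightarrow> 'f::field) \<Rightarrow> ('k \<Rightarrow> 'l::field) \<Rightarrow> 'l \<Rightarrow> 'l set \<Rightarrow>
     ('f, 'v) module \<Rightarrow> (('l \<Rightarrow> 'l) \<Rightarrow> 'v \<Rightarrow> 'v) \<Rightarrow> nat \<Rightarrow> 'l set \<Rightarrow> 'f fls" where
  "carlitz_factor iF iL z K V \<rho> n p =
     (let B = ints iL z UNIV; I = Idl\<^bsub>B\<^esub> p; \<zeta> = I +>\<^bsub>B\<^esub> z; q = card (UNIV :: 'k set);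
          M = power_module (quot_space iL B I) n
      in at_t (hom_char_poly iF (Gal K) V \<rho> M (coset_act n) (lie_carlitz_t (B Quot I) \<zeta> n)) /
         at_t (hom_char_poly iF (Gal K) V \<rho> M (coset_act n) (carlitz_t (B Quot I) \<zeta> q n)))"

definition L_value ::
    "('k::field \<Rightarrow> 'f::field) \<Rightarrow> ('k \<Rightarrow> 'l::field) \<Rightarrow> 'l \<Rightarrow> 'l set \<Rightarrow> ('f, 'v) module \<Rightarrow>
     (('l \<Rightarrow> 'l) \<Rightarrow> 'v \<Rightarrow> 'v) \<Rightarrow> ('l set \<Rightarrow> 'l set) \<Rightarrow> nat \<Rightarrow> 'f fls" where
  "L_value iF iL z K V \<rho> PP n = uprod (inv_factor iF iL z K V \<rho> PP n) (max_ideals (ints iL z K))"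

definition L_carlitz ::
    "('k::{field, finite} \<Rightarrow> 'f::field) \<Rightarrow> ('k \<Rightarrow> 'l::field) \<Rightarrow> 'l \<Rightarrow> 'l set \<Rightarrow>
     ('f, 'v) module \<Rightarrow> (('l \<Rightarrow> 'l) \<Rightarrow> 'v \<Rightarrow> 'v) \<Rightarrow> nat \<Rightarrow> 'f fls" where
  "L_carlitz iF iL z K V \<rho> n = uprod (carlitz_factor iF iL z K V \<rho> n) (max_ideals (ints iL z K))"

end

theory Submission
  imports "HOL-Algebra.Algebraic_Closure_Type" "HOL-Algebra.Sylow" Defs
begin

text \<open>Both factors at a prime are determinants of matrices over \<open>F\<close>. For the Carlitz factor, the quotient of
 the two characteristic polynomials on \<open>Hom(V, B/pB)\<close> is the inverse of \<open>det (1 - (t - z)^-n \<tau>)\<close>, with \<open>\<tau>\<close> the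
 \<open>q\<close>-power map. A map into \<open>B/pB\<close> and its reduction modulo a prime above \<open>p\<close> determine each other up to
 a power of \<open>\<tau>\<close>, which leaves such determinants unchanged, so \<open>B/pB\<close> may be replaced by the residue field and
 \<open>V\<close> by its coinvariants. There \<open>\<tau>\<close> permutes the \<open>d\<close> conjugates of \<open>z\<close> cyclically, and by the normal basis
 theorem the determinant is that of the Frobenius divided by the residue polynomial to the \<open>n\<close>. The factors for
 invariants and coinvariants differ only at the finitely many ramified primes.\<close>


text \<open>When p ramifies, B/pB has nilpotents, and the characteristic may divide the order of G,
  so \<open>Hom(V, -)\<close> over k[G] need not be exact: the passage to the residue field cannot
  go through exact sequences. What remains is a pair of maps. \<open>Pi\<close> reduces modulo a
  prime above p. \<open>Sec\<close> lifts a residue to all primes above p at once and then raises it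
  to the power q^\<open>M0\<close>, which erases the choice of the lift. Both composites are the
  \<open>M0\<close>-th iterate of the q-power map. Since \<open>M0\<close> is a power of the
  characteristic, the \<open>M0\<close>-th power of det(1 - X) is det(1 - X^\<open>M0\<close>); the
  two sides are then compared by det(1 - A B) = det(1 - B A), and roots of this order are unique in
  a domain of that characteristic. Coinvariants appear, and not invariants, because inertia acts
  trivially on the residue field: a map from V into it factors through the largest quotient of V
  with trivial inertia action. Residue fields are embedded into one algebraic closure of k, so that
  Frobenius conjugates are plain powers in a single field type.\<close>

no_notation var (\<open>X\<index>\<close>)

abbreviation ring_on :: "'l::field set => 'l ring" where "ring_on C == class_ring\<lparr>carrier := C\<rparr>"
abbreviation pcoeff :: "'a::zero poly => nat => 'a" where "pcoeff == Polynomial.coeff"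
abbreviation mdet :: "'a::comm_ring_1 mat => 'a" where "mdet == Determinant.det"


section \<open>Matrices\<close>

lemma mat_assoc:
 "dim_col A = dim_row B ==> dim_col B = dim_row C ==> (A * B) * C = A * ((B::'a::semiring_0 mat) * C)"
 by (rule assoc_mult_mat[of _ "dim_row A" "dim_row B" _ "dim_row C" _ "dim_col C"]) auto

lemma mat_distl:
 "dim_col A = dim_row B ==> dim_row C = dim_row B ==> dim_col C = dim_col B ==>
 A * ((B::'a::semiring_0 mat) + C) = A * B + A * C"
 by (rule mult_add_distrib_mat[of _ "dim_row A" "dim_row B" _ "dim_col B"]) auto

lemma mat_distr:
 "dim_row A = dim_row B ==> dim_col A = dim_col B ==> dim_col B = dim_row C ==>
 (A + (B::'a::semiring_0 mat)) * C = A * C + B * C"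
 by (rule add_mult_distrib_mat[of _ "dim_row A" "dim_col A" _ _ "dim_col C"]) auto

lemma mat_distl_minus:
 "dim_col A = dim_row B ==> dim_row C = dim_row B ==> dim_col C = dim_col B ==>
 A * ((B::'a::ring mat) - C) = A * B - A * C"
 by (rule mult_minus_distrib_mat[of _ "dim_row A" "dim_row B" _ "dim_col B"]) auto

lemma mat_distr_minus:
 "dim_row A = dim_row B ==> dim_col A = dim_col B ==> dim_col B = dim_row C ==>
 (A - (B::'a::ring mat)) * C = A * C - B * C"
 by (rule minus_mult_distrib_mat[of _ "dim_row A" "dim_col A" _ _ "dim_col C"]) auto

lemma mat_smultl:
 "dim_col A = dim_row B ==> (c \<cdot>\<^sub>m A) * B = c \<cdot>\<^sub>m (A * (B::'a::comm_semiring_0 mat))"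
 by (rule mult_smult_assoc_mat[of _ "dim_row A" "dim_col A" _ "dim_col B"]) auto

lemma mat_smultr:
 "dim_col A = dim_row B ==> A * (c \<cdot>\<^sub>m B) = c \<cdot>\<^sub>m (A * (B::'a::comm_semiring_0 mat))"
 by (rule mult_smult_distrib[of _ "dim_row A" "dim_col A" _ "dim_col B"]) auto

lemma mat_onel: "dim_row A = n ==> 1\<^sub>m n * (A::'a::semiring_1 mat) = A"
 by (rule left_mult_one_mat[of _ _ "dim_col A"]) auto

lemma mat_oner: "dim_col A = n ==> (A::'a::semiring_1 mat) * 1\<^sub>m n = A"
 by (rule right_mult_one_mat[of _ "dim_row A"]) auto

lemma mat_zerol: "dim_row A = n ==> 0\<^sub>m r n * (A::'a::semiring_0 mat) = 0\<^sub>m r (dim_col A)"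
 by (rule left_mult_zero_mat[of _ _ "dim_col A"]) auto

lemma mat_zeror: "dim_col A = n ==> (A::'a::semiring_0 mat) * 0\<^sub>m n r = 0\<^sub>m (dim_row A) r"
 by (rule right_mult_zero_mat[of _ "dim_row A"]) auto

lemma mat_pow_Suc': "dim_row A = dim_col A ==> (A::'a::semiring_1 mat) ^\<^sub>m Suc k = A * A ^\<^sub>m k"
proof (induction k)
 case (Suc k)
 have "A ^\<^sub>m Suc (Suc k) = (A * A ^\<^sub>m k) * A" using Suc by simp
 thus ?case using Suc.prems by (simp add: mat_assoc)
qed (simp add: mat_onel mat_oner)

lemma dim_pow_mat [simp]: "dim_row A = dim_col A ==> dim_row (A ^\<^sub>m k) = dim_row A"
 "dim_row A = dim_col A ==> dim_col (A ^\<^sub>m k) = dim_col A"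
 by (induction k) auto

lemmas mat_laws = mat_assoc mat_distl mat_distr mat_distl_minus mat_distr_minus
 mat_smultl mat_smultr mat_onel mat_oner mat_zerol mat_zeror

lemma map_mat_mult_hom:
 assumes "comm_ring_hom h" and "dim_col A = dim_row B"
 shows "map_mat h (A * B) = map_mat h A * map_mat h B"
proof -
 interpret comm_ring_hom h by fact
 show ?thesis by (rule mat_hom_mult[of _ "dim_row A" "dim_row B" _ "dim_col B"]) (use assms in auto)
qed

lemma map_mat_pow_hom:
 assumes "comm_ring_hom h" and "dim_col A = dim_row A"
 shows "map_mat h (A ^\<^sub>m k) = map_mat h A ^\<^sub>m k"
proof -
 interpret comm_ring_hom h by fact
 show ?thesis by (rule mat_hom_pow[of _ "dim_row A"]) (use assms in auto)
qed

lemma map_mat_one_hom: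
 assumes "comm_ring_hom h"
 shows "map_mat h (1\<^sub>m n) = 1\<^sub>m n"
proof -
 interpret comm_ring_hom h by fact
 show ?thesis by (rule mat_hom_one)
qed

section \<open>Finite sums of rectangular matrices\<close>

fun msum :: "nat => nat => (nat => 'a::comm_ring_1 mat) => nat => 'a mat" where
 "msum r c f 0 = 0\<^sub>m r c"
| "msum r c f (Suc k) = msum r c f k + f k"

lemma dim_msum [simp]:
 assumes "!!i. i < k ==> f i : carrier_mat r c"
 shows "dim_row (msum r c f k) = r" "dim_col (msum r c f k) = c"
 using assms
proof (induction k)
 case (Suc k)
 { case 1 thus ?case by fastforce next case 2 thus ?case by fastforce }
qed auto

lemma msum_carrier:
 "(!!i. i < k ==> f i : carrier_mat r c) ==> msum r c f k : carrier_mat r c"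
 by auto

lemma msum_mult_right:
 assumes "!!i. i < k ==> f i : carrier_mat r c" and "B : carrier_mat c e"
 shows "msum r c f k * B = msum r e (%i. f i * B) k"
 using assms(1)
proof (induction k)
 case (Suc k)
 from Suc.prems[of k] have "dim_row (f k) = r" "dim_col (f k) = c" by auto
 moreover have "dim_row (msum r c f k) = r" "dim_col (msum r c f k) = c"
  using Suc.prems by (subst dim_msum; simp)+
 ultimately show ?case using Suc assms(2) by (simp add: mat_distr)
qed (use assms(2) in auto)

lemma msum_mult_left:
 assumes "!!i. i < k ==> f i : carrier_mat r c" and "B : carrier_mat e r"
 shows "B * msum r c f k = msum e c (%i. B * f i) k"
 using assms(1)
proof (induction k)
 case (Suc k)
 from Suc.prems[of k] have "dim_row (f k) = r" "dim_col (f k) = c" by auto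
 moreover have "dim_row (msum r c f k) = r" "dim_col (msum r c f k) = c"
  using Suc.prems by (subst dim_msum; simp)+
 ultimately show ?case using Suc assms(2) by (simp add: mat_distl)
qed (use assms(2) in auto)

lemma msum_cong: "(!!i. i < k ==> f i = g i) ==> msum r c f k = msum r c g k"
 by (induction k) auto

lemma msum_zero: "(!!i. i < k ==> f i = 0\<^sub>m r c) ==> msum r c f k = 0\<^sub>m r c"
 by (induction k) auto

lemma msum_delta:
 assumes "A : carrier_mat r c"
 shows "msum r c (%i. if i = l then A else 0\<^sub>m r c) k = (if l < k then A else 0\<^sub>m r c)"
 using assms by (induction k) (auto simp: less_Suc_eq)

lemma map_mat_msum:
 assumes "comm_ring_hom h" and "!!i. i < k ==> f i : carrier_mat r c"
 shows "map_mat h (msum r c f k) = msum r c (%i. map_mat h (f i)) k"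
proof -
 interpret comm_ring_hom h by fact
 show ?thesis using assms(2)
 proof (induction k)
  case 0
  show ?case by auto
 next
  case (Suc k)
  from Suc.prems[of k] have "dim_row (f k) = r" "dim_col (f k) = c" by auto
  moreover have "dim_row (msum r c f k) = r" "dim_col (msum r c f k) = c"
  using Suc.prems by (subst dim_msum; simp)+
  moreover have "msum r c (%i. map_mat h (f i)) k = map_mat h (msum r c f k)"
  using Suc by auto
  ultimately show ?case by (auto intro!: eq_matI simp: hom_add)
 qed
qed

section \<open>Determinants\<close>

text \<open>The block matrix with identity blocks on the diagonal and \<open>A\<close>,
  \<open>B\<close> off it factors both as \<open>?L1 * ?R1\<close> and as \<open>?R1 * ?R2\<close>.
  The common factor \<open>?R1\<close> has determinant 1, and the other two are block
  triangular.\<close>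

lemma det_one_minus_swap:
 fixes A B :: "'a::idom mat"
 assumes A: "A : carrier_mat n m" and B: "B : carrier_mat m n"
 shows "mdet (1\<^sub>m n - A * B) = mdet (1\<^sub>m m - B * A)"
proof -
 have AB: "A * B : carrier_mat n n" and BA: "B * A : carrier_mat m m" using A B by auto
 let ?M = "four_block_mat (1\<^sub>m n) A B (1\<^sub>m m)"
 let ?L1 = "four_block_mat (1\<^sub>m n - A * B) A (0\<^sub>m m n) (1\<^sub>m m)"
 let ?R1 = "four_block_mat (1\<^sub>m n) (0\<^sub>m n m) B (1\<^sub>m m)"
 let ?R2 = "four_block_mat (1\<^sub>m n) A (0\<^sub>m m n) (1\<^sub>m m - B * A)"
 have cancel: "1\<^sub>m k - C + C = 1\<^sub>m k" "C + (1\<^sub>m k - C) = 1\<^sub>m k"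
  if "C : carrier_mat k k" for C :: "'a mat" and k
  using that by (auto intro!: eq_matI)
 note [simp] = cancel(1)[OF AB] cancel(2)[OF BA]
 have "?L1 * ?R1 = ?M"
  by (subst mult_four_block_mat[of _ n n _ m _ m _ _ n _ m]) (use A B AB BA in \<open>auto\<close>)
 moreover have "?R1 * ?R2 = ?M"
  by (subst mult_four_block_mat[of _ n n _ m _ m _ _ n _ m]) (use A B AB BA in \<open>auto\<close>)
 moreover have L1: "?L1 : carrier_mat (n + m) (n + m)" and R1: "?R1 : carrier_mat (n + m) (n + m)"
  and R2: "?R2 : carrier_mat (n + m) (n + m)"
  using A B AB BA by (auto intro!: four_block_carrier_mat)
 ultimately have "mdet ?L1 * mdet ?R1 = mdet ?R1 * mdet ?R2"
  by (metis det_mult)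
 moreover have "mdet ?L1 = mdet (1\<^sub>m n - A * B)"
  by (subst det_four_block_mat_lower_left_zero[of _ n _ m]) (use A B AB in auto)
 moreover have "mdet ?R1 = 1"
  by (subst det_four_block_mat_upper_right_zero[of _ n _ m]) (use A B in auto)
 moreover have "mdet ?R2 = mdet (1\<^sub>m m - B * A)"
  by (subst det_four_block_mat_lower_left_zero[of _ n _ m]) (use A B BA in auto)
 ultimately show ?thesis by simp
qed

text \<open>The determinant of 1 - x A is a polynomial in x with constant term 1, here evaluated at
  \<open>s\<close>. This is why an Euler factor is congruent to 1 modulo the power of 1/t in front
  of its matrix.\<close>

lemma det_one_minus_smult_expand:
 fixes A :: "'a::comm_ring_1 mat"
 assumes A: "A : carrier_mat n n"
 shows "EX r. mdet (1\<^sub>m n - s \<cdot>\<^sub>m A) = 1 + s * r"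
proof -
 interpret c: comm_ring_hom "%x::'a. [:x:]" by standard auto
 define P where "P = 1\<^sub>m n - [:0, 1:] \<cdot>\<^sub>m map_mat (%x. [:x:]) A"
 define g where "g = mdet P"
 have ev: "poly g x = mdet (1\<^sub>m n - x \<cdot>\<^sub>m A)" for x
 proof -
  have e: "comm_ring_hom (%p::'a poly. poly p x)" by standard auto
  have "poly g x = mdet (map_mat (%p. poly p x) P)"
  unfolding g_def by (rule comm_ring_hom.hom_det[OF e, symmetric])
  also have "map_mat (%p. poly p x) P = 1\<^sub>m n - x \<cdot>\<^sub>m A"
  unfolding P_def using A by (auto intro!: eq_matI)
  finally show ?thesis .
 qed
 have "1\<^sub>m n - 0 \<cdot>\<^sub>m A = 1\<^sub>m n" using A by (auto intro!: eq_matI)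
 hence "poly g 0 = 1" unfolding ev by simp
 obtain a h where g: "g = pCons a h" by (cases g)
 with `poly g 0 = 1` have "a = 1" by simp
 with g ev[of s] show ?thesis by (intro exI[of _ "poly h s"]) simp
qed

section \<open>Determinants of 1 - X in prime characteristic\<close>

lemma pow_one_minus_entry:
 fixes X :: "'a::comm_ring_1 mat"
 assumes X: "X : carrier_mat n n" and "i < n" "j < n"
 shows "((1\<^sub>m n - X) ^\<^sub>m k) $$ (i, j) =
  (\<Sum>l\<le>k. of_nat (k choose l) * (-1) ^ l * (X ^\<^sub>m l) $$ (i, j))"
 using assms(2,3)
proof (induction k arbitrary: j)
 case (Suc k)
 let ?a = "%l j. (X ^\<^sub>m l) $$ (i, j)"
 have d [simp]: "dim_row X = n" "dim_col X = n" using X by auto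
 let ?Y = "(1\<^sub>m n - X) ^\<^sub>m k"
 have dY [simp]: "dim_row ?Y = n" "dim_col ?Y = n" by simp_all
 have "(1\<^sub>m n - X) ^\<^sub>m Suc k = ?Y - ?Y * X"
  by (simp add: mat_distl_minus mat_oner)
 hence "((1\<^sub>m n - X) ^\<^sub>m Suc k) $$ (i, j) = ?Y $$ (i,j) - (?Y * X) $$ (i, j)"
  using Suc.prems by simp
 also have "(?Y * X) $$ (i, j) = (\<Sum>m<n. ?Y $$ (i, m) * X $$ (m, j))"
  using Suc.prems by (auto simp: scalar_prod_def atLeast0LessThan intro!: sum.cong)
 also have "... = (\<Sum>m<n. (\<Sum>l\<le>k. of_nat (k choose l) * (-1) ^ l * ?a l m) * X $$ (m, j))"
  using Suc by (intro sum.cong) auto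
 also have "... = (\<Sum>l\<le>k. of_nat (k choose l) * (-1) ^ l * (\<Sum>m<n. ?a l m * X $$ (m, j)))"
  by (simp add: sum_distrib_right sum_distrib_left sum.swap[of _ "{..k}"] mult.assoc)
 also have "... = (\<Sum>l\<le>k. of_nat (k choose l) * (-1) ^ l * ?a (Suc l) j)"
  using Suc.prems by (intro sum.cong) (auto simp: scalar_prod_def atLeast0LessThan intro!: sum.cong)
 finally have "((1\<^sub>m n - X) ^\<^sub>m Suc k) $$ (i, j) =
  (\<Sum>l\<le>k. of_nat (k choose l) * (-1) ^ l * ?a l j) -
  (\<Sum>l\<le>k. of_nat (k choose l) * (-1) ^ l * ?a (Suc l) j)"
  using Suc by simp
 also have "(\<Sum>l\<le>k. of_nat (k choose l) * (-1) ^ l * ?a l j) =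
  ?a 0 j + (\<Sum>l\<le>k. of_nat (k choose Suc l) * (-1) ^ Suc l * ?a (Suc l) j)"
  using sum.atMost_Suc_shift[of "%l. of_nat (k choose l) * (-1) ^ l * ?a l j" k]
  by (simp add: binomial_eq_0 sum_negf del: pow_mat.simps)
 finally show ?case
  by (subst sum.atMost_Suc_shift)
   (simp add: algebra_simps sum.distrib sum_negf sum_subtractf del: pow_mat.simps)
qed simp

text \<open>\<open>X\<close> commutes with the identity, and the inner binomial coefficients vanish
  in characteristic p, so only the two end terms of \<open>pow_one_minus_entry\<close>
  survive.\<close>

lemma pow_CHAR_one_minus:
 fixes X :: "'a::comm_ring_1 mat"
 assumes X: "X : carrier_mat n n" and p: "prime CHAR('a)"
 shows "(1\<^sub>m n - X) ^\<^sub>m CHAR('a) = 1\<^sub>m n - X ^\<^sub>m CHAR('a)"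
proof (rule eq_matI)
 let ?p = "CHAR('a)"
 have d [simp]: "dim_row X = n" "dim_col X = n" using X by auto
 \<comment> \<open>In characteristic 2 the sign is right as well, since there -1 = 1.\<close>
 have sgn: "(-1) ^ ?p = (-1 :: 'a)" using minus_power_prime_CHAR[OF refl p, of 1] by simp
 have p0: "?p ~= 0" using p by (metis not_prime_0)
 fix i j assume "i < dim_row (1\<^sub>m n - X ^\<^sub>m ?p)" "j < dim_col (1\<^sub>m n - X ^\<^sub>m ?p)"
 hence ij: "i < n" "j < n" using p0 by (auto split: if_splits)
 have "((1\<^sub>m n - X) ^\<^sub>m ?p) $$ (i, j) =
  (\<Sum>l\<le>?p. of_nat (?p choose l) * (-1) ^ l * (X ^\<^sub>m l) $$ (i, j))"
  by (rule pow_one_minus_entry[OF X ij])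
 also have "... = (\<Sum>l\<in>{0, ?p}. of_nat (?p choose l) * (-1) ^ l * (X ^\<^sub>m l) $$ (i, j))"
 proof (rule sum.mono_neutral_right)
  show "ALL l:{..?p} - {0, ?p}. of_nat (?p choose l) * (-1) ^ l * (X ^\<^sub>m l) $$ (i, j) = 0"
  proof
  fix l assume "l : {..?p} - {0, ?p}"
  hence "?p dvd (?p choose l)" using p p0 by (intro dvd_choose_prime) auto
  hence "of_nat (?p choose l) = (0::'a)" by (simp add: of_nat_eq_0_iff_char_dvd)
  thus "of_nat (?p choose l) * (-1) ^ l * (X ^\<^sub>m l) $$ (i, j) = 0" by simp
  qed
 qed auto
 also have "... = (1\<^sub>m n - X ^\<^sub>m ?p) $$ (i, j)" using ij p0 sgn by simp
 finally show "((1\<^sub>m n - X) ^\<^sub>m ?p) $$ (i, j) = (1\<^sub>m n - X ^\<^sub>m ?p) $$ (i, j)" .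
qed auto

lemma det_pow_mat: "A : carrier_mat n n ==> mdet (A ^\<^sub>m k) = mdet (A::'a::comm_ring_1 mat) ^ k"
 by (induction k) (auto simp: det_mult[of _ n])

lemma pow_mat_pow: "A : carrier_mat n n ==> (A ^\<^sub>m a) ^\<^sub>m b = (A::'a::comm_ring_1 mat) ^\<^sub>m (a * b)"
proof (induction b)
 case (Suc b)
 have "A ^\<^sub>m (x + y) = A ^\<^sub>m x * A ^\<^sub>m y" for x y
  using Suc.prems by (induction y) (auto simp: mat_laws)
 from this[of "a * b" a] show ?case using Suc by (simp add: add.commute)
qed auto

text \<open>Together with \<open>CHAR_power_inj\<close> this permits comparing det(1 - X) and det(1
  - Y) through large powers of X and Y, as long as the exponent is a power of the
  characteristic.\<close>

lemma det_one_minus_CHAR_power: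
 fixes X :: "'a::comm_ring_1 mat"
 assumes X: "X : carrier_mat n n" and p: "prime CHAR('a)"
 shows "mdet (1\<^sub>m n - X) ^ (CHAR('a) ^ k) = mdet (1\<^sub>m n - X ^\<^sub>m (CHAR('a) ^ k))"
proof (induction k)
 case (Suc k)
 let ?p = "CHAR('a)"
 have Xk: "X ^\<^sub>m (?p ^ k) : carrier_mat n n" using X by simp
 have "mdet (1\<^sub>m n - X) ^ (?p ^ Suc k) = mdet (1\<^sub>m n - X ^\<^sub>m (?p ^ k)) ^ ?p"
  using Suc by (metis power_Suc2 power_mult)
 also have "... = mdet ((1\<^sub>m n - X ^\<^sub>m (?p ^ k)) ^\<^sub>m ?p)"
  by (subst det_pow_mat[of _ n]) (use Xk in \<open>auto intro: minus_carrier_mat\<close>)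
 also have "... = mdet (1\<^sub>m n - (X ^\<^sub>m (?p ^ k)) ^\<^sub>m ?p)"
  by (simp add: pow_CHAR_one_minus[OF Xk p])
 finally show ?case using X by (simp add: pow_mat_pow mult.commute)
qed (use X in \<open>simp add: mat_onel\<close>)

text \<open>By additivity of Frobenius the p^k-th power of x - y vanishes, and a domain has no
  nilpotents.\<close>

lemma CHAR_power_inj:
 fixes x y :: "'a::idom"
 assumes p: "prime CHAR('a)" and "x ^ (CHAR('a) ^ k) = y ^ (CHAR('a) ^ k)"
 shows "x = y"
proof -
 have "x ^ (CHAR('a) ^ k) = ((x - y) + y) ^ (CHAR('a) ^ k)" by simp
 also have "... = (x - y) ^ (CHAR('a) ^ k) + y ^ (CHAR('a) ^ k)"
  by (rule freshmans_dream') (use p in auto)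
 finally show ?thesis using assms(2) by simp
qed

text \<open>The exponent p^d is at least \<open>d\<close>, so the p^d-th power of \<open>X\<close>
  is zero and that power of the determinant is 1.\<close>

lemma det_one_minus_nilpotent:
 fixes X :: "'a::idom mat"
 assumes X: "X : carrier_mat n n" and p: "prime CHAR('a)" and nil: "X ^\<^sub>m d = 0\<^sub>m n n"
 shows "mdet (1\<^sub>m n - X) = 1"
proof -
 let ?p = "CHAR('a)"
 have "d <= ?p ^ d" using p prime_gt_1_nat[OF p] by (simp add: less_imp_le)
 have "X ^\<^sub>m (d + k) = 0\<^sub>m n n" for k
  using X nil by (induction k) auto
 from this[of "?p ^ d - d"] `d <= ?p ^ d` have "X ^\<^sub>m (?p ^ d) = 0\<^sub>m n n" by simp
 moreover have "1\<^sub>m n - 0\<^sub>m n n = (1\<^sub>m n :: 'a mat)" by auto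
 ultimately have "mdet (1\<^sub>m n - X) ^ (?p ^ d) = 1 ^ (?p ^ d)"
  using det_one_minus_CHAR_power[OF X p, of d] by simp
 thus ?thesis by (rule CHAR_power_inj[OF p])
qed

text \<open>The determinant has constant term det 1 = 1 and is thus a unit among power series; the
  adjugate divided by it is the inverse.\<close>

lemma unipotent_fps_mat_inverse:
 fixes Y :: "'f::field fps mat"
 assumes Y: "Y : carrier_mat n n" and c: "map_mat (%f. fps_nth f 0) Y = 1\<^sub>m n"
 obtains W where "W : carrier_mat n n" "Y * W = 1\<^sub>m n" "W * Y = 1\<^sub>m n"
proof -
 interpret e: comm_ring_hom "%f::'f fps. fps_nth f 0" by standard (auto simp: fps_mult_nth)
 have "fps_nth (mdet Y) 0 = mdet (map_mat (%f. fps_nth f 0) Y)" by simp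
 hence "fps_nth (mdet Y) 0 = 1" using c by simp
 hence u: "inverse (mdet Y) * mdet Y = 1"
  by (intro inverse_mult_eq_1) simp
 let ?W = "inverse (mdet Y) \<cdot>\<^sub>m adj_mat Y"
 have "?W : carrier_mat n n" using adj_mat(1)[OF Y] by simp
 moreover have d: "dim_row Y = n" "dim_col Y = n" "dim_row (adj_mat Y) = n" "dim_col (adj_mat Y) = n"
  using Y adj_mat(1)[OF Y] by auto
 hence "Y * ?W = 1\<^sub>m n" "?W * Y = 1\<^sub>m n" using adj_mat(2,3)[OF Y] u
  by (auto simp: mat_laws smult_smult_assoc intro!: eq_matI)
 ultimately show ?thesis using that by blast
qed

lemma mat_smult_smult: "c \<cdot>\<^sub>m (d \<cdot>\<^sub>m A) = (c * d) \<cdot>\<^sub>m (A::'a::comm_ring_1 mat)"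
 by (auto intro!: eq_matI simp: mult.assoc)

section \<open>Matrices of power series\<close>

abbreviation cmat :: "'f::field mat => 'f fps mat" where
 "cmat \<equiv> map_mat fps_const"

lemma fps_const_hom: "comm_ring_hom (fps_const :: 'f::field => _)"
 by standard (auto simp: fps_const_add fps_const_mult)

lemma fps_nth_0_hom: "comm_ring_hom (%f::'f::field fps. fps_nth f 0)"
 by standard (auto simp: fps_mult_nth)

lemma cmat_mult: "dim_col A = dim_row B ==> cmat (A * B) = cmat A * cmat B"
 by (rule map_mat_mult_hom[OF fps_const_hom])

lemma cmat_pow: "dim_col A = dim_row A ==> cmat (A ^\<^sub>m k) = cmat A ^\<^sub>m k"
 by (rule map_mat_pow_hom[OF fps_const_hom])

lemma cmat_one: "cmat (1\<^sub>m n) = 1\<^sub>m n"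
 by (rule map_mat_one_hom[OF fps_const_hom])

lemma nth_0_cmat [simp]: "map_mat (%f. fps_nth f 0) (cmat A) = A"
 by (auto intro!: eq_matI)

text \<open>The variable of the power series stands for \<open>1/t\<close>; \<open>tmat Z\<close> is \<open>1 - Z/t\<close>.\<close>

definition tmat :: "'f::field mat => 'f fps mat" where
 "tmat Z = 1\<^sub>m (dim_row Z) - fps_X \<cdot>\<^sub>m cmat Z"

text \<open>The resolvent (1 - Z/t)^-1. It exists by \<open>unipotent_fps_mat_inverse\<close>, as
  \<open>tmat Z\<close> has constant term the identity, and it enters through the identities of
  lemma \<open>tres\<close>.\<close>

definition tres :: "'f::field mat => 'f fps mat" where
 "tres Z = (SOME W. W : carrier_mat (dim_row Z) (dim_row Z) \<and>
  tmat Z * W = 1\<^sub>m (dim_row Z) & W * tmat Z = 1\<^sub>m (dim_row Z))"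

lemma dim_tmat [simp]: "dim_row (tmat Z) = dim_row Z" "dim_col (tmat Z) = dim_col Z"
 by (simp_all add: tmat_def)

lemma tmat_nth_0: "dim_row Z = dim_col Z ==> map_mat (%f. fps_nth f 0) (tmat Z) = 1\<^sub>m (dim_row Z)"
 unfolding tmat_def by (auto intro!: eq_matI)

lemma tres:
 assumes "dim_row Z = dim_col Z"
 shows "tres Z : carrier_mat (dim_row Z) (dim_row Z)"
  "tmat Z * tres Z = 1\<^sub>m (dim_row Z)" "tres Z * tmat Z = 1\<^sub>m (dim_row Z)"
proof -
 have "tmat Z : carrier_mat (dim_row Z) (dim_row Z)" using assms by (auto intro!: carrier_matI)
 from unipotent_fps_mat_inverse[OF this tmat_nth_0[OF assms]]
 have "EX W. W : carrier_mat (dim_row Z) (dim_row Z) \<and>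
  tmat Z * W = 1\<^sub>m (dim_row Z) & W * tmat Z = 1\<^sub>m (dim_row Z)" by metis
 from someI_ex[OF this] show "tres Z : carrier_mat (dim_row Z) (dim_row Z)"
  "tmat Z * tres Z = 1\<^sub>m (dim_row Z)" "tres Z * tmat Z = 1\<^sub>m (dim_row Z)"
  unfolding tres_def by auto
qed

lemma dim_tres [simp]:
 assumes "dim_row Z = dim_col Z"
 shows "dim_row (tres Z) = dim_row Z" "dim_col (tres Z) = dim_col Z"
 using tres(1)[OF assms] assms by auto

lemma tres_nth_0:
 assumes "dim_row Z = dim_col Z"
 shows "map_mat (%f. fps_nth f 0) (tres Z) = 1\<^sub>m (dim_row Z)"
proof -
 have "map_mat (%f. fps_nth f 0) (tmat Z * tres Z) = 1\<^sub>m (dim_row Z)"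
  using tres(2)[OF assms] map_mat_one_hom[OF fps_nth_0_hom] by simp
 thus ?thesis using assms
  by (simp add: map_mat_mult_hom[OF fps_nth_0_hom] tmat_nth_0 mat_onel)
qed

lemma tmat_intertwine:
 assumes "dim_row A = dim_col A" "dim_row B = dim_col B" "dim_col P = dim_row A"
  "dim_row P = dim_row B" and eq: "P * A = B * P"
 shows "cmat P * tmat A = tmat B * cmat P"
 using assms unfolding tmat_def by (simp add: mat_laws eq flip: cmat_mult)

lemma intertwine_inverse:
 fixes P :: "'a::comm_ring_1 mat"
 assumes d: "dim_row A = n" "dim_col A = n" "dim_row A' = n" "dim_col A' = n"
  "dim_row B = m" "dim_col B = m" "dim_row B' = m" "dim_col B' = m"
  "dim_row P = m" "dim_col P = n"
  and inv: "A * A' = 1\<^sub>m n" "B' * B = 1\<^sub>m m" and eq: "P * A = B * P"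
 shows "P * A' = B' * P"
proof -
 have "P * A' = B' * (B * P) * A'"
  using d by (simp add: mat_assoc[symmetric] inv(2) mat_onel)
 also have "... = B' * (P * (A * A'))" using d by (simp add: eq[symmetric] mat_assoc)
 finally show ?thesis using d by (simp add: inv(1) mat_oner)
qed

lemma tres_intertwine:
 assumes "dim_row A = dim_col A" "dim_row B = dim_col B" "dim_col P = dim_row A"
  "dim_row P = dim_row B" and "P * A = B * P"
 shows "cmat P * tres A = tres B * cmat P"
 by (rule intertwine_inverse[of "tmat A" "dim_row A" _ "tmat B" "dim_row B"])
  (use assms in \<open>auto simp: tres tmat_intertwine\<close>)

lemma intertwine_pow:
 fixes P :: "'a::comm_ring_1 mat"
 assumes d: "dim_row A = n" "dim_col A = n" "dim_row B = m" "dim_col B = m"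
  "dim_row P = m" "dim_col P = n" and eq: "P * A = B * P"
 shows "P * A ^\<^sub>m k = B ^\<^sub>m k * P"
proof (induction k)
 case (Suc k)
 have "P * (A ^\<^sub>m k * A) = (P * A ^\<^sub>m k) * A" using d by (simp add: mat_assoc)
 also have "... = B ^\<^sub>m k * (P * A)" using d Suc by (simp add: mat_assoc)
 also have "... = B ^\<^sub>m k * B * P" using d eq by (simp add: mat_assoc)
 finally show ?case by simp
qed (use d in \<open>simp add: mat_laws\<close>)

lemma pow_mat_add: "dim_row A = dim_col A ==> (A::'a::comm_ring_1 mat) ^\<^sub>m (a + b) = A ^\<^sub>m a * A ^\<^sub>m b"
 by (induction b) (auto simp: mat_laws)

text \<open>The relation \<open>T * Z = Z ^\<^sub>m q * T\<close> is the matrix form of tau(z x) =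
  z^q tau(x) for the q-power map tau. Iterating it moves \<open>Z\<close> past
  \<open>T ^\<^sub>m j\<close> and raises it to the q^j.\<close>

lemma semilinear_pow:
 fixes Z T :: "'f::field mat"
 assumes "Z : carrier_mat N N" "T : carrier_mat N N" and TZ: "T * Z = Z ^\<^sub>m q * T"
 shows "T ^\<^sub>m j * Z = Z ^\<^sub>m (q ^ j) * T ^\<^sub>m j"
proof (induction j)
 case (Suc j)
 have d [simp]: "dim_row Z = N" "dim_col Z = N" "dim_row T = N" "dim_col T = N" using assms by auto
 have "T ^\<^sub>m Suc j * Z = T * (T ^\<^sub>m j * Z)" by (simp only: mat_pow_Suc' d) (simp add: mat_assoc)
 also have "... = (T * Z ^\<^sub>m (q ^ j)) * T ^\<^sub>m j" by (simp add: Suc mat_assoc)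
 also have "T * Z ^\<^sub>m (q ^ j) = (Z ^\<^sub>m q) ^\<^sub>m (q ^ j) * T"
  by (rule intertwine_pow[of _ N _ N]) (simp_all add: TZ)
 also have "(Z ^\<^sub>m q) ^\<^sub>m (q ^ j) = Z ^\<^sub>m (q ^ Suc j)" using assms(1) by (simp add: pow_mat_pow)
 finally show ?case by (simp only: mat_pow_Suc' d) (simp add: mat_assoc)
qed (use assms in \<open>simp add: mat_laws\<close>)

text \<open>\<open>(1 - z/t)\<^sup>-\<^sup>n \<tau>\<close>, for matrices \<open>Z\<close> of \<open>z\<close> and \<open>T\<close> of \<open>\<tau>\<close>.\<close>

definition twist :: "nat => 'f::field mat => 'f mat => 'f fps mat" where
 "twist n Z T = tres Z ^\<^sub>m n * cmat T"

text \<open>The resolvents of z^(q^i) for i < j, each to the power n, that collect on the left of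
  the j-th power of \<open>twist\<close>. Over a full set of conjugates the inverse
  \<open>lfac\<close> is a scalar, see \<open>lfac_scalar\<close>.\<close>

fun cfac :: "nat => nat => 'f::field mat => nat => 'f fps mat" where
 "cfac n q Z 0 = 1\<^sub>m (dim_row Z)"
| "cfac n q Z (Suc j) = cfac n q Z j * tres (Z ^\<^sub>m (q ^ j)) ^\<^sub>m n"

text \<open>New factors enter on the left, opposite to \<open>cfac\<close>, so that in the product
  of \<open>cfac\<close> and \<open>lfac\<close> the innermost pair cancels first.\<close>

fun lfac :: "nat => nat => 'f::field mat => nat => 'f fps mat" where
 "lfac n q Z 0 = 1\<^sub>m (dim_row Z)"
| "lfac n q Z (Suc j) = tmat (Z ^\<^sub>m (q ^ j)) ^\<^sub>m n * lfac n q Z j"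

lemma dim_cfac [simp]:
 assumes "dim_row Z = dim_col Z"
 shows "dim_row (cfac n q Z j) = dim_row Z" "dim_col (cfac n q Z j) = dim_row Z"
  "dim_row (lfac n q Z j) = dim_row Z" "dim_col (lfac n q Z j) = dim_row Z"
 using assms by (induction j) auto

lemma dim_twist [simp]:
 assumes "dim_row Z = dim_col Z"
 shows "dim_row (twist n Z T) = dim_row Z" "dim_col (twist n Z T) = dim_col T"
 using assms by (auto simp: twist_def)

text \<open>Each step moves \<open>T ^\<^sub>m j\<close> to the right past one resolvent of
  \<open>Z\<close>, which \<open>semilinear_pow\<close> turns into the resolvent of the q^j-th power
  of \<open>Z\<close>.\<close>

lemma twist_pow:
 fixes Z T :: "'f::field mat"
 assumes Z: "Z : carrier_mat N N" and T: "T : carrier_mat N N" and TZ: "T * Z = Z ^\<^sub>m q * T"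
 shows "twist n Z T ^\<^sub>m j = cfac n q Z j * cmat (T ^\<^sub>m j)"
proof (induction j)
 case (Suc j)
 have d [simp]: "dim_row Z = N" "dim_col Z = N" "dim_row T = N" "dim_col T = N" using assms by auto
 have "cmat (T ^\<^sub>m j) * tres Z = tres (Z ^\<^sub>m (q ^ j)) * cmat (T ^\<^sub>m j)"
  by (rule tres_intertwine) (simp_all add: semilinear_pow[OF assms])
 hence *: "cmat (T ^\<^sub>m j) * tres Z ^\<^sub>m n = tres (Z ^\<^sub>m (q ^ j)) ^\<^sub>m n * cmat (T ^\<^sub>m j)"
  by (intro intertwine_pow[of _ N _ N]) simp_all
 have "twist n Z T ^\<^sub>m Suc j = cfac n q Z j * (cmat (T ^\<^sub>m j) * tres Z ^\<^sub>m n) * cmat T"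
  by (simp add: Suc) (simp add: twist_def mat_assoc)
 also have "... = cfac n q Z (Suc j) * cmat (T ^\<^sub>m Suc j)"
  by (simp add: * mat_assoc cmat_mult)
 finally show ?case .
qed (use assms in \<open>simp add: mat_laws cmat_one\<close>)

lemma pow_mult_inverse:
 fixes A :: "'a::comm_ring_1 mat"
 assumes "dim_row A = N" "dim_col A = N" "dim_row B = N" "dim_col B = N" "A * B = 1\<^sub>m N"
 shows "A ^\<^sub>m k * B ^\<^sub>m k = 1\<^sub>m N"
proof (induction k)
 case (Suc k)
 have "A ^\<^sub>m Suc k * B ^\<^sub>m Suc k = A ^\<^sub>m k * (A * B) * B ^\<^sub>m k"
  using assms(1-4) by (simp only: mat_pow_Suc'[of B]) (simp add: mat_assoc)
 thus ?case using assms Suc by (simp add: mat_laws)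
qed (use assms in \<open>simp add: mat_onel\<close>)

lemma cfac_lfac:
 assumes "Z : carrier_mat N N"
 shows "cfac n q Z j * lfac n q Z j = 1\<^sub>m N"
proof (induction j)
 case (Suc j)
 have d [simp]: "dim_row Z = N" "dim_col Z = N" using assms by auto
 let ?Z = "Z ^\<^sub>m (q ^ j)"
 have "tres ?Z ^\<^sub>m n * tmat ?Z ^\<^sub>m n = 1\<^sub>m N"
  by (rule pow_mult_inverse) (use tres(3)[of ?Z] in auto)
 moreover have "cfac n q Z (Suc j) * lfac n q Z (Suc j) =
  cfac n q Z j * (tres ?Z ^\<^sub>m n * tmat ?Z ^\<^sub>m n) * lfac n q Z j"
  by (simp add: mat_assoc)
 ultimately show ?case using Suc by (simp add: mat_laws)
qed (use assms in \<open>simp add: mat_laws\<close>)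

lemma cfac_intertwine:
 assumes Z: "Z : carrier_mat N N" and W: "W : carrier_mat M M" and P: "P : carrier_mat M N"
  and PZ: "P * Z = W * P"
 shows "cmat P * cfac n q Z j = cfac n q W j * cmat P"
proof (induction j)
 case (Suc j)
 have d [simp]: "dim_row Z = N" "dim_col Z = N" "dim_row W = M" "dim_col W = M"
  "dim_row P = M" "dim_col P = N" using assms by auto
 have "P * Z ^\<^sub>m (q ^ j) = W ^\<^sub>m (q ^ j) * P"
  by (rule intertwine_pow[of _ N _ M]) (simp_all add: PZ)
 hence "cmat P * tres (Z ^\<^sub>m (q ^ j)) = tres (W ^\<^sub>m (q ^ j)) * cmat P"
  by (intro tres_intertwine) simp_all
 hence *: "cmat P * tres (Z ^\<^sub>m (q ^ j)) ^\<^sub>m n = tres (W ^\<^sub>m (q ^ j)) ^\<^sub>m n * cmat P"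
  by (intro intertwine_pow[of _ N _ M]) simp_all
 have "cmat P * cfac n q Z (Suc j) = (cmat P * cfac n q Z j) * tres (Z ^\<^sub>m (q ^ j)) ^\<^sub>m n"
  by (simp add: mat_assoc)
 also have "... = cfac n q W (Suc j) * cmat P" by (simp add: Suc * mat_assoc)
 finally show ?case .
qed (use assms in \<open>simp add: mat_laws\<close>)

text \<open>The maps \<open>P\<close> and \<open>S\<close> exhibit \<open>twist n Z T\<close> and \<open>twist n W U\<close> as shift equivalent. Since \<open>M\<close> is a
 power of the characteristic, the determinants may be compared after taking `M`-th powers, where
 the swap identity applies.\<close>

lemma det_twist_shift_equivalent:
 fixes Z T :: "'f::field mat"
 assumes Z: "Z : carrier_mat a a" and T: "T : carrier_mat a a" and TZ: "T * Z = Z ^\<^sub>m q * T"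
  and W: "W : carrier_mat b b" and U: "U : carrier_mat b b" and UW: "U * W = W ^\<^sub>m q * U"
  and P: "P : carrier_mat b a" and S: "S : carrier_mat a b"
  and PZ: "P * Z = W * P"
  and SP: "S * P = T ^\<^sub>m M" and PS: "P * S = U ^\<^sub>m M"
  and M: "M = CHAR('f) ^ e" and p: "prime CHAR('f)"
 shows "mdet (1\<^sub>m a - u \<cdot>\<^sub>m twist n Z T) = mdet (1\<^sub>m b - u \<cdot>\<^sub>m twist n W U)"
proof -
 have d [simp]: "dim_row Z = a" "dim_col Z = a" "dim_row T = a" "dim_col T = a"
  "dim_row W = b" "dim_col W = b" "dim_row U = b" "dim_col U = b"
  "dim_row P = b" "dim_col P = a" "dim_row S = a" "dim_col S = b" using assms by auto
 have C: "CHAR('f fps) = CHAR('f)" by simp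
 have pf: "prime CHAR('f fps)" using p by simp
 let ?X = "u \<cdot>\<^sub>m twist n Z T" and ?Y = "u \<cdot>\<^sub>m twist n W U"
 have X: "?X : carrier_mat a a" and Y: "?Y : carrier_mat b b" by (auto intro!: carrier_matI)
 have sp: "(u \<cdot>\<^sub>m A) ^\<^sub>m k = u ^ k \<cdot>\<^sub>m A ^\<^sub>m k" if "dim_row A = dim_col A" for A k
  using that by (induction k) (auto simp: mat_laws mat_smult_smult mult.commute)
 \<comment> \<open>The \<open>M\<close>-th powers of \<open>?X\<close> and \<open>?Y\<close> are the
   two products, in either order, of one pair of matrices, because \<open>S * P\<close> and
   \<open>P * S\<close> are the \<open>M\<close>-th powers of \<open>T\<close> and
   \<open>U\<close>.\<close>
 have 1: "?X ^\<^sub>m M = (u ^ M \<cdot>\<^sub>m (cfac n q Z M * cmat S)) * cmat P"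
  by (simp add: sp twist_pow[OF Z T TZ] SP[symmetric] cmat_mult mat_laws)
 have 2: "?Y ^\<^sub>m M = cmat P * (u ^ M \<cdot>\<^sub>m (cfac n q Z M * cmat S))"
 proof -
  have "cmat P * (cfac n q Z M * cmat S) = (cmat P * cfac n q Z M) * cmat S"
  by (simp add: mat_assoc)
  also have "... = cfac n q W M * cmat (U ^\<^sub>m M)"
  by (simp add: cfac_intertwine[OF Z W P PZ] mat_assoc cmat_mult flip: PS)
  finally show ?thesis
  by (simp add: sp twist_pow[OF W U UW] mat_smultr)
 qed
 have "mdet (1\<^sub>m a - ?X) ^ M = mdet (1\<^sub>m a - ?X ^\<^sub>m M)"
  using det_one_minus_CHAR_power[OF X pf, of e] by (simp add: M C)
 also have "... = mdet (1\<^sub>m b - ?Y ^\<^sub>m M)"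
  unfolding 1 2 by (rule det_one_minus_swap) (auto intro!: carrier_matI)
 also have "... = mdet (1\<^sub>m b - ?Y) ^ M"
  using det_one_minus_CHAR_power[OF Y pf, of e] by (simp add: M C)
 finally show ?thesis unfolding M using CHAR_power_inj[OF pf, of _ e] unfolding C by blast
qed

text \<open>If \<open>T\<close> is induced, that is, the space is the sum of \<open>T\<^sup>j J\<close> for \<open>j < d\<close>, then so is any \<open>X\<close> with
 constant term `T`, and only the `d`-th power of `X` on `J` contributes to the determinant.\<close>

lemma det_one_minus_induced:
 fixes T J \<Phi> :: "'f::field mat"
 assumes X: "X : carrier_mat N N" and X0: "map_mat (%f. fps_nth f 0) X = T"
  and T: "T : carrier_mat N N" and J: "J : carrier_mat N m" and \<Phi>: "\<Phi> : carrier_mat m m"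
  and pr: "!!j. j < d ==> pr j : carrier_mat m N" and d: "d >= 1"
  and sum: "msum N N (%j. T ^\<^sub>m j * J * pr j) d = 1\<^sub>m N"
  and orth: "!!i j. i < d ==> j < d ==> pr j * (T ^\<^sub>m i * J) = (if i = j then 1\<^sub>m m else 0\<^sub>m m m)"
  and top: "X ^\<^sub>m d * cmat J = c \<cdot>\<^sub>m (cmat J * cmat \<Phi>)"
  and p: "prime CHAR('f)"
 shows "mdet (1\<^sub>m N - u \<cdot>\<^sub>m X) = mdet (1\<^sub>m m - (u ^ d * c) \<cdot>\<^sub>m cmat \<Phi>)"
proof -
 have dd [simp]: "dim_row X = N" "dim_col X = N" "dim_row T = N" "dim_col T = N"
  "dim_row J = N" "dim_col J = m" "dim_row \<Phi> = m" "dim_col \<Phi> = m" using assms by auto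
 have dpr [simp]: "dim_row (pr j) = m" "dim_col (pr j) = N" if "j < d" for j
  using pr[OF that] by auto
 have pf: "prime CHAR('f fps)" using p by simp
 define V where "V j = X ^\<^sub>m j * cmat J" for j
 have dV [simp]: "dim_row (V j) = N" "dim_col (V j) = m" for j by (simp_all add: V_def)
 have XV: "X * V j = V (Suc j)" for j
  by (simp only: V_def mat_pow_Suc'[of X] dd) (simp add: mat_assoc)
 \<comment> \<open>\<open>Y\<close> sends the frame \<open>T ^\<^sub>m j * J\<close> to the frame
   \<open>V j\<close>. Its constant term is the identity by \<open>sum\<close>, so the
   \<open>V j\<close> form a frame over the power series.\<close>
 define Y where "Y = msum N N (%j. V j * cmat (pr j)) d"
 have carr: "V j * cmat (pr j) : carrier_mat N N" if "j < d" for j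
  using that by (auto intro!: carrier_matI)
 have Yc: "Y : carrier_mat N N" unfolding Y_def by (rule msum_carrier) (rule carr)
 have "map_mat (%f. fps_nth f 0) Y = msum N N (%j. map_mat (%f. fps_nth f 0) (V j * cmat (pr j))) d"
  unfolding Y_def by (rule map_mat_msum[OF fps_nth_0_hom]) (rule carr)
 also have "... = msum N N (%j. T ^\<^sub>m j * J * pr j) d"
  by (rule msum_cong)
   (simp add: V_def map_mat_mult_hom[OF fps_nth_0_hom] map_mat_pow_hom[OF fps_nth_0_hom] X0)
 finally have Y0: "map_mat (%f. fps_nth f 0) Y = 1\<^sub>m N" using sum by simp
 obtain W where W: "W : carrier_mat N N" "Y * W = 1\<^sub>m N" "W * Y = 1\<^sub>m N"
  using unipotent_fps_mat_inverse[OF Yc Y0] .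
 have dW [simp]: "dim_row W = N" "dim_col W = N" "dim_row Y = N" "dim_col Y = N" using W Yc by auto
 have YT: "Y * cmat (T ^\<^sub>m i * J) = V i" if i: "i < d" for i
 proof -
  have "Y * cmat (T ^\<^sub>m i * J) = msum N m (%j. V j * cmat (pr j) * cmat (T ^\<^sub>m i * J)) d"
  unfolding Y_def by (rule msum_mult_right) (use carr in auto)
  also have "... = msum N m (%j. if j = i then V i else 0\<^sub>m N m) d"
  proof (rule msum_cong)
  fix j assume j: "j < d"
  have "V j * cmat (pr j) * cmat (T ^\<^sub>m i * J) = V j * cmat (pr j * (T ^\<^sub>m i * J))"
   using j by (simp add: mat_assoc cmat_mult)
  also have "... = (if j = i then V i else 0\<^sub>m N m)"
  proof -
   have "cmat (0\<^sub>m m m :: 'f mat) = 0\<^sub>m m m" by auto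
   thus ?thesis using j i orth[OF i j] by (auto simp: cmat_one mat_laws)
  qed
  finally show "V j * cmat (pr j) * cmat (T ^\<^sub>m i * J) = (if j = i then V i else 0\<^sub>m N m)" .
  qed
  also have "... = V i" using i by (subst msum_delta) (auto intro!: carrier_matI)
  finally show ?thesis .
 qed
 \<comment> \<open>The coordinate along the last frame element \<open>V (d - 1)\<close>.\<close>
 define \<pi> where "\<pi> = cmat (pr (d - 1)) * W"
 have d\<pi> [simp]: "dim_row \<pi> = m" "dim_col \<pi> = N" using d by (simp_all add: \<pi>_def)
 have \<pi>V: "\<pi> * V i = (if i = d - 1 then 1\<^sub>m m else 0\<^sub>m m m)" if i: "i < d" for i
 proof -
  have "\<pi> * V i = cmat (pr (d - 1)) * (W * Y) * cmat (T ^\<^sub>m i * J)"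
  unfolding \<pi>_def YT[OF i, symmetric] using d by (simp add: mat_assoc)
  also have "... = cmat (pr (d - 1) * (T ^\<^sub>m i * J))"
  using d W(3) by (simp add: mat_laws cmat_mult)
  also have "... = (if i = d - 1 then 1\<^sub>m m else 0\<^sub>m m m)"
  using orth[OF i, of "d - 1"] d by (auto simp: cmat_one)
  finally show ?thesis .
 qed
 \<comment> \<open>\<open>A\<close> agrees with \<open>X\<close> on the frame, except that the step
   from \<open>V (d - 1)\<close> to \<open>V d\<close> is cut off; what remains is a nilpotent
   shift.\<close>
 define A where "A = X - V d * \<pi>"
 have dA [simp]: "dim_row A = N" "dim_col A = N" by (simp_all add: A_def)
 have AV: "A * V i = (if i = d - 1 then 0\<^sub>m N m else V (Suc i))" if i: "i < d" for i
 proof -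
  have "A * V i = V (Suc i) - V d * (\<pi> * V i)"
  unfolding A_def by (simp add: mat_laws XV)
  moreover have "V (Suc i) - 0\<^sub>m N m = V (Suc i)" "V d - V d = 0\<^sub>m N m"
  by (auto intro!: eq_matI)
  ultimately show ?thesis using i d by (auto simp: \<pi>V mat_laws)
 qed
 have AkV: "A ^\<^sub>m k * V i = (if i + k < d then V (i + k) else 0\<^sub>m N m)" if "i < d" for i k
  using that
 proof (induction k)
  case (Suc k)
  have "A ^\<^sub>m Suc k * V i = A * (A ^\<^sub>m k * V i)"
  by (simp only: mat_pow_Suc' dA) (simp add: mat_assoc)
  thus ?case using Suc AV[of "i + k"] by (auto simp: mat_laws)
 qed (simp add: mat_laws)
 have "A ^\<^sub>m d * Y = 0\<^sub>m N N"
 proof -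
  have "A ^\<^sub>m d * Y = msum N N (%j. A ^\<^sub>m d * (V j * cmat (pr j))) d"
  unfolding Y_def by (rule msum_mult_left) (use carr in \<open>auto intro!: carrier_matI\<close>)
  also have "... = msum N N (%j. 0\<^sub>m N N) d"
  proof (rule msum_cong)
  fix j assume j: "j < d"
  have "A ^\<^sub>m d * (V j * cmat (pr j)) = (A ^\<^sub>m d * V j) * cmat (pr j)"
   using j by (simp add: mat_assoc)
  thus "A ^\<^sub>m d * (V j * cmat (pr j)) = 0\<^sub>m N N" using j by (simp add: AkV mat_laws)
  qed
  finally show ?thesis by (simp add: msum_zero)
 qed
 hence "A ^\<^sub>m d * (Y * W) = 0\<^sub>m N N" by (simp add: mat_assoc[symmetric] mat_laws)
 hence Ad: "A ^\<^sub>m d = 0\<^sub>m N N" by (simp add: W mat_laws)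
 have sp: "(u \<cdot>\<^sub>m A) ^\<^sub>m k = u ^ k \<cdot>\<^sub>m A ^\<^sub>m k" for k
  by (induction k) (auto simp: mat_laws mat_smult_smult mult.commute)
 have "(u \<cdot>\<^sub>m A) ^\<^sub>m d = 0\<^sub>m N N" unfolding sp Ad by auto
 hence det1: "mdet (1\<^sub>m N - u \<cdot>\<^sub>m A) = 1"
  by (intro det_one_minus_nilpotent[OF _ pf, of _ _ d]) (auto intro!: carrier_matI)
 \<comment> \<open>The truncated geometric series of \<open>u A\<close> applied to \<open>J\<close>;
   1 - u A times \<open>E d\<close> telescopes to \<open>J\<close> because \<open>A\<close> kills
   \<open>V (d - 1)\<close>.\<close>
 define E where "E k = msum N m (%j. u ^ j \<cdot>\<^sub>m V j) k" for k
 have dE [simp]: "dim_row (E k) = N" "dim_col (E k) = m" for k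
  unfolding E_def by (subst dim_msum; auto intro!: carrier_matI)+
 have E: "(1\<^sub>m N - u \<cdot>\<^sub>m A) * E k = cmat J - (if k < d then u ^ k \<cdot>\<^sub>m V k else 0\<^sub>m N m)" if "k <= d" for k
  using that
 proof (induction k)
  case 0
  have "V 0 = cmat J" by (simp add: V_def mat_onel)
  thus ?case using d by (auto simp: E_def mat_laws intro!: eq_matI)
 next
  case (Suc k)
  have "(1\<^sub>m N - u \<cdot>\<^sub>m A) * E (Suc k) =
   (1\<^sub>m N - u \<cdot>\<^sub>m A) * E k + (1\<^sub>m N - u \<cdot>\<^sub>m A) * (u ^ k \<cdot>\<^sub>m V k)"
  by (simp add: E_def[of "Suc k"] flip: E_def) (simp add: mat_distl)
  also have "(1\<^sub>m N - u \<cdot>\<^sub>m A) * (u ^ k \<cdot>\<^sub>m V k) = u ^ k \<cdot>\<^sub>m V k - u ^ Suc k \<cdot>\<^sub>m (A * V k)"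
  by (simp add: mat_laws) (auto intro!: eq_matI simp: algebra_simps simp del: index_mult_mat(1))
  finally show ?case using Suc by (auto simp: AV intro!: eq_matI)
 qed
 have "(1\<^sub>m N - u \<cdot>\<^sub>m A) * E d = cmat J" using E[of d] by (auto intro!: eq_matI)
 \<comment> \<open>1 - u X is 1 - u A times a perturbation of the identity that factors through
   \<pi>. The first factor has determinant 1, and the swap identity brings the second down to size
   \<open>m\<close>.\<close>
 hence "(1\<^sub>m N - u \<cdot>\<^sub>m A) * (1\<^sub>m N - (E d * ((u * c) \<cdot>\<^sub>m cmat \<Phi>)) * \<pi>) =
  (1\<^sub>m N - u \<cdot>\<^sub>m A) - (cmat J * ((u * c) \<cdot>\<^sub>m cmat \<Phi>)) * \<pi>"
  by (simp add: mat_distl_minus mat_oner mat_assoc[symmetric])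
 also have "cmat J * ((u * c) \<cdot>\<^sub>m cmat \<Phi>) = u \<cdot>\<^sub>m V d"
  unfolding V_def top by (simp add: mat_laws mat_smult_smult)
 also have "(1\<^sub>m N - u \<cdot>\<^sub>m A) - (u \<cdot>\<^sub>m V d) * \<pi> = 1\<^sub>m N - u \<cdot>\<^sub>m X"
 proof -
  define R where "R = V d * \<pi>"
  have [simp]: "dim_row R = N" "dim_col R = N" by (simp_all add: R_def)
  show ?thesis unfolding A_def
  by (simp add: mat_smultl flip: R_def) (auto intro!: eq_matI simp: algebra_simps)
 qed
 finally have "mdet (1\<^sub>m N - u \<cdot>\<^sub>m X) =
  mdet (1\<^sub>m N - u \<cdot>\<^sub>m A) * mdet (1\<^sub>m N - (E d * ((u * c) \<cdot>\<^sub>m cmat \<Phi>)) * \<pi>)"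
  by (subst det_mult[of _ N, symmetric]) (auto intro!: carrier_matI)
 also have "... = mdet (1\<^sub>m m - \<pi> * (E d * ((u * c) \<cdot>\<^sub>m cmat \<Phi>)))"
  unfolding det1 mult_1 by (rule det_one_minus_swap) (auto intro!: carrier_matI)
 also have "\<pi> * (E d * ((u * c) \<cdot>\<^sub>m cmat \<Phi>)) = (\<pi> * E d) * ((u * c) \<cdot>\<^sub>m cmat \<Phi>)"
  by (simp add: mat_assoc)
 also have "\<pi> * E d = u ^ (d - 1) \<cdot>\<^sub>m 1\<^sub>m m"
 proof -
  have "\<pi> * E d = msum m m (%j. \<pi> * (u ^ j \<cdot>\<^sub>m V j)) d"
  unfolding E_def by (rule msum_mult_left) (auto intro!: carrier_matI)
  also have "... = msum m m (%j. if j = d - 1 then u ^ (d - 1) \<cdot>\<^sub>m 1\<^sub>m m else 0\<^sub>m m m) d"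
  by (rule msum_cong) (auto simp: mat_laws \<pi>V)
  also have "... = u ^ (d - 1) \<cdot>\<^sub>m 1\<^sub>m m"
  using d by (subst msum_delta) auto
  finally show ?thesis .
 qed
 also have "u ^ (d - 1) \<cdot>\<^sub>m 1\<^sub>m m * ((u * c) \<cdot>\<^sub>m cmat \<Phi>) = (u ^ d * c) \<cdot>\<^sub>m cmat \<Phi>"
  using d by (cases d) (simp_all add: mat_laws mat_smult_smult mult_ac)
 finally show ?thesis .
qed

text \<open>The Carlitz action differs from the linear one by a term through a single copy of the
  module: the first coordinate is raised to the q and fed into the last. Dividing by 1 - X Lie and
  applying the swap identity leaves a determinant on that copy. The n coordinates passed on the way
  from the last to the first account for the exponent n.\<close>

lemma det_carlitz:
 fixes Z T Lie pr :: "'f::field mat"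
 assumes Z: "Z : carrier_mat a a" and T: "T : carrier_mat a a" and Lie: "Lie : carrier_mat b b"
  and pr: "pr : carrier_mat a b" and \<iota>: "!!i. i : {1..n} ==> \<iota> i : carrier_mat b a" and n: "n >= 1"
  and pr\<iota>: "!!i. i : {1..n} ==> pr * \<iota> i = (if i = 1 then 1\<^sub>m a else 0\<^sub>m a a)"
  and Lie1: "Lie * \<iota> 1 = \<iota> 1 * Z"
  and Lie_Suc: "!!i. 1 <= i ==> i < n ==> Lie * \<iota> (Suc i) = \<iota> (Suc i) * Z + \<iota> i"
 shows "mdet (1\<^sub>m b - fps_X \<cdot>\<^sub>m cmat (Lie + \<iota> n * T * pr)) =
  mdet (1\<^sub>m b - fps_X \<cdot>\<^sub>m cmat Lie) * mdet (1\<^sub>m a - fps_X ^ n \<cdot>\<^sub>m twist n Z T)"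
proof -
 have dd [simp]: "dim_row Z = a" "dim_col Z = a" "dim_row T = a" "dim_col T = a"
  "dim_row Lie = b" "dim_col Lie = b" "dim_row pr = a" "dim_col pr = b" using assms by auto
 have d\<iota> [simp]: "dim_row (\<iota> i) = b" "dim_col (\<iota> i) = a" if "1 <= i" "i <= n" for i
  using \<iota>[of i] that by auto
 \<comment> \<open>Substitution from the first coordinate upwards: for i from 1 on,
   \<open>R i\<close> solves (1 - X Lie) R = X \<open>\<iota> i\<close>.\<close>
 define R where "R = rec_nat (0\<^sub>m b a) (%i r. fps_X \<cdot>\<^sub>m ((cmat (\<iota> (Suc i)) + r) * tres Z))"
 have R0: "R 0 = 0\<^sub>m b a" and RS: "R (Suc i) = fps_X \<cdot>\<^sub>m ((cmat (\<iota> (Suc i)) + R i) * tres Z)" for i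
  by (simp_all add: R_def)
 have dR [simp]: "dim_row (R i) = b" "dim_col (R i) = a" if "i <= n" for i
  using that by (induction i) (simp_all add: R0 RS)
 let ?L = "1\<^sub>m b - fps_X \<cdot>\<^sub>m cmat Lie"
 have cadd: "cmat (A + B) = cmat A + cmat B" if "dim_row A = dim_row B" "dim_col A = dim_col B"
  for A B :: "'f mat" using that by (auto intro!: eq_matI simp: fps_const_add)
 have LR: "?L * R (Suc i) = fps_X \<cdot>\<^sub>m cmat (\<iota> (Suc i))" if "i < n" for i
  using that
 proof (induction i)
  case (Suc i)
  define j where "j = cmat (\<iota> (Suc i))"
  define k where "k = cmat (\<iota> (Suc (Suc i)))"
  define z where "z = cmat Z"
  have [simp]: "dim_row j = b" "dim_col j = a" "dim_row k = b" "dim_col k = a"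
  "dim_row z = a" "dim_col z = a"
  using Suc.prems by (simp_all add: j_def k_def z_def)
  have Lk: "cmat Lie * k = k * z + j"
  using Lie_Suc[of "Suc i"] Suc.prems
  by (simp add: j_def k_def z_def cadd flip: cmat_mult)
  have "?L * (k + R (Suc i)) = ?L * k + ?L * R (Suc i)"
  using Suc.prems by (simp add: mat_distl)
  also have "?L * R (Suc i) = fps_X \<cdot>\<^sub>m j" using Suc by (simp add: j_def)
  also have "?L * k = k - fps_X \<cdot>\<^sub>m (k * z + j)" by (simp add: mat_laws Lk)
  also have "k - fps_X \<cdot>\<^sub>m (k * z + j) + fps_X \<cdot>\<^sub>m j = k * (1\<^sub>m a - fps_X \<cdot>\<^sub>m z)"
  by (simp add: mat_laws)
   (auto intro!: eq_matI simp: algebra_simps simp del: index_mult_mat(1))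
  finally have "?L * (k + R (Suc i)) = k * tmat Z" by (simp add: tmat_def z_def)
  hence "?L * ((k + R (Suc i)) * tres Z) = k * (tmat Z * tres Z)"
  using Suc.prems by (simp add: mat_assoc[symmetric])
  hence "?L * ((k + R (Suc i)) * tres Z) = k" using tres(2)[of Z] by (simp add: mat_laws)
  thus ?case
  using Suc.prems by (simp add: RS[of "Suc i"] mat_smultr flip: k_def)
 next
  case 0
  define k where "k = cmat (\<iota> (Suc 0))"
  have [simp]: "dim_row k = b" "dim_col k = a"
  using 0 by (simp_all add: k_def)
  have Lk: "cmat Lie * k = k * cmat Z"
  using Lie1 0 by (simp add: k_def flip: cmat_mult)
  have z: "k + 0\<^sub>m b a = k" by (auto intro!: eq_matI)
  have "?L * k = k * tmat Z" by (simp add: mat_laws Lk tmat_def)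
  hence "?L * (k * tres Z) = k * (tmat Z * tres Z)" by (simp add: mat_assoc[symmetric])
  hence "?L * (k * tres Z) = k" using tres(2)[of Z] by (simp add: mat_laws)
  thus ?case by (simp add: RS[of 0] R0 z mat_smultr flip: k_def)
 qed
 have prR: "cmat pr * R i = (if i = 0 then 0\<^sub>m a a else fps_X ^ i \<cdot>\<^sub>m tres Z ^\<^sub>m i)" if "i <= n" for i
  using that
 proof (induction i)
  case (Suc i)
  have c0: "cmat (0\<^sub>m a a :: 'f mat) = 0\<^sub>m a a" by auto
  have "cmat pr * R (Suc i) = fps_X \<cdot>\<^sub>m ((cmat (pr * \<iota> (Suc i)) + cmat pr * R i) * tres Z)"
  using Suc.prems by (simp add: RS mat_smultr mat_assoc[symmetric] mat_distl cmat_mult)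
  also have "cmat (pr * \<iota> (Suc i)) + cmat pr * R i = fps_X ^ i \<cdot>\<^sub>m tres Z ^\<^sub>m i"
  using Suc pr\<iota>[of "Suc i"] by (auto simp: cmat_one c0 intro!: eq_matI)
  finally show ?case by (simp add: mat_laws mat_smult_smult)
 qed (simp add: R0 mat_laws)
 define Q where "Q = R n * cmat T"
 have dQ [simp]: "dim_row Q = b" "dim_col Q = a" by (simp_all add: Q_def)
 have "?L * (1\<^sub>m b - Q * cmat pr) = ?L - (?L * R n) * (cmat T * cmat pr)"
  by (simp add: mat_distl_minus mat_oner Q_def mat_assoc)
 also have "?L * R n = fps_X \<cdot>\<^sub>m cmat (\<iota> n)" using LR[of "n - 1"] n by simp
 also have "fps_X \<cdot>\<^sub>m cmat (\<iota> n) * (cmat T * cmat pr) = fps_X \<cdot>\<^sub>m cmat (\<iota> n * T * pr)"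
  using n by (simp add: mat_laws cmat_mult)
 also have "?L - fps_X \<cdot>\<^sub>m cmat (\<iota> n * T * pr) = 1\<^sub>m b - fps_X \<cdot>\<^sub>m cmat (Lie + \<iota> n * T * pr)"
  using n by (subst cadd) (auto intro!: eq_matI simp: algebra_simps simp del: index_mult_mat(1))
 finally have "mdet (1\<^sub>m b - fps_X \<cdot>\<^sub>m cmat (Lie + \<iota> n * T * pr)) =
  mdet ?L * mdet (1\<^sub>m b - Q * cmat pr)"
  by (subst det_mult[of _ b, symmetric]) (auto intro!: carrier_matI)
 also have "mdet (1\<^sub>m b - Q * cmat pr) = mdet (1\<^sub>m a - cmat pr * Q)"
  by (rule det_one_minus_swap) (auto intro!: carrier_matI)
 also have "cmat pr * Q = fps_X ^ n \<cdot>\<^sub>m twist n Z T"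
  using n prR[of n] by (simp add: Q_def mat_assoc[symmetric] twist_def mat_smultl)
 finally show ?thesis .
qed

text \<open>A representation \<open>\<mu>\<close> of a subring of a field extends to polynomials, with \<open>1/t\<close> as the variable.\<close>

lemma lfac_scalar:
 fixes \<mu> :: "'e::field => 'f::field mat" and em :: "'k::field => 'e" and iF :: "'k => 'f"
 assumes \<mu>: "!!x. x : R ==> \<mu> x : carrier_mat N N"
  and R: "0 : R" "1 : R" "!!x y. x : R ==> y : R ==> x - y : R" "!!x y. x : R ==> y : R ==> x * y : R"
  and diff: "!!x y. x : R ==> y : R ==> \<mu> (x - y) = \<mu> x - \<mu> y"
  and mult: "!!x y. x : R ==> y : R ==> \<mu> (x * y) = \<mu> x * \<mu> y"
  and em: "!!c. em c : R" "!!c. \<mu> (em c) = iF c \<cdot>\<^sub>m 1\<^sub>m N"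
  and em_hom: "comm_ring_hom em" and iF_hom: "comm_ring_hom iF"
  and \<zeta>: "\<zeta> : R" "\<mu> \<zeta> = Z"
  and P: "map_poly em P = (\<Prod>i<d. [:1, - (\<zeta> ^ (q ^ i)):])"
 shows "lfac n q Z d = fps_of_poly (map_poly iF P) ^ n \<cdot>\<^sub>m 1\<^sub>m N"
proof -
 interpret em: comm_ring_hom em by (rule em_hom)
 interpret iF: comm_ring_hom iF by (rule iF_hom)
 interpret emp: map_poly_comm_ring_hom em ..
 interpret iFp: map_poly_comm_ring_hom iF ..
 \<comment> \<open>A polynomial over \<open>R\<close> becomes a matrix of power series by applying
   \<open>\<mu>\<close> to each coefficient; multiplying the polynomial by 1 - x X then multiplies
   the matrix by \<open>tmat (\<mu> x)\<close>.\<close>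
 define Mg where "Mg g = mat N N (%(i, j). Abs_fps (%k. \<mu> (pcoeff g k) $$ (i, j)))" for g
 have Zc: "Z : carrier_mat N N" using \<zeta> \<mu> by auto
 hence dZ [simp]: "dim_row Z = N" "dim_col Z = N" by auto
 have \<mu>1: "\<mu> 1 = 1\<^sub>m N" using em(2)[of 1] em by (auto intro!: eq_matI)
 have \<mu>0: "\<mu> 0 = 0\<^sub>m N N" using em(2)[of 0] em by (auto intro!: eq_matI)
 have Rpow: "x ^ k : R" if "x : R" for x k using that R by (induction k) auto
 have \<mu>pow: "\<mu> (x ^ k) = \<mu> x ^\<^sub>m k" if "x : R" for x k
 proof (induction k)
  case (Suc k)
  have "\<mu> (x ^ k * x) = \<mu> (x ^ k) * \<mu> x" using that by (intro mult Rpow)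
  thus ?case using Suc by (simp add: mult.commute)
 qed (use \<mu>[OF that] \<mu>1 in auto)
 have co: "pcoeff ([:1, - x:] * g) k = pcoeff g k - x * (if k = 0 then 0 else pcoeff g (k - 1))"
  for x :: 'e and g k
  by (cases k) (auto simp: mult_pCons_left)
 have step: "tmat (\<mu> x) * Mg g = Mg ([:1, - x:] * g)" "ALL k. pcoeff ([:1, - x:] * g) k : R"
  if x: "x : R" and g: "ALL k. pcoeff g k : R" for x g
 proof -
  show "ALL k. pcoeff ([:1, - x:] * g) k : R"
  unfolding co using x g R by auto
  have dx [simp]: "dim_row (\<mu> x) = N" "dim_col (\<mu> x) = N" using \<mu>[OF x] by auto
  have dM [simp]: "dim_row (Mg g) = N" "dim_col (Mg g) = N" for g by (simp_all add: Mg_def)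
  have "tmat (\<mu> x) * Mg g = Mg g - fps_X \<cdot>\<^sub>m (cmat (\<mu> x) * Mg g)"
  unfolding tmat_def by (simp add: mat_laws)
  also have "... = Mg ([:1, - x:] * g)"
  proof (rule eq_matI)
  fix i j assume "i < dim_row (Mg ([:1, - x:] * g))" "j < dim_col (Mg ([:1, - x:] * g))"
  hence ij: "i < N" "j < N" by auto
  have e: "(cmat (\<mu> x) * Mg g) $$ (i, j) = Abs_fps (%k. (\<mu> x * \<mu> (pcoeff g k)) $$ (i, j))"
  proof (rule fps_ext)
   fix k
   have dk: "dim_row (\<mu> (pcoeff g k)) = N" "dim_col (\<mu> (pcoeff g k)) = N" using \<mu> g by auto
   show "fps_nth ((cmat (\<mu> x) * Mg g) $$ (i, j)) k =
    fps_nth (Abs_fps (%k. (\<mu> x * \<mu> (pcoeff g k)) $$ (i, j))) k"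
    using ij dk by (auto simp: scalar_prod_def Mg_def fps_sum_nth intro!: sum.cong)
  qed
  show "(Mg g - fps_X \<cdot>\<^sub>m (cmat (\<mu> x) * Mg g)) $$ (i, j) = Mg ([:1, - x:] * g) $$ (i, j)"
  proof (rule fps_ext)
   fix k
   have gk: "pcoeff g l : R" for l using g by auto
   have dk: "dim_row (\<mu> (pcoeff g l)) = N" "dim_col (\<mu> (pcoeff g l)) = N" for l using \<mu> gk by auto
   have "\<mu> (pcoeff ([:1, - x:] * g) k) =
    \<mu> (pcoeff g k) - (if k = 0 then 0\<^sub>m N N else \<mu> x * \<mu> (pcoeff g (k - 1)))"
    unfolding co using x gk R mult[of x] diff[of "pcoeff g k"] by (auto simp: \<mu>0)
   moreover have "(Mg g - fps_X \<cdot>\<^sub>m (cmat (\<mu> x) * Mg g)) $$ (i, j) =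
    Mg g $$ (i, j) - fps_X * Abs_fps (%k. (\<mu> x * \<mu> (pcoeff g k)) $$ (i, j))"
    using ij e by (simp del: index_mult_mat(1))
   ultimately show "fps_nth ((Mg g - fps_X \<cdot>\<^sub>m (cmat (\<mu> x) * Mg g)) $$ (i, j)) k =
    fps_nth (Mg ([:1, - x:] * g) $$ (i, j)) k"
    using ij dk by (simp add: Mg_def del: index_mult_mat(1) mult_pCons_left)
  qed
  qed auto
  finally show "tmat (\<mu> x) * Mg g = Mg ([:1, - x:] * g)" .
 qed
 have stepn: "tmat (\<mu> x) ^\<^sub>m k * Mg g = Mg ([:1, - x:] ^ k * g) & (ALL l. pcoeff ([:1, - x:] ^ k * g) l : R)"
  if x: "x : R" and g: "ALL k. pcoeff g k : R" for x g k
 proof (induction k)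
  case 0
  have "dim_row (\<mu> x) = N" using \<mu>[OF x] by auto
  thus ?case using g by (simp add: Mg_def mat_laws)
 next
  case (Suc k)
  have dx: "dim_row (\<mu> x) = N" "dim_col (\<mu> x) = N" using \<mu>[OF x] by auto
  have "tmat (\<mu> x) ^\<^sub>m Suc k * Mg g = tmat (\<mu> x) * (tmat (\<mu> x) ^\<^sub>m k * Mg g)"
  by (simp only: mat_pow_Suc' dim_tmat dx) (simp add: mat_assoc dx Mg_def)
  thus ?case using step[OF x, of "[:1, - x:] ^ k * g"] Suc by (simp add: mult.assoc del: mult_pCons_left)
 qed
 have main: "lfac n q Z j = Mg ((\<Prod>i<j. [:1, - (\<zeta> ^ (q ^ i)):]) ^ n) \<and>
  (ALL l. pcoeff ((\<Prod>i<j. [:1, - (\<zeta> ^ (q ^ i)):]) ^ n) l : R)" for j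
 proof (induction j)
  case 0
  have "Mg 1 = 1\<^sub>m N"
  proof (rule eq_matI)
  fix i j assume ij: "i < dim_row (1\<^sub>m N :: 'f fps mat)" "j < dim_col (1\<^sub>m N :: 'f fps mat)"
  show "Mg 1 $$ (i, j) = 1\<^sub>m N $$ (i, j)"
   by (rule fps_ext) (use ij in \<open>auto simp: Mg_def \<mu>0 \<mu>1 one_pCons coeff_pCons split: nat.splits\<close>)
  qed (auto simp: Mg_def)
  moreover have "pcoeff (1 :: 'e poly) l : R" for l
  using R by (auto simp: one_pCons coeff_pCons split: nat.splits)
  ultimately show ?case by simp
 next
  case (Suc j)
  have \<zeta>j: "\<zeta> ^ (q ^ j) : R" by (rule Rpow) (rule \<zeta>)
  have "lfac n q Z (Suc j) = tmat (\<mu> (\<zeta> ^ (q ^ j))) ^\<^sub>m n * lfac n q Z j"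
  by (simp add: \<mu>pow \<zeta>)
  moreover have "(\<Prod>i<Suc j. [:1, - (\<zeta> ^ (q ^ i)):]) ^ n =
   [:1, - (\<zeta> ^ (q ^ j)):] ^ n * (\<Prod>i<j. [:1, - (\<zeta> ^ (q ^ i)):]) ^ n"
  by (simp only: prod.lessThan_Suc power_mult_distrib mult.commute)
  ultimately show ?case using stepn[OF \<zeta>j, of "(\<Prod>i<j. [:1, - (\<zeta> ^ (q ^ i)):]) ^ n" n] Suc
  by (simp del: mult_pCons_left mult_pCons_right lfac.simps)
 qed
 \<comment> \<open>By \<open>P\<close> the product over the conjugates has coefficients from k, and
   \<open>\<mu>\<close> sends those to scalar matrices.\<close>
 have "(\<Prod>i<d. [:1, - (\<zeta> ^ (q ^ i)):]) ^ n = map_poly em (P ^ n)"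
  by (simp add: P emp.hom_power)
 hence "lfac n q Z d = Mg (map_poly em (P ^ n))" using main[of d] by simp
 also have "... = fps_of_poly (map_poly iF (P ^ n)) \<cdot>\<^sub>m 1\<^sub>m N"
  by (rule eq_matI) (auto simp: Mg_def coeff_map_poly em(2) intro!: fps_ext)
 also have "fps_of_poly (map_poly iF (P ^ n)) = fps_of_poly (map_poly iF P) ^ n"
  by (simp add: iFp.hom_power fps_of_poly_power)
 finally show ?thesis .
qed

no_notation fps_nth (infixl \<open>$\<close> 75)

section \<open>Coordinates\<close>

text \<open>Closure of the carrier under the operations is included, so that the vector space axioms
  can be pulled back from \<open>carrier_vec n\<close>, as in
  \<open>coords_vectorspace\<close>.\<close>

definition coords :: "('f::field, 'm) module => nat => ('m => 'f vec) => bool" where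
 "coords M n T \<longleftrightarrow> bij_betw T (carrier M) (carrier_vec n) & \<zero>\<^bsub>M\<^esub> : carrier M & T \<zero>\<^bsub>M\<^esub> = 0\<^sub>v n \<and>
  (ALL x:carrier M. ALL y:carrier M. x \<oplus>\<^bsub>M\<^esub> y : carrier M & T (x \<oplus>\<^bsub>M\<^esub> y) = T x + T y) \<and>
  (ALL c. ALL x:carrier M. c \<odot>\<^bsub>M\<^esub> x : carrier M & T (c \<odot>\<^bsub>M\<^esub> x) = c \<cdot>\<^sub>v T x)"

lemma coordsD:
 assumes "coords M n T"
 shows "\<zero>\<^bsub>M\<^esub> : carrier M" "T \<zero>\<^bsub>M\<^esub> = 0\<^sub>v n"
  "!!x. x : carrier M ==> T x : carrier_vec n"
  "!!x y. x : carrier M ==> y : carrier M ==> x \<oplus>\<^bsub>M\<^esub> y : carrier M"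
  "!!x y. x : carrier M ==> y : carrier M ==> T (x \<oplus>\<^bsub>M\<^esub> y) = T x + T y"
  "!!c x. x : carrier M ==> c \<odot>\<^bsub>M\<^esub> x : carrier M"
  "!!c x. x : carrier M ==> T (c \<odot>\<^bsub>M\<^esub> x) = c \<cdot>\<^sub>v T x"
  "!!x y. x : carrier M ==> y : carrier M ==> T x = T y ==> x = y"
  "!!v. v : carrier_vec n ==> EX x:carrier M. T x = v"
proof -
 have img: "T ` carrier M = carrier_vec n" and inj: "inj_on T (carrier M)"
  using assms by (auto simp: coords_def bij_betw_def)
 show "!!x. x : carrier M ==> T x : carrier_vec n" using img by blast
 show "!!x y. x : carrier M ==> y : carrier M ==> T x = T y ==> x = y"
  using inj by (auto dest: inj_onD)
 show "!!v. v : carrier_vec n ==> EX x:carrier M. T x = v" unfolding img[symmetric] by blast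
qed (use assms in \<open>auto simp: coords_def\<close>)

lemma coords_vectorspace:
 fixes M :: "('f::field, 'm) module"
 assumes c: "coords M n T"
 shows "vectorspace class_ring M"
proof (rule vs_criteria)
 note D = coordsD[OF c]
 have dT [simp]: "dim_vec (T x) = n" if "x : carrier M" for x using D(3)[OF that] by simp
 show "field (class_ring :: 'f ring)" by (rule class_field)
 show "\<zero>\<^bsub>M\<^esub> : carrier M" by (rule D)
 show "ALL v w. v : carrier M & w : carrier M --> v \<oplus>\<^bsub>M\<^esub> w : carrier M" using D(4) by blast
 show "ALL c v. c : carrier (class_ring :: 'f ring) & v : carrier M --> c \<odot>\<^bsub>M\<^esub> v : carrier M"
  using D(6) by blast
 show "ALL v:carrier M. EX neg_v:carrier M. v \<oplus>\<^bsub>M\<^esub> neg_v = \<zero>\<^bsub>M\<^esub>"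
 proof
  fix v assume v: "v : carrier M"
  have "T (v \<oplus>\<^bsub>M\<^esub> ((-1) \<odot>\<^bsub>M\<^esub> v)) = T v + (-1) \<cdot>\<^sub>v T v" using v by (simp add: D(4-7))
  also have "... = 0\<^sub>v n" using D(3)[OF v] by (auto intro!: eq_vecI)
  finally show "EX neg_v:carrier M. v \<oplus>\<^bsub>M\<^esub> neg_v = \<zero>\<^bsub>M\<^esub>"
  using v D(1,2,4,6) by (intro bexI[of _ "(-1) \<odot>\<^bsub>M\<^esub> v"] D(8)) simp_all
 qed
 show "ALL v w. v : carrier M & w : carrier M --> v \<oplus>\<^bsub>M\<^esub> w = w \<oplus>\<^bsub>M\<^esub> v"
  by (intro allI ballI impI D(8); (elim conjE)?) (simp_all add: D(1,2,4-7), (intro eq_vecI; simp add: algebra_simps)?)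
 show "ALL v w x. v : carrier M & w : carrier M & x : carrier M -->
  v \<oplus>\<^bsub>M\<^esub> w \<oplus>\<^bsub>M\<^esub> x = v \<oplus>\<^bsub>M\<^esub> (w \<oplus>\<^bsub>M\<^esub> x)"
  by (intro allI ballI impI D(8); (elim conjE)?) (simp_all add: D(1,2,4-7), (intro eq_vecI; simp add: algebra_simps)?)
 show "ALL v:carrier M. v \<oplus>\<^bsub>M\<^esub> \<zero>\<^bsub>M\<^esub> = v"
  by (intro allI ballI impI D(8); (elim conjE)?) (simp_all add: D(1,2,4-7), (intro eq_vecI; simp add: algebra_simps)?)
 show "ALL a b v. a : carrier (class_ring :: 'f ring) & b : carrier (class_ring :: 'f ring) & v : carrier M -->
  (a \<otimes>\<^bsub>class_ring\<^esub> b) \<odot>\<^bsub>M\<^esub> v = a \<odot>\<^bsub>M\<^esub> (b \<odot>\<^bsub>M\<^esub> v)"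
  by (intro allI ballI impI D(8); (elim conjE)?) (simp_all add: D(1,2,4-7), (intro eq_vecI; simp add: algebra_simps)?)
 show "ALL v:carrier M. \<one>\<^bsub>class_ring :: 'f ring\<^esub> \<odot>\<^bsub>M\<^esub> v = v"
  by (intro allI ballI impI D(8); (elim conjE)?) (simp_all add: D(1,2,4-7), (intro eq_vecI; simp add: algebra_simps)?)
 show "ALL a b v. a : carrier (class_ring :: 'f ring) & b : carrier (class_ring :: 'f ring) & v : carrier M -->
  (a \<oplus>\<^bsub>class_ring\<^esub> b) \<odot>\<^bsub>M\<^esub> v = a \<odot>\<^bsub>M\<^esub> v \<oplus>\<^bsub>M\<^esub> b \<odot>\<^bsub>M\<^esub> v"
  by (intro allI ballI impI D(8); (elim conjE)?) (simp_all add: D(1,2,4-7), (intro eq_vecI; simp add: algebra_simps)?)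
 show "ALL a v w. a : carrier (class_ring :: 'f ring) & v : carrier M & w : carrier M -->
  a \<odot>\<^bsub>M\<^esub> (v \<oplus>\<^bsub>M\<^esub> w) = a \<odot>\<^bsub>M\<^esub> v \<oplus>\<^bsub>M\<^esub> a \<odot>\<^bsub>M\<^esub> w"
  by (intro allI ballI impI D(8); (elim conjE)?) (simp_all add: D(1,2,4-7), (intro eq_vecI; simp add: algebra_simps)?)
qed

lemma coords_lincomb:
 assumes c: "coords M n T" and B: "finite B" "B <= carrier M"
 shows "module.lincomb M a B : carrier M"
  "!!i. i < n ==> T (module.lincomb M a B) $ i = (\<Sum>v\<in>B. a v * (T v $ i))"
proof -
 note D = coordsD[OF c]
 interpret vs: vectorspace class_ring M by (rule coords_vectorspace[OF c])
 have "vs.lincomb a B : carrier M \<and>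
  (ALL i<n. T (vs.lincomb a B) $ i = (\<Sum>v\<in>B. a v * (T v $ i)))"
  using B
 proof (induction B rule: finite_induct)
  case (insert x B)
  have cl: "(%v. a v \<odot>\<^bsub>M\<^esub> v) : insert x B \<rightarrow> carrier M" using insert by (auto intro: D)
  have "vs.lincomb a (insert x B) = a x \<odot>\<^bsub>M\<^esub> x \<oplus>\<^bsub>M\<^esub> vs.lincomb a B"
  unfolding vs.lincomb_def using insert cl by (subst vs.M.finsum_insert) auto
  moreover have "x : carrier M" "vs.lincomb a B : carrier M" using insert by auto
  moreover from this have [simp]: "dim_vec (T x) = n" "dim_vec (T (vs.lincomb a B)) = n"
  using D(3) by auto
  ultimately show ?case using insert by (auto simp: D(4-7))
 qed (auto simp: vs.lincomb_def D(1-7))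
 thus "vs.lincomb a B : carrier M"
  "!!i. i < n ==> T (vs.lincomb a B) $ i = (\<Sum>v\<in>B. a v * (T v $ i))" by auto
qed

lemma basis_iff:
 fixes M :: "('f::field, 'm) module"
 assumes "vectorspace class_ring M" "finite B" "B <= carrier M"
 shows "vectorspace.basis class_ring M B \<longleftrightarrow>
  (ALL v. v : carrier M --> (EX! a. a : B \<rightarrow>\<^sub>E UNIV & module.lincomb M a B = v))"
proof -
 interpret vs: vectorspace class_ring M by fact
 show ?thesis using vs.basis_criterion[OF assms(2,3)] by simp
qed

lemma coords_unit_basis:
 fixes M :: "('f::field, 'm) module"
 assumes c: "coords M n T"
 obtains bs where "length bs = n" "distinct bs" "set bs <= carrier M"
  "!!i. i < n ==> T (bs ! i) = unit_vec n i" "ordered_basis M bs"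
proof -
 note D = coordsD[OF c]
 have "ALL i. EX x. i < n --> x : carrier M & T x = unit_vec n i"
  using D(9)[OF unit_vec_carrier] by blast
 then obtain b where b: "!!i. i < n ==> b i : carrier M & T (b i) = unit_vec n i" by metis
 have inj: "inj_on b {0..<n}"
 proof (rule inj_onI)
  fix i j assume "i : {0..<n}" "j : {0..<n}" "b i = b j"
  hence "unit_vec n i $ i = (unit_vec n j $ i :: 'f)" "i < n" "j < n" using b by (metis atLeastLessThan_iff)+
  thus "i = j" by (auto split: if_splits)
 qed
 let ?bs = "map b [0..<n]"
 have dist: "distinct ?bs" using inj by (simp add: distinct_map)
 have sub: "set ?bs <= carrier M" using b by auto
 have set: "set ?bs = b ` {0..<n}" by auto
 have lc: "T (module.lincomb M a (set ?bs)) $ i = a (b i)" if "i < n" for a i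
 proof -
  have "T (module.lincomb M a (set ?bs)) $ i = (\<Sum>v\<in>b ` {0..<n}. a v * (T v $ i))"
  using coords_lincomb(2)[OF c _ sub that] by simp
  also have "... = (\<Sum>j\<in>{0..<n}. a (b j) * (T (b j) $ i))" by (subst sum.reindex[OF inj]) simp
  also have "... = (\<Sum>j\<in>{0..<n}. if j = i then a (b i) else 0)"
  by (rule sum.cong) (use b that in \<open>auto simp: unit_vec_def\<close>)
  also have "... = a (b i)" using that by simp
  finally show ?thesis .
 qed
 have "vectorspace.basis class_ring M (set ?bs)"
 proof (subst basis_iff[OF coords_vectorspace[OF c] _ sub]; (intro allI impI)?)
  fix v assume v: "v : carrier M"
  show "EX! a. a : set ?bs \<rightarrow>\<^sub>E UNIV & module.lincomb M a (set ?bs) = v"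
  proof (rule ex1I)
  let ?a = "\<lambda>x\<in>set ?bs. T v $ (the_inv_into {0..<n} b x)"
  have "T (module.lincomb M ?a (set ?bs)) = T v"
  proof (rule eq_vecI)
   show "dim_vec (T (module.lincomb M ?a (set ?bs))) = dim_vec (T v)"
    using D(3)[OF v] D(3)[OF coords_lincomb(1)[OF c _ sub, of ?a]] by simp
   fix i assume "i < dim_vec (T v)"
   hence i: "i < n" using D(3)[OF v] by simp
   have "the_inv_into {0..<n} b (b i) = i" using the_inv_into_f_f[OF inj] i by simp
   thus "T (module.lincomb M ?a (set ?bs)) $ i = T v $ i" using i by (simp only: lc) simp
  qed
  thus "?a : set ?bs \<rightarrow>\<^sub>E UNIV & module.lincomb M ?a (set ?bs) = v"
   using D(8)[OF coords_lincomb(1)[OF c _ sub, of ?a] v] by auto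
  fix a assume a: "a : set ?bs \<rightarrow>\<^sub>E UNIV & module.lincomb M a (set ?bs) = v"
  show "a = ?a"
  proof (rule extensionalityI[of _ "set ?bs"])
   fix x assume "x : set ?bs"
   then obtain i where i: "i < n" "x = b i" by auto
   have "the_inv_into {0..<n} b (b i) = i" using the_inv_into_f_f[OF inj] i by simp
   thus "a x = ?a x" using i lc[of i a] a by simp
  qed (use a in \<open>auto simp: PiE_def\<close>)
  qed
 qed simp
 hence "ordered_basis M ?bs" using dist by (simp add: ordered_basis_def)
 thus ?thesis using b by (intro that[OF _ dist sub]) auto
qed

text \<open>\<open>endo_mat\<close> refers to an arbitrarily chosen basis. The matrix
  \<open>S\<close> of the \<open>T\<close>-coordinates of that basis conjugates one matrix into the
  other, so characteristic polynomials and determinants may be computed in any coordinates.\<close>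

lemma endo_mat_coords:
 fixes M :: "('f::field, 'm) module"
 assumes c: "coords M n T" and \<phi>: "!!x. x : carrier M ==> \<phi> x : carrier M"
  and A: "A : carrier_mat n n" "!!x. x : carrier M ==> T (\<phi> x) = A *\<^sub>v T x"
 shows "endo_mat M \<phi> : carrier_mat n n" "similar_mat A (endo_mat M \<phi>)"
proof -
 note D = coordsD[OF c]
 interpret vs: vectorspace class_ring M by (rule coords_vectorspace[OF c])
 obtain bs0 where bs0: "length bs0 = n" "ordered_basis M bs0" using coords_unit_basis[OF c] by metis
 define bs where "bs = (SOME bs. ordered_basis M bs)"
 have ob: "ordered_basis M bs" unfolding bs_def by (rule someI) (rule bs0)
 hence dist: "distinct bs" and bas: "vs.basis (set bs)" by (auto simp: ordered_basis_def)
 hence sub: "set bs <= carrier M" by (auto simp: vs.basis_def)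
 have "card (set bs0) = card (set bs)"
  using vs.dim_basis[OF _ bas] vs.dim_basis[of "set bs0"] bs0 by (simp add: ordered_basis_def)
 hence len: "length bs = n"
  using bs0 dist by (simp add: distinct_card ordered_basis_def)
 define S where "S = mat n n (%(i, j). T (bs ! j) $ i)"
 define E where "E = endo_mat M \<phi>"
 have E: "E = mat n n (%(i, j). basis_coeffs M (set bs) (\<phi> (bs ! j)) (bs ! i))"
  unfolding E_def endo_mat_def endo_mat_wrt_def bs_def[symmetric] len by simp
 have coeffs: "vs.lincomb (basis_coeffs M (set bs) x) (set bs) = x" if x: "x : carrier M" for x
 proof -
  have "EX! a. a : set bs \<rightarrow>\<^sub>E UNIV & vs.lincomb a (set bs) = x"
  using bas x basis_iff[OF coords_vectorspace[OF c] _ sub] by auto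
  hence "EX! a. a : set bs \<rightarrow>\<^sub>E UNIV & x = vs.lincomb a (set bs)" by metis
  from theI'[OF this] show ?thesis unfolding basis_coeffs_def by simp
 qed
 have expand: "T x $ i = (\<Sum>l<n. basis_coeffs M (set bs) x (bs ! l) * (T (bs ! l) $ i))"
  if x: "x : carrier M" and i: "i < n" for x i
 proof -
  have "T x $ i = (\<Sum>v\<in>set bs. basis_coeffs M (set bs) x v * (T v $ i))"
  using coords_lincomb(2)[OF c _ sub i, of "basis_coeffs M (set bs) x"] coeffs[OF x] by simp
  also have "bij_betw ((!) bs) {..<n} (set bs)" using bij_betw_nth[OF dist] len by simp
  hence "(\<Sum>v\<in>set bs. basis_coeffs M (set bs) x v * (T v $ i)) =
   (\<Sum>l<n. basis_coeffs M (set bs) x (bs ! l) * (T (bs ! l) $ i))"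
  by (rule sum.reindex_bij_betw[symmetric])
  finally show ?thesis .
 qed
 have bsj: "bs ! j : carrier M" "T (bs ! j) : carrier_vec n" if "j < n" for j
  using that len sub D(3)[of "bs ! j"] by (auto simp: subset_iff)
 have Sc: "S : carrier_mat n n" and Ec: "E : carrier_mat n n" by (auto simp: S_def E)
 have AS: "A * S = S * E"
 proof (rule eq_matI)
  fix i j assume "i < dim_row (S * E)" "j < dim_col (S * E)"
  hence ij: "i < n" "j < n" using Sc Ec by auto
  have "(A * S) $$ (i, j) = (A *\<^sub>v T (bs ! j)) $ i"
  using ij A bsj[of j] by (auto simp: S_def scalar_prod_def)
  also have "... = T (\<phi> (bs ! j)) $ i" using A bsj ij by simp
  also have "... = (\<Sum>l<n. basis_coeffs M (set bs) (\<phi> (bs ! j)) (bs ! l) * (T (bs ! l) $ i))"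
  using ij bsj by (intro expand \<phi>) auto
  also have "... = (S * E) $$ (i, j)"
  using ij by (auto simp: S_def E scalar_prod_def atLeast0LessThan mult.commute intro!: sum.cong)
  finally show "(A * S) $$ (i, j) = (S * E) $$ (i, j)" .
 qed (use A Sc Ec in auto)
 have "ALL i. EX x. i < n --> x : carrier M & T x = unit_vec n i"
  using D(9)[OF unit_vec_carrier] by blast
 then obtain b where b: "!!i. i < n ==> b i : carrier M & T (b i) = unit_vec n i" by metis
 \<comment> \<open>The inverse of \<open>S\<close>: the preimages \<open>b j\<close> of the unit
   vectors, expanded in the chosen basis.\<close>
 define C where "C = mat n n (%(l, j). basis_coeffs M (set bs) (b j) (bs ! l))"
 have Cc: "C : carrier_mat n n" by (auto simp: C_def)
 have SC: "S * C = 1\<^sub>m n"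
 proof (rule eq_matI)
  fix i j assume "i < dim_row (1\<^sub>m n :: 'f mat)" "j < dim_col (1\<^sub>m n :: 'f mat)"
  hence ij: "i < n" "j < n" by auto
  have "(S * C) $$ (i, j) = (\<Sum>l<n. basis_coeffs M (set bs) (b j) (bs ! l) * (T (bs ! l) $ i))"
  using ij by (auto simp: S_def C_def scalar_prod_def atLeast0LessThan mult.commute intro!: sum.cong)
  also have "... = T (b j) $ i" using expand[of "b j" i] b ij by auto
  finally show "(S * C) $$ (i, j) = 1\<^sub>m n $$ (i, j)" using b ij by (auto simp: unit_vec_def)
 qed (use Sc Cc in auto)
 hence CS: "C * S = 1\<^sub>m n" by (rule mat_mult_left_right_inverse[OF Sc Cc])
 show "endo_mat M \<phi> : carrier_mat n n" using Ec by (simp add: E_def)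
 have "A = S * E * C"
  using AS SC A(1) Sc Ec Cc by (metis assoc_mult_mat right_mult_one_mat)
 thus "similar_mat A (endo_mat M \<phi>)" unfolding E_def[symmetric]
  by (intro similar_matI[of _ _ S C n]) (use A Sc Ec Cc SC CS in auto)
qed

lemma mod_char_poly_coords:
 fixes M :: "('f::field, 'm) module"
 assumes "coords M n T" and "!!x. x : carrier M ==> \<phi> x : carrier M"
  and "A : carrier_mat n n" "!!x. x : carrier M ==> T (\<phi> x) = A *\<^sub>v T x"
 shows "mod_char_poly M \<phi> = char_poly A"
 using endo_mat_coords(2)[OF assms] unfolding mod_char_poly_def by (simp add: char_poly_similar)

lemma fls_const_hom: "comm_ring_hom (fls_const :: 'f::field => _)"
 by standard (auto simp: fls_plus_const fls_const_mult_const)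

lemma det_one_minus_coords:
 fixes M :: "('f::field, 'm) module"
 assumes "coords M n T" and "!!x. x : carrier M ==> \<phi> x : carrier M"
  and "A : carrier_mat n n" "!!x. x : carrier M ==> T (\<phi> x) = A *\<^sub>v T x"
 shows "det_one_minus c M \<phi> = mdet (1\<^sub>m n - c \<cdot>\<^sub>m map_mat fls_const A)"
proof -
 interpret h: comm_ring_hom "fls_const :: 'f => _" by (rule fls_const_hom)
 let ?h = "map_mat fls_const"
 define E where "E = endo_mat M \<phi>"
 have E: "E : carrier_mat n n" and "similar_mat A E" using endo_mat_coords[OF assms] by (auto simp: E_def)
 then obtain S C where w: "similar_mat_wit A E S C" unfolding similar_mat_def by blast
 have SC: "S : carrier_mat n n" "C : carrier_mat n n" "S * C = 1\<^sub>m n" "C * S = 1\<^sub>m n" "A = S * E * C"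
  using similar_mat_witD2[OF assms(3) w] by - (assumption+)
 have d [simp]: "dim_row S = n" "dim_col S = n" "dim_row C = n" "dim_col C = n" "dim_row E = n" "dim_col E = n"
  using SC E by auto
 have m: "?h (X * Y) = ?h X * ?h Y" if "dim_col X = dim_row Y" for X Y :: "'f mat"
  using that by (rule map_mat_mult_hom[OF fls_const_hom])
 have hSC: "?h S * ?h C = 1\<^sub>m n" "?h C * ?h S = 1\<^sub>m n" using SC h.mat_hom_one by (simp_all add: m[symmetric])
 have "1\<^sub>m n - c \<cdot>\<^sub>m ?h A = ?h S * (1\<^sub>m n - c \<cdot>\<^sub>m ?h E) * ?h C"
  unfolding SC(5) by (simp add: m mat_laws hSC)
 hence "similar_mat (1\<^sub>m n - c \<cdot>\<^sub>m ?h A) (1\<^sub>m n - c \<cdot>\<^sub>m ?h E)"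
  by (intro similar_matI[of _ _ "?h S" "?h C" n]) (use hSC assms(3) in \<open>auto intro!: carrier_matI\<close>)
 thus ?thesis unfolding det_one_minus_def Let_def E_def[symmetric] d by (simp add: det_similar)
qed

lemma coords_linear_mat:
 fixes M1 :: "('f::field, 'm) module"
 assumes c1: "coords M1 n1 T1" and c2: "coords M2 n2 T2"
  and f: "!!x. x : carrier M1 ==> f x : carrier M2"
  and add: "!!x y. x : carrier M1 ==> y : carrier M1 ==> f (x \<oplus>\<^bsub>M1\<^esub> y) = f x \<oplus>\<^bsub>M2\<^esub> f y"
  and smult: "!!a x. x : carrier M1 ==> f (a \<odot>\<^bsub>M1\<^esub> x) = a \<odot>\<^bsub>M2\<^esub> f x"
 obtains A where "A : carrier_mat n2 n1" "!!x. x : carrier M1 ==> T2 (f x) = A *\<^sub>v T1 x"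
proof -
 note D1 = coordsD[OF c1] and D2 = coordsD[OF c2]
 interpret m1: vectorspace class_ring M1 by (rule coords_vectorspace[OF c1])
 interpret m2: vectorspace class_ring M2 by (rule coords_vectorspace[OF c2])
 obtain bs where bs: "length bs = n1" "distinct bs" "set bs <= carrier M1"
  "!!i. i < n1 ==> T1 (bs ! i) = unit_vec n1 i" using coords_unit_basis[OF c1] by metis
 have bsc: "bs ! j : carrier M1" if "j < n1" for j using bs that by auto
 define A where "A = mat n2 n1 (%(i, j). T2 (f (bs ! j)) $ i)"
 have f0: "f \<zero>\<^bsub>M1\<^esub> = \<zero>\<^bsub>M2\<^esub>"
  using smult[of "\<zero>\<^bsub>M1\<^esub>" 0] f[of "\<zero>\<^bsub>M1\<^esub>"] m1.smult_l_null[of "\<zero>\<^bsub>M1\<^esub>"] m2.smult_l_null[of "f \<zero>\<^bsub>M1\<^esub>"] by simp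
 have lin: "T2 (f (m1.lincomb a (set xs))) = T2 (f (m1.lincomb a (set xs))) \<and>
  (ALL i<n2. T2 (f (m1.lincomb a (set xs))) $ i = (\<Sum>v\<in>set xs. a v * (T2 (f v) $ i)))"
  if "set xs <= carrier M1" "distinct xs" for a xs
  using that
 proof (induction xs)
  case Nil
  thus ?case by (auto simp: m1.lincomb_def f0 D2(1-7))
 next
  case (Cons x xs)
  have cl: "(%v. a v \<odot>\<^bsub>M1\<^esub> v) : insert x (set xs) \<rightarrow> carrier M1" using Cons by (auto intro: D1)
  have e: "m1.lincomb a (set (x # xs)) = a x \<odot>\<^bsub>M1\<^esub> x \<oplus>\<^bsub>M1\<^esub> m1.lincomb a (set xs)"
  unfolding m1.lincomb_def list.set using Cons cl by (subst m1.M.finsum_insert) auto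
  have cc: "x : carrier M1" "m1.lincomb a (set xs) : carrier M1" using Cons by auto
  hence "f (m1.lincomb a (set (x # xs))) = a x \<odot>\<^bsub>M2\<^esub> f x \<oplus>\<^bsub>M2\<^esub> f (m1.lincomb a (set xs))"
  unfolding e by (simp add: add smult D1(1-7))
  moreover have [simp]: "dim_vec (T2 (f x)) = n2" "dim_vec (T2 (f (m1.lincomb a (set xs)))) = n2"
  using D2(3)[OF f] cc by auto
  ultimately show ?case using Cons cc f by (auto simp: D2(4-7))
 qed
 have "T2 (f x) = A *\<^sub>v T1 x" if x: "x : carrier M1" for x
 proof -
  define a where "a = (%v. T1 x $ (THE i. i < n1 & bs ! i = v))"
  have a: "a (bs ! i) = T1 x $ i" if "i < n1" for i
  proof -
  have "(THE j. j < n1 & bs ! j = bs ! i) = i"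
   using that bs nth_eq_iff_index_eq[of bs] by (intro the_equality) auto
  thus ?thesis by (simp add: a_def)
  qed
  have bij: "bij_betw ((!) bs) {..<n1} (set bs)" using bij_betw_nth[OF bs(2)] bs(1) by simp
  have "T1 (m1.lincomb a (set bs)) = T1 x"
  proof (rule eq_vecI)
  show "dim_vec (T1 (m1.lincomb a (set bs))) = dim_vec (T1 x)"
   using D1(3)[OF x] D1(3)[OF coords_lincomb(1)[OF c1 _ bs(3), of a]] by simp
  fix i assume "i < dim_vec (T1 x)"
  hence i: "i < n1" using D1(3)[OF x] by simp
  have "T1 (m1.lincomb a (set bs)) $ i = (\<Sum>l<n1. a (bs ! l) * (T1 (bs ! l) $ i))"
   using coords_lincomb(2)[OF c1 _ bs(3) i, of a] sum.reindex_bij_betw[OF bij, of "%v. a v * (T1 v $ i)"] by simp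
  also have "... = (\<Sum>l<n1. if l = i then T1 x $ i else 0)"
   by (rule sum.cong) (use i a bs in \<open>auto simp: unit_vec_def\<close>)
  finally show "T1 (m1.lincomb a (set bs)) $ i = T1 x $ i" using i by simp
  qed
  hence x': "m1.lincomb a (set bs) = x"
  using D1(8)[OF coords_lincomb(1)[OF c1 _ bs(3), of a] x] by simp
  show ?thesis
  proof (rule eq_vecI)
  show "dim_vec (T2 (f x)) = dim_vec (A *\<^sub>v T1 x)" using D2(3)[OF f[OF x]] by (simp add: A_def)
  fix i assume "i < dim_vec (A *\<^sub>v T1 x)"
  hence i: "i < n2" by (simp add: A_def)
  have "T2 (f x) $ i = (\<Sum>l<n1. a (bs ! l) * (T2 (f (bs ! l)) $ i))"
   using lin[OF bs(3,2), of a] i sum.reindex_bij_betw[OF bij, of "%v. a v * (T2 (f v) $ i)"] x' by simp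
  also have "... = (A *\<^sub>v T1 x) $ i"
   using i D1(3)[OF x] by (auto simp: A_def scalar_prod_def a atLeast0LessThan mult.commute intro!: sum.cong)
  finally show "T2 (f x) $ i = (A *\<^sub>v T1 x) $ i" .
  qed
 qed
 thus ?thesis by (intro that[of A]) (auto simp: A_def)
qed

lemma coords_linear_ex:
 fixes M1 :: "('f::field, 'm) module"
 assumes "coords M1 n1 T1" and "coords M2 n2 T2"
  and "!!x. x : carrier M1 ==> f x : carrier M2"
  and "!!x y. x : carrier M1 ==> y : carrier M1 ==> f (x \<oplus>\<^bsub>M1\<^esub> y) = f x \<oplus>\<^bsub>M2\<^esub> f y"
  and "!!a x. x : carrier M1 ==> f (a \<odot>\<^bsub>M1\<^esub> x) = a \<odot>\<^bsub>M2\<^esub> f x"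
 shows "EX A:carrier_mat n2 n1. ALL x:carrier M1. T2 (f x) = A *\<^sub>v T1 x"
proof -
 obtain A where "A : carrier_mat n2 n1" "!!x. x : carrier M1 ==> T2 (f x) = A *\<^sub>v T1 x"
  using coords_linear_mat[OF assms] by metis
 thus ?thesis by blast
qed

lemma coords_mat_eqI:
 fixes A B :: "'f::field mat"
 assumes c: "coords M n T" and A: "A : carrier_mat m n" and B: "B : carrier_mat m n"
  and eq: "!!x. x : carrier M ==> A *\<^sub>v T x = B *\<^sub>v T x"
 shows "A = B"
proof (rule eq_matI)
 fix i j assume "i < dim_row B" "j < dim_col B"
 hence ij: "i < m" "j < n" using B by auto
 obtain x where x: "x : carrier M" "T x = unit_vec n j" using coordsD(9)[OF c, of "unit_vec n j"] by auto
 have "(C *\<^sub>v unit_vec n j) $ i = C $$ (i, j)" if "C : carrier_mat m n" for C :: "'f mat"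
 proof -
  have "(C *\<^sub>v unit_vec n j) $ i = row C i \<bullet> unit_vec n j" using that ij by simp
  also have "... = row C i $ j" using that ij by (intro scalar_prod_right_unit) auto
  finally show ?thesis using that ij by simp
 qed
 thus "A $$ (i, j) = B $$ (i, j)" using eq[OF x(1)] A B x by metis
qed (use A B in auto)

lemma coords_exists:
 fixes M :: "('f::field, 'm) module"
 assumes vs: "vectorspace class_ring M" and fd: "vectorspace.fin_dim class_ring M"
 obtains n T where "coords M n T"
proof -
 interpret vs: vectorspace class_ring M by fact
 obtain B where B: "finite B" "vs.basis B" using vs.finite_basis_exists[OF fd] by auto
 hence sub: "B <= carrier M" by (auto simp: vs.basis_def)
 obtain bs where bs: "set bs = B" "distinct bs" using finite_distinct_list[OF B(1)] by auto
 define n where "n = length bs"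
 define a where "a x = (THE a. a : B \<rightarrow>\<^sub>E UNIV & vs.lincomb a B = x)" for x
 have ex1: "EX! a. a : B \<rightarrow>\<^sub>E UNIV & vs.lincomb a B = x" if "x : carrier M" for x
  using that B basis_iff[OF vs B(1) sub] by auto
 have a: "a x : B \<rightarrow>\<^sub>E UNIV" "vs.lincomb (a x) B = x" if "x : carrier M" for x
  using theI'[OF ex1[OF that]] unfolding a_def by auto
 have uniq: "f = a x" if "f : B \<rightarrow>\<^sub>E UNIV" "vs.lincomb f B = x" "x : carrier M" for f x
  using ex1[OF that(3)] that a[OF that(3)] by blast
 define T where "T x = vec n (%i. a x (bs ! i))" for x
 have lcr: "vs.lincomb (restrict f B) B = vs.lincomb f B" for f :: "'m => 'f"
  using sub by (intro vs.lincomb_cong) auto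
 have a_add: "a (x \<oplus>\<^bsub>M\<^esub> y) = (\<lambda>b\<in>B. a x b + a y b)" if x: "x : carrier M" and y: "y : carrier M" for x y
 proof (rule uniq[symmetric])
  have "vs.lincomb (%b. a x b + a y b) B = vs.lincomb (a x) B \<oplus>\<^bsub>M\<^esub> vs.lincomb (a y) B"
  using vs.lincomb_sum[OF B(1) sub, of "a x" "a y"] by simp
  thus "vs.lincomb (\<lambda>b\<in>B. a x b + a y b) B = x \<oplus>\<^bsub>M\<^esub> y" using x y a by (simp add: lcr)
 qed (use x y in auto)
 have a_smult: "a (c \<odot>\<^bsub>M\<^esub> x) = (\<lambda>b\<in>B. c * a x b)" if x: "x : carrier M" for x c
 proof (rule uniq[symmetric])
  have "vs.lincomb (%b. c * a x b) B = c \<odot>\<^bsub>M\<^esub> vs.lincomb (a x) B"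
  using vs.lincomb_smult[OF sub, of "a x" c] by simp
  thus "vs.lincomb (\<lambda>b\<in>B. c * a x b) B = c \<odot>\<^bsub>M\<^esub> x" using x a by (simp add: lcr)
 qed (use x in auto)
 have bsB: "bs ! i : B" if "i < n" for i using that bs by (auto simp: n_def)
 have "coords M n T" unfolding coords_def
 proof (intro conjI ballI allI)
  show add: "T (x \<oplus>\<^bsub>M\<^esub> y) = T x + T y" if "x : carrier M" "y : carrier M" for x y
  using that bsB by (auto simp: T_def a_add)
  show sm: "T (c \<odot>\<^bsub>M\<^esub> x) = c \<cdot>\<^sub>v T x" if "x : carrier M" for c x
  using that bsB by (auto simp: T_def a_smult)
  have "T (0 \<odot>\<^bsub>M\<^esub> \<zero>\<^bsub>M\<^esub>) = 0 \<cdot>\<^sub>v T \<zero>\<^bsub>M\<^esub>" by (rule sm) simp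
  hence "T \<zero>\<^bsub>M\<^esub> = 0 \<cdot>\<^sub>v T \<zero>\<^bsub>M\<^esub>" using vs.smult_l_null[of "\<zero>\<^bsub>M\<^esub>"] by simp
  moreover have "0 \<cdot>\<^sub>v T \<zero>\<^bsub>M\<^esub> = 0\<^sub>v n" by (auto simp: T_def)
  ultimately show "T \<zero>\<^bsub>M\<^esub> = 0\<^sub>v n" by simp
  show "bij_betw T (carrier M) (carrier_vec n)"
  proof (rule bij_betw_imageI)
  show "inj_on T (carrier M)"
  proof (rule inj_onI)
   fix x y assume x: "x : carrier M" and y: "y : carrier M" and eq: "T x = T y"
   have "a x = a y"
   proof (rule extensionalityI[of _ B])
    fix b assume "b : B"
    then obtain i where i: "i < n" "b = bs ! i" using bs by (metis in_set_conv_nth n_def)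
    thus "a x b = a y b" using arg_cong[OF eq, of "%v. v $ i"] by (simp add: T_def)
   qed (use a x y in \<open>auto simp: PiE_def\<close>)
   thus "x = y" using a x y by metis
  qed
  show "T ` carrier M = carrier_vec n"
  proof (rule equalityI; rule subsetI)
   fix v :: "'f vec" assume v: "v : carrier_vec n"
   define f where "f = (\<lambda>b\<in>B. v $ (THE i. i < n & bs ! i = b))"
   have f: "f (bs ! i) = v $ i" if "i < n" for i
   proof -
    have "(THE j. j < n & bs ! j = bs ! i) = i"
    using that bs nth_eq_iff_index_eq[of bs] by (intro the_equality) (auto simp: n_def)
    thus ?thesis using bsB[OF that] by (simp add: f_def)
   qed
   have lc: "vs.lincomb f B : carrier M" using sub by auto
   have "f = a (vs.lincomb f B)" by (rule uniq) (use lc in \<open>auto simp: f_def\<close>)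
   hence "T (vs.lincomb f B) = v" using v f by (auto simp: T_def intro!: eq_vecI)
   thus "v : T ` carrier M" using lc by blast
  qed (auto simp: T_def)
  qed
 qed auto
 thus ?thesis by (rule that)
qed

lemma finite_vectorspace_fin_dim:
 assumes "vectorspace class_ring (M :: ('f::field, 'm) module)" and "finite (carrier M)"
 shows "vectorspace.fin_dim class_ring M"
proof -
 interpret vs: vectorspace class_ring M by fact
 have "vs.span (carrier M) = carrier M"
  using vs.span_is_subset2[of "carrier M"] vs.in_own_span[of "carrier M"] by auto
 thus ?thesis unfolding vs.fin_dim_def using assms(2) by blast
qed

lemma coords_card:
 assumes "coords (M :: ('f::{field,finite}, 'm) module) n T"
 shows "finite (carrier M)" "card (carrier M) = card (UNIV :: 'f set) ^ n"
proof -
 have b: "bij_betw (vec n) ({..<n} \<rightarrow>\<^sub>E (UNIV :: 'f set)) (carrier_vec n)"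
 proof (rule bij_betwI[where g = "%v. \<lambda>i\<in>{..<n}. v $ i"])
  show "(\<lambda>i\<in>{..<n}. vec n f $ i) = f" if "f : {..<n} \<rightarrow>\<^sub>E (UNIV :: 'f set)" for f
  using that by (auto simp: PiE_def extensional_def fun_eq_iff)
 qed auto
 have "finite ({..<n} \<rightarrow>\<^sub>E (UNIV :: 'f set))" by (intro finite_PiE) auto
 hence "finite (carrier_vec n :: 'f vec set)" using b bij_betw_finite by blast
 moreover have "card (carrier_vec n :: 'f vec set) = card (UNIV :: 'f set) ^ n"
  using bij_betw_same_card[OF b] by (simp add: card_PiE)
 ultimately show "finite (carrier M)" "card (carrier M) = card (UNIV :: 'f set) ^ n"
  using assms bij_betw_same_card bij_betw_finite unfolding coords_def by metis+
qed

section \<open>Finite fields\<close>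

lemma prime_CHAR_finite_field: "prime CHAR('k::{field,finite})"
 using prime_CHAR_semidom[where ?'a = 'k] finite_imp_CHAR_pos[where ?'a = 'k] by simp

text \<open>A prime l dividing the cardinality gives, by Sylow's theorem, a subgroup of order l in
  the additive group. A nonzero element of it is killed by l, so l is the characteristic.\<close>

lemma card_finite_field_power_CHAR: "EX a. card (UNIV :: 'k::{field,finite} set) = CHAR('k) ^ a"
proof -
 let ?G = "add_monoid (class_ring :: 'k ring)"
 let ?q = "card (UNIV :: 'k set)"
 have G: "group ?G" 
 proof (rule groupI)
  show "EX y:carrier ?G. y \<otimes>\<^bsub>?G\<^esub> x = \<one>\<^bsub>?G\<^esub>" for x by (auto intro!: exI[of _ "- x"])
 qed (auto simp: add.assoc)
 have "l = CHAR('k)" if l: "prime l" "l dvd ?q" for l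
 proof -
  obtain m where m: "Coset.order ?G = l ^ 1 * m" using l by (auto simp: Coset.order_def)
  obtain H where H: "subgroup H ?G" "card H = l ^ 1" using sylow_thm[OF l(1) G m] by auto
  interpret H: subgroup H ?G by fact
  have "H ~= {0}" using H(2) l(1) by auto
  then obtain x where x: "x : H" "x ~= 0" using H.one_closed by auto
  interpret HG: group "?G\<lparr>carrier := H\<rparr>" by (rule H.subgroup_is_group[OF G])
  have pw: "x [^]\<^bsub>?G\<lparr>carrier := H\<rparr>\<^esub> (k::nat) = of_nat k * x" for k
  by (induction k) (auto simp: nat_pow_def algebra_simps)
  have fin: "finite H" using finite_subset[of H UNIV] by simp
  have "x [^]\<^bsub>?G\<lparr>carrier := H\<rparr>\<^esub> Coset.order (?G\<lparr>carrier := H\<rparr>) = \<one>\<^bsub>?G\<lparr>carrier := H\<rparr>\<^esub>"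
  by (rule HG.pow_order_eq_1) (use x fin in auto)
  moreover have "Coset.order (?G\<lparr>carrier := H\<rparr>) = l" using H(2) by (simp add: Coset.order_def)
  ultimately have "x [^]\<^bsub>?G\<lparr>carrier := H\<rparr>\<^esub> l = 0" by simp
  with pw[of l] have "of_nat l * x = 0" by simp
  hence "CHAR('k) dvd l" using x by (simp add: of_nat_eq_0_iff_char_dvd)
  thus ?thesis using l(1) prime_CHAR_finite_field[where ?'k = 'k] primes_dvd_imp_eq by blast
 qed
 note pr = this
 have "0 < ?q" by (simp add: card_gt_0_iff)
 have "EX a. n = CHAR('k) ^ a" if "n > 0" "!!l. prime l ==> l dvd n ==> l = CHAR('k)" for n :: nat
  using that
 proof (induction n rule: less_induct)
  case (less n)
  show ?case
  proof (cases "n = 1")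
  case False
  then obtain l where l: "prime l" "l dvd n" using prime_factor_nat by blast
  then obtain k where k: "n = l * k" by auto
  have "k < n" "k > 0" using k less.prems(1) prime_gt_1_nat[OF l(1)] by auto
  moreover have "l' = CHAR('k)" if "prime l'" "l' dvd k" for l' using that less.prems(2) k by auto
  ultimately obtain a where "k = CHAR('k) ^ a" using less.IH by blast
  hence "n = CHAR('k) ^ Suc a" using k less.prems(2)[OF l] by simp
  thus ?thesis by blast
  qed (auto intro: exI[of _ 0])
 qed
 from this[OF `0 < ?q` pr] show ?thesis .
qed

lemma card_finite_field_ge_2: "2 <= card (UNIV :: 'k::{field,finite} set)"
proof -
 have "card {0, 1 :: 'k} <= card (UNIV :: 'k set)" by (rule card_mono) auto
 thus ?thesis by simp
qed

text \<open>Multiplication by a nonzero x permutes the nonzero elements, so their product is not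
  changed by the factor x^(q - 1).\<close>

lemma power_card_field: "(x :: 'k::{field,finite}) ^ card (UNIV :: 'k set) = x"
proof (cases "x = 0")
 case False
 let ?q = "card (UNIV :: 'k set)"
 have q: "?q >= 2" by (rule card_finite_field_ge_2)
 have "(\<Prod>y\<in>UNIV-{0}. x * y) = x ^ (?q - 1) * \<Prod>(UNIV-{0})"
  by (simp add: prod.distrib)
 moreover have "(\<Prod>y\<in>UNIV-{0}. x * y) = (\<Prod>y\<in>UNIV-{0}. y)"
  by (rule prod.reindex_bij_witness[of _ "%y. y / x" "%y. x * y"]) (use False in auto)
 ultimately have "x ^ (?q - 1) = 1" by simp
 hence "x * x ^ (?q - 1) = x" by simp
 thus ?thesis using q by (simp flip: power_Suc)
qed (use card_finite_field_ge_2[where ?'k = 'k] in auto)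

lemma CHAR_field_hom:
 assumes "field_hom (em :: 'k::field => 'e::field)"
 shows "CHAR('e) = CHAR('k)"
proof -
 interpret field_hom em by fact
 have "CHAR('e) dvd n \<longleftrightarrow> CHAR('k) dvd n" for n
 proof -
  have "em (of_nat n) = of_nat n" by (induction n) (auto simp: hom_add)
  moreover have "em x * em (inverse x) = 1" if "x ~= 0" for x
  using that by (simp flip: hom_mult)
  hence "em x = 0 \<longleftrightarrow> x = 0" for x by (metis hom_zero mult_zero_left zero_neq_one)
  hence "em (of_nat n) = 0 \<longleftrightarrow> of_nat n = (0::'k)" by blast
  ultimately have "of_nat n = (0::'e) \<longleftrightarrow> of_nat n = (0::'k)" by simp
  thus ?thesis by (simp add: of_nat_eq_0_iff_char_dvd)
 qed
 thus ?thesis by (meson dvd_antisym dvd_refl)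
qed

section \<open>Extension fields of k as modules over k[X], X acting as Frobenius\<close>

locale finite_field_ext =
 fixes em :: "'k::{field,finite} => 'e::field" and q :: nat
 assumes em: "field_hom em" and q: "q = card (UNIV :: 'k set)"
begin

sublocale em: field_hom em by (rule em)

lemma CHAR_e: "CHAR('e) = CHAR('k)" by (rule CHAR_field_hom[OF em])

lemma q_ge: "2 <= q" unfolding q by (rule card_finite_field_ge_2)

lemma q_pow_CHAR: "EX a. q ^ i = CHAR('e) ^ a"
proof -
 obtain a where "q = CHAR('e) ^ a" using card_finite_field_power_CHAR[where ?'k = 'k] unfolding q CHAR_e by blast
 hence "q ^ i = CHAR('e) ^ (a * i)" by (simp add: power_mult)
 thus ?thesis by blast
qed

lemma prime_CHAR_e: "prime CHAR('e)" using prime_CHAR_finite_field[where ?'k = 'k] by (simp add: CHAR_e)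

lemma q_power_add: "(x + y :: 'e) ^ (q ^ i) = x ^ (q ^ i) + y ^ (q ^ i)"
proof -
 obtain a where a: "q ^ i = CHAR('e) ^ a" using q_pow_CHAR by blast
 show ?thesis by (rule freshmans_dream'[OF prime_CHAR_e a])
qed

lemma q_pos [simp]: "0 < q" "q ^ i ~= 0" using q_ge by auto

lemma q_power_diff: "(x - y :: 'e) ^ (q ^ i) = x ^ (q ^ i) - y ^ (q ^ i)"
 using q_power_add[of "x - y" y i] by (simp add: eq_diff_eq)

lemma q_power_minus: "(- y :: 'e) ^ (q ^ i) = - (y ^ (q ^ i))"
 using q_power_diff[of 0 y i] by (simp add: power_0_left)

lemma q_power_sum: "(\<Sum>x\<in>A. f x :: 'e) ^ (q ^ i) = (\<Sum>x\<in>A. f x ^ (q ^ i))"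
proof -
 obtain a where a: "q ^ i = CHAR('e) ^ a" using q_pow_CHAR by blast
 show ?thesis by (rule freshmans_dream_sum'[OF prime_CHAR_e a])
qed

lemma q_power_em: "em c ^ (q ^ i) = em c"
proof (induction i)
 case (Suc i)
 have "em c ^ (q ^ Suc i) = (em c ^ (q ^ i)) ^ q" by (simp add: power_mult[symmetric] mult.commute)
 also have "... = em (c ^ q)" by (simp add: Suc em.hom_power)
 finally show ?case by (simp add: q power_card_field)
qed simp

lemma q_power_power: "((x::'e) ^ (q ^ i)) ^ (q ^ j) = x ^ (q ^ (i + j))"
 by (simp add: power_mult[symmetric] power_add)

lemma q_power_inj: "(x::'e) ^ (q ^ i) = y ^ (q ^ i) ==> x = y"
proof -
 obtain a where a: "q ^ i = CHAR('e) ^ a" using q_pow_CHAR by blast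
 show "x ^ (q ^ i) = y ^ (q ^ i) ==> x = y" unfolding a by (rule CHAR_power_inj[OF prime_CHAR_e])
qed

text \<open>The variable of a polynomial over \<open>k\<close> acts as the Frobenius \<open>x \<mapsto> x\<^sup>q\<close>.\<close>

definition qact :: "'k poly => 'e => 'e" where
 "qact g x = (\<Sum>i\<le>degree g. em (pcoeff g i) * x ^ (q ^ i))"

lemma qact_upto: "degree g <= N ==> qact g x = (\<Sum>i\<le>N. em (pcoeff g i) * x ^ (q ^ i))"
 unfolding qact_def by (rule sum.mono_neutral_left) (auto simp: coeff_eq_0)

lemma qact_add: "qact (g + h) x = qact g x + qact h x"
proof -
 let ?N = "max (degree g) (degree h)"
 have "degree (g + h) <= ?N" by (rule degree_add_le_max)
 thus ?thesis
  by (simp add: qact_upto[of _ ?N] em.hom_add algebra_simps sum.distrib)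
qed

lemma qact_smult: "qact (Polynomial.smult c g) x = em c * qact g x"
 by (simp add: qact_upto[of _ "degree g"] em.hom_mult sum_distrib_left mult.assoc)

lemma qact_diff: "qact (g - h) x = qact g x - qact h x"
proof -
 have e: "g - h = g + Polynomial.smult (-1) h" by simp
 show ?thesis by (simp only: e qact_add qact_smult) (simp add: em.hom_uminus)
qed

lemma qact_0 [simp]: "qact 0 x = 0" "qact g 0 = 0"
 by (simp_all add: qact_def)

lemma qact_pCons: "qact (pCons a g) x = em a * x + qact g (x ^ q)"
proof -
 have "qact (pCons a g) x = (\<Sum>i\<le>Suc (degree g). em (pcoeff (pCons a g) i) * x ^ (q ^ i))"
  by (rule qact_upto) (simp add: degree_pCons_le)
 also have "... = em a * x + (\<Sum>i\<le>degree g. em (pcoeff g i) * x ^ (q ^ Suc i))"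
  by (subst sum.atMost_Suc_shift) simp
 finally show ?thesis by (simp add: qact_def power_mult)
qed

lemma qact_q_power: "qact g (x ^ q) = qact g x ^ q"
 by (simp add: qact_def q_power_sum[where i = 1, simplified] q_power_em[where i = 1, simplified]
  power_mult_distrib power_mult[symmetric] mult.commute)

text \<open>Elements of k are fixed by the q-power map and therefore commute with it, so the usual
  product of polynomials corresponds to composition. This makes the field a k[X]-module.\<close>

lemma qact_mult: "qact (g * h) x = qact g (qact h x)"
proof (induction g arbitrary: x)
 case (pCons a g)
 have "qact (pCons a g * h) x = em a * qact h x + qact (g * h) (x ^ q)"
  by (simp add: qact_add qact_smult qact_pCons)
 also have "... = em a * qact h x + qact g (qact h x ^ q)" by (simp add: pCons qact_q_power)
 finally show ?case by (simp add: qact_pCons)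
qed simp

lemma qact_add_right: "qact g (x + y) = qact g x + qact g y"
 by (simp add: qact_def q_power_add algebra_simps sum.distrib)

lemma qact_monom: "qact (Polynomial.monom c i) x = em c * x ^ (q ^ i)"
proof -
 have "qact (Polynomial.monom c i) x = (\<Sum>j\<le>i. em (pcoeff (Polynomial.monom c i) j) * x ^ (q ^ j))"
  by (rule qact_upto) (rule degree_monom_le)
 also have "... = (\<Sum>j\<le>i. if j = i then em c * x ^ (q ^ j) else 0)" by (rule sum.cong) auto
 finally show ?thesis by simp
qed

text \<open>As a function \<open>qact g\<close> is a polynomial of degree q^(degree g), and its
  roots are counted.\<close>

lemma card_qact_ker:
 assumes "g ~= 0"
 shows "finite {x. qact g x = 0}" "card {x. qact g x = 0} <= q ^ degree g"
proof -
 define G where "G = (\<Sum>i\<le>degree g. Polynomial.monom (em (pcoeff g i)) (q ^ i))"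
 have ev: "poly G x = qact g x" for x by (simp add: G_def qact_def poly_sum poly_monom)
 have inj: "q ^ i = q ^ j \<longleftrightarrow> i = j" for i j using q_ge by simp
 have "pcoeff G (q ^ degree g) = (\<Sum>i\<le>degree g. if i = degree g then em (lead_coeff g) else 0)"
  unfolding G_def coeff_sum by (rule sum.cong) (auto simp: inj)
 hence "pcoeff G (q ^ degree g) ~= 0" using assms by simp
 hence G0: "G ~= 0" by auto
 have "degree G <= q ^ degree g" unfolding G_def
 proof (rule degree_sum_le)
  fix i assume "i : {..degree g}"
  hence "q ^ i <= q ^ degree g" using q_ge by (intro power_increasing) auto
  thus "degree (Polynomial.monom (em (pcoeff g i)) (q ^ i)) <= q ^ degree g"
  using degree_monom_le order_trans by blast
 qed simp
 thus "finite {x. qact g x = 0}" "card {x. qact g x = 0} <= q ^ degree g"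
  using poly_roots_finite[OF G0] card_poly_roots_bound[OF G0] by (simp_all add: ev)
qed

end

lemma poly_ideal_generator:
 fixes M :: "'k::field poly"
 assumes "M : I" "M ~= 0" and add: "!!g h. g : I ==> h : I ==> g - h : I"
  and mult: "!!g h. h : I ==> g * h : I"
 shows "EX m. lead_coeff m = 1 & (ALL g. g : I \<longleftrightarrow> m dvd g)"
proof -
 define P where "P n \<longleftrightarrow> (EX g:I. g ~= 0 & degree g = n)" for n
 have "P (degree M)" using assms by (auto simp: P_def)
 hence "P (LEAST n. P n)" by (rule LeastI)
 then obtain g where g: "g : I" "g ~= 0" "degree g = (LEAST n. P n)" by (auto simp: P_def)
 define m where "m = Polynomial.smult (inverse (lead_coeff g)) g"
 have m: "lead_coeff m = 1" "degree m = degree g" using g(2) by (auto simp: m_def)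
 have "m = [:inverse (lead_coeff g):] * g" by (simp add: m_def)
 hence mI: "m : I" using mult[OF g(1), of "[:inverse (lead_coeff g):]"] by simp
 have "h : I \<longleftrightarrow> m dvd h" for h
 proof
  assume h: "h : I"
  have "h mod m = h - (h div m) * m" by (simp add: minus_div_mult_eq_mod)
  hence "h mod m : I" using add[OF h mult[OF mI, of "h div m"]] by simp
  moreover have "m ~= 0" using m by auto
  ultimately have "h mod m = 0"
  using degree_mod_less'[of m h] not_less_Least[of "degree (h mod m)" P] g m
  by (auto simp: P_def)
  thus "m dvd h" by auto
 next
  assume "m dvd h"
  then obtain c where "h = m * c" by (elim dvdE)
  thus "h : I" using mult[OF mI, of c] by (simp add: mult.commute)
 qed
 with m(1) show ?thesis by blast
qed

text \<open>The bound is put on coefficients and not on \<open>degree\<close>, so that it admits the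
  zero polynomial and leaves only that one for s = 0.\<close>

lemma card_polys_degree_less:
 "finite {g :: 'k::{field,finite} poly. ALL i>=s. pcoeff g i = 0} \<and>
 card {g :: 'k poly. ALL i>=s. pcoeff g i = 0} = card (UNIV :: 'k set) ^ s"
proof -
 let ?S = "{g :: 'k poly. ALL i>=s. pcoeff g i = 0}"
 let ?F = "{..<s} \<rightarrow>\<^sub>E (UNIV :: 'k set)"
 let ?g = "%c. \<Sum>i<s. Polynomial.monom (c i) i :: 'k poly"
 have co: "pcoeff (?g c) i = (if i < s then c i else 0)" for c i
  unfolding coeff_sum coeff_monom by simp
 have "bij_betw ?g ?F ?S"
 proof (rule bij_betwI[where g = "%g. \<lambda>i\<in>{..<s}. pcoeff g i"])
  show "?g : ?F \<rightarrow> ?S" unfolding Pi_def mem_Collect_eq co by simp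
  show "(%g. \<lambda>i\<in>{..<s}. pcoeff g i) : ?S \<rightarrow> ?F" by simp
  show "(\<lambda>i\<in>{..<s}. pcoeff (?g c) i) = c" if "c : ?F" for c
  unfolding co using PiE_arb[OF that] by (intro ext) simp
  show "?g (\<lambda>i\<in>{..<s}. pcoeff g i) = g" if "g : ?S" for g
  unfolding poly_eq_iff co using that by simp
 qed
 note b = this
 have fin: "finite ?F" by (intro finite_PiE) auto
 have "card ?F = card (UNIV :: 'k set) ^ s" by (simp add: card_PiE)
 thus ?thesis using bij_betw_finite[OF b] bij_betw_same_card[OF b] fin by simp
qed

lemma monic_dvd_antisym:
 fixes D D' :: "'k::field poly"
 assumes "lead_coeff D = 1" "lead_coeff D' = 1" "D dvd D'" "degree D' <= degree D"
 shows "D = D'"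
proof -
 obtain c where c: "D' = D * c" using assms(3) by (elim dvdE)
 have "D ~= 0" "D' ~= 0" using assms by auto
 hence "c ~= 0" using c by auto
 hence "degree c = 0" using assms(4) c `D ~= 0` by (simp add: degree_mult_eq)
 then obtain a where a: "c = [:a:]" by (rule degree_eq_zeroE)
 have "lead_coeff D' = lead_coeff D * lead_coeff c" unfolding c by (rule lead_coeff_mult)
 hence "a = 1" using assms(1,2) a by simp
 thus ?thesis using c a by simp
qed

text \<open>In a finite torsion module over \<open>k[X]\<close>, the number of elements with a given annihilator is
 determined by the numbers of elements killed by the various divisors.\<close>

lemma count_annihilators:
 fixes M :: "'k::field poly" and mp :: "'a => 'k poly" and mp' :: "'b => 'k poly"
 assumes fin: "finite S" "finite S'"
  and mon: "!!x. x : S ==> lead_coeff (mp x) = 1" "!!x. x : S' ==> lead_coeff (mp' x) = 1"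
  and cnt: "!!D. D dvd M ==> lead_coeff D = 1 ==> card {x\<in>S. mp x dvd D} = card {x\<in>S'. mp' x dvd D}"
  and D: "D dvd M" "lead_coeff D = 1"
 shows "card {x\<in>S. mp x = D} = card {x\<in>S'. mp' x = D}"
 using D
proof (induction "degree D" arbitrary: D rule: less_induct)
 case less
 \<comment> \<open>Only annihilators that actually occur are collected, which keeps the index set
   finite; all of them have smaller degree than \<open>D\<close>.\<close>
 define I where "I = {D' : mp ` S \<union> mp' ` S'. D' dvd D & D' ~= D}"
 have finI: "finite I" using fin by (simp add: I_def)
 have I: "card {x\<in>S. mp x = D'} = card {x\<in>S'. mp' x = D'}" if "D' : I" for D'
 proof (rule less.hyps)
  show lc: "lead_coeff D' = 1" using that mon by (auto simp: I_def)
  show "D' dvd M" using that less.prems by (auto simp: I_def intro: dvd_trans)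
  show "degree D' < degree D"
  proof (rule ccontr)
  assume "\<not> degree D' < degree D"
  moreover have "D' dvd D" "D' ~= D" using that by (simp_all add: I_def)
  ultimately show False using monic_dvd_antisym[OF lc less.prems(2)] by simp
  qed
 qed
 have split: "card {x\<in>X. f x dvd D} = card {x\<in>X. f x = D} + (\<Sum>D'\<in>I. card {x\<in>X. f x = D'})"
  if X: "finite X" "f ` X <= mp ` S \<union> mp' ` S'" for X :: "'c set" and f
 proof -
  have "{x\<in>X. f x dvd D} = {x\<in>X. f x = D} \<union> (\<Union>D'\<in>I. {x\<in>X. f x = D'})"
  using X by (auto simp: I_def)
  also have "card ... = card {x\<in>X. f x = D} + card (\<Union>D'\<in>I. {x\<in>X. f x = D'})"
  by (rule card_Un_disjoint) (use X finI in \<open>auto simp: I_def\<close>)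
  also have "card (\<Union>D'\<in>I. {x\<in>X. f x = D'}) = (\<Sum>D'\<in>I. card {x\<in>X. f x = D'})"
  by (rule card_UN_disjoint) (use X finI in auto)
  finally show ?thesis .
 qed
 have "(\<Sum>D'\<in>I. card {x\<in>S. mp x = D'}) = (\<Sum>D'\<in>I. card {x\<in>S'. mp' x = D'})"
  by (rule sum.cong) (use I in auto)
 thus ?case using cnt[OF less.prems] split[OF fin(1), of mp] split[OF fin(2), of mp'] by auto
qed

section \<open>Normal bases of finite fields\<close>

context finite_field_ext
begin

lemma finite_roots_q: "r >= 1 ==> finite {x::'e. x ^ (q ^ r) = x} & card {x::'e. x ^ (q ^ r) = x} <= q ^ r"
proof -
 assume r: "r >= 1"
 let ?M = "Polynomial.monom (1::'k) r - 1"
 have "pcoeff ?M r = 1" using r by (simp add: coeff_eq_0)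
 hence M0: "?M ~= 0" by (metis coeff_0 zero_neq_one)
 have "degree ?M <= r" by (rule degree_diff_le) (auto simp: degree_monom_le)
 hence "q ^ degree ?M <= q ^ r" using q_ge by (intro power_increasing) auto
 moreover have "qact ?M x = 0 \<longleftrightarrow> x ^ (q ^ r) = x" for x
  using qact_monom[of 1 0 x] by (simp add: qact_diff qact_monom one_pCons[symmetric] flip: monom_0)
 ultimately show ?thesis using card_qact_ker[OF M0] by auto
qed

text \<open>Let X act as the q-power map. For each divisor of X^r - 1, the roots of x^(q^r) = x and
  the ring k[X]/(X^r - 1) have equally many elements killed by it; by
  \<open>count_annihilators\<close> they have equally many with annihilator exactly X^r - 1. The
  class of 1 is one in the ring, so there is one among the roots, and its r conjugates are
  independent over k.\<close>

theorem normal_basis: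
 assumes r: "r >= 1" and card: "card {x::'e. x ^ (q ^ r) = x} = q ^ r"
 obtains b where "b ^ (q ^ r) = b" "!!c. (\<Sum>i<r. em (c i) * b ^ (q ^ i)) = 0 ==> ALL i<r. c i = 0"
proof -
 define E where "E = {x::'e. x ^ (q ^ r) = x}"
 define M where "M = Polynomial.monom (1::'k) r - 1"
 have Mr: "pcoeff M r = 1" using r by (simp add: M_def coeff_eq_0)
 hence M0: "M ~= 0" by (metis coeff_0 zero_neq_one)
 have "degree M <= r" unfolding M_def by (rule degree_diff_le) (auto simp: degree_monom_le)
 hence degM: "degree M = r" using Mr le_degree[of M r] by (simp add: order_antisym)
 hence lcM: "lead_coeff M = 1" using Mr by simp
 have qM: "qact M x = x ^ (q ^ r) - x" for x
  using qact_monom[of 1 0 x] by (simp add: M_def qact_diff qact_monom one_pCons[symmetric] flip: monom_0)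
 have finE: "finite E" using finite_roots_q[OF r] by (simp add: E_def)
 have qE: "qact g x : E" if "x : E" for g x
 proof -
  have "qact M (qact g x) = qact g (qact M x)" by (simp add: mult.commute flip: qact_mult)
  thus ?thesis using that by (simp add: qM E_def)
 qed
 have "EX m. lead_coeff m = 1 & (ALL g. qact g x = 0 \<longleftrightarrow> m dvd g)" if "x : E" for x
 proof -
  have 1: "M : {g. qact g x = 0}" using that by (simp add: qM E_def)
  have 2: "g - h : {g. qact g x = 0}" if "g : {g. qact g x = 0}" "h : {g. qact g x = 0}" for g h
  using that by (simp add: qact_diff)
  have 3: "g * h : {g. qact g x = 0}" if "h : {g. qact g x = 0}" for g h
  using that by (simp add: qact_mult)
  show ?thesis using poly_ideal_generator[OF 1 M0 2 3] by simp
 qed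
 then obtain mp where mp: "!!x. x : E ==> lead_coeff (mp x) = 1"
  "!!x g. x : E ==> qact g x = 0 \<longleftrightarrow> mp x dvd g" by metis
 define R where "R = {g :: 'k poly. ALL i>=r. pcoeff g i = 0}"
 have finR: "finite R" using card_polys_degree_less[of r, where ?'k = 'k] by (simp add: R_def)
 have "EX m. lead_coeff m = 1 & (ALL g. M dvd g * h \<longleftrightarrow> m dvd g)" for h
 proof -
  have 1: "M : {g. M dvd g * h}" by simp
  have 2: "g1 - g2 : {g. M dvd g * h}" if "g1 : {g. M dvd g * h}" "g2 : {g. M dvd g * h}" for g1 g2
  using that by (simp add: left_diff_distrib)
  have 3: "g1 * g2 : {g. M dvd g * h}" if "g2 : {g. M dvd g * h}" for g1 g2
  using that by (simp add: mult.assoc)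
  show ?thesis using poly_ideal_generator[OF 1 M0 2 3] by simp
 qed
 \<comment> \<open>\<open>mp' h\<close> generates the annihilator of the class of h in k[X]/M;
   \<open>R\<close> is a set of representatives of that ring.\<close>
 then obtain mp' where mp': "!!x. lead_coeff (mp' x) = 1" "!!h g. M dvd g * h \<longleftrightarrow> mp' h dvd g" by metis
 have cnt: "card {x\<in>E. mp x dvd D} = card {x\<in>R. mp' x dvd D}" if D: "D dvd M" "lead_coeff D = 1" for D
 proof -
  obtain D' where D': "M = D * D'" using D(1) by (elim dvdE)
  hence nz: "D ~= 0" "D' ~= 0" using M0 by auto
  have deg: "degree D + degree D' = r" using degM D' nz by (simp add: degree_mult_eq)
  let ?K = "{x\<in>E. qact D x = 0}"
  have "?K = {x\<in>E. mp x dvd D}" using mp by auto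
  \<comment> \<open>The kernel of \<open>D\<close> has at most q^(degree D) elements, and the image
    of \<open>D\<close> lies in the kernel of the cofactor \<open>D'\<close>, which is bounded
    likewise. As \<open>E\<close> has q^r elements, both bounds are attained.\<close>
  moreover have "card ?K = q ^ degree D"
  proof (rule order_antisym)
  show "card ?K <= q ^ degree D"
   using card_mono[OF card_qact_ker(1)[OF nz(1)], of ?K] card_qact_ker(2)[OF nz(1)] by fastforce
  have sub: "qact D ` E <= {x. qact D' x = 0}"
  proof
   fix y assume "y : qact D ` E"
   then obtain x where x: "x : E" "y = qact D x" by auto
   have "qact D' y = qact M x" unfolding x D' by (simp add: mult.commute flip: qact_mult)
   thus "y : {x. qact D' x = 0}" using x by (simp add: qM E_def)
  qed
  have im: "card (qact D ` E) <= q ^ degree D'"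
   using card_mono[OF card_qact_ker(1)[OF nz(2)] sub] card_qact_ker(2)[OF nz(2)] by simp
  have fib: "card {x\<in>E. qact D x = y} <= card ?K" if y: "y : qact D ` E" for y
  proof -
   obtain x0 where x0: "x0 : E" "y = qact D x0" using y by auto
   have "qact D (x - x0) = qact D x - qact D x0" for x
    using qact_add_right[of D "x - x0" x0] by simp
   thus ?thesis using x0 finE
    by (intro card_inj_on_le[of "%x. x - x0"]) (auto simp: E_def q_power_diff inj_on_def)
  qed
  have "E = (\<Union>y\<in>qact D ` E. {x\<in>E. qact D x = y})" by auto
  hence "q ^ r = card (\<Union>y\<in>qact D ` E. {x\<in>E. qact D x = y})"
   using card E_def by metis
  also have "... <= (\<Sum>y\<in>qact D ` E. card {x\<in>E. qact D x = y})"
   by (rule card_UN_le) (use finE in auto)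
  also have "... <= (\<Sum>y\<in>qact D ` E. card ?K)" by (rule sum_mono) (rule fib)
  also have "... <= q ^ degree D' * card ?K" using im by simp
  finally have "q ^ degree D' * q ^ degree D <= q ^ degree D' * card ?K"
   by (simp add: deg[symmetric] power_add mult.commute)
  thus "q ^ degree D <= card ?K" by simp
  qed
  moreover have "{x\<in>R. mp' x dvd D} = (%g. D' * g) ` {g. ALL i>=degree D. pcoeff g i = 0}"
  proof (intro equalityI subsetI)
  fix h assume "h : {x\<in>R. mp' x dvd D}"
  hence h: "h : R" "M dvd D * h" using mp' by auto
  hence "D' dvd h" using nz by (simp add: D')
  then obtain g where g: "h = D' * g" by (elim dvdE)
  have "pcoeff g i = 0" if "i >= degree D" for i
  proof (cases "g = 0")
   case False
   hence h0: "h ~= 0" using g nz by simp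
   have "degree h < r"
   proof (rule ccontr)
    assume "\<not> degree h < r"
    hence "lead_coeff h = 0" using h(1) by (simp add: R_def)
    thus False using h0 by simp
   qed
   hence "degree g < degree D" using g False nz deg by (simp add: degree_mult_eq)
   thus ?thesis using that by (simp add: coeff_eq_0)
  qed simp
  thus "h : (%g. D' * g) ` {g. ALL i>=degree D. pcoeff g i = 0}" using g by auto
  next
  fix h assume "h : (%g. D' * g) ` {g. ALL i>=degree D. pcoeff g i = 0}"
  then obtain g where g: "h = D' * g" "ALL i>=degree D. pcoeff g i = 0" by auto
  have "pcoeff h i = 0" if "i >= r" for i
  proof (cases "g = 0")
   case False
   hence "degree g < degree D" using g(2) by (metis leading_coeff_0_iff not_less)
   hence "degree h < r" using g False nz deg by (simp add: degree_mult_eq)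
   thus ?thesis using that by (simp add: coeff_eq_0)
  qed (use g in simp)
  moreover have "M dvd D * h" unfolding D' g by (simp add: mult.assoc[symmetric])
  ultimately show "h : {x\<in>R. mp' x dvd D}" using mp' by (auto simp: R_def)
  qed
  moreover have "card ((%g. D' * g) ` {g :: 'k poly. ALL i>=degree D. pcoeff g i = 0}) = q ^ degree D"
  using card_polys_degree_less[of "degree D", where ?'k = 'k] nz by (subst card_image) (auto simp: inj_on_def q)
  ultimately show ?thesis by simp
 qed
 have "card {x\<in>E. mp x = M} = card {x\<in>R. mp' x = M}"
  by (rule count_annihilators[OF finE finR mp(1) mp'(1) cnt]) (use lcM in auto)
 moreover have "1 : {x\<in>R. mp' x = M}"
 proof -
  have "M dvd mp' 1" "mp' 1 dvd M" using mp'(2)[of M 1] mp'(2)[of "mp' 1" 1] by auto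
  hence "mp' 1 = M"
  using monic_dvd_antisym[OF mp'(1) lcM] M0 dvd_imp_degree_le[of M "mp' 1"] mp'(1)[of 1] by fastforce
  thus ?thesis using r by (auto simp: R_def coeff_eq_0)
 qed
 hence "card {x\<in>R. mp' x = M} ~= 0" using finR by (auto simp: card_eq_0_iff)
 ultimately have "{x\<in>E. mp x = M} ~= {}" by (metis card.empty)
 then obtain b where b: "b : E" "mp b = M" by auto
 show ?thesis
 proof (rule that)
  show "b ^ (q ^ r) = b" using b by (simp add: E_def)
  fix c assume c: "(\<Sum>i<r. em (c i) * b ^ (q ^ i)) = 0"
  \<comment> \<open>A linear relation between the conjugates of \<open>b\<close> is a polynomial of
    degree below r that annihilates \<open>b\<close>, hence a multiple of \<open>M\<close>.\<close>
  define g where "g = (\<Sum>i<r. Polynomial.monom (c i) i)"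
  have co: "pcoeff g i = (if i < r then c i else 0)" for i by (simp add: g_def coeff_sum)
  have "degree g <= r - 1" by (rule degree_le) (auto simp: co)
  hence "qact g b = (\<Sum>i\<le>r-1. em (pcoeff g i) * b ^ (q ^ i))" by (rule qact_upto)
  also have "{..r-1} = {..<r}" using r by auto
  also have "(\<Sum>i<r. em (pcoeff g i) * b ^ (q ^ i)) = 0" using c by (simp add: co)
  finally have "M dvd g" using mp(2)[OF b(1)] b(2) by simp
  hence "g = 0" using `degree g <= r - 1` degM r dvd_imp_degree_le[of M g] by fastforce
  thus "ALL i<r. c i = 0" using co by (metis coeff_0)
 qed
qed

end

section \<open>Spaces of equivariant maps\<close>

text \<open>Scalars of F act by precomposition on V, so the axioms come from V; on the side of M it
  is enough that scalars of k and group elements are additive operators.\<close>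

lemma hom_space_vectorspace:
 fixes V :: "('f::field, 'v) module" and M :: "('k, 'm) module"
 assumes V: "vectorspace class_ring V"
  and \<rho>: "!!g v. g : G ==> v : carrier V ==> \<rho> g v : carrier V"
  "!!g a v. g : G ==> v : carrier V ==> \<rho> g (a \<odot>\<^bsub>V\<^esub> v) = a \<odot>\<^bsub>V\<^esub> \<rho> g v"
  and M: "abelian_group M"
  and sm: "!!c x. x : carrier M ==> c \<odot>\<^bsub>M\<^esub> x : carrier M"
  "!!c x y. x : carrier M ==> y : carrier M ==> c \<odot>\<^bsub>M\<^esub> (x \<oplus>\<^bsub>M\<^esub> y) = c \<odot>\<^bsub>M\<^esub> x \<oplus>\<^bsub>M\<^esub> c \<odot>\<^bsub>M\<^esub> y"
  and act: "!!g x. g : G ==> x : carrier M ==> act g x : carrier M"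
  "!!g x y. g : G ==> x : carrier M ==> y : carrier M ==> act g (x \<oplus>\<^bsub>M\<^esub> y) = act g x \<oplus>\<^bsub>M\<^esub> act g y"
 shows "vectorspace class_ring (hom_space iF G V \<rho> M act)"
proof -
 interpret V: vectorspace class_ring V by fact
 interpret M: abelian_group M by fact
 let ?H = "hom_space iF G V \<rho> M act"
 have z: "h \<zero>\<^bsub>M\<^esub> = \<zero>\<^bsub>M\<^esub>" if "!!x. x : carrier M ==> h x : carrier M"
  "!!x y. x : carrier M ==> y : carrier M ==> h (x \<oplus>\<^bsub>M\<^esub> y) = h x \<oplus>\<^bsub>M\<^esub> h y" for h :: "'m => 'm"
 proof -
  have "h \<zero>\<^bsub>M\<^esub> \<oplus>\<^bsub>M\<^esub> h \<zero>\<^bsub>M\<^esub> = h \<zero>\<^bsub>M\<^esub>"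
  using that(2)[of "\<zero>\<^bsub>M\<^esub>" "\<zero>\<^bsub>M\<^esub>"] by simp
  thus ?thesis using that(1)[of "\<zero>\<^bsub>M\<^esub>"] by simp
 qed
 have z1: "c \<odot>\<^bsub>M\<^esub> \<zero>\<^bsub>M\<^esub> = \<zero>\<^bsub>M\<^esub>" for c by (rule z) (use sm in auto)
 have z2: "act g \<zero>\<^bsub>M\<^esub> = \<zero>\<^bsub>M\<^esub>" if "g : G" for g by (rule z) (use act that in auto)
 have Vsm: "a \<odot>\<^bsub>V\<^esub> v : carrier V" if "v : carrier V" for a v using V.smult_closed[of a v] that by simp
 have Vcomm: "a \<odot>\<^bsub>V\<^esub> (b \<odot>\<^bsub>V\<^esub> v) = b \<odot>\<^bsub>V\<^esub> (a \<odot>\<^bsub>V\<^esub> v)" if "v : carrier V" for a b v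
  using V.smult_assoc1[of a b v] V.smult_assoc1[of b a v] that by (simp add: mult.commute)
 have Vadd: "a \<odot>\<^bsub>V\<^esub> (v \<oplus>\<^bsub>V\<^esub> w) = a \<odot>\<^bsub>V\<^esub> v \<oplus>\<^bsub>V\<^esub> a \<odot>\<^bsub>V\<^esub> w"
  if "v : carrier V" "w : carrier V" for a v w using V.smult_r_distr[of a v w] that by simp
 have Vadd2: "(a + b) \<odot>\<^bsub>V\<^esub> v = a \<odot>\<^bsub>V\<^esub> v \<oplus>\<^bsub>V\<^esub> b \<odot>\<^bsub>V\<^esub> v" if "v : carrier V" for a b v
  using V.smult_l_distr[of a b v] that by simp
 have Vassoc: "(a * b) \<odot>\<^bsub>V\<^esub> v = a \<odot>\<^bsub>V\<^esub> (b \<odot>\<^bsub>V\<^esub> v)" if "v : carrier V" for a b v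
  using V.smult_assoc1[of a b v] that by simp
 have Vone: "1 \<odot>\<^bsub>V\<^esub> v = v" if "v : carrier V" for v using V.smult_one[of v] that by simp
 have C: "f : carrier ?H \<longleftrightarrow> f : carrier V \<rightarrow>\<^sub>E carrier M \<and>
   (ALL v:carrier V. ALL w:carrier V. f (v \<oplus>\<^bsub>V\<^esub> w) = f v \<oplus>\<^bsub>M\<^esub> f w) \<and>
   (ALL c. ALL v:carrier V. f (iF c \<odot>\<^bsub>V\<^esub> v) = c \<odot>\<^bsub>M\<^esub> f v) \<and>
   (ALL g:G. ALL v:carrier V. f (\<rho> g v) = act g (f v))" for f
  by (simp add: hom_space_def)
 have S: "\<zero>\<^bsub>?H\<^esub> = (\<lambda>v\<in>carrier V. \<zero>\<^bsub>M\<^esub>)" "!!f h. f \<oplus>\<^bsub>?H\<^esub> h = (\<lambda>v\<in>carrier V. f v \<oplus>\<^bsub>M\<^esub> h v)"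
  "!!a f. a \<odot>\<^bsub>?H\<^esub> f = (\<lambda>v\<in>carrier V. f (a \<odot>\<^bsub>V\<^esub> v))"
  by (simp_all add: hom_space_def)
 have cl: "f v : carrier M" if "f : carrier ?H" "v : carrier V" for f v using that by (auto simp: C)
 have add_cl: "f \<oplus>\<^bsub>?H\<^esub> h : carrier ?H" if f: "f : carrier ?H" and h: "h : carrier ?H" for f h
  using f h cl[OF f] cl[OF h] Vsm \<rho> unfolding C S
  by (auto simp: sm act M.a_ac restrict_def)
 have sm_cl: "a \<odot>\<^bsub>?H\<^esub> f : carrier ?H" if f: "f : carrier ?H" for a f
 proof -
  have 1: "f (a \<odot>\<^bsub>V\<^esub> (iF c \<odot>\<^bsub>V\<^esub> v)) = c \<odot>\<^bsub>M\<^esub> f (a \<odot>\<^bsub>V\<^esub> v)" if "v : carrier V" for c v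
  using f Vsm[OF that] unfolding C by (simp add: Vcomm[OF that, of a])
  have 2: "f (a \<odot>\<^bsub>V\<^esub> \<rho> g v) = act g (f (a \<odot>\<^bsub>V\<^esub> v))" if "v : carrier V" "g : G" for g v
  using f Vsm[OF that(1)] that unfolding C by (simp flip: \<rho>(2))
  show ?thesis using f cl[OF f] Vsm \<rho>(1) 1 2 unfolding C S by (auto simp: Vadd restrict_def)
 qed
 have eqI: "f = h" if "f : carrier ?H" "h : carrier ?H" "!!v. v : carrier V ==> f v = h v" for f h
  using that by (auto simp: C intro: PiE_ext)
 have ap: "(f \<oplus>\<^bsub>?H\<^esub> h) v = f v \<oplus>\<^bsub>M\<^esub> h v" "(a \<odot>\<^bsub>?H\<^esub> f) v = f (a \<odot>\<^bsub>V\<^esub> v)" "\<zero>\<^bsub>?H\<^esub> v = \<zero>\<^bsub>M\<^esub>"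
  if "v : carrier V" for f h a v using that by (simp_all add: S)
 have zero_cl: "\<zero>\<^bsub>?H\<^esub> : carrier ?H" using \<rho> Vsm unfolding C S by (auto simp: z1 z2 restrict_def)
 have f0: "f \<zero>\<^bsub>V\<^esub> = \<zero>\<^bsub>M\<^esub>" if f: "f : carrier ?H" for f
 proof -
  have "f (\<zero>\<^bsub>V\<^esub> \<oplus>\<^bsub>V\<^esub> \<zero>\<^bsub>V\<^esub>) = f \<zero>\<^bsub>V\<^esub> \<oplus>\<^bsub>M\<^esub> f \<zero>\<^bsub>V\<^esub>" using f V.zero_closed unfolding C by blast
  moreover have "\<zero>\<^bsub>V\<^esub> \<oplus>\<^bsub>V\<^esub> \<zero>\<^bsub>V\<^esub> = \<zero>\<^bsub>V\<^esub>" by simp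
  ultimately have "f \<zero>\<^bsub>V\<^esub> \<oplus>\<^bsub>M\<^esub> f \<zero>\<^bsub>V\<^esub> = f \<zero>\<^bsub>V\<^esub>" by simp
  thus ?thesis using cl[OF f, of "\<zero>\<^bsub>V\<^esub>"] by simp
 qed
 show ?thesis
 proof (rule vs_criteria)
  show "field (class_ring :: 'f ring)" by (rule class_field)
  show "ALL f:carrier ?H. EX h:carrier ?H. f \<oplus>\<^bsub>?H\<^esub> h = \<zero>\<^bsub>?H\<^esub>"
  proof
  fix f assume f: "f : carrier ?H"
  have "f \<oplus>\<^bsub>?H\<^esub> ((-1) \<odot>\<^bsub>?H\<^esub> f) = \<zero>\<^bsub>?H\<^esub>"
  proof (rule eqI)
   fix v assume v: "v : carrier V"
   have "v \<oplus>\<^bsub>V\<^esub> (-1) \<odot>\<^bsub>V\<^esub> v = \<zero>\<^bsub>V\<^esub>"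
    using Vadd2[OF v, of 1 "-1"] V.smult_l_null[OF v] Vone[OF v] by simp
   moreover have "f (v \<oplus>\<^bsub>V\<^esub> (-1) \<odot>\<^bsub>V\<^esub> v) = f v \<oplus>\<^bsub>M\<^esub> f ((-1) \<odot>\<^bsub>V\<^esub> v)"
    using f v Vsm[OF v] unfolding C by blast
   ultimately show "(f \<oplus>\<^bsub>?H\<^esub> ((-1) \<odot>\<^bsub>?H\<^esub> f)) v = \<zero>\<^bsub>?H\<^esub> v"
    using v f0[OF f] by (simp add: ap)
  qed (use f add_cl sm_cl zero_cl in auto)
  thus "EX h:carrier ?H. f \<oplus>\<^bsub>?H\<^esub> h = \<zero>\<^bsub>?H\<^esub>" using sm_cl[OF f] by blast
  qed
  show "ALL f h. f : carrier ?H & h : carrier ?H --> f \<oplus>\<^bsub>?H\<^esub> h = h \<oplus>\<^bsub>?H\<^esub> f"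
  by (auto intro!: eqI add_cl simp: ap cl M.a_comm)
  show "ALL f h k. f : carrier ?H & h : carrier ?H & k : carrier ?H -->
   f \<oplus>\<^bsub>?H\<^esub> h \<oplus>\<^bsub>?H\<^esub> k = f \<oplus>\<^bsub>?H\<^esub> (h \<oplus>\<^bsub>?H\<^esub> k)"
  by (auto intro!: eqI add_cl simp: ap cl M.a_assoc)
  show "ALL f:carrier ?H. f \<oplus>\<^bsub>?H\<^esub> \<zero>\<^bsub>?H\<^esub> = f"
  by (auto intro!: eqI add_cl zero_cl simp: ap cl)
  show "ALL a b f. a : carrier (class_ring :: 'f ring) & b : carrier (class_ring :: 'f ring) & f : carrier ?H -->
   (a \<otimes>\<^bsub>class_ring\<^esub> b) \<odot>\<^bsub>?H\<^esub> f = a \<odot>\<^bsub>?H\<^esub> (b \<odot>\<^bsub>?H\<^esub> f)"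
  by (auto intro!: eqI sm_cl simp: ap Vsm Vassoc Vcomm)
  show "ALL f:carrier ?H. \<one>\<^bsub>class_ring :: 'f ring\<^esub> \<odot>\<^bsub>?H\<^esub> f = f"
  by (auto intro!: eqI sm_cl simp: ap Vone)
  show "ALL a b f. a : carrier (class_ring :: 'f ring) & b : carrier (class_ring :: 'f ring) & f : carrier ?H -->
   (a \<oplus>\<^bsub>class_ring\<^esub> b) \<odot>\<^bsub>?H\<^esub> f = a \<odot>\<^bsub>?H\<^esub> f \<oplus>\<^bsub>?H\<^esub> b \<odot>\<^bsub>?H\<^esub> f"
  proof (intro allI impI; elim conjE)
  fix a b :: 'f and f assume f: "f : carrier ?H"
  show "(a \<oplus>\<^bsub>class_ring\<^esub> b) \<odot>\<^bsub>?H\<^esub> f = a \<odot>\<^bsub>?H\<^esub> f \<oplus>\<^bsub>?H\<^esub> b \<odot>\<^bsub>?H\<^esub> f"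
  proof (rule eqI)
   fix v assume v: "v : carrier V"
   have "f (a \<odot>\<^bsub>V\<^esub> v \<oplus>\<^bsub>V\<^esub> b \<odot>\<^bsub>V\<^esub> v) = f (a \<odot>\<^bsub>V\<^esub> v) \<oplus>\<^bsub>M\<^esub> f (b \<odot>\<^bsub>V\<^esub> v)"
    using f Vsm[OF v] unfolding C by blast
   thus "((a \<oplus>\<^bsub>class_ring\<^esub> b) \<odot>\<^bsub>?H\<^esub> f) v = (a \<odot>\<^bsub>?H\<^esub> f \<oplus>\<^bsub>?H\<^esub> b \<odot>\<^bsub>?H\<^esub> f) v"
    using v by (simp add: ap Vadd2)
  qed (use f add_cl sm_cl in auto)
  qed
  show "ALL a f h. a : carrier (class_ring :: 'f ring) & f : carrier ?H & h : carrier ?H -->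
   a \<odot>\<^bsub>?H\<^esub> (f \<oplus>\<^bsub>?H\<^esub> h) = a \<odot>\<^bsub>?H\<^esub> f \<oplus>\<^bsub>?H\<^esub> a \<odot>\<^bsub>?H\<^esub> h"
  by (auto intro!: eqI sm_cl add_cl simp: ap Vsm)
 qed (use add_cl sm_cl zero_cl in auto)
qed

section \<open>Equivariant maps into a finite field\<close>

lemma coords_module_vec: "coords (module_vec TYPE('f::field) m) m id"
 unfolding coords_def by (auto simp: module_vec_simps)

text \<open>The situation after reduction modulo a prime: r is the degree over k of the residue
  field above, d that of the residue field below, f the relative degree, and \<open>A\<close> a
  Frobenius on the coinvariants, of order dividing f.\<close>

locale equivariant_maps = finite_field_ext em q for em :: "'k::{field,finite} => 'e::field" and q +
 fixes iF :: "'k => 'f::field" and A :: "'f mat" and m d f r :: nat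
 assumes iF: "field_hom iF" and finF: "finite (UNIV :: 'f set)"
  and A: "A : carrier_mat m m" and Af: "A ^\<^sub>m f = 1\<^sub>m m" and d: "d >= 1" and f: "f >= 1"
  and r: "r = d * f" and card_E: "card {x::'e. x ^ (q ^ r) = x} = q ^ r"
begin

sublocale iF: field_hom iF by (rule iF)

definition E :: "'e set" where "E = {x. x ^ (q ^ r) = x}"

definition E_mod :: "('k, 'e) module" where
 "E_mod = \<lparr>carrier = E, monoid.mult = (*), one = 1, zero = 0, add = (+), module.smult = (%c x. em c * x)\<rparr>"

text \<open>Equivariance under a cyclic group is one condition on a generator, hence the index set
  \<open>unit\<close>: the condition reads h(A v) = h(v)^(q^d).\<close>

definition H :: "('f, 'f vec => 'e) module" where
 "H = hom_space iF (UNIV :: unit set) (module_vec TYPE('f) m) (%_ w. A *\<^sub>v w) E_mod (%_ x. x ^ (q ^ d))"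

lemma r_pos: "r >= 1" using d f by (simp add: r)

lemma E_closed: "0 : E" "x : E ==> y : E ==> x + y : E" "x : E ==> y : E ==> x * y : E"
 "x : E ==> - x : E" "em c : E" "x : E ==> x ^ k : E"
 by (simp_all add: E_def q_power_add power_mult_distrib q_power_minus q_power_em power_0_left)
  (metis power_mult mult.commute)

lemma finite_E: "finite E" using finite_roots_q[OF r_pos] by (simp add: E_def)

lemma E_d_subset: "x ^ (q ^ d) = x ==> x : E"
proof -
 assume x: "x ^ (q ^ d) = x"
 have "x ^ (q ^ (d * j)) = x" for j
 proof (induction j)
  case (Suc j)
  have "x ^ (q ^ (d * Suc j)) = (x ^ (q ^ (d * j))) ^ (q ^ d)"
  by (simp add: q_power_power add.commute)
  thus ?case using Suc x by simp
 qed simp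
 from this[of f] have "x ^ (q ^ r) = x" unfolding r .
 thus "x : E" by (simp add: E_def)
qed

lemma carrier_H: "h : carrier H \<longleftrightarrow> h : carrier_vec m \<rightarrow>\<^sub>E E \<and>
  (ALL v:carrier_vec m. ALL w:carrier_vec m. h (v + w) = h v + h w) \<and>
  (ALL c. ALL v:carrier_vec m. h (iF c \<cdot>\<^sub>v v) = em c * h v) \<and>
  (ALL v:carrier_vec m. h (A *\<^sub>v v) = h v ^ (q ^ d))"
 unfolding H_def hom_space_def E_mod_def by (simp add: module_vec_simps)

lemma ops_H: "\<zero>\<^bsub>H\<^esub> = (\<lambda>v\<in>carrier_vec m. 0)" "h \<oplus>\<^bsub>H\<^esub> k = (\<lambda>v\<in>carrier_vec m. h v + k v)"
  "a \<odot>\<^bsub>H\<^esub> h = (\<lambda>v\<in>carrier_vec m. h (a \<cdot>\<^sub>v v))"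
 unfolding H_def hom_space_def E_mod_def by (simp_all add: module_vec_simps)

lemma vectorspace_H: "vectorspace class_ring H"
 unfolding H_def
proof (rule hom_space_vectorspace)
 show "vectorspace class_ring (module_vec TYPE('f) m)" by (rule coords_vectorspace[OF coords_module_vec])
 show "abelian_group E_mod"
 proof (rule abelian_groupI)
  show "EX y:carrier E_mod. y \<oplus>\<^bsub>E_mod\<^esub> x = \<zero>\<^bsub>E_mod\<^esub>" if "x : carrier E_mod" for x
  using that by (intro bexI[of _ "- x"]) (auto simp: E_mod_def E_closed)
 qed (auto simp: E_mod_def E_closed add_ac)
qed (use A in \<open>auto simp: E_mod_def E_closed module_vec_simps distrib_left q_power_add mult_mat_vec\<close>)

lemma finite_H: "finite (carrier H)"
proof -
 have "finite (carrier_vec m :: 'f vec set)"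
 proof -
  have "carrier_vec m <= (%g. vec m g) ` ({..<m} \<rightarrow>\<^sub>E (UNIV :: 'f set))"
  proof
  fix v :: "'f vec" assume "v : carrier_vec m"
  hence "vec m (\<lambda>i\<in>{..<m}. v $ i) = v" by (intro eq_vecI) simp_all
  moreover have "(\<lambda>i\<in>{..<m}. v $ i) : {..<m} \<rightarrow>\<^sub>E (UNIV :: 'f set)" by simp
  ultimately show "v : (%g. vec m g) ` ({..<m} \<rightarrow>\<^sub>E (UNIV :: 'f set))" by (metis imageI)
  qed
  moreover have "finite ({..<m} \<rightarrow>\<^sub>E (UNIV :: 'f set))" by (intro finite_PiE) (use finF in auto)
  ultimately show ?thesis using finite_subset by blast
 qed
 hence "finite (carrier_vec m \<rightarrow>\<^sub>E E :: ('f vec => 'e) set)" using finite_E by (intro finite_PiE) auto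
 moreover have "carrier H <= carrier_vec m \<rightarrow>\<^sub>E E" by (auto simp: carrier_H)
 ultimately show ?thesis by (rule finite_subset[rotated])
qed

lemma H_eqI: "g : carrier H ==> h : carrier H ==> (!!v. v : carrier_vec m ==> g v = h v) ==> g = h"
 unfolding carrier_H by (elim conjE) (rule PiE_ext)

definition scale :: "'e => ('f vec => 'e) => ('f vec => 'e)" where
 "scale x h = (\<lambda>w\<in>carrier_vec m. x * h w)"

definition frob :: "nat => ('f vec => 'e) => ('f vec => 'e)" where
 "frob j h = (\<lambda>w\<in>carrier_vec m. h w ^ (q ^ j))"

lemma Av: "v : carrier_vec m ==> A *\<^sub>v v : carrier_vec m" using A by auto

lemma carrier_H_D:
 assumes "h : carrier H"
 shows "v : carrier_vec m ==> h v : E"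
  "v : carrier_vec m ==> w : carrier_vec m ==> h (v + w) = h v + h w"
  "v : carrier_vec m ==> h (iF c \<cdot>\<^sub>v v) = em c * h v"
  "v : carrier_vec m ==> h (A *\<^sub>v v) = h v ^ (q ^ d)"
 using assms unfolding carrier_H by auto

text \<open>Equivariance compares x h(v) with its q^d-th power, so x has to be fixed by that
  power.\<close>

lemma scale_closed:
 assumes x: "x ^ (q ^ d) = x" and h: "h : carrier H"
 shows "scale x h : carrier H"
 unfolding carrier_H
proof (intro conjI ballI allI)
 note D = carrier_H_D[OF h]
 show "scale x h : carrier_vec m \<rightarrow>\<^sub>E E"
  unfolding scale_def using D(1) E_d_subset[OF x] by (intro restrict_PiE_iff[THEN iffD2] ballI E_closed(3))
 fix v w :: "'f vec" and c assume v: "v : carrier_vec m"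
 show "scale x h (iF c \<cdot>\<^sub>v v) = em c * scale x h v" using v by (simp add: scale_def D(3))
 show "scale x h (A *\<^sub>v v) = scale x h v ^ (q ^ d)"
  using v Av[OF v] x by (simp add: scale_def D(4) power_mult_distrib)
 assume w: "w : carrier_vec m"
 show "scale x h (v + w) = scale x h v + scale x h w" using v w by (simp add: scale_def D(2) distrib_left)
qed

lemma frob_closed:
 assumes h: "h : carrier H"
 shows "frob j h : carrier H"
 unfolding carrier_H
proof (intro conjI ballI allI)
 note D = carrier_H_D[OF h]
 show "frob j h : carrier_vec m \<rightarrow>\<^sub>E E"
  unfolding frob_def using D(1) by (intro restrict_PiE_iff[THEN iffD2] ballI E_closed(6))
 fix v w :: "'f vec" and c assume v: "v : carrier_vec m"
 show "frob j h (iF c \<cdot>\<^sub>v v) = em c * frob j h v"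
  using v by (simp add: frob_def D(3) power_mult_distrib q_power_em)
 show "frob j h (A *\<^sub>v v) = frob j h v ^ (q ^ d)"
  using v Av[OF v] by (simp add: frob_def D(4) q_power_power add.commute)
 assume w: "w : carrier_vec m"
 show "frob j h (v + w) = frob j h v + frob j h w" using v w by (simp add: frob_def D(2) q_power_add)
qed

lemma frob_frob: "h : carrier H ==> frob i (frob j h) = frob (i + j) h"
 by (intro ext) (simp add: frob_def q_power_power add.commute)

text \<open>Any nonzero k-linear functional on F serves here in place of the trace: sending a to the
  functional x \<mapsto> \<psi>(a x) is injective, and counting shows that every functional is
  reached.\<close>

lemma linear_dual:
 obtains \<psi> :: "'f => 'k" where "!!x y. \<psi> (x + y) = \<psi> x + \<psi> y" "!!c x. \<psi> (iF c * x) = c * \<psi> x"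
  "EX x. \<psi> x ~= 0"
  "!!g. (!!x y. g (x + y) = g x + g y) ==> (!!c x. g (iF c * x) = c * g x) ==> EX a. ALL x. g x = \<psi> (a * x)"
proof -
 define M :: "('k, 'f) module" where
  "M = \<lparr>carrier = UNIV, monoid.mult = (*), one = 1, zero = 0, add = (+), module.smult = (%c x. iF c * x)\<rparr>"
 have Ms [simp]: "carrier M = UNIV" "\<zero>\<^bsub>M\<^esub> = 0" "x \<oplus>\<^bsub>M\<^esub> y = x + y" "c \<odot>\<^bsub>M\<^esub> x = iF c * x" for x y c
  by (simp_all add: M_def)
 have vs: "vectorspace class_ring M"
 proof (rule vs_criteria)
  show "field (class_ring :: 'k ring)" by (rule class_field)
  show "ALL v:carrier M. EX w:carrier M. v \<oplus>\<^bsub>M\<^esub> w = \<zero>\<^bsub>M\<^esub>" by (auto intro: exI[of _ "- _"])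
 qed (auto simp: iF.hom_add iF.hom_mult algebra_simps)
 obtain s T where c: "coords M s T"
  using coords_exists[OF vs finite_vectorspace_fin_dim[OF vs]] finF by auto
 note C = coordsD[OF c, simplified]
 have s: "s ~= 0"
 proof
  assume "s = 0"
  hence "T 0 = T 1" using C(3)[of 0] C(3)[of 1] by auto
  thus False using C(8) by fastforce
 qed
 have dT [simp]: "dim_vec (T x) = s" for x using C(3)[of x] by simp
 \<comment> \<open>The first coordinate with respect to a k-basis of F; it exists and is nonzero
   because F is not the zero space.\<close>
 define \<psi> where "\<psi> x = T x $ 0" for x
 have \<psi>: "\<psi> (x + y) = \<psi> x + \<psi> y" "\<psi> (iF c * x) = c * \<psi> x" for x y c
  using s C(5)[of x y] C(7)[of c x] by (simp_all add: \<psi>_def)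
 obtain x0 where x0: "T x0 = unit_vec s 0" using C(9)[of "unit_vec s 0"] by auto
 have nz: "\<psi> x0 ~= 0" using x0 s by (simp add: \<psi>_def)
 define S where "S = {g :: 'f => 'k. (ALL x y. g (x + y) = g x + g y) & (ALL c x. g (iF c * x) = c * g x)}"
 have "EX v:carrier_vec s. ALL x. g x = v \<bullet> T x" if g: "g : S" for g
 proof -
  define M1 :: "('k, 'k) module" where
  "M1 = \<lparr>carrier = UNIV, monoid.mult = (*), one = 1, zero = 0, add = (+), module.smult = (*)\<rparr>"
  have "bij_betw (%x. vec 1 (%_. x)) (UNIV :: 'k set) (carrier_vec 1)"
  by (rule bij_betwI[where g = "%v. v $ 0"]) auto
  hence c1: "coords M1 1 (%x. vec 1 (%_. x))"
  unfolding coords_def M1_def by auto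
  have "EX B. B : carrier_mat 1 s & (ALL x. vec 1 (%_. g x) = B *\<^sub>v T x)"
  by (rule coords_linear_mat[OF c c1, of g]) (use g in \<open>auto simp: S_def M1_def\<close>)
  then obtain B where B: "B : carrier_mat 1 s" "!!x. vec 1 (%_. g x) = B *\<^sub>v T x" by auto
  have "g x = row B 0 \<bullet> T x" for x
  using arg_cong[OF B(2)[of x], of "%v. v $ 0"] B(1) by auto
  thus ?thesis using B(1) by (intro bexI[of _ "row B 0"]) auto
 qed
 then obtain vv where vv: "!!g. g : S ==> vv g : carrier_vec s & (ALL x. g x = vv g \<bullet> T x)" by metis
 have inj: "inj_on vv S"
 proof (rule inj_onI)
  fix g h assume "g : S" "h : S" "vv g = vv h"
  thus "g = h" using vv[of g] vv[of h] by auto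
 qed
 have "bij_betw T (UNIV :: 'f set) (carrier_vec s)" using c by (simp add: coords_def)
 hence cv: "card (carrier_vec s :: 'k vec set) = card (UNIV :: 'f set)" "finite (carrier_vec s :: 'k vec set)"
  using bij_betw_same_card finF bij_betw_finite by metis+
 have finS: "finite S" and cS: "card S <= card (UNIV :: 'f set)"
  using inj_on_finite[OF inj _ cv(2)] card_inj_on_le[OF inj _ cv(2)] vv cv(1) by auto
 have sub: "range (%a x. \<psi> (a * x)) <= S"
 proof -
  have "\<psi> (a * (iF c * x)) = c * \<psi> (a * x)" for a c x by (simp add: \<psi>(2) mult.left_commute[of a])
  thus ?thesis by (auto simp: S_def distrib_left \<psi>(1))
 qed
 have "inj (%a x. \<psi> (a * x))"
 proof (rule injI, rule ccontr)
  fix a b assume eq: "(%x. \<psi> (a * x)) = (%x. \<psi> (b * x))" and ne: "a ~= b"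
  have "\<psi> (a * (x0 / (a - b))) = \<psi> (b * (x0 / (a - b)))" using eq by metis
  moreover have "a * (x0 / (a - b)) = b * (x0 / (a - b)) + x0" using ne by (simp add: field_simps)
  ultimately show False using \<psi>(1)[of "b * (x0 / (a - b))" x0] nz by simp
 qed
 hence "card (range (%a x. \<psi> (a * x))) = card (UNIV :: 'f set)" by (simp add: card_image)
 hence rS: "range (%a x. \<psi> (a * x)) = S" using card_subset_eq[OF finS sub] card_mono[OF finS sub] cS by simp
 hence "EX a. ALL x. g x = \<psi> (a * x)" if "g : S" for g
 proof -
  have "g : range (%a x. \<psi> (a * x))" unfolding rS by (rule that)
  thus ?thesis by blast
 qed
 thus ?thesis using that[of \<psi>] \<psi> nz unfolding S_def by blast
qed

text \<open>\<open>linear_dual\<close> on each coordinate axis of F^m gives the entries of the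
  vector. Uniqueness holds because \<psi> composed with multiplication by a nonzero scalar is
  nonzero.\<close>

lemma vec_dual:
 assumes \<psi>: "!!x y. \<psi> (x + y) = \<psi> x + \<psi> y" "EX x. \<psi> x ~= 0"
  and rep: "!!g :: 'f => 'k. (!!x y. g (x + y) = g x + g y) ==> (!!c x. g (iF c * x) = c * g x) ==> EX a. ALL x. g x = \<psi> (a * x)"
  and g: "!!v w. v : carrier_vec m ==> w : carrier_vec m ==> g (v + w) = g v + g w"
  "!!c v. v : carrier_vec m ==> g (iF c \<cdot>\<^sub>v v) = c * g v"
 shows "EX! a. a : carrier_vec m & (ALL w:carrier_vec m. g w = \<psi> (a \<bullet> w))"
proof -
 have "\<psi> 0 + \<psi> 0 = \<psi> 0 + 0" using \<psi>(1)[of 0 0] by (simp only: add_0_right)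
 hence \<psi>0: "\<psi> 0 = 0" by (simp only: add_left_cancel)
 have \<psi>sum: "\<psi> (sum F X) = (\<Sum>x\<in>X. \<psi> (F x))" for F and X :: "nat set"
  by (induction X rule: infinite_finite_induct) (auto simp: \<psi> \<psi>0)
 have "ALL j. EX a. ALL x. g (x \<cdot>\<^sub>v unit_vec m j) = \<psi> (a * x)"
 proof (intro allI rep)
  fix j x y c
  show "g ((x + y) \<cdot>\<^sub>v unit_vec m j) = g (x \<cdot>\<^sub>v unit_vec m j) + g (y \<cdot>\<^sub>v unit_vec m j)"
  by (subst g(1)[symmetric]) (auto simp: add_smult_distrib_vec)
  show "g ((iF c * x) \<cdot>\<^sub>v unit_vec m j) = c * g (x \<cdot>\<^sub>v unit_vec m j)"
  by (subst g(2)[symmetric]) (auto simp: smult_smult_assoc)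
 qed
 then obtain a where a: "!!j x. g (x \<cdot>\<^sub>v unit_vec m j) = \<psi> (a j * x)" by metis
 have "g (0\<^sub>v m) + g (0\<^sub>v m) = g (0\<^sub>v m) + 0"
  using g(1)[of "0\<^sub>v m" "0\<^sub>v m"] by (simp only: add_0_right zero_carrier_vec left_zero_vec)
 hence g0: "g (0\<^sub>v m) = 0" by (simp only: add_left_cancel)
 have part: "g (vec m (%i. if i < k then w $ i else 0)) = (\<Sum>j<k. \<psi> (a j * w $ j))" if "k <= m" for w k
  using that
 proof (induction k)
  case 0
  have "vec m (%i. 0 :: 'f) = 0\<^sub>v m" by auto
  thus ?case by (simp add: g0)
 next
  case (Suc k)
  have "vec m (%i. if i < Suc k then w $ i else 0) =
   vec m (%i. if i < k then w $ i else 0) + w $ k \<cdot>\<^sub>v unit_vec m k"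
  using Suc.prems by (auto simp: unit_vec_def less_Suc_eq)
  thus ?case using Suc by (simp add: g(1) a)
 qed
 have ex: "g w = \<psi> (vec m a \<bullet> w)" if "w : carrier_vec m" for w
 proof -
  have "w = vec m (%i. if i < m then w $ i else 0)" using that by auto
  hence "g w = (\<Sum>j<m. \<psi> (a j * w $ j))" using part[of m w] by simp
  thus ?thesis using that by (auto simp: scalar_prod_def \<psi>sum atLeast0LessThan intro!: sum.cong)
 qed
 show ?thesis
 proof (rule ex1I[of _ "vec m a"])
  show "vec m a : carrier_vec m & (ALL w:carrier_vec m. g w = \<psi> (vec m a \<bullet> w))" using ex by auto
  fix b assume b: "b : carrier_vec m & (ALL w:carrier_vec m. g w = \<psi> (b \<bullet> w))"
  obtain x0 where x0: "\<psi> x0 ~= 0" using \<psi> by auto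
  show "b = vec m a"
  proof (rule eq_vecI)
  fix i assume "i < dim_vec (vec m a)"
  hence i: "i < m" by simp
  have eq: "\<psi> (b $ i * x) = \<psi> (a i * x)" for x
  proof -
   have "b \<bullet> (x \<cdot>\<^sub>v unit_vec m i) = x * b $ i"
    using b i by (simp add: scalar_prod_smult_right)
   thus ?thesis using a[of x i] b i by (simp add: mult.commute)
  qed
  show "b $ i = vec m a $ i"
  proof (rule ccontr)
   assume "b $ i ~= vec m a $ i"
   hence ne: "b $ i - a i ~= 0" using i by simp
   let ?y = "x0 / (b $ i - a i)"
   have "b $ i * ?y = a i * ?y + x0" using ne by (simp add: field_simps)
   thus False using eq[of ?y] \<psi>(1)[of "a i * ?y" x0] x0 by simp
  qed
  qed (use b in auto)
 qed
qed

lemma msum_mult_vec: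
 assumes "!!i. i < k ==> F i : carrier_mat r1 c1" "v : carrier_vec c1" "i < r1"
 shows "(msum r1 c1 F k *\<^sub>v v) $ i = (\<Sum>j<k. (F j *\<^sub>v v) $ i)"
 using assms(1)
proof (induction k)
 case (Suc k)
 have "msum r1 c1 F k : carrier_mat r1 c1" "F k : carrier_mat r1 c1"
  using Suc.prems by (auto intro: msum_carrier)
 hence "msum r1 c1 F (Suc k) *\<^sub>v v = msum r1 c1 F k *\<^sub>v v + F k *\<^sub>v v"
  using assms(2) by (simp add: add_mult_distrib_mat_vec)
 moreover have "dim_vec (F k *\<^sub>v v) = r1" using `F k : carrier_mat r1 c1` by simp
 ultimately show ?case using Suc assms(3) by (simp del: index_mult_mat_vec msum.simps(2))
qed (use assms in auto)

end

section \<open>The determinant of the twisted Frobenius on equivariant maps\<close>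

context equivariant_maps
begin

text \<open>In a normal basis b^(q^l), l < r = d f, write l = d i + j. The condition h(A v) =
  h(v)^(q^d) ties together the coordinates with equal j, so the space is the direct sum of tau^j F^m
  for j < d, where tau is the q-power map, and tau^d acts on F^m as the transpose of
  \<open>A\<close>. The resolvents collected in tau^d run over d conjugates of z and form a scalar,
  so \<open>det_one_minus_induced\<close> applies.\<close>

theorem det_equivariant_maps:
 assumes c: "coords H N TT" and Zc: "Z : carrier_mat N N" and Tc: "T : carrier_mat N N"
  and Z: "!!h. h : carrier H ==> TT (scale \<zeta> h) = Z *\<^sub>v TT h"
  and T: "!!h. h : carrier H ==> TT (frob 1 h) = T *\<^sub>v TT h"
  and \<zeta>: "\<zeta> ^ (q ^ d) = \<zeta>" and P: "map_poly em P = (\<Prod>i<d. [:1, - (\<zeta> ^ (q ^ i)):])"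
 shows "mdet (1\<^sub>m N - u \<cdot>\<^sub>m twist n Z T) =
  mdet (1\<^sub>m m - (u ^ d * inverse (fps_of_poly (map_poly iF P) ^ n)) \<cdot>\<^sub>m cmat A)"
  and "T * Z = Z ^\<^sub>m q * T"
proof -
 note C = coordsD[OF c]
 interpret VH: vectorspace class_ring H by (rule vectorspace_H)
 have pF: "prime CHAR('f)"
  using CHAR_field_hom[OF iF] prime_CHAR_finite_field[where ?'k = 'k] by simp
 have dZ [simp]: "dim_row Z = N" "dim_col Z = N" "dim_row T = N" "dim_col T = N" using Zc Tc by auto
 \<comment> \<open>The field with q^d elements, over which the space is a module through
   \<open>scale\<close>; it contains \<open>\<zeta>\<close>.\<close>
 define R where "R = {x::'e. x ^ (q ^ d) = x}"
 have R: "0 : R" "1 : R" "!!x y. x : R ==> y : R ==> x - y : R" "!!x y. x : R ==> y : R ==> x * y : R"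
  "!!c. em c : R" "\<zeta> : R"
  by (auto simp: R_def q_power_diff power_mult_distrib q_power_em \<zeta> power_0_left)
 have "EX B. B : carrier_mat N N & (ALL h:carrier H. TT (scale x h) = B *\<^sub>v TT h)" if x: "x : R" for x
 proof -
  have cl: "scale x h : carrier H" if "h : carrier H" for h using scale_closed x that by (auto simp: R_def)
  have "EX B:carrier_mat N N. ALL h:carrier H. TT (scale x h) = B *\<^sub>v TT h"
  proof (rule coords_linear_ex[OF c c])
  show "scale x (h \<oplus>\<^bsub>H\<^esub> k) = scale x h \<oplus>\<^bsub>H\<^esub> scale x k" for h k
   unfolding scale_def ops_H by (intro ext) (simp add: distrib_left)
  show "scale x (a \<odot>\<^bsub>H\<^esub> h) = a \<odot>\<^bsub>H\<^esub> scale x h" for a h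
   unfolding scale_def ops_H by (intro ext) simp
  qed (rule cl)
  thus ?thesis by blast
 qed
 then obtain \<mu> where \<mu>: "!!x. x : R ==> \<mu> x : carrier_mat N N"
  "!!x h. x : R ==> h : carrier H ==> TT (scale x h) = \<mu> x *\<^sub>v TT h" by metis
 have sc: "scale x h : carrier H" if "x : R" "h : carrier H" for x h
  using scale_closed that by (auto simp: R_def)
 have \<mu>eq: "\<mu> x = B" if "x : R" "B : carrier_mat N N" "!!h. h : carrier H ==> TT (scale x h) = B *\<^sub>v TT h" for x B
  by (rule coords_mat_eqI[OF c]) (use \<mu> that in auto)
 have \<mu>Z: "\<mu> \<zeta> = Z" by (rule \<mu>eq) (use R Zc Z in auto)
 have \<mu>mult: "\<mu> (x * y) = \<mu> x * \<mu> y" if xy: "x : R" "y : R" for x y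
 proof (rule \<mu>eq)
  fix h assume h: "h : carrier H"
  have "scale (x * y) h = scale x (scale y h)" by (auto simp: scale_def)
  thus "TT (scale (x * y) h) = \<mu> x * \<mu> y *\<^sub>v TT h"
  using \<mu> xy h sc C(3)[OF h] by (simp add: assoc_mult_mat_vec[of _ N N _ N])
 qed (use xy R \<mu>(1)[OF xy(1)] \<mu>(1)[OF xy(2)] in \<open>auto intro: mult_carrier_mat\<close>)
 have \<mu>add: "\<mu> (x + y) = \<mu> x + \<mu> y" if xy: "x : R" "y : R" "x + y : R" for x y
 proof (rule \<mu>eq)
  fix h assume h: "h : carrier H"
  have "scale (x + y) h = scale x h \<oplus>\<^bsub>H\<^esub> scale y h" by (auto simp: scale_def ops_H distrib_right)
  thus "TT (scale (x + y) h) = (\<mu> x + \<mu> y) *\<^sub>v TT h"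
  using \<mu> xy h sc C(3)[OF h] C(5) by (simp add: add_mult_distrib_mat_vec[of _ N N])
 qed (use xy \<mu>(1)[OF xy(1)] \<mu>(1)[OF xy(2)] in auto)
 have \<mu>diff: "\<mu> (x - y) = \<mu> x - \<mu> y" if xy: "x : R" "y : R" for x y
 proof -
  have "\<mu> x = \<mu> (x - y) + \<mu> y" using \<mu>add[of "x - y" y] xy R by simp
  thus ?thesis using \<mu>(1)[OF xy(1)] \<mu>(1)[OF xy(2)] \<mu>(1)[OF R(3)[OF xy]] by (auto intro!: eq_matI)
 qed
 have \<mu>em: "\<mu> (em c) = iF c \<cdot>\<^sub>m 1\<^sub>m N" for c
 proof (rule \<mu>eq)
  fix h assume h: "h : carrier H"
  have "scale (em c) h = iF c \<odot>\<^bsub>H\<^esub> h" using h by (auto simp: scale_def ops_H carrier_H)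
  thus "TT (scale (em c) h) = iF c \<cdot>\<^sub>m 1\<^sub>m N *\<^sub>v TT h"
  using C(7)[OF h] C(3)[OF h] by (auto intro!: eq_vecI)
 qed (use R in auto)
 have lf: "lfac n q Z d = fps_of_poly (map_poly iF P) ^ n \<cdot>\<^sub>m 1\<^sub>m N"
  by (rule lfac_scalar[of R \<mu> N em iF \<zeta>]) (use \<mu> R \<mu>diff \<mu>mult \<mu>em \<mu>Z P em.comm_ring_hom_axioms iF.comm_ring_hom_axioms in auto)
 define g where "g = fps_of_poly (map_poly iF P) ^ n"
 have "em (pcoeff P 0) = 1"
 proof -
  have "poly (map_poly em P) 0 = 1" unfolding P poly_prod by simp
  thus ?thesis by (simp add: poly_0_coeff_0 coeff_map_poly)
 qed
 hence "em (pcoeff P 0 - 1) = 0" by (simp add: em.hom_minus)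
 hence "pcoeff P 0 = 1" by simp
 hence "fps_nth g 0 = 1" by (simp add: g_def coeff_map_poly fps_nth_power_0)
 hence ig: "inverse g * g = 1" by (intro inverse_mult_eq_1) simp
 have TTc: "TT h : carrier_vec N" if "h : carrier H" for h using C(3)[OF that] .
 have Tj: "TT (frob j h) = T ^\<^sub>m j *\<^sub>v TT h" if h: "h : carrier H" for j h
  using h
 proof (induction j arbitrary: h)
  case 0
  have "frob 0 h = h" using 0 by (intro H_eqI frob_closed) (auto simp: frob_def)
  thus ?case using TTc[OF 0] Tc by simp
 next
  case (Suc j)
  have "frob (Suc j) h = frob j (frob 1 h)" using Suc.prems by (simp add: frob_frob)
  hence "TT (frob (Suc j) h) = T ^\<^sub>m j *\<^sub>v (T *\<^sub>v TT h)"
  using Suc frob_closed[OF Suc.prems, of 1] T by simp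
  also have "... = T ^\<^sub>m Suc j *\<^sub>v TT h"
  using TTc[OF Suc.prems] Tc by (simp add: assoc_mult_mat_vec[of _ N N _ N])
  finally show ?case .
 qed
 show TZ: "T * Z = Z ^\<^sub>m q * T"
 proof -
  have Rp: "\<zeta> ^ k : R" for k using R by (induction k) auto
  have Zk: "\<mu> (\<zeta> ^ k) = Z ^\<^sub>m k" for k
  proof (induction k)
  case 0
  have "\<mu> 1 = iF 1 \<cdot>\<^sub>m 1\<^sub>m N" using \<mu>em[of 1] by simp
  thus ?case by (auto intro!: eq_matI)
  next
  case (Suc k)
  thus ?case using \<mu>mult[OF Rp R(6), of k] by (simp add: \<mu>Z mult.commute)
  qed
  show ?thesis
  proof (rule coords_mat_eqI[OF c])
  fix h assume h: "h : carrier H"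
  have "T * Z *\<^sub>v TT h = TT (frob 1 (scale \<zeta> h))"
   using T[OF sc[OF R(6) h]] Z[OF h] TTc[OF h] Tc Zc by (simp add: assoc_mult_mat_vec[of _ N N _ N])
  also have "frob 1 (scale \<zeta> h) = scale (\<zeta> ^ q) (frob 1 h)"
   by (auto simp: scale_def frob_def power_mult_distrib)
  also have "TT ... = Z ^\<^sub>m q *\<^sub>v (T *\<^sub>v TT h)"
   using \<mu>(2)[OF Rp frob_closed[OF h], of q 1] T[OF h] Zk[of q] by simp
  also have "... = Z ^\<^sub>m q * T *\<^sub>v TT h"
   using TTc[OF h] Tc Zc by (simp add: assoc_mult_mat_vec[of _ N N _ N])
  finally show "T * Z *\<^sub>v TT h = Z ^\<^sub>m q * T *\<^sub>v TT h" .
  qed (rule mult_carrier_mat[OF Tc Zc], rule mult_carrier_mat[OF pow_carrier_mat[OF Zc] Tc])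
 qed
 obtain b where bE: "b ^ (q ^ r) = b"
  and bind: "!!c. (\<Sum>i<r. em (c i) * b ^ (q ^ i)) = 0 ==> ALL i<r. c i = 0"
  using normal_basis[OF r_pos card_E] by metis
 have binj: "ALL i<r. c i = c' i" if "(\<Sum>i<r. em (c i) * b ^ (q ^ i)) = (\<Sum>i<r. em (c' i) * b ^ (q ^ i))" for c c'
  using bind[of "%i. c i - c' i"] that by (simp add: em.hom_minus left_diff_distrib sum_subtractf)
 have bpow: "b ^ (q ^ i) : E" for i using bE E_closed(6)[of b] by (simp add: E_def)
 have sumE: "ALL e. (\<Sum>i\<in>X. em (c i) * b ^ (q ^ e i)) : E" for X :: "nat set" and c
  by (induction X rule: infinite_finite_induct) (auto intro: E_closed bpow)
 have surj: "EX c. x = (\<Sum>i<r. em (c i) * b ^ (q ^ i))" if x: "x : E" for x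
 proof -
  let ?F = "{..<r} \<rightarrow>\<^sub>E (UNIV :: 'k set)" and ?s = "%c. \<Sum>i<r. em (c i) * b ^ (q ^ i)"
  have "inj_on ?s ?F"
  proof (rule inj_onI)
  fix c c' assume cc: "c : ?F" "c' : ?F" and eq: "?s c = ?s c'"
  show "c = c'" by (rule PiE_ext[OF cc]) (use binj[OF eq] in auto)
  qed
  hence "card (?s ` ?F) = q ^ r" by (simp add: card_image card_PiE q)
  moreover have "?s ` ?F <= E" using sumE[THEN spec[where x = "%i. i"]] by auto
  ultimately have "?s ` ?F = E" using card_subset_eq[OF finite_E] card_E by (simp add: E_def)
  thus ?thesis using x by auto
 qed
 \<comment> \<open>\<open>cf x i\<close> is the i-th coordinate of x in the normal basis.\<close>
 then obtain cf where cf: "!!x. x : E ==> x = (\<Sum>i<r. em (cf x i) * b ^ (q ^ i))" by metis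
 have cf_eq: "cf x i = c i" if "x = (\<Sum>i<r. em (c i) * b ^ (q ^ i))" "i < r" for x c i
 proof -
  have "x : E" using sumE[THEN spec[where x = "%i. i"]] that by simp
  thus ?thesis using binj[OF trans[OF cf[symmetric] that(1)]] that(2) by blast
 qed
 have cf_add: "cf (x + y) i = cf x i + cf y i" if "x : E" "y : E" "i < r" for x y i
 proof (rule cf_eq)
  have "x + y = (\<Sum>i<r. em (cf x i) * b ^ (q ^ i)) + (\<Sum>i<r. em (cf y i) * b ^ (q ^ i))"
  by (rule arg_cong2[OF cf[OF that(1)] cf[OF that(2)]])
  thus "x + y = (\<Sum>i<r. em (cf x i + cf y i) * b ^ (q ^ i))"
  by (simp only: em.hom_add distrib_right sum.distrib)
 qed (rule that(3))
 have cf_em: "cf (em c * x) i = c * cf x i" if "x : E" "i < r" for x c i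
 proof (rule cf_eq)
  have "em c * x = em c * (\<Sum>i<r. em (cf x i) * b ^ (q ^ i))"
  by (rule arg_cong[OF cf[OF that(1)]])
  thus "em c * x = (\<Sum>i<r. em (c * cf x i) * b ^ (q ^ i))"
  by (simp only: em.hom_mult mult.assoc sum_distrib_left)
 qed (rule that(2))
 have "EX \<psi> :: 'f => 'k. (ALL x y. \<psi> (x + y) = \<psi> x + \<psi> y) & (ALL c x. \<psi> (iF c * x) = c * \<psi> x) \<and>
  (EX x. \<psi> x ~= 0) & (ALL g. (ALL x y. g (x + y) = g x + g y) --> (ALL c x. g (iF c * x) = c * g x) -->
   (EX a. ALL x. g x = \<psi> (a * x)))"
 proof (rule linear_dual)
  fix \<psi> :: "'f => 'k"
  assume a: "!!x y. \<psi> (x + y) = \<psi> x + \<psi> y" "!!c x. \<psi> (iF c * x) = c * \<psi> x" "EX x. \<psi> x ~= 0"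
  and a4: "!!g. (!!x y. g (x + y) = g x + g y) ==> (!!c x. g (iF c * x) = c * g x) ==> EX a. ALL x. g x = \<psi> (a * x)"
  show ?thesis
  proof (intro exI[of _ \<psi>] conjI allI impI)
  fix g :: "'f => 'k" assume "ALL x y. g (x + y) = g x + g y" "ALL c x. g (iF c * x) = c * g x"
  thus "EX a. ALL x. g x = \<psi> (a * x)" by (intro a4) auto
  qed (rule a)+
 qed
 then obtain \<psi> :: "'f => 'k" where \<psi>0: "(ALL x y. \<psi> (x + y) = \<psi> x + \<psi> y) & (ALL c x. \<psi> (iF c * x) = c * \<psi> x) \<and>
  (EX x. \<psi> x ~= 0) & (ALL g. (ALL x y. g (x + y) = g x + g y) --> (ALL c x. g (iF c * x) = c * g x) -->
   (EX a. ALL x. g x = \<psi> (a * x)))" by (rule exE)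
 hence \<psi>: "!!x y. \<psi> (x + y) = \<psi> x + \<psi> y" "!!c x. \<psi> (iF c * x) = c * \<psi> x" "EX x. \<psi> x ~= 0"
  "!!g. (!!x y. g (x + y) = g x + g y) ==> (!!c x. g (iF c * x) = c * g x) ==> EX a. ALL x. g x = \<psi> (a * x)"
  by simp_all
 have Apow: "A ^\<^sub>m k *\<^sub>v v : carrier_vec m" if "v : carrier_vec m" for k v
  using mult_mat_vec_carrier[OF pow_carrier_mat[OF A] that] .
 have hadd: "h (v + w) = h v + h w" if "h : carrier H" "v : carrier_vec m" "w : carrier_vec m" for h v w
  using that by (auto simp: carrier_H)
 have hsm: "h (iF c \<cdot>\<^sub>v v) = em c * h v" if "h : carrier H" "v : carrier_vec m" for h v c
  using that by (auto simp: carrier_H)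
 have hA: "h (A *\<^sub>v v) = h v ^ (q ^ d)" if "h : carrier H" "v : carrier_vec m" for h v
  using that by (auto simp: carrier_H)
 have hE: "h v : E" if "h : carrier H" "v : carrier_vec m" for h v
  using that by (auto simp: carrier_H)
 text \<open>Induction from \<open>\<tau>\<^sup>d\<close> to \<open>\<tau>\<close>: the embedding \<open>J\<close> and the projections \<open>pr\<close>.\<close>
 define Jf where "Jf a = (\<lambda>w\<in>carrier_vec m. \<Sum>i<f. em (\<psi> (a \<bullet> (A ^\<^sub>m (f - i) *\<^sub>v w))) * b ^ (q ^ (d * i)))" for a
 define prj where "prj j h = (THE a. a : carrier_vec m & (ALL w:carrier_vec m. cf (h w) j = \<psi> (a \<bullet> w)))" for j h
 have pr_ex1: "EX! a. a : carrier_vec m & (ALL w:carrier_vec m. cf (h w) j = \<psi> (a \<bullet> w))"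
  if h: "h : carrier H" and j: "j < r" for h j
  by (rule vec_dual) (use \<psi> h j in \<open>simp_all add: hadd hsm hE cf_add cf_em\<close>)
 have prj: "prj j h : carrier_vec m" "!!w. w : carrier_vec m ==> cf (h w) j = \<psi> (prj j h \<bullet> w)"
  if "h : carrier H" "j < r" for h j
 proof -
  note t = theI'[OF pr_ex1[OF that], folded prj_def]
  show "prj j h : carrier_vec m" by (rule conjunct1[OF t])
  show "!!w. w : carrier_vec m ==> cf (h w) j = \<psi> (prj j h \<bullet> w)" by (rule bspec[OF conjunct2[OF t]])
 qed
 have prj_eq: "prj j h = a" if "h : carrier H" "j < r" "a : carrier_vec m"
  "!!w. w : carrier_vec m ==> cf (h w) j = \<psi> (a \<bullet> w)" for h j a
  using pr_ex1[OF that(1,2)] prj[OF that(1,2)] that(3,4) by metis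
 have Jw: "Jf a w = (\<Sum>i<f. em (\<psi> (a \<bullet> (A ^\<^sub>m (f - i) *\<^sub>v w))) * b ^ (q ^ (d * i)))" if "w : carrier_vec m" for a w
  using that by (simp add: Jf_def)
 \<comment> \<open>Applying \<open>A\<close> shifts the summation index by one. The end terms match
   because A^f = 1 and b^(q^r) = b.\<close>
 have JA: "Jf a (A *\<^sub>v w) = Jf a w ^ (q ^ d)" if w: "w : carrier_vec m" for a w
 proof -
  let ?t = "%i. em (\<psi> (a \<bullet> (A ^\<^sub>m (f + 1 - i) *\<^sub>v w))) * b ^ (q ^ (d * i))"
  have AA: "A ^\<^sub>m k *\<^sub>v (A *\<^sub>v w) = A ^\<^sub>m (k + 1) *\<^sub>v w" for k
  using A w by (simp add: assoc_mult_mat_vec[of _ m m _ m])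
  have "Jf a (A *\<^sub>v w) = (\<Sum>i<f. ?t i)"
  unfolding Jw[OF Av[OF w]] by (rule sum.cong) (auto simp: AA Suc_diff_le)
  also have "... = (\<Sum>i<f. ?t (Suc i))"
  proof -
  have "A ^\<^sub>m (f + 1) = A ^\<^sub>m 1" using Af A by simp
  moreover have "b ^ (q ^ (d * f)) = b" using bE r by simp
  ultimately have "?t 0 = ?t f" by simp
  moreover have "(\<Sum>i<f. ?t (Suc i)) + ?t 0 = (\<Sum>i<f. ?t i) + ?t f"
   using sum.lessThan_Suc_shift[of ?t f] sum.lessThan_Suc[of ?t f] by (simp only: add.commute)
  ultimately show ?thesis by simp
  qed
  also have "... = Jf a w ^ (q ^ d)"
  unfolding Jw[OF w] q_power_sum
  by (rule sum.cong) (auto simp: power_mult_distrib q_power_em q_power_power add.commute)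
  finally show ?thesis .
 qed
 have Jcl: "Jf a : carrier H" if a: "a : carrier_vec m" for a
  unfolding carrier_H
 proof (intro conjI ballI allI)
  show "Jf a : carrier_vec m \<rightarrow>\<^sub>E E" using sumE by (auto simp: Jf_def)
  fix v w :: "'f vec" and c assume v: "v : carrier_vec m"
  show "Jf a (A *\<^sub>v v) = Jf a v ^ (q ^ d)" by (rule JA[OF v])
  have "a \<bullet> (A ^\<^sub>m k *\<^sub>v (iF c \<cdot>\<^sub>v v)) = iF c * (a \<bullet> (A ^\<^sub>m k *\<^sub>v v))" for k
  using a v A Apow[OF v, of k] by (simp add: mult_mat_vec[of _ m m] scalar_prod_smult_distrib[of _ m])
  thus "Jf a (iF c \<cdot>\<^sub>v v) = em c * Jf a v"
  using v by (simp add: Jw \<psi> em.hom_mult sum_distrib_left mult.assoc)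
  assume w: "w : carrier_vec m"
  have "a \<bullet> (A ^\<^sub>m k *\<^sub>v (v + w)) = a \<bullet> (A ^\<^sub>m k *\<^sub>v v) + a \<bullet> (A ^\<^sub>m k *\<^sub>v w)" for k
  using a v w A Apow[OF v, of k] Apow[OF w, of k]
  by (simp add: mult_add_distrib_mat_vec[of _ m m] scalar_prod_add_distrib[of _ m])
  thus "Jf a (v + w) = Jf a v + Jf a w"
  using v w by (simp add: Jw \<psi> em.hom_add distrib_right sum.distrib)
 qed
 have "EX J:carrier_mat N m. ALL a:carrier (module_vec TYPE('f) m). TT (Jf a) = J *\<^sub>v id a"
 proof (rule coords_linear_ex[OF coords_module_vec c])
  show "Jf a : carrier H" if "a : carrier (module_vec TYPE('f) m)" for a
  using that Jcl by (simp add: module_vec_simps)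
  show "Jf (a \<oplus>\<^bsub>module_vec TYPE('f) m\<^esub> a') = Jf a \<oplus>\<^bsub>H\<^esub> Jf a'"
  if "a : carrier (module_vec TYPE('f) m)" "a' : carrier (module_vec TYPE('f) m)" for a a'
  proof -
  have "(a + a') \<bullet> (A ^\<^sub>m k *\<^sub>v w) = a \<bullet> (A ^\<^sub>m k *\<^sub>v w) + a' \<bullet> (A ^\<^sub>m k *\<^sub>v w)"
   if "w : carrier_vec m" for w k
   using Apow[OF that] `a : _` `a' : _` by (simp add: module_vec_simps add_scalar_prod_distrib[of _ m])
  thus ?thesis unfolding module_vec_simps Jf_def ops_H
   by (intro ext) (simp add: \<psi>(1) em.hom_add distrib_right sum.distrib)
  qed
  show "Jf (x \<odot>\<^bsub>module_vec TYPE('f) m\<^esub> a) = x \<odot>\<^bsub>H\<^esub> Jf a" if "a : carrier (module_vec TYPE('f) m)" for x a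
  proof -
  have "(x \<cdot>\<^sub>v a) \<bullet> (A ^\<^sub>m k *\<^sub>v w) = a \<bullet> (A ^\<^sub>m k *\<^sub>v (x \<cdot>\<^sub>v w))"
   if "w : carrier_vec m" for w k
   using Apow[OF that, of k] `a : _` that A
   by (simp add: module_vec_simps mult_mat_vec[of _ m m] scalar_prod_smult_distrib[of _ m] smult_scalar_prod_distrib[of _ m])
  thus ?thesis unfolding module_vec_simps Jf_def ops_H by (intro ext) simp
  qed
 qed
 then obtain J where Jm: "J : carrier_mat N m" "!!a. a : carrier_vec m ==> TT (Jf a) = J *\<^sub>v a"
  unfolding module_vec_simps id_apply by blast
 have "EX B:carrier_mat m N. ALL h:carrier H. id (prj j h) = B *\<^sub>v TT h" if j: "j < r" for j
 proof (rule coords_linear_ex[OF c coords_module_vec])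
  show "prj j h : carrier (module_vec TYPE('f) m)" if "h : carrier H" for h
  using prj(1)[OF that j] by (simp add: module_vec_simps)
  show "prj j (h \<oplus>\<^bsub>H\<^esub> k) = prj j h \<oplus>\<^bsub>module_vec TYPE('f) m\<^esub> prj j k"
  if hk: "h : carrier H" "k : carrier H" for h k
  unfolding module_vec_simps
  proof (rule prj_eq[OF C(4)[OF hk] j])
  fix w :: "'f vec" assume w: "w : carrier_vec m"
  have "cf (h w + k w) j = \<psi> (prj j h \<bullet> w + prj j k \<bullet> w)"
   using hk w j prj[OF _ j] by (simp add: cf_add hE \<psi>)
  thus "cf ((h \<oplus>\<^bsub>H\<^esub> k) w) j = \<psi> ((prj j h + prj j k) \<bullet> w)"
   using w prj(1)[OF hk(1) j] prj(1)[OF hk(2) j] by (simp add: ops_H add_scalar_prod_distrib[of _ m])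
  qed (use prj hk j in auto)
  show "prj j (x \<odot>\<^bsub>H\<^esub> h) = x \<odot>\<^bsub>module_vec TYPE('f) m\<^esub> prj j h" if h: "h : carrier H" for h x
  unfolding module_vec_simps
  proof (rule prj_eq[OF C(6)[OF h] j])
  fix w :: "'f vec" assume w: "w : carrier_vec m"
  have "prj j h \<bullet> (x \<cdot>\<^sub>v w) = (x \<cdot>\<^sub>v prj j h) \<bullet> w"
   using w prj(1)[OF h j] by (simp add: scalar_prod_smult_right smult_scalar_prod_distrib[of _ m])
  thus "cf ((x \<odot>\<^bsub>H\<^esub> h) w) j = \<psi> ((x \<cdot>\<^sub>v prj j h) \<bullet> w)"
   using w prj(2)[OF h j, of "x \<cdot>\<^sub>v w"] by (simp add: ops_H)
  qed (use prj h j in auto)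
 qed
 then obtain pr where prm: "!!j. j < r ==> pr j : carrier_mat m N"
  "!!j h. j < r ==> h : carrier H ==> prj j h = pr j *\<^sub>v TT h" unfolding id_apply by metis
 have dr: "j < r" if "j < d" for j using that mult_le_mono2[of 1 f d] f unfolding r by linarith
 have idx: "d * i + j < r" if "i < f" "j < d" for i j
 proof -
  have "d * i + j < d * i + d" using that by simp
  also have "... = d * Suc i" by simp
  also have "... <= d * f" using that by (intro mult_le_mono2) simp
  finally show ?thesis by (simp add: r)
 qed
 have sum_idx: "(\<Sum>j<d. \<Sum>i<f. F (d * i + j)) = (\<Sum>l<r. F l)" for F :: "nat => 'e"
 proof -
  have "(\<Sum>l<r. F l) = (\<Sum>i<f. sum F {i * d..<i * d + d})"
  using sum.nat_group[of F d f] by (simp add: r mult.commute)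
  also have "... = (\<Sum>i<f. \<Sum>j<d. F (d * i + j))"
  proof (rule sum.cong)
  fix i show "sum F {i * d..<i * d + d} = (\<Sum>j<d. F (d * i + j))"
   using sum.shift_bounds_nat_ivl[of F 0 "i * d" d] by (simp add: atLeast0LessThan add.commute mult.commute)
  qed simp
  finally show ?thesis by (subst sum.swap) simp
 qed
 have frobJ: "frob j (Jf a) w = (\<Sum>i<f. em (\<psi> (a \<bullet> (A ^\<^sub>m (f - i) *\<^sub>v w))) * b ^ (q ^ (d * i + j)))"
  if "w : carrier_vec m" for j a w
  using that by (simp add: frob_def Jw q_power_sum power_mult_distrib q_power_em q_power_power)
 \<comment> \<open>The first d coordinate functions of h determine all others: h(A v) = h(v)^(q^d)
   shifts coordinates by d, and A^(f - i) stands for the inverse of A^i.\<close>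
 have cf_shift: "cf (h w) (d * i + j) = cf (h (A ^\<^sub>m (f - i) *\<^sub>v w)) j"
  if h: "h : carrier H" and w: "w : carrier_vec m" and ij: "i < f" "j < d" for h w i j
 proof -
  have step: "cf (h (A *\<^sub>v v)) (d * Suc i + j) = cf (h v) (d * i + j)"
  if v: "v : carrier_vec m" and i: "Suc i < f" for v i
  proof -
  have "h (A *\<^sub>v v) = (\<Sum>l<r. em (cf (h v) l) * b ^ (q ^ l)) ^ (q ^ d)"
   using hA[OF h v] cf[OF hE[OF h v]] by simp
  also have "... = (\<Sum>l<r. em (cf (h v) l) * b ^ (q ^ (l + d)))"
   by (simp add: q_power_sum power_mult_distrib q_power_em q_power_power)
  \<comment> \<open>The q^d-power rotates the normal basis by d places, with wrap-around modulo
    r.\<close>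
  also have "... = (\<Sum>l<r. em (cf (h v) (if l < d then l + r - d else l - d)) * b ^ (q ^ l))"
  proof (rule sum.reindex_bij_witness[of _ "%l. if l < d then l + r - d else l - d" "%l. if l + d < r then l + d else l + d - r"])
   have dr': "d <= r" using f by (simp add: r)
   fix l assume l: "l : {..<r}"
   show "(if (if l + d < r then l + d else l + d - r) < d then (if l + d < r then l + d else l + d - r) + r - d
    else (if l + d < r then l + d else l + d - r) - d) = l" using l dr' by auto
   show "(if l + d < r then l + d else l + d - r) : {..<r}" using l dr' by auto
   show "(if (if l < d then l + r - d else l - d) + d < r then (if l < d then l + r - d else l - d) + d
    else (if l < d then l + r - d else l - d) + d - r) = l" using l dr' by auto
   show "(if l < d then l + r - d else l - d) : {..<r}" using l dr' by auto
   have "b ^ (q ^ (l + d)) = b ^ (q ^ (l + d - r))" if "\<not> l + d < r"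
   proof -
    have "b ^ (q ^ (l + d)) = (b ^ (q ^ r)) ^ (q ^ (l + d - r))" using that by (simp add: q_power_power)
    thus ?thesis using bE by simp
   qed
   moreover have "(if (if l + d < r then l + d else l + d - r) < d then (if l + d < r then l + d else l + d - r) + r - d
    else (if l + d < r then l + d else l + d - r) - d) = l" using l dr' by auto
   ultimately show "em (cf (h v) (if (if l + d < r then l + d else l + d - r) < d
     then (if l + d < r then l + d else l + d - r) + r - d
     else (if l + d < r then l + d else l + d - r) - d)) * b ^ (q ^ (if l + d < r then l + d else l + d - r))
    = em (cf (h v) l) * b ^ (q ^ (l + d))" by auto
  qed
  finally have "cf (h (A *\<^sub>v v)) (d * Suc i + j) = cf (h v) (if d * Suc i + j < d then d * Suc i + j + r - d else d * Suc i + j - d)"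
   by (rule cf_eq) (rule idx[OF i ij(2)])
  thus ?thesis by simp
  qed
  have it: "cf (h (A ^\<^sub>m i *\<^sub>v v)) (d * i + j) = cf (h v) j" if "v : carrier_vec m" "i < f" for v i
  using that
  proof (induction i)
  case (Suc i)
  have "A ^\<^sub>m Suc i *\<^sub>v v = A *\<^sub>v (A ^\<^sub>m i *\<^sub>v v)"
   using A Suc.prems by (simp only: mat_pow_Suc' carrier_matD) (simp add: assoc_mult_mat_vec[of _ m m _ m])
  thus ?case using Suc step[OF Apow[OF Suc.prems(1)], of i i] by simp
  qed (use A in simp)
  have "A ^\<^sub>m i *\<^sub>v (A ^\<^sub>m (f - i) *\<^sub>v w) = A ^\<^sub>m f *\<^sub>v w"
  using A w ij pow_mat_add[of A i "f - i"] by (simp add: assoc_mult_mat_vec[of _ m m _ m, symmetric])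
  thus ?thesis using it[OF Apow[OF w] ij(1), of "f - i"] Af w by simp
 qed
 have T1: "msum N N (%j. T ^\<^sub>m j * J * pr j) d = 1\<^sub>m N"
 proof (rule coords_mat_eqI[OF c])
  have Fc: "T ^\<^sub>m j * J * pr j : carrier_mat N N" if "j < d" for j
  by (rule mult_carrier_mat[OF mult_carrier_mat[OF pow_carrier_mat[OF Tc] Jm(1)] prm(1)[OF dr[OF that]]])
  thus "msum N N (%j. T ^\<^sub>m j * J * pr j) d : carrier_mat N N" by (rule msum_carrier)
  fix h assume h: "h : carrier H"
  define tm where "tm j = frob j (Jf (prj j h))" for j
  have tmc: "tm j : carrier H" if "j < d" for j
  unfolding tm_def using prj(1)[OF h dr[OF that]] by (intro frob_closed Jcl)
  have tmv: "TT (tm j) = (T ^\<^sub>m j * J * pr j) *\<^sub>v TT h" if j: "j < d" for j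
  proof -
  have "(T ^\<^sub>m j * J * pr j) *\<^sub>v TT h = T ^\<^sub>m j * J *\<^sub>v (pr j *\<^sub>v TT h)"
   by (rule assoc_mult_mat_vec[OF mult_carrier_mat[OF pow_carrier_mat[OF Tc] Jm(1)] prm(1)[OF dr[OF j]] TTc[OF h]])
  also have "... = T ^\<^sub>m j *\<^sub>v (J *\<^sub>v prj j h)"
   unfolding prm(2)[OF dr[OF j] h, symmetric]
   by (rule assoc_mult_mat_vec[of _ N N _ m]) (use Tc Jm(1) prj(1)[OF h dr[OF j]] in auto)
  finally show ?thesis unfolding tm_def
   using Tj[OF Jcl] Jm(2) prj(1)[OF h dr[OF j]] by simp
  qed
  define S where "S = rec_nat \<zero>\<^bsub>H\<^esub> (%j s. s \<oplus>\<^bsub>H\<^esub> tm j)"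
  have S0: "S 0 = \<zero>\<^bsub>H\<^esub>" and SS: "S (Suc k) = S k \<oplus>\<^bsub>H\<^esub> tm k" for k by (simp_all add: S_def)
  have Scl: "S k : carrier H" if "k <= d" for k
  using that by (induction k) (auto simp: S0 SS C tmc)
  have Sv: "S k w = (\<Sum>j<k. tm j w)" if "w : carrier_vec m" for k w
  using that by (induction k) (auto simp: S0 SS ops_H)
  have ST: "TT (S k) $ i = (\<Sum>j<k. TT (tm j) $ i)" if "k <= d" "i < N" for k i
  using that
  proof (induction k)
  case (Suc k)
  have "TT (S (Suc k)) = TT (S k) + TT (tm k)"
   unfolding SS using Suc.prems by (intro C(5) Scl tmc) auto
  moreover have "dim_vec (TT (tm k)) = N" using TTc[OF tmc[of k]] Suc.prems by simp
  ultimately show ?case using Suc by simp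
  qed (simp add: S0 C)
  have "S d = h"
  proof (rule H_eqI)
  fix w :: "'f vec" assume w: "w : carrier_vec m"
  have "S d w = (\<Sum>j<d. \<Sum>i<f. em (cf (h w) (d * i + j)) * b ^ (q ^ (d * i + j)))"
   unfolding Sv[OF w]
  proof (rule sum.cong)
   fix j assume j: "j : {..<d}"
   have "em (\<psi> (prj j h \<bullet> (A ^\<^sub>m (f - i) *\<^sub>v w))) = em (cf (h w) (d * i + j))" if "i < f" for i
    using cf_shift[OF h w that, of j] prj(2)[OF h dr[of j] Apow[OF w]] j by simp
   thus "tm j w = (\<Sum>i<f. em (cf (h w) (d * i + j)) * b ^ (q ^ (d * i + j)))"
    unfolding tm_def frobJ[OF w] by (intro sum.cong) auto
  qed simp
  also have "... = h w" unfolding sum_idx[of "%l. em (cf (h w) l) * b ^ (q ^ l)"] using cf[OF hE[OF h w]] by simp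
  finally show "S d w = h w" .
  qed (use Scl h in auto)
  show "msum N N (%j. T ^\<^sub>m j * J * pr j) d *\<^sub>v TT h = 1\<^sub>m N *\<^sub>v TT h"
  proof (rule eq_vecI)
  fix i assume "i < dim_vec (1\<^sub>m N *\<^sub>v TT h)"
  hence i: "i < N" by simp
  have "(msum N N (%j. T ^\<^sub>m j * J * pr j) d *\<^sub>v TT h) $ i = (\<Sum>j<d. ((T ^\<^sub>m j * J * pr j) *\<^sub>v TT h) $ i)"
   by (rule msum_mult_vec[OF Fc TTc[OF h] i])
  also have "... = TT (S d) $ i" unfolding ST[OF order_refl i] by (rule sum.cong) (auto simp: tmv)
  finally show "(msum N N (%j. T ^\<^sub>m j * J * pr j) d *\<^sub>v TT h) $ i = (1\<^sub>m N *\<^sub>v TT h) $ i"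
   using `S d = h` TTc[OF h] by simp
  qed (use carrier_matD(1)[OF msum_carrier[of d "%j. T ^\<^sub>m j * J * pr j", OF Fc]] in simp)
 qed auto
 have orth: "pr j * (T ^\<^sub>m i * J) = (if i = j then 1\<^sub>m m else 0\<^sub>m m m)" if ij: "i < d" "j < d" for i j
 proof (rule coords_mat_eqI[OF coords_module_vec])
  note prJ = prm(1)[OF dr[OF ij(2)]]
  note TJ = mult_carrier_mat[OF pow_carrier_mat[OF Tc, of i] Jm(1)]
  show "pr j * (T ^\<^sub>m i * J) : carrier_mat m m" by (rule mult_carrier_mat[OF prJ TJ])
  fix a assume "a : carrier (module_vec TYPE('f) m)"
  hence a: "a : carrier_vec m" by (simp add: module_vec_simps)
  have "pr j * (T ^\<^sub>m i * J) *\<^sub>v a = pr j *\<^sub>v (T ^\<^sub>m i * J *\<^sub>v a)"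
  by (rule assoc_mult_mat_vec[OF prJ TJ a])
  also have "T ^\<^sub>m i * J *\<^sub>v a = T ^\<^sub>m i *\<^sub>v (J *\<^sub>v a)"
  by (rule assoc_mult_mat_vec[OF pow_carrier_mat[OF Tc] Jm(1) a])
  also have "... = TT (frob i (Jf a))" using Tj[OF Jcl[OF a]] Jm(2)[OF a] by simp
  also have "pr j *\<^sub>v ... = prj j (frob i (Jf a))"
  using prm(2)[OF dr[OF ij(2)] frob_closed[OF Jcl[OF a]]] by simp
  also have "... = (if i = j then a else 0\<^sub>v m)"
  proof (rule prj_eq[OF frob_closed[OF Jcl[OF a]] dr[OF ij(2)]])
  fix w :: "'f vec" assume w: "w : carrier_vec m"
  \<comment> \<open>Coordinates of tau^i applied to \<open>Jf a\<close>: they are supported on the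
    indices congruent to i modulo d, so the j-th one vanishes unless j = i.\<close>
  define c where "c l = (if l mod d = i then \<psi> (a \<bullet> (A ^\<^sub>m (f - l div d) *\<^sub>v w)) else 0)" for l
  have "frob i (Jf a) w = (\<Sum>j<d. \<Sum>l<f. em (c (d * l + j)) * b ^ (q ^ (d * l + j)))"
  proof -
   have "(\<Sum>j<d. \<Sum>l<f. em (c (d * l + j)) * b ^ (q ^ (d * l + j))) =
    (\<Sum>j<d. if j = i then frob i (Jf a) w else 0)"
    by (rule sum.cong) (auto simp: c_def frobJ[OF w])
   thus ?thesis using ij by simp
  qed
  also have "... = (\<Sum>l<r. em (c l) * b ^ (q ^ l))" by (rule sum_idx)
  finally have "cf (frob i (Jf a) w) j = c j" by (rule cf_eq) (rule dr[OF ij(2)])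
  moreover have "\<psi> 0 = 0"
  proof -
   have "\<psi> 0 + \<psi> 0 = \<psi> 0 + 0" using \<psi>(1)[of 0 0] by (simp only: add_0_right)
   thus ?thesis by (simp only: add_left_cancel)
  qed
  ultimately show "cf (frob i (Jf a) w) j = \<psi> ((if i = j then a else 0\<^sub>v m) \<bullet> w)"
  proof (cases "i = j")
   case True
   hence "c j = \<psi> (a \<bullet> w)" using ij Af w by (simp add: c_def)
   thus ?thesis using True `cf _ j = c j` by simp
  next
   case False
   hence "c j = 0" using ij by (simp add: c_def)
   thus ?thesis using False `cf _ j = c j` `\<psi> 0 = 0` w by simp
  qed
  qed (use a in auto)
  finally show "pr j * (T ^\<^sub>m i * J) *\<^sub>v id a = (if i = j then 1\<^sub>m m else 0\<^sub>m m m) *\<^sub>v id a"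
  using a by auto
 qed (cases "i = j"; simp)
 \<comment> \<open>On the space tau^d is composition with \<open>A\<close>; for \<open>Jf a\<close>
   this moves \<open>A\<close> to the other side of the scalar product, where it becomes its
   transpose.\<close>
 have TdJ: "T ^\<^sub>m d * J = J * transpose_mat A"
 proof (rule coords_mat_eqI[OF coords_module_vec])
  fix a assume "a : carrier (module_vec TYPE('f) m)"
  hence a: "a : carrier_vec m" by (simp add: module_vec_simps)
  have At: "transpose_mat A *\<^sub>v a : carrier_vec m" using A a by auto
  have "T ^\<^sub>m d * J *\<^sub>v a = TT (frob d (Jf a))"
  using Tj[OF Jcl[OF a]] Jm(2)[OF a] assoc_mult_mat_vec[of "T ^\<^sub>m d" N N J m a] Tc Jm(1) a by simp
  also have "frob d (Jf a) = Jf (transpose_mat A *\<^sub>v a)"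
  proof (rule H_eqI[OF frob_closed[OF Jcl[OF a]] Jcl[OF At]])
  fix w :: "'f vec" assume w: "w : carrier_vec m"
  have "frob d (Jf a) w = Jf a (A *\<^sub>v w)" using w by (simp add: frob_def JA)
  also have "... = Jf (transpose_mat A *\<^sub>v a) w"
  proof -
   have "a \<bullet> (A ^\<^sub>m k *\<^sub>v (A *\<^sub>v w)) = (transpose_mat A *\<^sub>v a) \<bullet> (A ^\<^sub>m k *\<^sub>v w)" for k
   proof -
    have "A ^\<^sub>m k *\<^sub>v (A *\<^sub>v w) = A *\<^sub>v (A ^\<^sub>m k *\<^sub>v w)"
    using A w assoc_mult_mat_vec[of "A ^\<^sub>m k" m m A m w] assoc_mult_mat_vec[of A m m "A ^\<^sub>m k" m w] mat_pow_Suc'[of A k]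
    by simp
    thus ?thesis using transpose_vec_mult_scalar[OF A Apow[OF w] a, of k] by simp
   qed
   thus ?thesis unfolding Jw[OF Av[OF w]] Jw[OF w] by simp
  qed
  finally show "frob d (Jf a) w = Jf (transpose_mat A *\<^sub>v a) w" .
  qed
  also have "TT ... = J * transpose_mat A *\<^sub>v a"
  using Jm(2)[OF At] assoc_mult_mat_vec[of J N m "transpose_mat A" m a] Jm(1) A a by simp
  finally show "T ^\<^sub>m d * J *\<^sub>v id a = J * transpose_mat A *\<^sub>v id a" by simp
 qed (rule mult_carrier_mat[OF pow_carrier_mat[OF Tc] Jm(1)], rule mult_carrier_mat[OF Jm(1)], use A in simp)
 have dJ [simp]: "dim_row J = N" "dim_col J = m" "dim_row A = m" "dim_col A = m" using Jm A by auto
 have cf1: "cfac n q Z d = inverse g \<cdot>\<^sub>m 1\<^sub>m N"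
 proof -
  have "g \<cdot>\<^sub>m cfac n q Z d = 1\<^sub>m N"
  using cfac_lfac[OF Zc, of n q d] unfolding lf g_def[symmetric] by (simp add: mat_smultr mat_oner)
  hence "inverse g \<cdot>\<^sub>m (g \<cdot>\<^sub>m cfac n q Z d) = inverse g \<cdot>\<^sub>m 1\<^sub>m N" by simp
  moreover have "1 \<cdot>\<^sub>m cfac n q Z d = cfac n q Z d" by (auto intro!: eq_matI)
  ultimately show ?thesis by (simp add: mat_smult_smult ig)
 qed
 have pow1: "1\<^sub>m N ^\<^sub>m k = (1\<^sub>m N :: 'f mat)" for k by (induction k) simp_all
 have "mdet (1\<^sub>m N - u \<cdot>\<^sub>m twist n Z T) =
  mdet (1\<^sub>m m - (u ^ d * inverse g) \<cdot>\<^sub>m cmat (transpose_mat A))"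
 proof (rule det_one_minus_induced[of "twist n Z T" N T J m "transpose_mat A" d pr])
  show "map_mat (%f. fps_nth f 0) (twist n Z T) = T"
  unfolding twist_def
  by (simp add: map_mat_mult_hom[OF fps_nth_0_hom] map_mat_pow_hom[OF fps_nth_0_hom] tres_nth_0 mat_onel pow1)
  have "twist n Z T ^\<^sub>m d * cmat J = inverse g \<cdot>\<^sub>m cmat (T ^\<^sub>m d * J)"
  unfolding twist_pow[OF Zc Tc TZ] cf1 by (simp add: mat_laws cmat_mult)
  thus "twist n Z T ^\<^sub>m d * cmat J = inverse g \<cdot>\<^sub>m (cmat J * cmat (transpose_mat A))"
  unfolding TdJ by (simp add: cmat_mult)
 qed (use Tc Jm A prm dr d T1 orth pF in \<open>auto intro!: carrier_matI\<close>)
 also have "1\<^sub>m m - (u ^ d * inverse g) \<cdot>\<^sub>m cmat (transpose_mat A) =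
  transpose_mat (1\<^sub>m m - (u ^ d * inverse g) \<cdot>\<^sub>m cmat A)"
  by (auto intro!: eq_matI)
 also have "mdet ... = mdet (1\<^sub>m m - (u ^ d * inverse g) \<cdot>\<^sub>m cmat A)"
  by (rule det_transpose) (auto intro!: carrier_matI)
 finally show "mdet (1\<^sub>m N - u \<cdot>\<^sub>m twist n Z T) =
  mdet (1\<^sub>m m - (u ^ d * inverse (fps_of_poly (map_poly iF P) ^ n)) \<cdot>\<^sub>m cmat A)"
  unfolding g_def .
qed

end

section \<open>Infinite products of one-units\<close>

definition unit_mod :: "nat => 'f::field fps => bool" where
 "unit_mod w F \<longleftrightarrow> (EX g. F = 1 + fps_X ^ w * g)"

lemma unit_mod_nth: "unit_mod w F ==> k < w ==> fps_nth F k = fps_nth 1 k"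
 by (auto simp: unit_mod_def fps_X_power_mult_nth)

lemma unit_mod_mono: "unit_mod w F ==> v <= w ==> unit_mod v F"
 unfolding unit_mod_def by (metis le_add_diff_inverse mult.assoc power_add)

lemma unit_mod_1 [simp]: "unit_mod w 1"
 unfolding unit_mod_def by (intro exI[of _ 0]) simp

lemma unit_mod_mult: "unit_mod w F ==> unit_mod w G ==> unit_mod w (F * G)"
proof -
 assume "unit_mod w F" "unit_mod w G"
 then obtain f g where "F = 1 + fps_X ^ w * f" "G = 1 + fps_X ^ w * g" by (auto simp: unit_mod_def)
 hence "F * G = 1 + fps_X ^ w * (f + g + f * fps_X ^ w * g)" by (simp add: algebra_simps)
 thus ?thesis unfolding unit_mod_def by blast
qed

lemma unit_mod_prod: "(!!i. i : S ==> unit_mod w (F i)) ==> unit_mod w (prod F S)"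
 by (induction S rule: infinite_finite_induct) (auto intro: unit_mod_mult)

lemma unit_mod_inverse:
 assumes "unit_mod w F" "w >= 1"
 shows "unit_mod w (inverse F)" "inverse F * F = 1"
proof -
 obtain f where f: "F = 1 + fps_X ^ w * f" using assms by (auto simp: unit_mod_def)
 have "fps_nth F 0 = 1" using unit_mod_nth[OF assms(1), of 0] assms(2) by simp
 thus inv: "inverse F * F = 1" by (intro inverse_mult_eq_1) simp
 hence "inverse F = 1 + fps_X ^ w * (- (inverse F * f))" unfolding f by (simp add: algebra_simps eq_diff_eq)
 thus "unit_mod w (inverse F)" unfolding unit_mod_def by blast
qed

lemma unit_mod_det:
 assumes "A : carrier_mat n n"
 shows "unit_mod w (mdet (1\<^sub>m n - (fps_X ^ w * c) \<cdot>\<^sub>m cmat A))"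
proof -
 have "(fps_X ^ w * c) \<cdot>\<^sub>m cmat A = fps_X ^ w \<cdot>\<^sub>m (c \<cdot>\<^sub>m cmat A)" by (simp add: mat_smult_smult)
 moreover have "c \<cdot>\<^sub>m cmat A : carrier_mat n n" using assms by simp
 ultimately show ?thesis
  using det_one_minus_smult_expand[of "c \<cdot>\<^sub>m cmat A" n "fps_X ^ w"] by (auto simp: unit_mod_def)
qed

text \<open>\<open>w i\<close> is an order in 1/t up to which the i-th factor agrees with 1. That
  only finitely many factors have bounded order makes the unordered product converge.\<close>

locale unit_family =
 fixes A :: "'i set" and w :: "'i => nat"
 assumes w_pos: "!!i. i : A ==> w i >= 1" and w_fin: "!!c. finite {i : A. w i <= c}"
begin

text \<open>Each coefficient of the infinite product is read off from a finite one, since factors of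
  weight above c do not affect the c-th coefficient.\<close>

definition plim :: "('i => 'f::field fps) => 'f fps" where
 "plim F = Abs_fps (%c. fps_nth (prod F {i : A. w i <= c}) c)"

lemma prod_nth_plim:
 assumes F: "!!i. i : A ==> unit_mod (w i) (F i)"
  and S: "finite S" "S <= A" "{i : A. w i <= c} <= S" and k: "k <= c"
 shows "fps_nth (prod F S) k = fps_nth (plim F) k"
proof -
 let ?K = "{i : A. w i <= k}"
 have sub: "?K <= S" using S k by auto
 have "unit_mod (Suc k) (prod F (S - ?K))"
 proof (rule unit_mod_prod)
  fix i assume "i : S - ?K"
  hence "i : A" "Suc k <= w i" using S by auto
  thus "unit_mod (Suc k) (F i)" using unit_mod_mono[OF F] by blast
 qed
 then obtain g where g: "prod F (S - ?K) = 1 + fps_X ^ Suc k * g" by (auto simp: unit_mod_def)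
 have "prod F S = prod F ?K * prod F (S - ?K)" using prod.subset_diff[OF sub S(1), of F] by (simp only: mult.commute)
 also have "... = prod F ?K + fps_X ^ Suc k * (g * prod F ?K)" unfolding g by (simp add: algebra_simps)
 finally have "fps_nth (prod F S) k = fps_nth (prod F ?K) k"
  by (simp only: fps_add_nth fps_X_power_mult_nth lessI if_True add_0_right)
 thus ?thesis by (simp add: plim_def)
qed

text \<open>Distance in \<open>fls\<close> is 2 to the minus subdegree of the difference, and the
  difference vanishes up to order c once all factors of weight at most c are included.\<close>

lemma plim_tendsto:
 fixes F :: "'i => 'f::field fps"
 assumes F: "!!i. i : A ==> unit_mod (w i) (F i)" and f: "!!i. i : A ==> f i = fps_to_fls (F i)"
 shows "((%S. prod f S) \<longlongrightarrow> fps_to_fls (plim F)) (finite_subsets_at_top A)"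
proof (rule tendstoI)
 fix e :: real assume "e > 0"
 obtain c where c: "inverse (2 ^ c) < e"
  using real_arch_pow_inv[OF `e > 0`, of "1 / 2"] by (auto simp: power_one_over inverse_eq_divide)
 show "\<forall>\<^sub>F S in finite_subsets_at_top A. dist (prod f S) (fps_to_fls (plim F)) < e"
  unfolding eventually_finite_subsets_at_top
 proof (intro exI conjI allI impI)
  show "finite {i : A. w i <= c}" by (rule w_fin)
  fix S assume S: "finite S & {i : A. w i <= c} <= S & S <= A"
  have "prod f S = (\<Prod>i\<in>S. fps_to_fls (F i))" by (rule prod.cong) (use S f in auto)
  also have "... = fps_to_fls (prod F S)"
  by (rule comm_monoid_mult_hom.hom_prod[symmetric]) (standard, auto simp: fls_times_fps_to_fls)
  finally have diff: "prod f S - fps_to_fls (plim F) = fps_to_fls (prod F S - plim F)"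
  by (simp add: fps_to_fls_minus)
  define h where "h = prod F S - plim F"
  have h: "fps_nth h k = 0" if "k <= c" for k
  using prod_nth_plim[OF F, of S c k] S that by (simp add: h_def)
  show "dist (prod f S) (fps_to_fls (plim F)) < e"
  proof (cases "h = 0")
  case True
  hence "prod f S = fps_to_fls (plim F)" using diff by (simp add: h_def)
  thus ?thesis using `e > 0` by simp
  next
  case False
  hence "c < subdegree h" using h by (metis nth_subdegree_nonzero not_less)
  hence "(2::real) ^ c <= 2 ^ subdegree h" by (intro power_increasing) auto
  hence "inverse (2 ^ subdegree h) <= inverse ((2::real) ^ c)" by (simp add: le_imp_inverse_le)
  moreover have "prod f S ~= fps_to_fls (plim F)"
   using False diff by (auto simp: h_def)
  hence "dist (prod f S) (fps_to_fls (plim F)) = inverse (2 ^ subdegree h)"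
   unfolding dist_fls_def diff h_def[symmetric] by (simp add: fls_subdegree_fls_to_fps)
  ultimately show ?thesis using c by linarith
  qed
 qed auto
qed

lemma uprod_plim:
 fixes F :: "'i => 'f::field fps"
 assumes F: "!!i. i : A ==> unit_mod (w i) (F i)" and f: "!!i. i : A ==> f i = fps_to_fls (F i)"
 shows "uprod_convergent f A" "uprod f A = fps_to_fls (plim F)" "unit_mod 1 (plim F)"
  "uprod f A : one_units"
proof -
 note t = plim_tendsto[of F f, OF F f]
 show "uprod_convergent f A" unfolding uprod_convergent_def using t by blast
 show u: "uprod f A = fps_to_fls (plim F)" unfolding uprod_def by (rule tendsto_Lim[OF _ t]) simp
 have "fps_nth (plim F) 0 = 1"
 proof -
  have e: "{i : A. w i <= 0} = {}" using w_pos by fastforce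
  show ?thesis unfolding plim_def fps_nth_Abs_fps e by simp
 qed
 hence "plim F = 1 + fps_X ^ 1 * fps_shift 1 (plim F)"
  by (intro fps_ext) (simp add: fps_X_power_mult_nth)
 thus um: "unit_mod 1 (plim F)" unfolding unit_mod_def by blast
 then obtain g where "plim F = 1 + fps_X * g" by (auto simp: unit_mod_def)
 hence "uprod f A = 1 + fls_X * fps_to_fls g"
  by (simp add: u fls_times_fps_to_fls)
 thus "uprod f A : one_units" unfolding one_units_def by blast
qed

text \<open>The ratio of the products is stated in cross-multiplied form, so that it can be checked
  coefficient by coefficient on finite products.\<close>

lemma plim_finite_change:
 fixes F G :: "'i => 'f::field fps"
 assumes F: "!!i. i : A ==> unit_mod (w i) (F i)" and G: "!!i. i : A ==> unit_mod (w i) (G i)"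
  and B: "finite B" "B <= A" and eq: "!!i. i : A - B ==> F i = G i"
 shows "plim F * prod G B = plim G * prod F B"
proof (rule fps_ext)
 fix c
 let ?S = "{i : A. w i <= c} \<union> B"
 have S: "finite ?S" "?S <= A" "{i : A. w i <= c} <= ?S" using w_fin B by auto
 have *: "fps_nth (plim F * H) c = fps_nth (prod F ?S * H) c"
  if "!!i. i : A ==> unit_mod (w i) (F i)" for F :: "'i => 'f fps" and H
  unfolding fps_mult_nth using prod_nth_plim[OF that S] by (intro sum.cong) auto
 have "prod F ?S = prod F (?S - B) * prod F B" for F :: "'i => 'f fps"
  using S(1) by (intro prod.subset_diff) auto
 moreover have "prod F (?S - B) = prod G (?S - B)" using eq by (intro prod.cong) auto
 ultimately have "prod F ?S * prod G B = prod G ?S * prod F B" by (simp add: mult_ac)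
 thus "fps_nth (plim F * prod G B) c = fps_nth (plim G * prod F B) c"
  using *[of F "prod G B"] *[of G "prod F B"] F G by simp
qed

end

section \<open>Rational functions\<close>

lemma at_t_hom: "comm_ring_hom (at_t :: 'f::field poly => _)"
proof -
 interpret h: comm_ring_hom "fls_const :: 'f => _" by (rule fls_const_hom)
 interpret hp: map_poly_comm_ring_hom "fls_const :: 'f => _" ..
 show ?thesis by standard (simp_all add: at_t_def hp.hom_add hp.hom_mult)
qed

lemma fps_to_fls_hom: "comm_ring_hom (fps_to_fls :: 'f::field fps => _)"
 by standard (simp_all add: fls_times_fps_to_fls)

lemma fls_X_inv_X: "fls_X_inv * (fls_X :: 'f::field fls) = 1" "fls_X * (fls_X_inv :: 'f fls) = 1"
 by (simp_all add: fls_X_inv_times_conv_shift)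

lemma at_t_pCons: "at_t (pCons a P) = fls_const a + fls_X_inv * at_t (P :: 'f::field poly)"
proof -
 have "map_poly fls_const (pCons a P) = pCons (fls_const a) (map_poly fls_const P)"
  by (rule poly_eqI) (auto simp: coeff_map_poly coeff_pCons split: nat.splits)
 thus ?thesis by (simp add: at_t_def)
qed

text \<open>Polynomials are in t and power series in 1/t: taking out the top power of t leaves the
  reversed polynomial, evaluated at 1/t.\<close>

lemma at_t_reflect:
 fixes P :: "'f::field poly"
 shows "at_t P = fls_X_inv ^ degree P * fps_to_fls (fps_of_poly (reflect_poly P))"
proof -
 interpret h: comm_ring_hom "fps_to_fls :: 'f fps => _" by (rule fps_to_fls_hom)
 have 1: "at_t P = (\<Sum>i\<le>degree P. fls_const (pcoeff P i) * fls_X_inv ^ i)"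
  unfolding at_t_def poly_altdef by (subst degree_map_poly) (simp_all add: coeff_map_poly)
 have "fps_of_poly (reflect_poly P) = (\<Sum>i\<le>degree P. fps_const (pcoeff P (degree P - i)) * fps_X ^ i)"
  
 proof (rule fps_ext)
  fix k
  have "fps_nth (\<Sum>i\<le>degree P. fps_const (pcoeff P (degree P - i)) * fps_X ^ i) k =
   (\<Sum>i\<le>degree P. if i = k then pcoeff P (degree P - k) else 0)"
  unfolding fps_sum_nth by (rule sum.cong) auto
  thus "fps_nth (fps_of_poly (reflect_poly P)) k =
   fps_nth (\<Sum>i\<le>degree P. fps_const (pcoeff P (degree P - i)) * fps_X ^ i) k"
  by (simp add: coeff_reflect_poly)
 qed
 hence "fps_to_fls (fps_of_poly (reflect_poly P)) =
  (\<Sum>i\<le>degree P. fls_const (pcoeff P (degree P - i)) * fls_X ^ i)"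
  by (simp add: h.hom_sum h.hom_mult h.hom_power)
 hence "fls_X_inv ^ degree P * fps_to_fls (fps_of_poly (reflect_poly P)) =
  (\<Sum>i\<le>degree P. fls_const (pcoeff P (degree P - i)) * (fls_X_inv ^ degree P * fls_X ^ i))"
  by (simp add: sum_distrib_left mult_ac)
 also have "... = (\<Sum>i\<le>degree P. fls_const (pcoeff P (degree P - i)) * fls_X_inv ^ (degree P - i))"
 proof (rule sum.cong)
  fix i assume "i : {..degree P}"
  hence "fls_X_inv ^ degree P = (fls_X_inv :: 'f fls) ^ (degree P - i) * fls_X_inv ^ i" by (simp flip: power_add)
  hence "fls_X_inv ^ degree P * (fls_X :: 'f fls) ^ i = fls_X_inv ^ (degree P - i) * (fls_X_inv * fls_X) ^ i"
  by (simp add: power_mult_distrib mult_ac)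
  thus "fls_const (pcoeff P (degree P - i)) * (fls_X_inv ^ degree P * fls_X ^ i) =
   fls_const (pcoeff P (degree P - i)) * fls_X_inv ^ (degree P - i)"
  by (simp add: fls_X_inv_X)
 qed simp
 also have "... = (\<Sum>i\<le>degree P. fls_const (pcoeff P i) * fls_X_inv ^ i)"
  by (rule sum.reindex_bij_witness[of _ "%i. degree P - i" "%i. degree P - i"]) auto
 finally show ?thesis using 1 by simp
qed

text \<open>From t - A = t (1 - A/t), a factor t leaves each of the n rows.\<close>

lemma at_t_char_poly:
 fixes A :: "'f::field mat"
 assumes A: "A : carrier_mat n n"
 shows "at_t (char_poly A) = fls_X_inv ^ n * fps_to_fls (mdet (1\<^sub>m n - fps_X \<cdot>\<^sub>m cmat A))"
proof -
 interpret a: comm_ring_hom "at_t :: 'f poly => _" by (rule at_t_hom)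
 interpret f: comm_ring_hom "fps_to_fls :: 'f fps => _" by (rule fps_to_fls_hom)
 have "at_t (char_poly A) = mdet (map_mat at_t (char_poly_matrix A))"
  unfolding char_poly_def by (rule a.hom_det[symmetric])
 also have "map_mat at_t (char_poly_matrix A) = fls_X_inv \<cdot>\<^sub>m map_mat fps_to_fls (1\<^sub>m n - fps_X \<cdot>\<^sub>m cmat A)"
 proof (rule eq_matI)
  fix i j assume "i < dim_row (fls_X_inv \<cdot>\<^sub>m map_mat fps_to_fls (1\<^sub>m n - fps_X \<cdot>\<^sub>m cmat A))"
  "j < dim_col (fls_X_inv \<cdot>\<^sub>m map_mat fps_to_fls (1\<^sub>m n - fps_X \<cdot>\<^sub>m cmat A))"
  hence ij: "i < n" "j < n" using A by auto
  have at1: "at_t [:- x, 1:] = fls_X_inv - fls_const x" "at_t [:- x:] = - fls_const x" for x :: 'f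
  by (simp_all add: at_t_pCons a.hom_zero)
  have X: "fls_X_inv * fps_to_fls (fps_X * fps_const x) = fls_const x" for x :: 'f
  by (simp add: f.hom_mult fls_X_inv_X flip: mult.assoc)
  show "map_mat at_t (char_poly_matrix A) $$ (i, j) =
   (fls_X_inv \<cdot>\<^sub>m map_mat fps_to_fls (1\<^sub>m n - fps_X \<cdot>\<^sub>m cmat A)) $$ (i, j)"
  using ij A X by (cases "i = j") (simp_all add: char_poly_matrix_def at1 f.hom_minus right_diff_distrib)
 qed (use A in \<open>auto simp: char_poly_matrix_def\<close>)
 also have "mdet ... = fls_X_inv ^ n * fps_to_fls (mdet (1\<^sub>m n - fps_X \<cdot>\<^sub>m cmat A))"
  using A by (simp add: f.hom_det)
 finally show ?thesis .
qed

lemma nonzero_ratfuns_1: "1 : (nonzero_ratfuns :: 'f::field fls set)"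
proof -
 interpret a: comm_ring_hom "at_t :: 'f poly => _" by (rule at_t_hom)
 show ?thesis
  unfolding nonzero_ratfuns_def by (auto intro!: exI[of _ 1])
qed

lemma nonzero_ratfuns_mult:
 "x : nonzero_ratfuns ==> y : nonzero_ratfuns ==> x * y : (nonzero_ratfuns :: 'f::field fls set)"
proof -
 interpret a: comm_ring_hom "at_t :: 'f poly => _" by (rule at_t_hom)
 assume "x : nonzero_ratfuns" "y : nonzero_ratfuns"
 then obtain P Q P' Q' where "x = at_t P / at_t Q" "y = at_t P' / at_t Q'" "P ~= 0" "Q ~= 0" "P' ~= 0" "Q' ~= 0"
  by (auto simp: nonzero_ratfuns_def)
 hence "x * y = at_t (P * P') / at_t (Q * Q')" "P * P' ~= 0" "Q * Q' ~= 0" by (simp_all add: a.hom_mult)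
 thus ?thesis unfolding nonzero_ratfuns_def by blast
qed

lemma nonzero_ratfuns_inverse: "x : nonzero_ratfuns ==> inverse x : nonzero_ratfuns"
 unfolding nonzero_ratfuns_def by (auto, metis inverse_divide)

lemma nonzero_ratfuns_prod:
 "(!!i. i : S ==> x i : nonzero_ratfuns) ==> prod x S : (nonzero_ratfuns :: 'f::field fls set)"
 by (induction S rule: infinite_finite_induct) (auto intro: nonzero_ratfuns_mult nonzero_ratfuns_1)

text \<open>The matrix P - A has polynomial entries, and its determinant is P^m times the
  determinant in question.\<close>

lemma det_ratfun:
 fixes A :: "'f::field mat"
 assumes A: "A : carrier_mat m m" and P: "at_t P ~= 0"
  and nz: "mdet (1\<^sub>m m - inverse (at_t P) \<cdot>\<^sub>m map_mat fls_const A) ~= 0"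
 shows "mdet (1\<^sub>m m - inverse (at_t P) \<cdot>\<^sub>m map_mat fls_const A) : nonzero_ratfuns"
proof -
 interpret a: comm_ring_hom "at_t :: 'f poly => _" by (rule at_t_hom)
 let ?D = "1\<^sub>m m - inverse (at_t P) \<cdot>\<^sub>m map_mat fls_const A"
 define B where "B = P \<cdot>\<^sub>m 1\<^sub>m m - map_mat (%x. [:x:]) A"
 have "at_t (mdet B) = mdet (map_mat at_t B)" by (rule a.hom_det[symmetric])
 also have "map_mat at_t B = at_t P \<cdot>\<^sub>m ?D"
  using A P by (auto intro!: eq_matI simp: B_def a.hom_minus at_t_pCons a.hom_zero right_diff_distrib mult.assoc[symmetric])
 also have "mdet ... = at_t P ^ m * mdet ?D" using A by simp
 finally have e: "at_t (mdet B) = at_t (P ^ m) * mdet ?D" by (simp add: a.hom_power)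
 have nP: "at_t (P ^ m) ~= 0" using P by (simp add: a.hom_power)
 hence "mdet ?D = at_t (mdet B) / at_t (P ^ m)" using e by (simp add: field_simps)
 moreover have "mdet B ~= 0" using e nz nP by auto
 moreover have "P ^ m ~= 0" using nP by (metis a.hom_zero)
 ultimately show ?thesis unfolding nonzero_ratfuns_def by blast
qed

section \<open>Integral elements\<close>

lemma sum_div_mod:
 fixes F :: "nat => nat => 'a::comm_monoid_add"
 shows "(\<Sum>p<a * b. F (p div b) (p mod b)) = (\<Sum>i<a. \<Sum>j<b. F i j)"
proof -
 have "(\<Sum>p<a * b. F (p div b) (p mod b)) = (\<Sum>i<a. \<Sum>p\<in>{i * b..<i * b + b}. F (p div b) (p mod b))"
  by (rule sum.nat_group[symmetric])
 also have "... = (\<Sum>i<a. \<Sum>j<b. F i j)"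
 proof (rule sum.cong)
  fix i
  have "(\<Sum>p\<in>{i * b..<i * b + b}. F (p div b) (p mod b)) = (\<Sum>j\<in>{0..<b}. F ((j + i * b) div b) ((j + i * b) mod b))"
  using sum.shift_bounds_nat_ivl[of "%p. F (p div b) (p mod b)" 0 "i * b" b] by (simp add: add.commute)
  also have "... = (\<Sum>j<b. F i j)" by (rule sum.cong) auto
  finally show "(\<Sum>p\<in>{i * b..<i * b + b}. F (p div b) (p mod b)) = (\<Sum>j<b. F i j)" .
 qed simp
 finally show ?thesis .
qed

text \<open>\<open>combine\<close> stops at the end of the shorter list, hence the minimum.\<close>

lemma combine_eq_sum:
 "ring.combine (class_ring :: 'a::field ring) Ks Us = (\<Sum>i<min (length Ks) (length Us). Ks ! i * Us ! i)"
proof -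
 note rr = class_ring.ring_axioms[where ?'a = 'a]
 show ?thesis
 proof (induction Ks arbitrary: Us)
  case Nil
  show ?case by (simp add: ring.combine.simps[OF rr])
 next
  case (Cons x Ks)
  thus ?case
  by (cases Us) (simp_all add: ring.combine.simps[OF rr] sum.lessThan_Suc_shift del: sum.lessThan_Suc)
 qed
qed

lemma map_poly_pCons_hom0: "h 0 = 0 ==> map_poly h (pCons a p) = pCons (h a) (map_poly h p)"
 by (rule poly_eqI) (auto simp: coeff_map_poly coeff_pCons split: nat.splits)

section \<open>Integral elements over k[z]\<close>

locale function_field =
 fixes iL :: "'k::{field,finite} => 'l::field" and z :: 'l and K :: "'l set"
 assumes iL: "field_hom iL" and trans: "!!a. eval_at iL z a = 0 ==> a = 0"
  and KL: "finite_extension (ratfun_image iL z) K" and gal: "finite_galois K"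
begin

sublocale iL: field_hom iL by (rule iL)

abbreviation ev :: "'k poly => 'l" where "ev \<equiv> eval_at iL z"

lemma ev_hom: "comm_ring_hom ev"
proof -
 interpret p: map_poly_comm_ring_hom iL ..
 show ?thesis by standard (simp_all add: eval_at_def p.hom_add p.hom_mult)
qed

sublocale ev: comm_ring_hom ev by (rule ev_hom)

lemma ev_0_iff [simp]: "ev a = 0 \<longleftrightarrow> a = 0" using trans by auto

lemma ev_eq_iff [simp]: "ev a = ev b \<longleftrightarrow> a = b"
 using ev_0_iff[of "a - b"] by (simp add: ev.hom_minus)

lemma ev_const: "ev [:c:] = iL c"
 by (simp add: eval_at_def map_poly_pCons_hom0)

lemma ev_X: "ev [:0, 1:] = z"
 by (simp add: eval_at_def map_poly_pCons_hom0)

lemma map_ev_inj: "map_poly ev a = map_poly ev b ==> a = b"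
 by (metis (no_types, lifting) coeff_map_poly ev.hom_zero ev_eq_iff poly_eqI)

text \<open>The coefficients are taken in k[X] itself and not in its image in L, so that
  characteristic polynomials of matrices over k[X] are integral equations at once;
  \<open>integral_alt\<close> gives the form with coefficients in the image.\<close>

definition integral :: "'l => bool" where
 "integral x \<longleftrightarrow> (EX a :: 'k poly poly. lead_coeff a = 1 & poly (map_poly ev a) x = 0)"

lemma degree_map_ev [simp]: "degree (map_poly ev a) = degree a"
 by (rule degree_map_poly) simp

lemma integral_alt: "integral x \<longleftrightarrow>
  (EX a. lead_coeff a = 1 & (ALL i. pcoeff a i : poly_image iL z) & poly a x = 0)"
proof
 assume "integral x"
 then obtain a :: "'k poly poly" where a: "lead_coeff a = 1" "poly (map_poly ev a) x = 0" by (auto simp: integral_def)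
 thus "EX a. lead_coeff a = 1 & (ALL i. pcoeff a i : poly_image iL z) & poly a x = 0"
  by (intro exI[of _ "map_poly ev a"]) (auto simp: coeff_map_poly poly_image_def)
next
 assume "EX a. lead_coeff a = 1 & (ALL i. pcoeff a i : poly_image iL z) & poly a x = 0"
 then obtain a where a: "lead_coeff a = 1" "!!i. pcoeff a i : range ev" "poly a x = 0"
  by (auto simp: poly_image_def)
 hence "ALL i. EX g. pcoeff a i = ev g" by blast
 then obtain g where g: "!!i. pcoeff a i = ev (g i)" by metis
 define b where "b = (\<Sum>i\<le>degree a. Polynomial.monom (g i) i)"
 have cb: "pcoeff b i = (if i <= degree a then g i else 0)" for i
  unfolding b_def coeff_sum coeff_monom by simp
 have "map_poly ev b = a"
  by (rule poly_eqI) (simp add: coeff_map_poly cb g[symmetric] coeff_eq_0)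
 moreover from this have "degree b = degree a" by (metis degree_map_ev)
 hence "ev (lead_coeff b) = 1" using a(1) g[of "degree a"] by (simp add: cb)
 hence "ev (lead_coeff b) = ev 1" by simp
 hence "lead_coeff b = 1" by (simp only: ev_eq_iff)
 ultimately show "integral x" using a(3) unfolding integral_def by blast
qed

text \<open>The vector of the \<open>w p\<close> is a nonzero eigenvector, with eigenvalue x, of a
  matrix over k[X], whose characteristic polynomial is monic.\<close>

lemma integral_by_matrix:
 fixes w :: "nat => 'l" and N :: nat
 assumes w0: "w p0 ~= 0" "p0 < N"
  and c: "!!p. p < N ==> EX c. x * w p = (\<Sum>p'<N. ev (c p') * w p')"
 shows "integral x"
proof -
 obtain C where C: "!!p. p < N ==> x * w p = (\<Sum>p'<N. ev (C p p') * w p')" using c by metis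
 define M where "M = mat N N (%(p, p'). C p p')"
 have Mc: "M : carrier_mat N N" by (simp add: M_def)
 have "eigenvector (map_mat ev M) (vec N w) x"
  unfolding eigenvector_def
 proof (intro conjI)
  show "vec N w ~= 0\<^sub>v (dim_row (map_mat ev M))"
  proof
  assume "vec N w = 0\<^sub>v (dim_row (map_mat ev M))"
  hence "vec N w $ p0 = 0" using w0(2) Mc by simp
  thus False using w0 by simp
  qed
  show "map_mat ev M *\<^sub>v vec N w = x \<cdot>\<^sub>v vec N w"
  by (rule eq_vecI) (auto simp: M_def scalar_prod_def C atLeast0LessThan)
 qed (simp add: M_def)
 hence "eigenvalue (map_mat ev M) x" unfolding eigenvalue_def by blast
 hence "poly (char_poly (map_mat ev M)) x = 0"
  using eigenvalue_root_char_poly[of "map_mat ev M" N x] Mc by simp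
 hence "poly (map_poly ev (char_poly M)) x = 0" by (simp add: ev.char_poly_hom[OF Mc])
 moreover have "lead_coeff (char_poly M) = 1" using degree_monic_char_poly[OF Mc] by simp
 ultimately show ?thesis unfolding integral_def by blast
qed

lemma integral_powers:
 assumes "integral x"
 obtains a where "a >= 1" "!!k. EX c. x ^ k = (\<Sum>i<a. ev (c i) * x ^ i)"
proof -
 obtain f :: "'k poly poly" where f: "lead_coeff f = 1" "poly (map_poly ev f) x = 0" using assms by (auto simp: integral_def)
 define a where "a = degree f"
 have a0: "a ~= 0"
 proof
  assume "a = 0"
  then obtain g where "f = [:g:]" unfolding a_def by (rule degree_eq_zeroE)
  hence "f = 1" using f(1) by (simp add: one_pCons)
  thus False using f(2) by simp
 qed
 have "poly (map_poly ev f) x = (\<Sum>i\<le>a. ev (pcoeff f i) * x ^ i)"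
  by (simp add: poly_altdef a_def coeff_map_poly)
 also have "... = (\<Sum>i<a. ev (pcoeff f i) * x ^ i) + x ^ a"
  using f(1) by (simp add: a_def lessThan_Suc_atMost[symmetric])
 finally have xa: "x ^ a = (\<Sum>i<a. ev (- pcoeff f i) * x ^ i)"
  using f(2) by (simp add: ev.hom_uminus sum_negf eq_neg_iff_add_eq_0 add.commute)
 have "EX c. x ^ k = (\<Sum>i<a. ev (c i) * x ^ i)" for k
 proof (induction k)
  case 0
  have "(\<Sum>i<a. ev (if i = 0 then 1 else 0) * x ^ i) = (\<Sum>i<a. if i = 0 then 1 else 0)"
  by (rule sum.cong) auto
  also have "... = 1" using a0 by simp
  finally show ?case by (intro exI[of _ "%i. if i = 0 then 1 else 0"]) simp
 next
  case (Suc k)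
  then obtain c where c: "x ^ k = (\<Sum>i<a. ev (c i) * x ^ i)" by auto
  obtain a' where a': "a = Suc a'" using a0 by (cases a) auto
  have "x ^ Suc k = (\<Sum>i<Suc a'. ev (c i) * x ^ Suc i)"
  by (simp add: c a' sum_distrib_left mult_ac del: sum.lessThan_Suc)
  also have "... = (\<Sum>i<a'. ev (c i) * x ^ Suc i) + ev (c a') * x ^ a" by (simp add: a')
  also have "(\<Sum>i<a'. ev (c i) * x ^ Suc i) = (\<Sum>i<a. ev (if i = 0 then 0 else c (i - 1)) * x ^ i)"
  unfolding a' by (subst sum.lessThan_Suc_shift) simp
  also have "(\<Sum>i<a. ev (if i = 0 then 0 else c (i - 1)) * x ^ i) + ev (c a') * x ^ a =
   (\<Sum>i<a. ev ((if i = 0 then 0 else c (i - 1)) + c a' * (- pcoeff f i)) * x ^ i)"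
  unfolding xa by (simp only: ev.hom_add ev.hom_mult distrib_right sum.distrib sum_distrib_left mult.assoc)
  finally show ?case by (rule exI[of _ "%i. (if i = 0 then 0 else c (i - 1)) + c a' * (- pcoeff f i)"])
 qed
 thus ?thesis using that[of a] a0 by simp
qed

text \<open>The products x^i y^j with bounded exponents span a module over k[z] that is stable under
  x and y, hence under x + y and x y. The pair (i, j) is encoded as p = i b + j, and the product for
  p = 0 is 1.\<close>

lemma integral_closed:
 assumes x: "integral x" and y: "integral y"
 shows "integral (x + y)" "integral (x * y)"
proof -
 obtain a where a: "a >= 1" "!!k. EX c. x ^ k = (\<Sum>i<a. ev (c i) * x ^ i)" using integral_powers[OF x] by metis
 obtain b where b: "b >= 1" "!!k. EX c. y ^ k = (\<Sum>i<b. ev (c i) * y ^ i)" using integral_powers[OF y] by metis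
 define w where "w p = x ^ (p div b) * y ^ (p mod b)" for p
 have N: "0 < a * b" using a b by simp
 have w0: "w 0 ~= 0" by (simp add: w_def)
 have mono: "EX c. x ^ k * y ^ l = (\<Sum>p<a * b. ev (c p) * w p)" for k l
 proof -
  obtain c where c: "x ^ k = (\<Sum>i<a. ev (c i) * x ^ i)" using a by blast
  obtain e where e: "y ^ l = (\<Sum>i<b. ev (e i) * y ^ i)" using b by blast
  have "x ^ k * y ^ l = (\<Sum>i<a. \<Sum>j<b. ev (c i * e j) * (x ^ i * y ^ j))"
  by (simp add: c e sum_product ev.hom_mult mult_ac)
  also have "... = (\<Sum>p<a * b. ev (c (p div b) * e (p mod b)) * w p)"
  unfolding w_def by (rule sum_div_mod[symmetric])
  finally show ?thesis by (rule exI[of _ "%p. c (p div b) * e (p mod b)"])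
 qed
 show "integral (x + y)"
 proof (rule integral_by_matrix[of w 0 "a * b"])
  fix p
  have "(x + y) * w p = x ^ Suc (p div b) * y ^ (p mod b) + x ^ (p div b) * y ^ Suc (p mod b)"
  by (simp add: w_def algebra_simps)
  moreover obtain c where "x ^ Suc (p div b) * y ^ (p mod b) = (\<Sum>p<a * b. ev (c p) * w p)" using mono by blast
  moreover obtain e where "x ^ (p div b) * y ^ Suc (p mod b) = (\<Sum>p<a * b. ev (e p) * w p)" using mono by blast
  ultimately have "(x + y) * w p = (\<Sum>p<a * b. ev (c p + e p) * w p)"
  by (simp add: ev.hom_add distrib_right sum.distrib)
  thus "EX c. (x + y) * w p = (\<Sum>p'<a * b. ev (c p') * w p')" by (rule exI[of _ "%p. c p + e p"])
 qed (use w0 N in auto)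
 show "integral (x * y)"
 proof (rule integral_by_matrix[of w 0 "a * b"])
  fix p
  have "(x * y) * w p = x ^ Suc (p div b) * y ^ Suc (p mod b)"
  by (simp add: w_def algebra_simps)
  thus "EX c. (x * y) * w p = (\<Sum>p'<a * b. ev (c p') * w p')" using mono by presburger
 qed (use w0 N in auto)
qed

lemma integral_ev: "integral (ev g)"
 unfolding integral_def
 by (rule exI[of _ "[:- g, 1:]"]) (simp add: map_poly_pCons_hom0 ev.hom_uminus)

lemma integral_diff: "integral x ==> integral y ==> integral (x - y)"
 using integral_closed(1)[of x "ev (-1) * y"] integral_closed(2)[of "ev (-1)" y] integral_ev[of "-1"]
 by (simp add: ev.hom_uminus)

lemma integral_misc: "integral 0" "integral 1" "integral z" "integral (iL c)"
 using integral_ev[of 0] integral_ev[of 1] integral_ev[of "[:0, 1:]"] integral_ev[of "[:c:]"]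
 by (simp_all add: ev_X ev_const)

lemma integral_sum: "(!!i. i : X ==> integral (f i)) ==> integral (sum f X)"
 by (induction X rule: infinite_finite_induct) (auto intro: integral_misc integral_closed)

lemma subfields: "subfield K (class_ring :: 'l ring)" "ratfun_image iL z <= K"
  "subfield (ratfun_image iL z) (class_ring :: 'l ring)"
 using KL by (auto simp: finite_extension_def)

lemma K_closed: "x : K ==> y : K ==> x + y : K" "x : K ==> y : K ==> x * y : K" "x : K ==> y : K ==> x - y : K"
 "0 : K" "1 : K" "x : K ==> x ~= 0 ==> inverse x : K"
proof -
 note rr = class_ring.ring_axioms[where ?'a = 'l]
 note sr = subfieldE(1)[OF subfields(1)]
 note cl = subringE[OF sr]
 show "x : K ==> y : K ==> x + y : K" "x : K ==> y : K ==> x * y : K" "0 : K" "1 : K"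
  using cl(6,7)[of x y] cl(2,3) by simp_all
 have "- y : K" if "y : K" using cl(5)[OF that] by (simp add: class_ring_simps)
 thus "x : K ==> y : K ==> x - y : K" using cl(7)[of x "- y"] by simp
 assume x: "x : K" "x ~= 0"
 hence "x : Units (class_ring\<lparr>carrier := K\<rparr>)" using subfield.subfield_Units[OF subfields(1)] by auto
 then obtain y where "y : K" "x * y = 1" by (auto simp: Units_def)
 thus "inverse x : K" using inverse_unique by blast
qed

lemma ev_K: "ev g : K"
proof -
 have "ev g : ratfun_image iL z" unfolding ratfun_image_def
  by (intro CollectI exI[of _ g] exI[of _ 1]) simp
 thus ?thesis using subfields by blast
qed

text \<open>The degree of \<open>L\<close> over \<open>k(z)\<close>, with a generating list.\<close>

lemma finite_degree:
 obtains n us where "!!f :: nat => 'l. EX c. (EX i<=n. c i ~= 0) & (\<Sum>i\<le>n. ev (c i) * f i) = 0"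
  "!!x. EX r. (ALL i. r i : ratfun_image iL z) & x = (\<Sum>i<length us. r i * us ! i)"
proof -
 note rr = class_ring.ring_axioms[where ?'a = 'l]
 let ?R = "class_ring :: 'l ring"
 let ?k = "ratfun_image iL z"
 have "ring.finite_dimension ?R ?k K" "ring.finite_dimension ?R K UNIV"
  using KL gal by (auto simp: finite_extension_def finite_galois_def)
 then obtain n1 n2 where "ring.dimension ?R n1 ?k K" "ring.dimension ?R n2 K UNIV" by (auto simp: ring.finite_dimension_def[OF rr])
 hence dim: "ring.dimension ?R (n1 * n2) ?k UNIV" by (rule ring.telescopic_base[OF rr subfields(3) subfields(1)])
 define n where "n = n1 * n2"
 obtain us where us: "length us = n" "ring.Span ?R ?k us = UNIV"
  using ring.exists_base[OF rr subfields(3) dim] unfolding n_def by blast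
 have k0: "0 : ?k" unfolding ratfun_image_def by (intro CollectI exI[of _ 0] exI[of _ 1]) simp
 have sp: "EX r. (ALL i. r i : ?k) & x = (\<Sum>i<length us. r i * us ! i)" for x
 proof -
  have "x : ring.Span ?R ?k us" using us by simp
  moreover have "(x : ring.Span ?R ?k us) =
   (EX Ks. set Ks <= ?k & length Ks = length us & x = ring.combine ?R Ks us)"
  by (rule ring.Span_mem_iff_length_version[OF rr subfields(3)]) simp
  ultimately obtain Ks where Ks: "set Ks <= ?k" "length Ks = length us" "x = ring.combine ?R Ks us"
  by blast
  hence "x = (\<Sum>i<length us. (if i < length us then Ks ! i else 0) * us ! i)"
  by (simp add: combine_eq_sum)
  moreover have "ALL i. (if i < length us then Ks ! i else 0) : ?k" using Ks k0 by (auto simp: subset_iff)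
  ultimately show ?thesis by (intro exI[of _ "%i. if i < length us then Ks ! i else 0"]) simp
 qed
 have rel: "EX c. (EX i<=n. c i ~= 0) & (\<Sum>i\<le>n. ev (c i) * f i) = 0" for f :: "nat => 'l"
 proof -
  let ?Us = "map f [0..<Suc n]"
  have "\<not> ring.independent ?R ?k ?Us"
  proof
  assume ind: "ring.independent ?R ?k ?Us"
  have "length ?Us <= n1 * n2"
   by (rule ring.independent_length_le_dimension[OF rr subfields(3) dim ind]) simp
  thus False by (simp add: n_def)
  qed
  hence "EX Ks. set Ks <= ?k & ring.combine ?R Ks ?Us = \<zero>\<^bsub>class_ring\<^esub> \<and>
   \<not> set (take (length ?Us) Ks) <= {\<zero>\<^bsub>class_ring\<^esub>}"
  using ring.trivial_combine_imp_independent[OF rr subfields(3), of ?Us] by (metis subset_UNIV partial_object.select_convs(1))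
  then obtain Ks where Ks: "set Ks <= ?k" "ring.combine ?R Ks ?Us = 0" "\<not> set (take (Suc n) Ks) <= {0}"
  by (auto simp del: upt_Suc)
  define r where "r i = (if i < length Ks then Ks ! i else 0)" for i
  have rk: "r i : ?k" for i using Ks(1) k0 by (auto simp: r_def subset_iff)
  have r0: "EX i<=n. r i ~= 0"
  proof -
  obtain x where "x : set (take (Suc n) Ks)" "x ~= 0" using Ks(3) by auto
  then obtain i where "i < length (take (Suc n) Ks)" "x = take (Suc n) Ks ! i" by (metis in_set_conv_nth)
  thus ?thesis using `x ~= 0` by (intro exI[of _ i]) (auto simp: r_def)
  qed
  have rf: "(\<Sum>i\<le>n. r i * f i) = 0"
  proof -
  have "(\<Sum>i\<le>n. r i * f i) = (\<Sum>i<min (length Ks) (Suc n). Ks ! i * f i)"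
   by (rule sum.mono_neutral_cong_right) (auto simp: r_def)
  also have "... = (\<Sum>i<min (length Ks) (length ?Us). Ks ! i * ?Us ! i)"
   by (rule sum.cong) (simp_all add: nth_append del: upt_Suc)
  finally show ?thesis using Ks(2) by (simp only: combine_eq_sum)
  qed
  have "ALL i. EX a b. b ~= 0 & r i = ev a / ev b" using rk unfolding ratfun_image_def by blast
  then obtain a b where ab: "!!i. b i ~= 0" "!!i. r i = ev (a i) / ev (b i)" by metis
  \<comment> \<open>A common denominator of the relation, which turns its coefficients into
    polynomials.\<close>
  define B where "B = (\<Prod>i\<le>n. b i)"
  have B0: "B ~= 0" using ab by (simp add: B_def)
  define c where "c i = a i * (\<Prod>j\<in>{..n} - {i}. b j)" for i
  have e: "ev (c i) = ev B * r i" if "i <= n" for i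
  proof -
  have "B = b i * (\<Prod>j\<in>{..n} - {i}. b j)" unfolding B_def using that by (intro prod.remove) auto
  thus ?thesis using ab(1)[of i] by (simp add: c_def ab(2) ev.hom_mult)
  qed
  have "(\<Sum>i\<le>n. ev (c i) * f i) = ev B * (\<Sum>i\<le>n. r i * f i)"
  unfolding sum_distrib_left by (rule sum.cong) (auto simp: e)
  moreover obtain i where "i <= n" "r i ~= 0" using r0 by blast
  hence "EX i<=n. c i ~= 0" using e[of i] B0 by (intro exI[of _ i]) auto
  ultimately show ?thesis using rf by (intro exI[of _ c]) auto
 qed
 show ?thesis using that[OF rel sp] .
qed

lemma algebraic:
 obtains c :: "'k poly poly" where "c ~= 0" "poly (map_poly ev c) x = 0"
proof -
 obtain n us where rel: "!!f :: nat => 'l. EX c. (EX i<=n. c i ~= 0) & (\<Sum>i\<le>n. ev (c i) * f i) = 0"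
  using finite_degree by metis
 obtain c where c: "EX i<=n. c i ~= 0" "(\<Sum>i\<le>n. ev (c i) * x ^ i) = 0" using rel[of "%i. x ^ i"] by auto
 define p where "p = (\<Sum>i\<le>n. Polynomial.monom (c i) i)"
 have co: "pcoeff p i = (if i <= n then c i else 0)" for i unfolding p_def coeff_sum coeff_monom by simp
 have "p ~= 0" using c(1) co by (metis coeff_0)
 moreover have "poly (map_poly ev p) x = (\<Sum>i\<le>n. ev (c i) * x ^ i)"
 proof -
  have "degree p <= n" by (rule degree_le) (simp add: co)
  hence "poly (map_poly ev p) x = (\<Sum>i\<le>n. pcoeff (map_poly ev p) i * x ^ i)"
  unfolding poly_altdef by (intro sum.mono_neutral_left) (auto simp: coeff_eq_0)
  thus ?thesis by (simp add: coeff_map_poly co)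
 qed
 ultimately show ?thesis using that c(2) by simp
qed

lemma integral_multiple:
 obtains w where "w ~= 0" "integral (ev w * x)"
proof -
 obtain c :: "'k poly poly" where c: "c ~= 0" "poly (map_poly ev c) x = 0" using algebraic by metis
 define m where "m = degree c"
 define w where "w = lead_coeff c"
 have w0: "w ~= 0" using c by (simp add: w_def)
 show ?thesis
 proof (cases m)
  case 0
  then obtain g where g: "c = [:g:]" unfolding m_def by (rule degree_eq_zeroE)
  hence "g = 0" using c(2) by (simp add: map_poly_pCons_hom0)
  thus ?thesis using c(1) g by simp
 next
  case (Suc m')
  \<comment> \<open>With w the leading coefficient of c, the expression w^(m - 1) c(x) is a monic
    polynomial in w x; this is that polynomial.\<close>
  define p where "p = Polynomial.monom 1 m + (\<Sum>i<m. Polynomial.monom (pcoeff c i * w ^ (m - 1 - i)) i)"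
  have co: "pcoeff p i = (if i = m then 1 else if i < m then pcoeff c i * w ^ (m - 1 - i) else 0)" for i
  unfolding p_def coeff_add coeff_sum coeff_monom by auto
  have deg: "degree p = m"
  by (rule order_antisym) (auto intro!: degree_le le_degree simp: co)
  have "poly (map_poly ev p) (ev w * x) = (\<Sum>i\<le>m. ev (pcoeff p i) * (ev w * x) ^ i)"
  by (simp add: poly_altdef deg coeff_map_poly)
  also have "... = (\<Sum>i\<le>m. ev w ^ (m - 1) * (ev (pcoeff c i) * x ^ i))"
  proof (rule sum.cong)
  fix i assume i: "i : {..m}"
  show "ev (pcoeff p i) * (ev w * x) ^ i = ev w ^ (m - 1) * (ev (pcoeff c i) * x ^ i)"
  proof (cases "i = m")
   case True
   thus ?thesis by (simp add: co Suc power_mult_distrib m_def[symmetric] w_def)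
  next
   case False
   hence "i <= m - 1" using i by simp
   hence "m - 1 = (m - 1 - i) + i" by simp
   hence "ev w ^ (m - 1) = ev w ^ (m - 1 - i) * ev w ^ i" by (metis power_add)
   thus ?thesis using i False by (simp add: co ev.hom_mult ev.hom_power power_mult_distrib)
  qed
  qed simp
  also have "... = ev w ^ (m - 1) * poly (map_poly ev c) x"
  by (simp add: poly_altdef m_def coeff_map_poly sum_distrib_left)
  finally have "poly (map_poly ev p) (ev w * x) = 0" using c by simp
  moreover have "lead_coeff p = 1" by (simp add: deg co)
  ultimately have "integral (ev w * x)" unfolding integral_def by blast
  thus ?thesis using w0 that by blast
 qed
qed

section \<open>The rings of integers and their reduction modulo an irreducible polynomial\<close>

definition A :: "'l set" where "A = {x : K. integral x}"
definition B :: "'l set" where "B = {x. integral x}"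

abbreviation A_ring :: "'l ring" where "A_ring \<equiv> ints iL z K"
abbreviation B_ring :: "'l ring" where "B_ring \<equiv> ints iL z UNIV"

lemma ring_simps [simp]:
 "carrier A_ring = A" "x \<otimes>\<^bsub>A_ring\<^esub> y = x * y" "x \<oplus>\<^bsub>A_ring\<^esub> y = x + y" "\<one>\<^bsub>A_ring\<^esub> = 1" "\<zero>\<^bsub>A_ring\<^esub> = 0"
 "carrier B_ring = B" "x \<otimes>\<^bsub>B_ring\<^esub> y = x * y" "x \<oplus>\<^bsub>B_ring\<^esub> y = x + y" "\<one>\<^bsub>B_ring\<^esub> = 1" "\<zero>\<^bsub>B_ring\<^esub> = 0"
 unfolding ints_def A_def B_def integral_closure_in_def integral_alt by auto

text \<open>Common frame for the rings of integers of K and of L; containing k[z], such a set is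
  also a k-algebra.\<close>

definition subring_of :: "'l set => bool" where
 "subring_of C \<longleftrightarrow> (ALL x:C. ALL y:C. x + y : C & x - y : C & x * y : C) & range ev <= C"

lemma subring_A: "subring_of A" and subring_B: "subring_of B"
 unfolding subring_of_def A_def B_def by (auto intro: integral_closed integral_diff integral_ev K_closed ev_K)

lemma subring_ofD:
 assumes "subring_of C"
 shows "x : C ==> y : C ==> x + y : C" "x : C ==> y : C ==> x - y : C"
  "x : C ==> y : C ==> x * y : C" "ev g : C" "0 : C" "1 : C" "z : C" "iL c : C" "x : C ==> - x : C"
  "x : C ==> x ^ k : C" "(!!i. i : X ==> f i : C) ==> sum f X : C"
proof -
 have ev: "ev g : C" for g using assms by (auto simp: subring_of_def)
 have add: "x + y : C" if "x : C" "y : C" for x y using assms that by (auto simp: subring_of_def)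
 have mult: "x * y : C" if "x : C" "y : C" for x y using assms that by (auto simp: subring_of_def)
 show "x : C ==> y : C ==> x + y : C" "x : C ==> y : C ==> x - y : C"
  "x : C ==> y : C ==> x * y : C" "ev g : C" using assms by (auto simp: subring_of_def)
 show 0: "0 : C" and 1: "1 : C" using ev[of 0] ev[of 1] by simp_all
 show "z : C" "iL c : C" using ev[of "[:0, 1:]"] ev[of "[:c:]"] by (simp_all add: ev_X ev_const)
 have "- x : C" if "x : C" for x using mult[OF ev[of "-1"] that] by (simp add: ev.hom_uminus)
 thus "x : C ==> - x : C" .
 show "x : C ==> x ^ k : C" using 1 mult by (induction k) auto
 show "(!!i. i : X ==> f i : C) ==> sum f X : C"
  using 0 add by (induction X rule: infinite_finite_induct) auto
qed

lemmas A_closed = subring_ofD[OF subring_A]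
lemmas B_closed = subring_ofD[OF subring_B]

lemma A_subset_B: "A <= B" by (auto simp: A_def B_def)

text \<open>Reduction modulo a prime \<open>\<pi>\<close> of \<open>k[z]\<close>; the rank of the ring bounds the size of the quotient.\<close>

definition irr :: "'k poly => bool" where
 "irr \<pi> \<longleftrightarrow> \<pi> ~= 0 & degree \<pi> >= 1 & (ALL g. \<not> \<pi> dvd g --> (EX h. \<pi> dvd g * h - 1))"

lemma finite_reps:
 assumes C: "subring_of C" and irr: "irr \<pi>"
 obtains X where "finite X" "X <= C" "!!x. x : C ==> EX y:X. EX c:C. x - y = ev \<pi> * c"
proof -
 note Cc = subring_ofD[OF C]
 obtain n us where rel: "!!f :: nat => 'l. EX c. (EX i<=n. c i ~= 0) & (\<Sum>i\<le>n. ev (c i) * f i) = 0"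
  using finite_degree by metis
 have \<pi>: "\<pi> ~= 0" "degree \<pi> >= 1" using irr by (auto simp: irr_def)
 \<comment> \<open>Independence of the residues of the \<open>f i\<close> in C/\<pi>C over the field
   k[X]/\<pi>.\<close>
 define indep where "indep r f \<longleftrightarrow> (ALL i<r. f i : C) \<and>
  (ALL c. (EX y:C. (\<Sum>i<r. ev (c i) * f i) = ev \<pi> * y) --> (ALL i<r. \<pi> dvd c i))" for r :: nat and f
 have bound: "r <= n" if ind: "indep r f" for r f
 proof (rule ccontr)
  assume "\<not> r <= n"
  hence r: "n < r" by simp
  obtain c0 where c00: "(EX i<=n. c0 i ~= 0) & (\<Sum>i\<le>n. ev (c0 i) * f i) = 0"
  using rel[of f] by (rule exE)
  note c0 = conjunct1[OF c00] conjunct2[OF c00]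
  \<comment> \<open>Infinite descent: in a vanishing relation every coefficient is divisible by
    \<pi>, and dividing by \<pi> gives a vanishing relation of smaller degree.\<close>
  have desc: "c i0 = 0" if "(\<Sum>i<r. ev (c i) * f i) = 0" "i0 < r" for c i0
  using that(1)
  proof (induction "degree (c i0)" arbitrary: c rule: less_induct)
  case less
  show ?case
  proof (rule ccontr)
   assume nz: "c i0 ~= 0"
   have "ALL i<r. \<pi> dvd c i" using ind less.prems Cc(5) unfolding indep_def by (metis mult_zero_right)
   hence "ALL i. EX e. i < r --> c i = \<pi> * e" by (auto elim!: dvdE)
   then obtain e where e: "!!i. i < r ==> c i = \<pi> * e i" by metis
   have "ev \<pi> * (\<Sum>i<r. ev (e i) * f i) = (\<Sum>i<r. ev (c i) * f i)"
    by (simp add: e ev.hom_mult sum_distrib_left mult.assoc)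
   hence "(\<Sum>i<r. ev (e i) * f i) = 0" using less.prems \<pi> by simp
   moreover have "e i0 ~= 0" using nz e[OF that(2)] by auto
   moreover have "degree (e i0) < degree (c i0)"
    using e[OF that(2)] nz \<pi> calculation(2) by (simp add: degree_mult_eq)
   ultimately show False using less.hyps by blast
  qed
  qed
  have "(\<Sum>i<r. ev (if i <= n then c0 i else 0) * f i) = (\<Sum>i\<le>n. ev (c0 i) * f i)"
  by (rule sum.mono_neutral_cong_right) (use r in auto)
  hence "(if i <= n then c0 i else 0) = 0" if "i < r" for i
  using desc[of "%i. if i <= n then c0 i else 0" i] c0 that by simp
  thus False using c0(1) r by (metis le_less_trans)
 qed
 have "indep 0 (%_. 0)" by (simp add: indep_def)
 hence ind0: "EX f. indep 0 f" by blast
 have "EX r. (EX f. indep r f) & (ALL y. (EX f. indep y f) --> id y <= id r)"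
  by (rule ex_has_greatest_nat[where P = "%r. EX f. indep r f" and b = "Suc n", OF ind0]) (auto simp: less_Suc_eq_le dest: bound)
 then obtain r where r: "EX f. indep r f" "!!y. EX f. indep y f ==> y <= r" unfolding id_apply by auto
 from r(1) obtain f where ind: "indep r f" by (rule exE)
 have max: "r' <= r" if "indep r' f'" for r' f' by (rule r(2)) (rule exI, rule that)
 have fC: "f i : C" if "i < r" for i using ind that by (auto simp: indep_def)
 define P where "P = {g :: 'k poly. ALL i>=degree \<pi>. pcoeff g i = 0}"
 have finP: "finite P" using card_polys_degree_less[of "degree \<pi>", where ?'k = 'k] by (simp add: P_def)
 define X where "X = (%g. \<Sum>i<r. ev (g i) * f i) ` ({..<r} \<rightarrow>\<^sub>E P)"
 have "finite X" unfolding X_def using finP by (intro finite_imageI finite_PiE) auto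
 moreover have "X <= C" unfolding X_def using fC by (auto intro!: Cc(11) Cc(3) Cc(4))
 moreover have "EX y:X. EX c:C. x - y = ev \<pi> * c" if x: "x : C" for x
 proof -
  \<comment> \<open>By maximality the family with x adjoined is dependent modulo \<pi>. The
    coefficient of x in the relation is not divisible by \<pi>, as the \<open>f i\<close> alone are
    independent, so it can be inverted.\<close>
  have "\<not> indep (Suc r) (f(r := x))" using max[of "Suc r" "f(r := x)"] by auto
  moreover have "ALL i<Suc r. (f(r := x)) i : C" using fC x by (auto simp: less_Suc_eq)
  ultimately obtain c y where cy: "y : C" "(\<Sum>i<Suc r. ev (c i) * (f(r := x)) i) = ev \<pi> * y"
  "EX i<Suc r. \<not> \<pi> dvd c i" unfolding indep_def by blast
  have "(\<Sum>i<r. ev (c i) * (f(r := x)) i) = (\<Sum>i<r. ev (c i) * f i)" by (rule sum.cong) auto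
  hence cy2: "(\<Sum>i<r. ev (c i) * f i) + ev (c r) * x = ev \<pi> * y" using cy(2) by simp
  have ndvd: "\<not> \<pi> dvd c r"
  proof
  assume dv: "\<pi> dvd c r"
  then obtain e where e: "c r = \<pi> * e" by (elim dvdE)
  have "(\<Sum>i<r. ev (c i) * f i) = ev \<pi> * (y - ev e * x)"
   using cy2 by (simp add: e ev.hom_mult algebra_simps)
  moreover have "y - ev e * x : C" using cy(1) x by (intro Cc)
  ultimately have "ALL i<r. \<pi> dvd c i" using ind unfolding indep_def by blast
  thus False using cy(3) dv by (auto simp: less_Suc_eq)
  qed
  then obtain h where "\<pi> dvd c r * h - 1" using irr by (auto simp: irr_def)
  then obtain e where e: "c r * h = 1 + \<pi> * e" by (metis dvdE diff_eq_eq add.commute)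
  \<comment> \<open>Reduction of the coefficients modulo \<pi> leaves only finitely many
    combinations, which form \<open>X\<close>.\<close>
  define g where "g = (\<lambda>i\<in>{..<r}. - (h * c i mod \<pi>))"
  have dg: "degree (h * c i mod \<pi>) < degree \<pi>" for i
  using degree_mod_less'[of \<pi> "h * c i"] \<pi> by (cases "h * c i mod \<pi> = 0") auto
  have gP: "g : {..<r} \<rightarrow>\<^sub>E P" by (auto simp: g_def P_def intro!: coeff_eq_0 intro: less_le_trans[OF dg])
  define s where "s i = - (h * c i div \<pi>)" for i
  have gs: "ev (g i) = - ev h * ev (c i) - ev \<pi> * ev (s i)" if "i < r" for i
  proof -
  have "g i = - (h * c i) - \<pi> * s i" proof -
  have "- (h * c i mod \<pi>) = - (h * c i) - \<pi> * s i"
   unfolding s_def minus_mult_div_eq_mod[symmetric, of "h * c i" \<pi>] by simp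
  thus ?thesis using that by (simp add: g_def)
  qed
  thus ?thesis by (simp add: ev.hom_minus ev.hom_uminus ev.hom_mult)
  qed
  let ?y = "\<Sum>i<r. ev (g i) * f i"
  have "?y = (\<Sum>i<r. - ev h * (ev (c i) * f i) - ev \<pi> * (ev (s i) * f i))"
  by (rule sum.cong) (simp_all add: gs algebra_simps)
  also have "... = - ev h * (\<Sum>i<r. ev (c i) * f i) - ev \<pi> * (\<Sum>i<r. ev (s i) * f i)"
  by (simp add: sum_subtractf sum_distrib_left)
  also have "(\<Sum>i<r. ev (c i) * f i) = ev \<pi> * y - ev (c r) * x" using cy2 by (simp add: algebra_simps)
  finally have y: "?y = ev (c r * h) * x - ev \<pi> * (ev h * y + (\<Sum>i<r. ev (s i) * f i))"
  by (simp add: ev.hom_mult algebra_simps)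
  have "x - ?y = ev \<pi> * (ev h * y + (\<Sum>i<r. ev (s i) * f i) - ev e * x)"
  unfolding y e by (simp add: ev.hom_mult ev.hom_add algebra_simps)
  moreover have "ev h * y + (\<Sum>i<r. ev (s i) * f i) - ev e * x : C"
  using fC by (intro Cc cy(1) x) auto
  moreover have "?y : X" unfolding X_def using gP by blast
  ultimately show ?thesis by blast
 qed
 ultimately show ?thesis using that by blast
qed

end

section \<open>Prime ideals of the rings of integers\<close>

context function_field
begin

lemma ring_eq: "A_ring = class_ring\<lparr>carrier := A\<rparr>" "B_ring = class_ring\<lparr>carrier := B\<rparr>"
 using ring_simps(1,6) unfolding ints_def by simp_all

lemma cring_subring:
 assumes "subring_of C"
 shows "cring ((ring_on C))"
proof (rule cringI)
 note Cc = subring_ofD[OF assms]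
 show "abelian_group ((ring_on C))"
  by (rule abelian_groupI) (auto intro: Cc bexI[of _ "- _"])
 show "comm_monoid ((ring_on C))"
  by (rule comm_monoidI) (auto intro: Cc)
qed (auto simp: distrib_right)

lemma cring_A: "cring A_ring" and cring_B: "cring B_ring"
 unfolding ring_eq by (intro cring_subring subring_A subring_B)+

text \<open>Prime ideals as plain sets, with the conditions in terms of the operations of L, for
  both rings of integers alike.\<close>

definition prime_of :: "'l set => 'l set => bool" where
 "prime_of C P \<longleftrightarrow> P <= C & 0 : P & 1 ~: P & (ALL x:P. ALL y:P. x + y : P) & (ALL c:C. ALL x:P. c * x : P) \<and>
  (ALL x:C. ALL y:C. x * y : P --> x : P | y : P)"

lemma prime_of_closed:
 assumes C: "subring_of C" and P: "prime_of C P"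
 shows "x : P ==> y : P ==> x + y : P" "x : P ==> y : P ==> x - y : P" "x : P ==> x : C"
  "c : C ==> x : P ==> c * x : P" "c : C ==> x : P ==> x * c : P" "0 : P" "1 ~: P"
  "x : C ==> y : C ==> x * y : P ==> x : P | y : P" "x : P ==> - x : P"
  "x : C ==> x ^ k : P ==> x : P" "x - y : P ==> y - x : P" "(!!i. i : X ==> f i : P) ==> sum f X : P"
proof -
 note Cc = subring_ofD[OF C]
 have add: "x + y : P" if "x : P" "y : P" for x y using P that by (auto simp: prime_of_def)
 have mult: "c * x : P" if "c : C" "x : P" for c x using P that by (auto simp: prime_of_def)
 have prm: "x : P | y : P" if "x : C" "y : C" "x * y : P" for x y using P that unfolding prime_of_def by blast
 have minus: "- x : P" if "x : P" for x using mult[OF Cc(9)[OF Cc(6)] that] by simp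
 show "x : P ==> y : P ==> x - y : P" using add[of x "- y"] minus[of y] by simp
 show "c : C ==> x : P ==> x * c : P" using mult[of c x] by (simp add: mult.commute)
 show "x - y : P ==> y - x : P" using minus[of "x - y"] by simp
 show 0: "0 : P" and 1: "1 ~: P" and sub: "x : P ==> x : C" using P by (auto simp: prime_of_def)
 show "x : C ==> x ^ k : P ==> x : P"
 proof (induction k)
  case (Suc k)
  thus ?case using prm[of x "x ^ k"] Cc(10)[of x k] by auto
 qed (use 1 in simp)
 show "(!!i. i : X ==> f i : P) ==> sum f X : P"
  by (induction X rule: infinite_finite_induct) (auto intro: 0 add)
 show "x : P ==> y : P ==> x + y : P" by (rule add)
 show "c : C ==> x : P ==> c * x : P" by (rule mult)
 show "x : C ==> y : C ==> x * y : P ==> x : P | y : P" by (rule prm)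
 show "x : P ==> - x : P" by (rule minus)
qed

lemma primeideal_prime_of:
 assumes C: "subring_of C" and P: "primeideal P ((ring_on C))"
 shows "prime_of C P"
proof -
 interpret P: primeideal P "(ring_on C)" by (rule P)
 have sub: "P <= C" using P.a_subset by simp
 have "1 ~: P" using P.I_notcarr P.one_imp_carrier by auto
 moreover have "x : P | y : P" if "x : C" "y : C" "x * y : P" for x y
  using P.I_prime[of x y] that by simp
 moreover have "x + y : P" if "x : P" "y : P" for x y using additive_subgroup.a_closed[OF ideal.axioms(1)[OF P.ideal_axioms] that] by simp
 moreover have "c * x : P" if "c : C" "x : P" for c x using P.I_l_closed[of x c] that by simp
 moreover have "0 : P" using additive_subgroup.zero_closed[OF ideal.axioms(1)[OF P.ideal_axioms]] by simp
 ultimately show ?thesis using sub unfolding prime_of_def by blast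
qed

lemma max_prime_of: "p : max_ideals A_ring ==> prime_of A p"
 using cring.maximalideal_prime[OF cring_A, of p] primeideal_prime_of[OF subring_A, of p]
 by (simp add: max_ideals_def ring_eq)

lemma eval_hom: "comm_ring_hom (eval_at iL x)"
proof -
 interpret p: map_poly_comm_ring_hom iL ..
 show ?thesis by standard (simp_all add: eval_at_def p.hom_add p.hom_mult)
qed

lemma eval_monom: "eval_at iL x (Polynomial.monom c i) = iL c * x ^ i"
 by (simp add: eval_at_def map_poly_monom poly_monom)

lemma eval_closed: "subring_of C ==> x : C ==> eval_at iL x f : C"
 unfolding eval_at_def poly_altdef by (auto intro!: subring_ofD simp: coeff_map_poly)

text \<open>The kernel of the map k[X] \<rightarrow> C/P sending X to g is a prime ideal, and
  \<open>M\<close> makes it nonzero; its monic generator is therefore irreducible.\<close>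

lemma prime_poly:
 assumes C: "subring_of C" and P: "prime_of C P" and g: "g : C" and M: "M ~= 0" "eval_at iL g M : P"
 obtains \<pi> where "irr \<pi>" "!!f. eval_at iL g f : P \<longleftrightarrow> \<pi> dvd f"
proof -
 note Cc = subring_ofD[OF C] and Pc = prime_of_closed[OF C P]
 interpret e: comm_ring_hom "eval_at iL g" by (rule eval_hom)
 have ec: "eval_at iL g f : C" for f by (rule eval_closed[OF C g])
 have "EX m. lead_coeff m = 1 & (ALL f. f : {f. eval_at iL g f : P} \<longleftrightarrow> m dvd f)"
  by (rule poly_ideal_generator[of M]) (use M in \<open>auto simp: e.hom_minus e.hom_mult intro: Pc ec\<close>)
 then obtain \<pi> where \<pi>: "lead_coeff \<pi> = 1" "!!f. eval_at iL g f : P \<longleftrightarrow> \<pi> dvd f" by auto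
 have \<pi>0: "\<pi> ~= 0" using \<pi>(1) by auto
 have n1: "\<not> \<pi> dvd 1" using \<pi>(2)[of 1] Pc(7) by simp
 have deg: "degree \<pi> >= 1"
 proof (rule ccontr)
  assume "\<not> degree \<pi> >= 1"
  hence "degree \<pi> = 0" by simp
  then obtain c where "\<pi> = [:c:]" by (rule degree_eq_zeroE)
  hence "\<pi> = 1" using \<pi>(1) by (simp add: one_pCons)
  thus False using n1 by simp
 qed
 have "EX h. \<pi> dvd f * h - 1" if f: "\<not> \<pi> dvd f" for f
 proof -
  \<comment> \<open>The ideal generated by \<pi> and f. Its generator m divides \<pi> but is not
    divisible by \<pi>, so primality of \<open>P\<close> puts the factor \<pi> into the cofactor,
    and m is a unit.\<close>
  define J where "J = {a. EX s t. a = s * \<pi> + t * f}"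
  have "EX m. lead_coeff m = 1 & (ALL f. f : J \<longleftrightarrow> m dvd f)"
  proof (rule poly_ideal_generator[of \<pi>])
  show "\<pi> : J" unfolding J_def by (intro CollectI exI[of _ 1] exI[of _ 0]) simp
  show "a - b : J" if ab: "a : J" "b : J" for a b
  proof -
   obtain s t s' t' where "a = s * \<pi> + t * f" "b = s' * \<pi> + t' * f" using ab by (auto simp: J_def)
   hence "a - b = (s - s') * \<pi> + (t - t') * f" by (simp add: algebra_simps)
   thus ?thesis unfolding J_def by blast
  qed
  show "c * a : J" if a: "a : J" for c a
  proof -
   obtain s t where "a = s * \<pi> + t * f" using a by (auto simp: J_def)
   hence "c * a = (c * s) * \<pi> + (c * t) * f" by (simp add: algebra_simps)
   thus ?thesis unfolding J_def by blast
  qed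
  qed (rule \<pi>0)
  then obtain m where m: "!!a. a : J \<longleftrightarrow> m dvd a" by auto
  have "\<pi> : J" unfolding J_def by (intro CollectI exI[of _ 1] exI[of _ 0]) simp
  hence "m dvd \<pi>" using m by blast
  then obtain c where c: "\<pi> = m * c" by (elim dvdE)
  have "f : J" unfolding J_def by (intro CollectI exI[of _ 0] exI[of _ 1]) simp
  hence mf: "m dvd f" using m by simp
  have "eval_at iL g m * eval_at iL g c : P" using \<pi>(2)[of \<pi>] by (simp add: c e.hom_mult)
  hence "\<pi> dvd m | \<pi> dvd c" using Pc(8)[OF ec ec] \<pi>(2) by blast
  moreover have "\<not> \<pi> dvd m" using mf f dvd_trans by blast
  ultimately obtain e' where e': "c = \<pi> * e'" by (elim disjE dvdE) auto
  have "\<pi> * 1 = \<pi> * (m * e')" using c unfolding e' by (simp add: mult_ac)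
  hence "1 = m * e'" using mult_left_cancel[OF \<pi>0] by blast
  hence "1 : J" using m by (metis dvd_triv_left)
  then obtain s t where st: "1 = s * \<pi> + t * f" by (auto simp: J_def)
  have "f * t - 1 = \<pi> * (- s)" unfolding st by (simp add: algebra_simps)
  thus ?thesis by (metis dvd_triv_left)
 qed
 hence "irr \<pi>" using \<pi>0 deg by (auto simp: irr_def)
 thus ?thesis using that \<pi>(2) by blast
qed

text \<open>For some nonzero w in k[z] the element w/x is integral, and (w/x) x = w lies in the
  prime.\<close>

lemma prime_contains_ev:
 assumes C: "C = A | C = B" and P: "prime_of C P" and x: "x : P" "x ~= 0"
 obtains u where "u ~= 0" "ev u : P"
proof -
 have sC: "subring_of C" using C subring_A subring_B by blast
 note Pc = prime_of_closed[OF sC P]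
 obtain w where w: "w ~= 0" "integral (ev w * inverse x)" using integral_multiple by metis
 have "ev w * inverse x : C"
 proof -
  have "ev w * inverse x : K" if "C = A" using Pc(3)[OF x(1)] x(2) that by (auto simp: A_def intro: K_closed ev_K)
  thus ?thesis using C w(2) by (auto simp: A_def B_def)
 qed
 hence "ev w * inverse x * x : P" using x by (intro Pc(4))
 hence "ev w : P" using x by (simp add: mult.assoc)
 thus ?thesis using w that by blast
qed

text \<open>A maximal ideal is not zero, for otherwise z would be invertible in the ring of integers
  of K. An integral equation for 1/z, multiplied by the top power of z, would be a vanishing
  polynomial in z whose constant term is the leading coefficient 1.\<close>

lemma max_contains_ev:
 assumes p: "p : max_ideals A_ring"
 obtains u where "u ~= 0" "ev u : p"
proof -
 have P: "prime_of A p" by (rule max_prime_of[OF p])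
 have mx: "maximalideal p A_ring" using p by (simp add: max_ideals_def)
 have "EX x:p. x ~= 0"
 proof (rule ccontr)
  assume n: "\<not> (EX x:p. x ~= 0)"
  hence p0: "p = {0}" using P by (auto simp: prime_of_def)
  have z0: "z ~= 0" using trans[of "[:0, 1:]"] ev_X by auto
  interpret A: cring A_ring by (rule cring_A)
  have "ideal (PIdl\<^bsub>A_ring\<^esub> z) A_ring" by (rule A.cgenideal_ideal) (simp add: A_closed)
  moreover have PI: "PIdl\<^bsub>A_ring\<^esub> z = (%x. x * z) ` A" unfolding cgenideal_def by auto
  moreover have "0 : PIdl\<^bsub>A_ring\<^esub> z" "z : PIdl\<^bsub>A_ring\<^esub> z"
  unfolding PI using A_closed(5,6) by (auto intro: image_eqI[of _ _ 0] image_eqI[of _ _ 1])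
  moreover have "PIdl\<^bsub>A_ring\<^esub> z <= carrier A_ring" unfolding PI by (auto intro: A_closed)
  ultimately have "PIdl\<^bsub>A_ring\<^esub> z = carrier A_ring"
  using maximalideal.I_maximal[OF mx, of "PIdl\<^bsub>A_ring\<^esub> z"] z0 by (auto simp: p0)
  hence "1 : (%x. x * z) ` A" using PI A_closed(6) by simp
  then obtain y where y: "y : A" "1 = y * z" by auto
  hence yz: "y = inverse z" using z0 by (metis inverse_unique mult.commute)
  obtain a :: "'k poly poly" where a: "lead_coeff a = 1" "poly (map_poly ev a) y = 0"
  using y by (auto simp: A_def integral_def)
  define m where "m = degree a"
  have "z ^ m * (\<Sum>i\<le>m. ev (pcoeff a i) * y ^ i) = 0"
  using a(2) by (simp add: poly_altdef m_def coeff_map_poly)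
  moreover have "z ^ m * (\<Sum>i\<le>m. ev (pcoeff a i) * y ^ i) = (\<Sum>i\<le>m. ev (pcoeff a i * [:0, 1:] ^ (m - i)))"
  unfolding sum_distrib_left
  proof (rule sum.cong)
  fix i assume "i : {..m}"
  hence "z ^ m = z ^ (m - i) * z ^ i" by (simp flip: power_add)
  hence "z ^ m * y ^ i = z ^ (m - i)" using z0 by (simp add: yz power_inverse)
  thus "z ^ m * (ev (pcoeff a i) * y ^ i) = ev (pcoeff a i * [:0, 1:] ^ (m - i))"
   by (simp add: ev.hom_mult ev.hom_power ev_X mult_ac)
  qed simp
  ultimately have "ev (\<Sum>i\<le>m. pcoeff a i * [:0, 1:] ^ (m - i)) = 0" by (simp add: ev.hom_sum)
  hence "(\<Sum>i\<le>m. pcoeff a i * [:0, 1:] ^ (m - i)) = 0" by simp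
  hence "poly (\<Sum>i\<le>m. pcoeff a i * [:0, 1:] ^ (m - i)) 0 = 0" by simp
  hence "(\<Sum>i\<le>m. poly (pcoeff a i) 0 * 0 ^ (m - i)) = 0" by (simp add: poly_sum)
  moreover have "(\<Sum>i\<le>m. poly (pcoeff a i) 0 * 0 ^ (m - i)) = (\<Sum>i\<le>m. if i = m then poly (pcoeff a m) 0 else 0)"
  by (rule sum.cong) auto
  ultimately show False using a(1) by (simp add: m_def)
 qed
 thus ?thesis using prime_contains_ev[OF _ P] that by blast
qed

lemma ev_prime:
 assumes C: "subring_of C" and P: "prime_of C P" and u: "u ~= 0" "ev u : P"
 obtains \<pi> where "irr \<pi>" "ev \<pi> : P" "\<pi> dvd u"
proof -
 obtain \<pi> where "irr \<pi>" "!!f. eval_at iL z f : P \<longleftrightarrow> \<pi> dvd f"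
  using prime_poly[OF C P subring_ofD(7)[OF C] u] by metis
 thus ?thesis using that[of \<pi>] u(2) by simp
qed

lemma finite_quotient:
 assumes C: "subring_of C" and P: "prime_of C P" and u: "u ~= 0" "ev u : P"
 obtains X where "finite X" "X <= C" "!!x. x : C ==> EX y:X. x - y : P"
proof -
 obtain \<pi> where \<pi>: "irr \<pi>" "ev \<pi> : P" using ev_prime[OF assms] by metis
 obtain X where X: "finite X" "X <= C" "!!x. x : C ==> EX y:X. EX c:C. x - y = ev \<pi> * c"
  using finite_reps[OF C \<pi>(1)] by metis
 have "EX y:X. x - y : P" if x: "x : C" for x
 proof -
  obtain y c where "y : X" "c : C" "x - y = ev \<pi> * c" using X(3)[OF x] by blast
  thus ?thesis using prime_of_closed(5)[OF C P, of c "ev \<pi>"] \<pi>(2) by (intro bexI[of _ y]) simp_all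
 qed
 thus ?thesis using that X by blast
qed

text \<open>A prime containing an irreducible \<pi> is determined by which of the finitely many
  representatives modulo \<pi> it contains; every prime containing u contains one of the finitely
  many irreducible divisors of u.\<close>

lemma finite_primes:
 assumes C: "subring_of C" and u: "u ~= 0"
 shows "finite {P. prime_of C P & ev u : P}"
proof -
 have fin1: "finite {P. prime_of C P & ev \<pi> : P}" if \<pi>: "irr \<pi>" for \<pi>
 proof -
  obtain X where X: "finite X" "X <= C" "!!x. x : C ==> EX y:X. EX c:C. x - y = ev \<pi> * c"
  using finite_reps[OF C \<pi>] by metis
  have "P <= Q" if P: "prime_of C P" "ev \<pi> : P" and Q: "prime_of C Q" "ev \<pi> : Q" and e: "P \<inter> X = Q \<inter> X" for P Q
  proof
  fix x assume x: "x : P"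
  note Pc = prime_of_closed[OF C P(1)] and Qc = prime_of_closed[OF C Q(1)]
  obtain y c where y: "y : X" "c : C" "x - y = ev \<pi> * c" using X(3)[OF Pc(3)[OF x]] by blast
  have "x - y : P" "x - y : Q" unfolding y(3) using Pc(5)[OF y(2) P(2)] Qc(5)[OF y(2) Q(2)] by simp_all
  hence "y : P" using Pc(2)[OF x, of "x - y"] by simp
  hence "y : Q" using y e by auto
  thus "x : Q" using Qc(1)[OF `x - y : Q`, of y] by simp
  qed
  hence "inj_on (%P. P \<inter> X) {P. prime_of C P & ev \<pi> : P}"
  by (intro inj_onI subset_antisym) (blast, metis (mono_tags, lifting) mem_Collect_eq)
  moreover have "(%P. P \<inter> X) ` {P. prime_of C P & ev \<pi> : P} <= Pow X" by auto
  ultimately show ?thesis using X(1) by (meson finite_Pow_iff inj_on_finite)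
 qed
 have "finite {\<pi> :: 'k poly. \<pi> dvd u}"
 proof (rule finite_subset)
  show "{\<pi>. \<pi> dvd u} <= {g. ALL i>=Suc (degree u). pcoeff g i = 0}"
  using dvd_imp_degree_le[OF _ u] by (auto intro!: coeff_eq_0 simp: Suc_le_eq intro: le_less_trans)
 qed (use card_polys_degree_less[of "Suc (degree u)", where ?'k = 'k] in simp)
 hence "finite (\<Union>\<pi>\<in>{\<pi>. \<pi> dvd u & irr \<pi>}. {P. prime_of C P & ev \<pi> : P})" using fin1 by auto
 moreover have "{P. prime_of C P & ev u : P} <= (\<Union>\<pi>\<in>{\<pi>. \<pi> dvd u & irr \<pi>}. {P. prime_of C P & ev \<pi> : P})"
 proof
  fix P assume "P : {P. prime_of C P & ev u : P}"
  hence P: "prime_of C P" "ev u : P" by auto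
  obtain \<pi> where "irr \<pi>" "ev \<pi> : P" "\<pi> dvd u" using ev_prime[OF C P(1) u P(2)] by metis
  thus "P : (\<Union>\<pi>\<in>{\<pi>. \<pi> dvd u & irr \<pi>}. {P. prime_of C P & ev \<pi> : P})" using P(1) by blast
 qed
 ultimately show ?thesis by (rule finite_subset[rotated])
qed

text \<open>The quotient is finite, so two powers of x agree modulo P; cancelling the smaller one
  gives a power congruent to 1, and with it an inverse of x modulo P.\<close>

lemma order_mod_prime:
 assumes C: "subring_of C" and P: "prime_of C P" and u: "u ~= 0" "ev u : P" and x: "x : C" "x ~: P"
 obtains N where "N >= 1" "x ^ N - 1 : P"
proof -
 note Pc = prime_of_closed[OF C P] and Cc = subring_ofD[OF C]
 obtain X where X: "finite X" "X <= C" "!!x. x : C ==> EX y:X. x - y : P"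
  using finite_quotient[OF C P u] by metis
 have "ALL i. EX y:X. x ^ i - y : P" using X(3) Cc(10)[OF x(1)] by blast
 then obtain y where y: "!!i. y i : X" "!!i. x ^ i - y i : P" by metis
 have "\<not> inj y"
 proof
  assume "inj y"
  moreover have "range y <= X" using y by auto
  ultimately show False using X(1) by (meson finite_imageD finite_subset infinite_UNIV_nat)
 qed
 then obtain i j where ij: "i < j" "y i = y j" unfolding inj_def by (metis linorder_neqE_nat)
 have e: "x ^ i * (x ^ (j - i) - 1) = (x ^ j - y j) - (x ^ i - y i)"
  using ij by (simp add: algebra_simps flip: power_add)
 have "x ^ i * (x ^ (j - i) - 1) : P" unfolding e by (rule Pc(2)[OF y(2) y(2)])
 moreover have "x ^ i ~: P" using Pc(10)[OF x(1)] x(2) by blast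
 ultimately have "x ^ (j - i) - 1 : P" using Pc(8) Cc(10)[OF x(1)] Cc(2)[OF _ Cc(6)] by blast
 thus ?thesis using that[of "j - i"] ij by simp
qed

section \<open>Residue fields inside an algebraic closure of k\<close>

lemma residue_generator:
 assumes P: "primeideal P B_ring" and u: "u ~= 0" "ev u : P"
 obtains g where "g : B" "g ~: P" "!!x. x : B ==> x ~: P ==> EX i. x - g ^ i : P"
proof -
 interpret P: primeideal P B_ring by (rule P)
 have Pp: "prime_of B P" using primeideal_prime_of[OF subring_B, of P] P by (simp add: ring_eq)
 note Pc = prime_of_closed[OF subring_B Pp]
 let ?R = "B_ring Quot P"
 interpret R: cring ?R by (rule P.quotient_is_cring[OF cring_B])
 have cosets: "carrier ?R = (%x. P +>\<^bsub>B_ring\<^esub> x) ` B" unfolding FactRing_def A_RCOSETS_def' by auto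
 have eq: "P +>\<^bsub>B_ring\<^esub> x = P +>\<^bsub>B_ring\<^esub> y \<longleftrightarrow> x - y : P" if "x : B" "y : B" for x y
 proof -
  have "y \<oplus>\<^bsub>B_ring\<^esub> (- y) = \<zero>\<^bsub>B_ring\<^esub>" by simp
  hence "\<ominus>\<^bsub>B_ring\<^esub> y = - y" by (metis P.minus_equality that(2) B_closed(9) ring_simps(6) P.add.m_comm)
  hence d: "x \<ominus>\<^bsub>B_ring\<^esub> y = x - y" by (simp add: a_minus_def)
  thus ?thesis using P.quotient_eq_iff_same_a_r_cos[OF P.ideal_axioms, of x y, unfolded d] that by simp
 qed
 have mult: "(P +>\<^bsub>B_ring\<^esub> x) \<otimes>\<^bsub>?R\<^esub> (P +>\<^bsub>B_ring\<^esub> y) = P +>\<^bsub>B_ring\<^esub> (x * y)" if "x : B" "y : B" for x y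
  using P.rcoset_mult_add[of x y] that by (simp add: FactRing_def)
 have one: "\<one>\<^bsub>?R\<^esub> = P +>\<^bsub>B_ring\<^esub> 1" by (simp add: FactRing_def)
 have zero: "\<zero>\<^bsub>?R\<^esub> = P +>\<^bsub>B_ring\<^esub> 0"
 proof -
  have "P +>\<^bsub>B_ring\<^esub> 0 = P" unfolding a_r_coset_def' by simp
  thus ?thesis by (simp add: FactRing_def)
 qed
 have "field ?R"
 proof (rule R.cring_fieldI2)
  show "\<zero>\<^bsub>?R\<^esub> ~= \<one>\<^bsub>?R\<^esub>" unfolding zero one using eq[of 0 1] B_closed(5,6) Pc(7) Pc(11)[of 0 1] by auto
  fix a assume a: "a : carrier ?R" "a ~= \<zero>\<^bsub>?R\<^esub>"
  then obtain x where x: "x : B" "a = P +>\<^bsub>B_ring\<^esub> x" using cosets by auto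
  have xP: "x ~: P" using a(2) eq[OF x(1) B_closed(5)] by (simp add: x zero)
  obtain N where N: "N >= 1" "x ^ N - 1 : P" using order_mod_prime[OF subring_B Pp u x(1) xP] by metis
  have "x * x ^ (N - 1) = x ^ N" using N(1) by (cases N) auto
  hence "a \<otimes>\<^bsub>?R\<^esub> (P +>\<^bsub>B_ring\<^esub> x ^ (N - 1)) = \<one>\<^bsub>?R\<^esub>"
  using eq[of "x ^ N" 1] N(2) x B_closed(6) B_closed(10)[OF x(1)] by (simp add: mult one)
  moreover have "P +>\<^bsub>B_ring\<^esub> x ^ (N - 1) : carrier ?R" unfolding cosets using B_closed(10)[OF x(1)] by blast
  ultimately show "EX b:carrier ?R. a \<otimes>\<^bsub>?R\<^esub> b = \<one>\<^bsub>?R\<^esub>" by blast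
 qed
 then interpret F: field ?R .
 have "finite (carrier ?R)"
 proof -
  obtain X where X: "finite X" "X <= B" "!!x. x : B ==> EX y:X. x - y : P"
  using finite_quotient[OF subring_B Pp u] by metis
  have "carrier ?R <= (%x. P +>\<^bsub>B_ring\<^esub> x) ` X"
  proof
  fix a assume "a : carrier ?R"
  then obtain x where x: "x : B" "a = P +>\<^bsub>B_ring\<^esub> x" using cosets by auto
  then obtain y where "y : X" "x - y : P" using X(3) by blast
  thus "a : (%x. P +>\<^bsub>B_ring\<^esub> x) ` X" using eq[of x y] x X(2) by auto
  qed
  thus ?thesis using X(1) finite_surj by blast
 qed
 from F.finite_field_mult_group_has_gen[OF this] obtain a where a: "a : carrier (mult_of ?R)"
  "carrier (mult_of ?R) = {a [^]\<^bsub>?R\<^esub> i | i :: nat. i : UNIV}" by auto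
 then obtain g where g: "g : B" "a = P +>\<^bsub>B_ring\<^esub> g" using cosets by auto
 have gP: "g ~: P" using a(1) eq[OF g(1) B_closed(5)] by (simp add: g zero)
 have pow: "a [^]\<^bsub>?R\<^esub> i = P +>\<^bsub>B_ring\<^esub> g ^ i" for i :: nat
  by (induction i) (simp_all add: one g mult B_closed(10) mult.commute)
 have "EX i. x - g ^ i : P" if x: "x : B" "x ~: P" for x
 proof -
  have "P +>\<^bsub>B_ring\<^esub> x : carrier (mult_of ?R)"
  using x eq[OF x(1) B_closed(5)] cosets by (auto simp: zero)
  then obtain i :: nat where "P +>\<^bsub>B_ring\<^esub> x = a [^]\<^bsub>?R\<^esub> i" using a(2) by auto
  thus ?thesis using eq[OF x(1) B_closed(10)[OF g(1)]] pow by auto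
 qed
 thus ?thesis using that g(1) gP by blast
qed

definition residue_map :: "'l set => ('l => 'k alg_closure) => bool" where
 "residue_map P \<chi> \<longleftrightarrow> (ALL x:B. ALL y:B. \<chi> (x + y) = \<chi> x + \<chi> y & \<chi> (x * y) = \<chi> x * \<chi> y) \<and>
  (ALL x:B. \<chi> x = 0 \<longleftrightarrow> x : P) & (ALL c. \<chi> (iL c) = to_ac c)"

lemma to_ac_field_hom: "field_hom (to_ac :: 'k => 'k alg_closure)"
 by standard simp_all

text \<open>A generator g of the multiplicative group generates the residue field over k, which is
  thus k[X]/\<pi> for the polynomial \<pi> of g; a root of \<pi> in the algebraic closure defines
  the embedding.\<close>

lemma residue_map_exists:
 assumes P: "primeideal P B_ring" and u: "u ~= 0" "ev u : P"
 shows "EX \<chi>. residue_map P \<chi>"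
proof -
 interpret ac: field_hom "to_ac :: 'k => 'k alg_closure" by (rule to_ac_field_hom)
 interpret acp: map_poly_comm_ring_hom "to_ac :: 'k => 'k alg_closure" ..
 have Pp: "prime_of B P" using primeideal_prime_of[OF subring_B, of P] P by (simp add: ring_eq)
 note Pc = prime_of_closed[OF subring_B Pp]
 obtain g where g: "g : B" "g ~: P" "!!x. x : B ==> x ~: P ==> EX i. x - g ^ i : P"
  using residue_generator[OF assms] by metis
 let ?e = "eval_at iL g"
 interpret e: comm_ring_hom ?e by (rule eval_hom)
 have eB: "?e f : B" for f by (rule eval_closed[OF subring_B g(1)])
 obtain N where N: "N >= 1" "g ^ N - 1 : P" using order_mod_prime[OF subring_B Pp u g(1,2)] by metis
 define M :: "'k poly" where "M = Polynomial.monom 1 N - 1"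
 have "pcoeff M N = 1" using N(1) by (simp add: M_def coeff_eq_0)
 hence M0: "M ~= 0" by (metis coeff_0 zero_neq_one)
 have "?e M : P" using N(2) by (simp add: M_def e.hom_minus eval_monom)
 then obtain \<pi> where \<pi>: "irr \<pi>" "!!f. ?e f : P \<longleftrightarrow> \<pi> dvd f" using prime_poly[OF subring_B Pp g(1) M0] by metis
 have "degree (map_poly to_ac \<pi> :: 'k alg_closure poly) > 0" using \<pi>(1) by (simp add: irr_def)
 then obtain \<theta> :: "'k alg_closure" where \<theta>: "poly (map_poly to_ac \<pi>) \<theta> = 0" using alg_closed_imp_poly_has_root by blast
 define v where "v f = poly (map_poly to_ac f) \<theta>" for f :: "'k poly"
 have v: "v (f + h) = v f + v h" "v (f * h) = v f * v h" "v (f - h) = v f - v h" "v [:c:] = to_ac c" "v 1 = 1" "v 0 = 0" for f h c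
  by (simp_all add: v_def acp.hom_add acp.hom_mult acp.hom_minus map_poly_pCons_hom0)
 have v0: "v f = 0 \<longleftrightarrow> \<pi> dvd f" for f
 proof
  have "v \<pi> = 0" using \<theta> by (simp add: v_def)
  thus "\<pi> dvd f ==> v f = 0" by (elim dvdE) (simp add: v(2))
  assume vf: "v f = 0"
  show "\<pi> dvd f"
  proof (rule ccontr)
  assume "\<not> \<pi> dvd f"
  then obtain h where "\<pi> dvd f * h - 1" using \<pi>(1) by (auto simp: irr_def)
  then obtain c where "f * h - 1 = \<pi> * c" by (elim dvdE)
  hence "v (f * h - 1) = v (\<pi> * c)" by simp
  moreover have "v \<pi> = 0" using \<theta> by (simp add: v_def)
  ultimately show False using vf by (simp add: v)
  qed
 qed
 define rep where "rep x = (SOME f. x - ?e f : P)" for x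
 have rep: "x - ?e (rep x) : P" if x: "x : B" for x
 proof -
  have "EX f. x - ?e f : P"
  proof (cases "x : P")
  case True
  thus ?thesis by (intro exI[of _ 0]) simp
  next
  case False
  then obtain i where "x - g ^ i : P" using g(3) x by blast
  thus ?thesis by (intro exI[of _ "Polynomial.monom 1 i"]) (simp add: eval_monom)
  qed
  thus ?thesis unfolding rep_def by (rule someI_ex)
 qed
 define \<chi> where "\<chi> x = v (rep x)" for x
 have \<chi>eq: "\<chi> x = v f" if "x : B" "x - ?e f : P" for x f
 proof -
  have "(x - ?e f) - (x - ?e (rep x)) : P" by (rule Pc(2)[OF that(2) rep[OF that(1)]])
  hence "?e (rep x - f) : P" by (simp add: e.hom_minus)
  thus ?thesis using v0[of "rep x - f"] \<pi>(2) by (simp add: \<chi>_def v)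
 qed
 have "residue_map P \<chi>"
  unfolding residue_map_def
 proof (intro conjI ballI allI)
  fix x y assume x: "x : B" and y: "y : B"
  have e1: "(x + y) - ?e (rep x + rep y) = (x - ?e (rep x)) + (y - ?e (rep y))" by (simp add: e.hom_add)
  have "(x + y) - ?e (rep x + rep y) : P" unfolding e1 by (rule Pc(1)[OF rep[OF x] rep[OF y]])
  thus "\<chi> (x + y) = \<chi> x + \<chi> y" using \<chi>eq[OF B_closed(1)[OF x y]] by (simp add: v) (simp add: \<chi>_def)
  have e2: "x * y - ?e (rep x * rep y) = (x - ?e (rep x)) * y + ?e (rep x) * (y - ?e (rep y))"
  by (simp add: e.hom_mult algebra_simps)
  have "x * y - ?e (rep x * rep y) : P"
  unfolding e2 by (rule Pc(1)[OF Pc(5)[OF y rep[OF x]] Pc(4)[OF eB rep[OF y]]])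
  thus "\<chi> (x * y) = \<chi> x * \<chi> y" using \<chi>eq[OF B_closed(3)[OF x y]] by (simp add: v) (simp add: \<chi>_def)
 next
  fix x assume x: "x : B"
  have "\<chi> x = 0 \<longleftrightarrow> ?e (rep x) : P" by (simp add: \<chi>_def v0 \<pi>(2))
  also have "... \<longleftrightarrow> x : P"
  using Pc(1)[OF rep[OF x], of "?e (rep x)"] Pc(2)[of x "x - ?e (rep x)"] rep[OF x] by auto
  finally show "\<chi> x = 0 \<longleftrightarrow> x : P" .
 next
  fix c
  have "?e [:c:] = iL c" by (simp add: eval_at_def map_poly_pCons_hom0)
  thus "\<chi> (iL c) = to_ac c" using \<chi>eq[of "iL c" "[:c:]"] B_closed(8) Pc(6) by (simp add: v)
 qed
 thus ?thesis by (rule exI[of _ \<chi>])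
qed

section \<open>The Galois group acting on integral elements\<close>

lemma GalD:
 assumes "\<sigma> : Gal K"
 shows "\<sigma> (x + y) = \<sigma> x + \<sigma> y" "\<sigma> (x * y) = \<sigma> x * \<sigma> y" "\<sigma> (x - y) = \<sigma> x - \<sigma> y" "\<sigma> 0 = 0" "\<sigma> 1 = 1"
  "\<sigma> x = \<sigma> y \<longleftrightarrow> x = y" "x : K ==> \<sigma> x = x" "\<sigma> (ev g) = ev g" "\<sigma> (x ^ k) = \<sigma> x ^ k" "\<sigma> (sum f X) = (\<Sum>i\<in>X. \<sigma> (f i))"
  "EX y. \<sigma> y = x" "\<sigma> (iL c) = iL c" "\<sigma> z = z"
proof -
 interpret s: field_hom \<sigma> using assms by (simp add: Gal_def)
 show "\<sigma> (x + y) = \<sigma> x + \<sigma> y" "\<sigma> (x * y) = \<sigma> x * \<sigma> y" "\<sigma> (x - y) = \<sigma> x - \<sigma> y" "\<sigma> 0 = 0" "\<sigma> 1 = 1"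
  "\<sigma> (x ^ k) = \<sigma> x ^ k" "\<sigma> (sum f X) = (\<Sum>i\<in>X. \<sigma> (f i))"
  by (simp_all add: s.hom_add s.hom_mult s.hom_minus s.hom_power s.hom_sum)
 have b: "bij \<sigma>" and K: "!!x. x : K ==> \<sigma> x = x" using assms by (auto simp: Gal_def)
 show "\<sigma> x = \<sigma> y \<longleftrightarrow> x = y" using b by (auto simp: bij_def inj_def)
 show "EX y. \<sigma> y = x" using b by (metis bij_pointE)
 show "x : K ==> \<sigma> x = x" by (rule K)
 show "\<sigma> (ev g) = ev g" for g by (rule K[OF ev_K])
 from this[of "[:c:]"] this[of "[:0, 1:]"] show "\<sigma> (iL c) = iL c" "\<sigma> z = z" by (simp_all add: ev_const ev_X)
qed

lemma Gal_poly: "\<sigma> : Gal K ==> poly (map_poly ev a) (\<sigma> x) = \<sigma> (poly (map_poly ev a) x)"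
 unfolding poly_altdef by (simp add: GalD coeff_map_poly)

lemma Gal_B: "\<sigma> : Gal K ==> x : B ==> \<sigma> x : B"
 unfolding B_def integral_def by (auto simp: Gal_poly GalD)

lemma Gal_id: "id : Gal K"
 by (auto simp: Gal_def) (standard, simp_all)

lemma Gal_comp:
 assumes "\<sigma> : Gal K" "\<tau> : Gal K"
 shows "\<sigma> \<circ> \<tau> : Gal K"
proof -
 have "field_hom (\<sigma> \<circ> \<tau>)" by standard (simp_all add: GalD[OF assms(1)] GalD[OF assms(2)])
 thus ?thesis using assms by (auto simp: Gal_def intro: bij_comp)
qed

lemma Gal_inv:
 assumes "\<sigma> : Gal K"
 obtains \<tau> where "\<tau> : Gal K" "\<sigma> \<circ> \<tau> = id" "\<tau> \<circ> \<sigma> = id"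
proof -
 have b: "bij \<sigma>" using assms by (simp add: Gal_def)
 define \<tau> where "\<tau> = inv_into UNIV \<sigma>"
 have st: "\<sigma> (\<tau> x) = x" "\<tau> (\<sigma> x) = x" for x
  using b by (simp_all add: \<tau>_def surj_f_inv_f bij_is_surj inv_f_f bij_is_inj)
 have "\<tau> a = b" if "\<sigma> b = a" for a b using that st by auto
 note te = this
 have "field_hom \<tau>" by standard (auto intro!: te simp: GalD[OF assms] st)
 moreover have "\<tau> x = x" if "x : K" for x by (rule te) (simp add: GalD(7)[OF assms that])
 moreover have "bij \<tau>" unfolding \<tau>_def by (rule bij_imp_bij_inv[OF b])
 ultimately have "\<tau> : Gal K" by (simp add: Gal_def)
 thus ?thesis using that st by (simp add: fun_eq_iff)
qed

text \<open>An automorphism over K is determined by its values on a list spanning L, and each value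
  is one of the finitely many roots of an algebraic equation of the list element.\<close>

lemma finite_Gal: "finite (Gal K)"
proof -
 obtain us where us: "!!x. EX r. (ALL i. r i : ratfun_image iL z) & x = (\<Sum>i<length us. r i * us ! i)"
  using finite_degree by metis
 have "ALL y. EX c :: 'k poly poly. c ~= 0 & poly (map_poly ev c) y = 0" using algebraic by metis
 then obtain c where c: "!!y. c y ~= 0" "!!y. poly (map_poly ev (c y)) y = 0" by metis
 define R where "R = (\<Union>y\<in>set us. {x. poly (map_poly ev (c y)) x = 0})"
 have "map_poly ev (c y) ~= 0" for y using c(1)[of y] map_ev_inj[of "c y" 0] by auto
 hence "finite R" unfolding R_def by (auto intro: poly_roots_finite)
 hence "finite {xs. set xs <= R & length xs = length us}" by (rule finite_lists_length_eq)
 moreover have "(%\<sigma>. map \<sigma> us) ` Gal K <= {xs. set xs <= R & length xs = length us}"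
  by (auto simp: R_def) (metis Gal_poly GalD(4) c(2))
 moreover have "inj_on (%\<sigma>. map \<sigma> us) (Gal K)"
 proof (rule inj_onI, rule ext)
  fix \<sigma> \<tau> x assume s: "\<sigma> : Gal K" and t: "\<tau> : Gal K" and e: "map \<sigma> us = map \<tau> us"
  obtain r where r: "ALL i. r i : ratfun_image iL z" "x = (\<Sum>i<length us. r i * us ! i)" using us by blast
  have rK: "r i : K" for i using r(1) subfields(2) by blast
  have "\<sigma> (us ! i) = \<tau> (us ! i)" if "i < length us" for i using e that by (metis nth_map)
  thus "\<sigma> x = \<tau> x" unfolding r(2) GalD(10)[OF s] GalD(10)[OF t]
  by (intro sum.cong) (simp_all add: GalD(2,7)[OF s] GalD(2,7)[OF t] rK)
 qed
 ultimately show ?thesis by (meson inj_on_finite)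
qed

lemma Gal_fixed: "x : B ==> (!!\<sigma>. \<sigma> : Gal K ==> \<sigma> x = x) ==> x : A"
 using gal unfolding finite_galois_def A_def B_def by blast

text \<open>The product runs over the group and not over the orbit, so conjugates count with
  multiplicity and the degree is always the order of the group.\<close>

definition orbit_poly :: "'l => 'l poly" where
 "orbit_poly x = (\<Prod>\<sigma>\<in>Gal K. [:- \<sigma> x, 1:])"

lemma coeff_prod_closed:
 assumes C: "subring_of C" and "!!i. i : X ==> a i : C"
 shows "pcoeff (\<Prod>i\<in>X. [:- a i, 1:]) j : C"
 using assms(2)
proof (induction X arbitrary: j rule: infinite_finite_induct)
 case (insert i X)
 note Cc = subring_ofD[OF C]
 have "pcoeff (\<Prod>i\<in>insert i X. [:- a i, 1:]) j =
  - a i * pcoeff (\<Prod>i\<in>X. [:- a i, 1:]) j + (case j of 0 => 0 | Suc j => pcoeff (\<Prod>i\<in>X. [:- a i, 1:]) j)"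
  using insert(1,2) by (simp add: coeff_pCons split: nat.splits)
 thus ?case using insert by (auto intro!: Cc(1) Cc(2) Cc(3) Cc(5,9) split: nat.splits)
qed (use subring_ofD(5,6)[OF C] in \<open>auto simp: coeff_1\<close>)

lemma orbit_poly:
 assumes x: "x : B"
 shows "pcoeff (orbit_poly x) j : A" "poly (orbit_poly x) x = 0" "degree (orbit_poly x) = card (Gal K)"
  "lead_coeff (orbit_poly x) = 1" "poly (orbit_poly x) y = (\<Prod>\<sigma>\<in>Gal K. y - \<sigma> x)"
proof -
 show py: "poly (orbit_poly x) y = (\<Prod>\<sigma>\<in>Gal K. y - \<sigma> x)" for y by (simp add: orbit_poly_def poly_prod)
 show "poly (orbit_poly x) x = 0"
  unfolding py using finite_Gal Gal_id by (intro prod_zero) (auto intro: bexI[of _ id])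
 show "degree (orbit_poly x) = card (Gal K)"
  unfolding orbit_poly_def by (subst degree_prod_eq_sum_degree) auto
 show "lead_coeff (orbit_poly x) = 1" unfolding orbit_poly_def by (simp add: lead_coeff_prod)
 show "pcoeff (orbit_poly x) j : A"
 proof (rule Gal_fixed)
  show "pcoeff (orbit_poly x) j : B"
  unfolding orbit_poly_def by (rule coeff_prod_closed[OF subring_B]) (rule Gal_B[OF _ x])
  fix \<tau> assume t: "\<tau> : Gal K"
  interpret t: field_hom \<tau> using t by (simp add: Gal_def)
  interpret tp: map_poly_comm_ring_hom \<tau> ..
  obtain \<tau>' where t': "\<tau>' : Gal K" "\<tau> \<circ> \<tau>' = id" "\<tau>' \<circ> \<tau> = id" using Gal_inv[OF t] by metis
  have "map_poly \<tau> (orbit_poly x) = (\<Prod>\<sigma>\<in>Gal K. [:- \<tau> (\<sigma> x), 1:])"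
  unfolding orbit_poly_def by (simp add: tp.hom_prod map_poly_pCons_hom0 t.hom_uminus)
  also have "... = orbit_poly x" unfolding orbit_poly_def
  by (rule prod.reindex_bij_witness[of _ "%\<sigma>. \<tau>' \<circ> \<sigma>" "%\<sigma>. \<tau> \<circ> \<sigma>"])
   (use t' in \<open>auto simp: Gal_comp t o_assoc[symmetric] fun_eq_iff\<close>)
  finally have "pcoeff (map_poly \<tau> (orbit_poly x)) j = pcoeff (orbit_poly x) j" by simp
  thus "\<tau> (pcoeff (orbit_poly x) j) = pcoeff (orbit_poly x) j" by (simp add: coeff_map_poly)
 qed
qed

end

section \<open>Finite subfields\<close>

context finite_field_ext
begin

text \<open>As a space over k, S has q^r elements. The product of the nonzero ones shows that each
  satisfies x^(q^r) = x, and this equation has at most as many solutions as S has elements.\<close>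

lemma finite_subring_card:
 fixes S :: "'e set"
 assumes fin: "finite S" and em: "!!c. em c : S" and add: "!!x y. x : S ==> y : S ==> x + y : S"
  and mult: "!!x y. x : S ==> y : S ==> x * y : S"
 shows "EX r>=1. S = {x. x ^ (q ^ r) = x} & card S = q ^ r"
proof -
 have S01: "0 : S" "1 : S" using em[of 0] em[of 1] by simp_all
 define M :: "('k, 'e) module" where
  "M = \<lparr>carrier = S, monoid.mult = (*), one = 1, zero = 0, add = (+), module.smult = (%c x. em c * x)\<rparr>"
 have Ms [simp]: "carrier M = S" "\<zero>\<^bsub>M\<^esub> = 0" "x \<oplus>\<^bsub>M\<^esub> y = x + y" "c \<odot>\<^bsub>M\<^esub> x = em c * x" for x y c
  by (simp_all add: M_def)
 have vs: "vectorspace class_ring M"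
 proof (rule vs_criteria)
  show "field (class_ring :: 'k ring)" by (rule class_field)
  show "ALL v:carrier M. EX w:carrier M. v \<oplus>\<^bsub>M\<^esub> w = \<zero>\<^bsub>M\<^esub>"
  proof
  fix v assume "v : carrier M"
  thus "EX w:carrier M. v \<oplus>\<^bsub>M\<^esub> w = \<zero>\<^bsub>M\<^esub>"
   using mult[OF em[of "-1"], of v] by (intro bexI[of _ "- v"]) (simp_all add: em.hom_uminus)
  qed
 qed (use S01 add mult em in \<open>auto simp: em.hom_add em.hom_mult algebra_simps\<close>)
 have "finite (carrier M)" using fin by simp
 from coords_exists[OF vs finite_vectorspace_fin_dim[OF vs this]] obtain r T where c: "coords M r T" by metis
 have card: "card S = q ^ r" using coords_card(2)[OF c] by (simp add: q)
 have "card {0, 1 :: 'e} <= card S" using fin S01 by (intro card_mono) auto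
 hence r: "r >= 1" using card by (cases r) auto
 have "x ^ (q ^ r) = x" if x: "x : S" for x
 proof (cases "x = 0")
  case False
  have inj: "inj_on ((*) x) (S - {0})" using False by (auto intro: inj_onI)
  have "(*) x ` (S - {0}) <= S - {0}" using mult[OF x] False by auto
  hence im: "(*) x ` (S - {0}) = S - {0}" using fin inj by (intro endo_inj_surj) auto
  have "(\<Prod>y\<in>S - {0}. y) = (\<Prod>y\<in>(*) x ` (S - {0}). y)" by (simp only: im)
  also have "... = (\<Prod>y\<in>S - {0}. x * y)" by (simp add: prod.reindex[OF inj])
  also have "... = x ^ (card (S - {0})) * (\<Prod>y\<in>S - {0}. y)" by (simp add: prod.distrib)
  finally have "x ^ card (S - {0}) = 1" using fin by simp
  moreover have "q ^ r = Suc (card (S - {0}))" using fin S01 card card_gt_0_iff[of S] by (auto simp: card_Diff_singleton)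
  ultimately show ?thesis by simp
 qed (simp add: power_0_left)
 hence "S <= {x. x ^ (q ^ r) = x}" by auto
 moreover have "card {x::'e. x ^ (q ^ r) = x} <= card S" "finite {x::'e. x ^ (q ^ r) = x}" using finite_roots_q[OF r] card by auto
 ultimately have "S = {x. x ^ (q ^ r) = x}" by (intro card_seteq) auto
 thus ?thesis using r card by blast
qed

lemma hom_q_power: "comm_ring_hom (%x::'e. x ^ (q ^ i))"
 by standard (simp_all add: q_power_add power_mult_distrib power_0_left)

text \<open>Write r = d j + s with s < d. All q^d elements of the smaller field are fixed by the
  q^s-power, which for s > 0 has at most q^s fixed elements.\<close>

lemma degree_dvd:
 assumes d: "d >= 1" and r: "r >= 1" and card: "card {x::'e. x ^ (q ^ d) = x} = q ^ d"
  and sub: "{x::'e. x ^ (q ^ d) = x} <= {x. x ^ (q ^ r) = x}"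
 shows "r = d * (r div d)" "r div d >= 1"
proof -
 define s where "s = r mod d"
 have sd: "s < d" using d by (simp add: s_def)
 have "s = 0"
 proof (rule ccontr)
  assume s0: "s ~= 0"
  have it: "x ^ (q ^ (d * j)) = x" if x: "x ^ (q ^ d) = x" for x :: 'e and j
  proof (induction j)
  case (Suc j)
  have "x ^ (q ^ (d * Suc j)) = (x ^ (q ^ (d * j))) ^ (q ^ d)" by (simp add: q_power_power add.commute)
  thus ?case using Suc x by simp
  qed simp
  have "x ^ (q ^ s) = x" if x: "x ^ (q ^ d) = x" for x :: 'e
  proof -
  have "x = x ^ (q ^ (d * (r div d) + s))" using sub x by (auto simp: s_def)
  also have "... = (x ^ (q ^ (d * (r div d)))) ^ (q ^ s)" by (simp only: q_power_power)
  finally show ?thesis using it[OF x] by simp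
  qed
  hence "{x::'e. x ^ (q ^ d) = x} <= {x. x ^ (q ^ s) = x}" by auto
  moreover have fs: "finite {x::'e. x ^ (q ^ s) = x} & card {x::'e. x ^ (q ^ s) = x} <= q ^ s"
  by (rule finite_roots_q) (use s0 in simp)
  ultimately have "card {x::'e. x ^ (q ^ d) = x} <= card {x::'e. x ^ (q ^ s) = x}" by (intro card_mono) simp_all
  hence "q ^ d <= q ^ s" using fs card by simp
  thus False using sd q_ge by simp
 qed
 thus "r = d * (r div d)" by (simp add: s_def dvd_eq_mod_eq_0[symmetric])
 thus "r div d >= 1" using r by (cases "r div d") auto
qed

end

lemma card_image_eq: "(!!x y. x : S ==> y : S ==> f x = f y \<longleftrightarrow> g x = g y) ==> card (f ` S) = card (g ` S)"
proof (rule bij_betw_same_card[of "%v. g (inv_into S f v)"])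
 assume a: "!!x y. x : S ==> y : S ==> f x = f y \<longleftrightarrow> g x = g y"
 have e: "g (inv_into S f (f x)) = g x" if "x : S" for x
  using a[OF inv_into_into[of "f x" f S] that] that f_inv_into_f[of "f x" f S] by simp
 show "bij_betw (%v. g (inv_into S f v)) (f ` S) (g ` S)"
  unfolding bij_betw_def
 proof
  show "inj_on (%v. g (inv_into S f v)) (f ` S)" using a by (auto intro!: inj_onI simp: e)
  show "(%v. g (inv_into S f v)) ` f ` S = g ` S" unfolding image_image by (rule image_cong) (simp_all add: e)
 qed
qed

section \<open>Cosets\<close>

definition cs :: "'l::field set => 'l => 'l set" where "cs I x = (%h. h + x) ` I"

lemma cs_mem: "y : cs I x \<longleftrightarrow> y - x : I"
 unfolding cs_def by (auto simp: image_iff) (metis diff_add_cancel)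

lemma quot_cs:
 fixes I :: "'l::field set"
 assumes I: "ideal I ((ring_on C))"
 shows "I +>\<^bsub>class_ring\<lparr>carrier := C\<rparr>\<^esub> x = cs I x"
  "carrier (class_ring\<lparr>carrier := C\<rparr> Quot I) = cs I ` C"
  "x : C ==> y : C ==> cs I x \<oplus>\<^bsub>class_ring\<lparr>carrier := C\<rparr> Quot I\<^esub> cs I y = cs I (x + y)"
  "x : C ==> y : C ==> cs I x \<otimes>\<^bsub>class_ring\<lparr>carrier := C\<rparr> Quot I\<^esub> cs I y = cs I (x * y)"
  "\<zero>\<^bsub>class_ring\<lparr>carrier := C\<rparr> Quot I\<^esub> = cs I 0" "\<one>\<^bsub>class_ring\<lparr>carrier := C\<rparr> Quot I\<^esub> = cs I 1"
proof -
 interpret I: ideal I "(ring_on C)" by (rule I)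
 show c: "I +>\<^bsub>class_ring\<lparr>carrier := C\<rparr>\<^esub> x = cs I x" for x unfolding a_r_coset_def' cs_def by auto
 show "carrier (class_ring\<lparr>carrier := C\<rparr> Quot I) = cs I ` C"
  unfolding FactRing_def A_RCOSETS_def' c by auto
 show "cs I x \<oplus>\<^bsub>class_ring\<lparr>carrier := C\<rparr> Quot I\<^esub> cs I y = cs I (x + y)" if "x : C" "y : C"
  using I.a_rcos_sum[of x y] that unfolding c by (simp add: FactRing_def)
 show "cs I x \<otimes>\<^bsub>class_ring\<lparr>carrier := C\<rparr> Quot I\<^esub> cs I y = cs I (x * y)" if "x : C" "y : C"
  using I.rcoset_mult_add[of x y] that unfolding c by (simp add: FactRing_def)
 show "\<zero>\<^bsub>class_ring\<lparr>carrier := C\<rparr> Quot I\<^esub> = cs I 0" by (simp add: FactRing_def cs_def)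
 show "\<one>\<^bsub>class_ring\<lparr>carrier := C\<rparr> Quot I\<^esub> = cs I 1" using c[of 1] by (simp add: FactRing_def)
qed

context function_field
begin

lemma ideal_subset:
 assumes C: "subring_of C" and J: "J <= C" "0 : J" "!!x y. x : J ==> y : J ==> x + y : J" "!!c x. c : C ==> x : J ==> c * x : J"
 shows "ideal J ((ring_on C))"
proof -
 let ?R = "(ring_on C)"
 interpret R: cring ?R by (rule cring_subring[OF C])
 have minus: "- x : J" if "x : J" for x using J(4)[OF subring_ofD(9)[OF C subring_ofD(6)[OF C]] that] by simp
 have J5: "x * c : J" if "c : C" "x : J" for c x using J(4)[OF that] by (simp add: mult.commute)
 show ?thesis
 proof (rule idealI)
  show "ring ?R" by (rule R.ring_axioms)
  show "subgroup J (add_monoid ?R)"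
  proof
  fix x assume x: "x : J"
  have "\<ominus>\<^bsub>?R\<^esub> x = - x"
   by (rule R.minus_equality) (use x J(1) minus in auto)
  thus "inv\<^bsub>add_monoid ?R\<^esub> x : J" using minus[OF x] by (simp add: a_inv_def)
  qed (use J in auto)
 qed (simp_all add: J(4) J5)
qed

lemma ideal_closed:
 assumes C: "subring_of C" and I: "ideal I ((ring_on C))"
 shows "x : I ==> x : C" "0 : I" "x : I ==> y : I ==> x + y : I" "c : C ==> x : I ==> c * x : I"
  "x : I ==> y : I ==> x - y : I" "cs I x = cs I y \<longleftrightarrow> x - y : I"
proof -
 interpret I: ideal I "(ring_on C)" by (rule I)
 show "x : I ==> x : C" for x using I.a_subset by auto
 show 0: "0 : I" using additive_subgroup.zero_closed[OF ideal.axioms(1)[OF I.ideal_axioms]] by simp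
 show add: "x : I ==> y : I ==> x + y : I" for x y using additive_subgroup.a_closed[OF ideal.axioms(1)[OF I.ideal_axioms], of x y] by simp
 show mult: "c : C ==> x : I ==> c * x : I" for c x using I.I_l_closed[of x c] by simp
 have minus: "- x : I" if "x : I" for x using mult[OF subring_ofD(9)[OF C subring_ofD(6)[OF C]] that] by simp
 show diff: "x : I ==> y : I ==> x - y : I" for x y using add[of x "- y"] minus by simp
 show "cs I x = cs I y \<longleftrightarrow> x - y : I"
 proof
  assume "cs I x = cs I y"
  moreover have "x : cs I x" using 0 by (simp add: cs_mem)
  ultimately show "x - y : I" by (simp add: cs_mem)
 next
  assume xy: "x - y : I"
  have "w - x : I \<longleftrightarrow> w - y : I" for w using add[OF _ xy, of "w - x"] diff[OF _ xy, of "w - y"] by auto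
  thus "cs I x = cs I y" by (auto simp: cs_mem)
 qed
qed

end

section \<open>Residue fields, decomposition group and Frobenius at a prime\<close>

locale prime_above = function_field iL z K for iL :: "'k::{field,finite} => 'l::field" and z K +
 fixes p P :: "'l set"
 assumes p: "p : max_ideals A_ring" and PP: "P : primes_above A_ring B_ring p"
begin

definition q :: nat where "q = card (UNIV :: 'k set)"

sublocale em: finite_field_ext "to_ac :: 'k => 'k alg_closure" q
 by standard (simp_all add: q_def)

lemma P_primeideal: "primeideal P B_ring" and P_A: "P \<inter> A = p"
 using PP by (auto simp: primes_above_def)

lemma P_prime: "prime_of B P"
 using primeideal_prime_of[OF subring_B, of P] P_primeideal by (simp add: ring_eq)

lemmas Pc = prime_of_closed[OF subring_B P_prime]

lemma p_sub: "p <= P" "p <= A" using P_A by auto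

lemma ex_u: "EX u. u ~= 0 & ev u : P" using max_contains_ev[OF p] p_sub by (metis subsetD)

definition \<chi> :: "'l => 'k alg_closure" where "\<chi> = (SOME \<chi>. residue_map P \<chi>)"

lemma residue_map_\<chi>: "residue_map P \<chi>"
proof -
 obtain u where "u ~= 0" "ev u : P" using ex_u by blast
 hence "EX \<chi>. residue_map P \<chi>" by (rule residue_map_exists[OF P_primeideal])
 thus ?thesis unfolding \<chi>_def by (rule someI_ex)
qed

lemma \<chi>_add: "x : B ==> y : B ==> \<chi> (x + y) = \<chi> x + \<chi> y"
 and \<chi>_mult: "x : B ==> y : B ==> \<chi> (x * y) = \<chi> x * \<chi> y"
 and \<chi>_0_iff: "x : B ==> \<chi> x = 0 \<longleftrightarrow> x : P"
 and \<chi>_iL: "\<chi> (iL c) = to_ac c"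
 using residue_map_\<chi> by (auto simp: residue_map_def)

lemma \<chi>_01 [simp]: "\<chi> 0 = 0" "\<chi> 1 = 1" using \<chi>_iL[of 0] \<chi>_iL[of 1] by simp_all

lemma \<chi>_diff: "x : B ==> y : B ==> \<chi> (x - y) = \<chi> x - \<chi> y"
 using \<chi>_add[of "x - y" y] B_closed(2)[of x y] by simp

lemma \<chi>_power: "x : B ==> \<chi> (x ^ k) = \<chi> x ^ k"
 by (induction k) (simp_all add: \<chi>_mult B_closed(10))

lemma \<chi>_sum: "(!!i. i : X ==> f i : B) ==> \<chi> (sum f X) = (\<Sum>i\<in>X. \<chi> (f i))"
 by (induction X rule: infinite_finite_induct) (simp_all add: \<chi>_add B_closed(11))

lemma \<chi>_eq_iff: "x : B ==> y : B ==> \<chi> x = \<chi> y \<longleftrightarrow> x - y : P"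
 using \<chi>_0_iff[of "x - y"] \<chi>_diff[of x y] B_closed(2)[of x y] by auto

lemma AB: "x : A ==> x : B" using A_subset_B by auto

definition E :: "'k alg_closure set" where "E = \<chi> ` B"
definition \<kappa> :: "'k alg_closure set" where "\<kappa> = \<chi> ` A"

lemma finite_E: "finite E"
proof -
 obtain u where u: "u ~= 0" "ev u : P" using ex_u by blast
 obtain X where X: "finite X" "X <= B" "!!x. x : B ==> EX y:X. x - y : P"
  using finite_quotient[OF subring_B P_prime u] by metis
 have "E <= \<chi> ` X"
 proof
  fix w assume "w : E"
  then obtain x where x: "x : B" "w = \<chi> x" by (auto simp: E_def)
  then obtain y where "y : X" "x - y : P" using X(3) by blast
  thus "w : \<chi> ` X" using \<chi>_eq_iff[of x y] x X(2) by auto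
 qed
 thus ?thesis using X(1) finite_surj by blast
qed

lemma image_closed:
 assumes C: "subring_of C" and sub: "C <= B"
 shows "to_ac c : \<chi> ` C" "x : \<chi> ` C ==> y : \<chi> ` C ==> x + y : \<chi> ` C"
  "x : \<chi> ` C ==> y : \<chi> ` C ==> x * y : \<chi> ` C"
proof -
 show "to_ac c : \<chi> ` C" unfolding \<chi>_iL[symmetric] by (rule imageI[OF subring_ofD(8)[OF C]])
 assume "x : \<chi> ` C" "y : \<chi> ` C"
 then obtain a b where ab: "a : C" "b : C" "x = \<chi> a" "y = \<chi> b" by blast
 have aB: "a : B" "b : B" using ab sub by blast+
 show "x + y : \<chi> ` C" unfolding ab(3,4) \<chi>_add[OF aB, symmetric] by (rule imageI[OF subring_ofD(1)[OF C ab(1,2)]])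
 show "x * y : \<chi> ` C" unfolding ab(3,4) \<chi>_mult[OF aB, symmetric] by (rule imageI[OF subring_ofD(3)[OF C ab(1,2)]])
qed

lemma ex_r: "EX r>=1. E = {x. x ^ (q ^ r) = x} & card E = q ^ r"
 by (rule em.finite_subring_card[OF finite_E]; unfold E_def; rule image_closed[OF subring_B order_refl]; assumption)

lemma ex_d: "EX d>=1. \<kappa> = {x. x ^ (q ^ d) = x} & card \<kappa> = q ^ d"
proof -
 have "\<kappa> <= E" unfolding E_def \<kappa>_def by (rule image_mono[OF A_subset_B])
 hence fin: "finite \<kappa>" using finite_E by (rule finite_subset)
 show ?thesis
  by (rule em.finite_subring_card[OF fin]; unfold \<kappa>_def; rule image_closed[OF subring_A A_subset_B]; assumption)
qed

text \<open>\<open>r\<close> and \<open>d\<close> are the degrees over k of the residue fields at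
  \<open>P\<close> and at \<open>p\<close>, \<open>f\<close> is the relative degree, and
  \<open>Q\<close> is the size of the residue field at \<open>p\<close>; \<open>ex_r\<close> and
  \<open>ex_d\<close> justify the choices.\<close>

definition r :: nat where "r = (SOME r. r >= 1 & E = {x. x ^ (q ^ r) = x} & card E = q ^ r)"
definition d :: nat where "d = (SOME d. d >= 1 & \<kappa> = {x. x ^ (q ^ d) = x} & card \<kappa> = q ^ d)"
definition f :: nat where "f = r div d"
definition Q :: nat where "Q = q ^ d"

lemma r_props: "r >= 1" "E = {x. x ^ (q ^ r) = x}" "card E = q ^ r"
proof -
 have e: "r >= 1 & E = {x. x ^ (q ^ r) = x} & card E = q ^ r" unfolding r_def by (rule someI_ex[OF ex_r])
 show "r >= 1" "E = {x. x ^ (q ^ r) = x}" "card E = q ^ r"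
  by (rule conjunct1[OF e], rule conjunct1[OF conjunct2[OF e]], rule conjunct2[OF conjunct2[OF e]])
qed

lemma d_props: "d >= 1" "\<kappa> = {x. x ^ (q ^ d) = x}" "card \<kappa> = q ^ d"
proof -
 have e: "d >= 1 & \<kappa> = {x. x ^ (q ^ d) = x} & card \<kappa> = q ^ d" unfolding d_def by (rule someI_ex[OF ex_d])
 show "d >= 1" "\<kappa> = {x. x ^ (q ^ d) = x}" "card \<kappa> = q ^ d"
  by (rule conjunct1[OF e], rule conjunct1[OF conjunct2[OF e]], rule conjunct2[OF conjunct2[OF e]])
qed

lemma rdf: "r = d * f" "f >= 1"
proof -
 have "\<kappa> <= E" unfolding E_def \<kappa>_def by (rule image_mono[OF A_subset_B])
 hence sub: "{x :: 'k alg_closure. x ^ (q ^ d) = x} <= {x. x ^ (q ^ r) = x}" unfolding d_props(2) r_props(2) .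
 have card: "card {x::'k alg_closure. x ^ (q ^ d) = x} = q ^ d" using d_props(3) unfolding d_props(2) .
 show "r = d * f" "f >= 1" unfolding f_def
  using em.degree_dvd[OF d_props(1) r_props(1) card sub] by simp_all
qed

lemma p_ideal: "ideal p ((ring_on A))"
 using p by (simp add: max_ideals_def maximalideal_def ring_eq)

text \<open>Identifies the exponent in \<open>frobenius_coset\<close>, which refers to the quotient
  record, with \<open>Q\<close>; elements of A are congruent modulo p if and only if they are so
  modulo \<open>P\<close>.\<close>

lemma card_residue_field: "card (carrier (A_ring Quot p)) = Q"
proof -
 have "card (cs p ` A) = card (\<chi> ` A)"
 proof (rule card_image_eq)
  fix x y assume xy: "x : A" "y : A"
  have "x - y : p \<longleftrightarrow> x - y : P" using P_A A_closed(2)[OF xy] by blast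
  thus "cs p x = cs p y \<longleftrightarrow> \<chi> x = \<chi> y"
  using ideal_closed(6)[OF subring_A p_ideal] \<chi>_eq_iff[OF AB AB] xy by simp
 qed
 thus ?thesis using d_props(3) unfolding ring_eq quot_cs(2)[OF p_ideal] by (simp add: \<kappa>_def Q_def)
qed

lemma \<chi>_E: "x : B ==> \<chi> x ^ (q ^ r) = \<chi> x" using r_props(2) unfolding E_def by blast
lemma \<chi>_A: "x : A ==> \<chi> x ^ Q = \<chi> x" using d_props(2) unfolding \<kappa>_def Q_def by blast

definition D :: "('l => 'l) set" where "D = decomposition_group K P"
definition In :: "('l => 'l) set" where "In = inertia_group B_ring K P"

lemma D_Gal: "\<sigma> : D ==> \<sigma> : Gal K" by (simp add: D_def decomposition_group_def)

lemma D_P: "\<sigma> : D ==> x : P ==> \<sigma> x : P" by (auto simp: D_def decomposition_group_def)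

lemma D_id: "id : D" using Gal_id by (simp add: D_def decomposition_group_def)

lemma D_comp: "\<sigma> : D ==> \<tau> : D ==> \<sigma> \<circ> \<tau> : D"
proof -
 assume s: "\<sigma> : D" and t: "\<tau> : D"
 have "(\<sigma> \<circ> \<tau>) ` P = \<sigma> ` (\<tau> ` P)" by (rule image_comp[symmetric])
 thus ?thesis using s t by (simp add: D_def decomposition_group_def Gal_comp)
qed

text \<open>One inclusion is enough: if the preimage of some y in \<open>P\<close> were outside
  \<open>P\<close>, a power of it would be 1 modulo \<open>P\<close>, and applying \<sigma> would
  make a power of y both 1 and 0 modulo \<open>P\<close>.\<close>

lemma D_mem:
 assumes s: "\<sigma> : Gal K" and sP: "!!x. x : P ==> \<sigma> x : P"
 shows "\<sigma> : D"
proof -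
 have "y : \<sigma> ` P" if y: "y : P" for y
 proof -
  obtain \<tau> where t: "\<tau> : Gal K" "\<sigma> \<circ> \<tau> = id" using Gal_inv[OF s] by metis
  have st: "\<sigma> (\<tau> y) = y" using t(2) by (simp add: fun_eq_iff)
  have xB: "\<tau> y : B" by (rule Gal_B[OF t(1) Pc(3)[OF y]])
  have "\<tau> y : P"
  proof (rule ccontr)
  assume n: "\<tau> y ~: P"
  obtain u where u: "u ~= 0" "ev u : P" using ex_u by blast
  obtain N where N: "N >= 1" "\<tau> y ^ N - 1 : P" using order_mod_prime[OF subring_B P_prime u xB n] by metis
  have "y ^ N - 1 : P" using sP[OF N(2)] by (simp add: GalD[OF s] st)
  moreover have "y ^ N : P" using N(1) Pc(5)[OF B_closed(10)[OF Pc(3)[OF y]] y, of "N - 1"] by (cases N) auto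
  ultimately show False using Pc(2)[of "y ^ N" "y ^ N - 1"] Pc(7) by simp
  qed
  thus ?thesis using st by (metis imageI)
 qed
 thus ?thesis using s sP by (auto simp: D_def decomposition_group_def)
qed

lemma D_inv:
 assumes "\<sigma> : D" "\<tau> : Gal K" "\<tau> \<circ> \<sigma> = id"
 shows "\<tau> : D"
proof (rule D_mem[OF assms(2)])
 fix x assume "x : P"
 then obtain y where "y : P" "x = \<sigma> y" using assms(1) by (auto simp: D_def decomposition_group_def)
 thus "\<tau> x : P" using assms(3) by (simp add: fun_eq_iff)
qed

text \<open>For each \<sigma> outside \<open>D\<close> some element lies outside \<open>P\<close>
  while its image under \<sigma> lies in \<open>P\<close>. The product of these is nonzero modulo
  \<open>P\<close> and sent into \<open>P\<close> by each such \<sigma>; a suitable power is 1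
  modulo \<open>P\<close>, and the elements of \<open>D\<close> preserve this.\<close>

lemma ex_idempotent:
 obtains a where "a : B" "!!\<sigma>. \<sigma> : Gal K ==> \<chi> (\<sigma> a) = (if \<sigma> : D then 1 else 0)"
proof -
 have "EX a:B. a ~: P & \<sigma> a : P" if s: "\<sigma> : Gal K" "\<sigma> ~: D" for \<sigma>
 proof -
  obtain \<tau> where t: "\<tau> : Gal K" "\<sigma> \<circ> \<tau> = id" using Gal_inv[OF s(1)] by metis
  have "\<tau> ~: D" using D_inv[OF _ s(1) t(2)] s(2) by blast
  then obtain x where x: "x : P" "\<tau> x ~: P" using D_mem[OF t(1)] by blast
  have "\<sigma> (\<tau> x) = x" using t(2) by (simp add: fun_eq_iff)
  thus ?thesis using x Gal_B[OF t(1) Pc(3)[OF x(1)]] by (intro bexI[of _ "\<tau> x"]) auto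
 qed
 then obtain a where a: "!!\<sigma>. \<sigma> : Gal K ==> \<sigma> ~: D ==> a \<sigma> : B & a \<sigma> ~: P & \<sigma> (a \<sigma>) : P" by metis
 let ?S = "Gal K - D"
 have finS: "finite ?S" using finite_Gal by auto
 have prodB: "prod h X : B" if "!!i. i : X ==> h i : B" for h :: "('l => 'l) => 'l" and X
  using that by (induction X rule: infinite_finite_induct) (auto intro: B_closed(3,6))
 define b where "b = prod a ?S"
 have bB: "b : B" unfolding b_def by (rule prodB) (use a in auto)
 have "prod a X ~: P" if "X <= ?S" for X
 proof -
  have "finite X" using that finS finite_subset by blast
  thus ?thesis using that
  proof (induction X rule: finite_induct)
  case (insert s X)
  have "a s : B" "prod a X : B" "a s ~: P" "prod a X ~: P" using insert a by (auto intro!: prodB)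
  thus ?case using Pc(8)[of "a s" "prod a X"] insert(1,2) by auto
  qed (use Pc(7) in simp)
 qed
 hence bP: "b ~: P" unfolding b_def by blast
 have sb: "\<sigma> b : P" if s: "\<sigma> : ?S" for \<sigma>
 proof -
  have sG: "\<sigma> : Gal K" using s by auto
  have "b = a \<sigma> * prod a (?S - {\<sigma>})" unfolding b_def by (rule prod.remove[OF finS s])
  hence "\<sigma> b = \<sigma> (prod a (?S - {\<sigma>})) * \<sigma> (a \<sigma>)" by (simp add: GalD(2)[OF sG] mult.commute)
  moreover have "\<sigma> (prod a (?S - {\<sigma>})) : B" by (rule Gal_B[OF sG prodB]) (use a in auto)
  ultimately show ?thesis using Pc(4) a[of \<sigma>] s by auto
 qed
 obtain u where u: "u ~= 0" "ev u : P" using ex_u by blast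
 obtain N where N: "N >= 1" "b ^ N - 1 : P" using order_mod_prime[OF subring_B P_prime u bB bP] by metis
 have bN: "b ^ N : B" by (rule B_closed(10)[OF bB])
 have "\<chi> (\<sigma> (b ^ N)) = (if \<sigma> : D then 1 else 0)" if s: "\<sigma> : Gal K" for \<sigma>
 proof (cases "\<sigma> : D")
  case True
  have "\<sigma> (b ^ N) - 1 : P" using D_P[OF True N(2)] by (simp add: GalD[OF s])
  thus ?thesis using True \<chi>_eq_iff[OF Gal_B[OF s bN] B_closed(6)] by simp
 next
  case False
  have "\<chi> (\<sigma> b) = 0" using sb[of \<sigma>] s False \<chi>_0_iff[OF Gal_B[OF s bB]] by simp
  thus ?thesis using False N(1) by (simp add: GalD[OF s] \<chi>_power[OF Gal_B[OF s bB]] power_0_left)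
 qed
 thus ?thesis using that bN by blast
qed

lemma prime_prod:
 assumes "finite X" "!!i. i : X ==> h i : B" "prod h X : P"
 shows "EX i:X. h i : P"
 using assms
proof (induction X rule: finite_induct)
 case (insert i X)
 have "prod h X : B" using insert(4) by (induction X rule: infinite_finite_induct) (auto intro: B_closed(3,6))
 thus ?case using insert Pc(8)[of "h i" "prod h X"] by auto
qed (use Pc(7) in simp)

text \<open>When the powers of y represent all nonzero residues, the action of \<sigma> on residues
  is known once it is known at y; a positive exponent takes care of the residue 0.\<close>

lemma power_lift:
 assumes g: "!!x. x : B ==> x ~: P ==> EX i. x - y ^ i : P" and y: "y : B" and s: "\<sigma> : D"
  and sy: "\<chi> (\<sigma> y) = \<chi> y ^ k" and k: "k >= 1" and x: "x : B"
 shows "\<chi> (\<sigma> x) = \<chi> x ^ k"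
proof (cases "x : P")
 case True
 thus ?thesis using D_P[OF s True] \<chi>_0_iff[OF x] \<chi>_0_iff[OF Gal_B[OF D_Gal[OF s] x]] k by (simp add: power_0_left)
next
 case False
 obtain i where i: "x - y ^ i : P" using g[OF x False] by blast
 note sD = GalD[OF D_Gal[OF s]] and sB = Gal_B[OF D_Gal[OF s]]
 have "\<sigma> x - \<sigma> y ^ i : P" using D_P[OF s i] by (simp add: sD)
 hence "\<chi> (\<sigma> x) = \<chi> (\<sigma> y ^ i)" using \<chi>_eq_iff[OF sB[OF x] B_closed(10)[OF sB[OF y]]] by simp
 also have "... = (\<chi> y ^ i) ^ k" by (simp add: \<chi>_power[OF sB[OF y]] sy power_mult[symmetric] mult.commute)
 finally have fin: "\<chi> (\<sigma> x) = (\<chi> y ^ i) ^ k" .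
 have "\<chi> x = \<chi> (y ^ i)" using \<chi>_eq_iff[OF x B_closed(10)[OF y]] i by blast
 hence "\<chi> y ^ i = \<chi> x" by (simp add: \<chi>_power[OF y])
 thus ?thesis using fin by simp
qed

lemma Q_pos: "Q >= 1" "Q ^ i >= 1" using em.q_pos by (simp_all add: Q_def Suc_leI)

text \<open>Take y with the residue of a generator and sent into \<open>P\<close> by all \<sigma>
  outside \<open>D\<close>. The polynomial with roots \<sigma> y has coefficients in A, whose
  residues the \<open>Q\<close>-power fixes, so y^Q is congruent to some \<sigma> y. This residue is
  nonzero, which forces \<sigma> into \<open>D\<close>.\<close>

lemma frobenius_exists: "EX \<phi>:D. ALL x:B. \<chi> (\<phi> x) = \<chi> x ^ Q"
proof -
 obtain u where u: "u ~= 0" "ev u : P" using ex_u by blast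
 obtain g where g: "g : B" "g ~: P" "!!x. x : B ==> x ~: P ==> EX i. x - g ^ i : P"
  using residue_generator[OF P_primeideal u] by metis
 obtain a where a: "a : B" "!!\<sigma>. \<sigma> : Gal K ==> \<chi> (\<sigma> a) = (if \<sigma> : D then 1 else 0)" using ex_idempotent by metis
 define y where "y = a * g"
 have y: "y : B" unfolding y_def by (rule B_closed(3)[OF a(1) g(1)])
 have \<chi>y: "\<chi> y = \<chi> g" using a(2)[OF Gal_id] D_id by (simp add: y_def \<chi>_mult a(1) g(1))
 have yg: "EX i. x - y ^ i : P" if x: "x : B" "x ~: P" for x
 proof -
  obtain i where "x - g ^ i : P" using g(3)[OF x] by blast
  hence "\<chi> x = \<chi> y ^ i" using \<chi>_eq_iff[OF x(1) B_closed(10)[OF g(1)]] \<chi>_power[OF g(1)] \<chi>y by simp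
  thus ?thesis using \<chi>_eq_iff[OF x(1) B_closed(10)[OF y]] \<chi>_power[OF y] by auto
 qed
 have yP: "y ~: P" using \<chi>y g(1,2) y \<chi>_0_iff by metis
 let ?o = "orbit_poly y"
 have \<chi>o: "\<chi> (poly ?o w) = (\<Sum>j\<le>degree ?o. \<chi> (pcoeff ?o j) * \<chi> w ^ j)" if w: "w : B" for w
  unfolding poly_altdef using AB[OF orbit_poly(1)[OF y]] w
  by (subst \<chi>_sum) (auto intro!: B_closed(3) B_closed(10) sum.cong simp: \<chi>_mult \<chi>_power B_closed(10))
 have yQ: "y ^ Q : B" by (rule B_closed(10)[OF y])
 have "\<chi> (poly ?o (y ^ Q)) = (\<Sum>j\<le>degree ?o. (\<chi> (pcoeff ?o j) * \<chi> y ^ j) ^ Q)"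
  unfolding \<chi>o[OF yQ] using \<chi>_A[OF orbit_poly(1)[OF y]]
  by (intro sum.cong) (simp_all add: power_mult_distrib \<chi>_power[OF y] power_mult[symmetric] mult.commute)
 also have "... = \<chi> (poly ?o y) ^ Q" unfolding \<chi>o[OF y] Q_def em.q_power_sum ..
 also have "... = 0" using orbit_poly(2)[OF y] Q_pos by (simp add: power_0_left)
 finally have "\<chi> (\<Prod>\<sigma>\<in>Gal K. y ^ Q - \<sigma> y) = 0" unfolding orbit_poly(5)[OF y] .
 moreover have "(\<Prod>\<sigma>\<in>Gal K. y ^ Q - \<sigma> y) : B"
  unfolding orbit_poly(5)[OF y, symmetric] poly_altdef
  by (rule B_closed(11), rule B_closed(3)[OF AB[OF orbit_poly(1)[OF y]] B_closed(10)[OF yQ]])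
 ultimately have "(\<Prod>\<sigma>\<in>Gal K. y ^ Q - \<sigma> y) : P" using \<chi>_0_iff by blast
 hence "EX \<sigma>:Gal K. y ^ Q - \<sigma> y : P"
  by (rule prime_prod[OF finite_Gal B_closed(2)[OF yQ Gal_B[OF _ y]], rotated])
 then obtain \<sigma> where s: "\<sigma> : Gal K" "y ^ Q - \<sigma> y : P" by blast
 hence sy: "\<chi> (\<sigma> y) = \<chi> y ^ Q" using \<chi>_eq_iff[OF yQ Gal_B[OF s(1) y]] \<chi>_power[OF y] by simp
 have sD: "\<sigma> : D"
 proof (rule ccontr)
  assume "\<sigma> ~: D"
  hence "\<chi> (\<sigma> y) = 0"
  using a(2)[OF s(1)] by (simp add: y_def GalD(2)[OF s(1)] \<chi>_mult Gal_B[OF s(1)] a(1) g(1))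
  hence "\<chi> y = 0" using sy by simp
  thus False using yP \<chi>_0_iff[OF y] by simp
 qed
 thus ?thesis using power_lift[OF yg y sD sy Q_pos(1)] by blast
qed

definition \<phi> :: "'l => 'l" where "\<phi> = frobenius A_ring B_ring K p P"

lemma \<phi>: "\<phi> : D" "x : B ==> \<chi> (\<phi> x) = \<chi> x ^ Q"
proof -
 have iff: "\<sigma> x - x ^ Q : P \<longleftrightarrow> \<chi> (\<sigma> x) = \<chi> x ^ Q" if "\<sigma> : D" "x : B" for \<sigma> x
  using \<chi>_eq_iff[OF Gal_B[OF D_Gal[OF that(1)] that(2)] B_closed(10)[OF that(2)]] \<chi>_power[OF that(2)] by simp
 have c: "frobenius_coset A_ring B_ring K p P = {\<sigma> : D. ALL x:B. \<chi> (\<sigma> x) = \<chi> x ^ Q}"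
  unfolding frobenius_coset_def card_residue_field D_def[symmetric] ring_simps
  by (rule Collect_cong) (use iff in blast)
 have "EX \<sigma>. \<sigma> : {\<sigma> : D. ALL x:B. \<chi> (\<sigma> x) = \<chi> x ^ Q}" using frobenius_exists by blast
 hence "\<phi> : {\<sigma> : D. ALL x:B. \<chi> (\<sigma> x) = \<chi> x ^ Q}"
  unfolding \<phi>_def frobenius_def c by (rule someI_ex)
 thus "\<phi> : D" "x : B ==> \<chi> (\<phi> x) = \<chi> x ^ Q" by auto
qed

lemma \<phi>_pow: "\<phi> ^^ i : D" "x : B ==> \<chi> ((\<phi> ^^ i) x) = \<chi> x ^ (Q ^ i)"
proof -
 show m: "\<phi> ^^ i : D" for i using D_id D_comp[OF \<phi>(1)] by (induction i) (auto simp: id_def)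
 show "x : B ==> \<chi> ((\<phi> ^^ i) x) = \<chi> x ^ (Q ^ i)"
  by (induction i) (simp_all add: \<phi>(2) Gal_B[OF D_Gal[OF m]] power_mult[symmetric] mult.commute)
qed

text \<open>The polynomial \<open>N\<close> whose roots are the \<open>Q\<close>-power conjugates of
  a generator has coefficients in the residue field of p. These lift to A, where \<sigma> acts
  trivially, so \<sigma> sends the generator to another root of \<open>N\<close>.\<close>

lemma decomposition_acts:
 assumes s: "\<sigma> : D"
 obtains i where "!!x. x : B ==> \<chi> (\<sigma> x) = \<chi> x ^ (Q ^ i)"
proof -
 obtain u where u: "u ~= 0" "ev u : P" using ex_u by blast
 obtain g where g: "g : B" "g ~: P" "!!x. x : B ==> x ~: P ==> EX i. x - g ^ i : P"
  using residue_generator[OF P_primeideal u] by metis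
 note sG = D_Gal[OF s]
 define \<gamma> where "\<gamma> = \<chi> g"
 interpret h: comm_ring_hom "%x :: 'k alg_closure. x ^ Q" unfolding Q_def by (rule em.hom_q_power)
 interpret hp: map_poly_comm_ring_hom "%x :: 'k alg_closure. x ^ Q" ..
 define N where "N = (\<Prod>i<f. [:- (\<gamma> ^ (Q ^ i)), 1:])"
 have "\<gamma> ^ (Q ^ f) = \<gamma>" using \<chi>_E[OF g(1)] by (simp add: \<gamma>_def Q_def rdf(1) power_mult)
 \<comment> \<open>The \<open>Q\<close>-power permutes the f roots cyclically, so it fixes the
   coefficients of \<open>N\<close>.\<close>
 hence N': "N = (\<Prod>i<f. [:- (\<gamma> ^ (Q ^ Suc i)), 1:])"
 proof -
  assume e: "\<gamma> ^ (Q ^ f) = \<gamma>"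
  obtain f' where f': "f = Suc f'" using rdf(2) by (cases f) auto
  have "N = [:- \<gamma>, 1:] * (\<Prod>i<f'. [:- (\<gamma> ^ (Q ^ Suc i)), 1:])"
  unfolding N_def f' by (subst prod.lessThan_Suc_shift) simp
  also have "... = (\<Prod>i<Suc f'. [:- (\<gamma> ^ (Q ^ Suc i)), 1:])"
  using e by (simp only: prod.lessThan_Suc f' mult.commute)
  finally show ?thesis unfolding f' .
 qed
 have "map_poly (%x. x ^ Q) N = (\<Prod>i<f. [:- (\<gamma> ^ (Q ^ Suc i)), 1:])"
  unfolding N_def by (simp add: hp.hom_prod map_poly_pCons_hom0 h.hom_uminus power_mult[symmetric] mult.commute)
 hence "map_poly (%x. x ^ Q) N = N" using N' by simp
 hence "pcoeff N j ^ Q = pcoeff N j" for j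
  using coeff_map_poly[of "%x :: 'k alg_closure. x ^ Q" N j] h.hom_zero by simp
 hence "pcoeff N j : \<kappa>" for j unfolding d_props(2) Q_def by simp
 hence "ALL j. EX c:A. \<chi> c = pcoeff N j" unfolding \<kappa>_def by (metis imageE)
 then obtain c where c: "!!j. c j : A" "!!j. \<chi> (c j) = pcoeff N j" by metis
 define M where "M w = (\<Sum>j\<le>degree N. c j * w ^ j)" for w
 have MB: "M w : B" if "w : B" for w
  unfolding M_def by (intro B_closed(11) B_closed(3) B_closed(10)[OF that] AB c)
 have \<chi>M: "\<chi> (M w) = poly N (\<chi> w)" if w: "w : B" for w
  unfolding M_def poly_altdef using AB[OF c(1)] w
  by (subst \<chi>_sum) (auto intro!: B_closed(3) B_closed(10) sum.cong simp: \<chi>_mult \<chi>_power c(2) B_closed(10))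
 have polyN: "poly N w = (\<Prod>i<f. w - \<gamma> ^ (Q ^ i))" for w by (simp add: N_def poly_prod)
 have "poly N \<gamma> = 0" unfolding polyN using rdf(2) by (intro prod_zero) (auto intro!: bexI[of _ 0])
 hence "M g : P" using \<chi>M[OF g(1)] \<chi>_0_iff[OF MB[OF g(1)]] by (simp add: \<gamma>_def)
 hence "\<sigma> (M g) : P" by (rule D_P[OF s])
 moreover have "\<sigma> (M g) = M (\<sigma> g)"
  unfolding M_def using c(1) by (simp add: GalD[OF sG] A_def)
 ultimately have "poly N (\<chi> (\<sigma> g)) = 0" using \<chi>M[OF Gal_B[OF sG g(1)]] \<chi>_0_iff[OF MB[OF Gal_B[OF sG g(1)]]] by simp
 then obtain i where "\<chi> (\<sigma> g) = \<chi> g ^ (Q ^ i)" unfolding polyN \<gamma>_def by auto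
 from power_lift[OF g(3) g(1) s this Q_pos(2)] that show ?thesis by blast
qed

lemma In_iff: "\<sigma> : In \<longleftrightarrow> \<sigma> : D & (ALL x:B. \<chi> (\<sigma> x) = \<chi> x)"
 unfolding In_def inertia_group_def D_def[symmetric] ring_simps using \<chi>_eq_iff Gal_B[OF D_Gal] by fastforce

lemma \<phi>_f: "\<phi> ^^ f : In"
 using \<phi>_pow(1)[of f] \<phi>_pow(2)[where i = f] \<chi>_E by (simp add: In_iff Q_def rdf(1) power_mult)

text \<open>\<sigma> and the i-th power of \<phi> act in the same way on residues; since the power
  map is injective, they differ by an element of inertia.\<close>

lemma decomposition_factor:
 assumes s: "\<sigma> : D" and i: "!!x. x : B ==> \<chi> (\<sigma> x) = \<chi> x ^ (Q ^ i)"
 obtains \<tau> where "\<tau> : In" "\<sigma> = (\<phi> ^^ i) \<circ> \<tau>"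
proof -
 note pG = D_Gal[OF \<phi>_pow(1)[of i]]
 obtain \<psi> where p: "\<psi> : Gal K" "(\<phi> ^^ i) \<circ> \<psi> = id" using Gal_inv[OF pG] by metis
 define \<tau> where "\<tau> = \<psi> \<circ> \<sigma>"
 have t: "\<tau> : Gal K" unfolding \<tau>_def by (rule Gal_comp[OF p(1) D_Gal[OF s]])
 have st: "\<sigma> = (\<phi> ^^ i) \<circ> \<tau>" unfolding \<tau>_def using p(2) by (simp add: o_assoc)
 have \<chi>t: "\<chi> (\<tau> x) = \<chi> x" if x: "x : B" for x
 proof -
  have "\<chi> (\<tau> x) ^ (Q ^ i) = \<chi> (\<sigma> x)" using \<phi>_pow(2)[OF Gal_B[OF t x]] st by simp
  hence "\<chi> (\<tau> x) ^ (q ^ (d * i)) = \<chi> x ^ (q ^ (d * i))" using i[OF x] by (simp add: Q_def power_mult)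
  thus ?thesis by (rule em.q_power_inj)
 qed
 have "\<tau> : D" by (rule D_mem[OF t]) (metis Pc(3) \<chi>_0_iff \<chi>t Gal_B[OF t])
 thus ?thesis using that[of \<tau>] \<chi>t st by (simp add: In_iff)
qed

text \<open>The Chinese remainder theorem for the primes above p, phrased as prescribed residues of
  all conjugates g y. By \<open>comp\<close> the values on a coset of \<open>D\<close> determine
  each other, so y is a sum with one term for each coset, localised by the element of
  \<open>ex_idempotent\<close>.\<close>

lemma crt:
 assumes w: "!!g. g : Gal K ==> w g : E"
  and comp: "!!g \<delta> i. g : Gal K ==> \<delta> : D ==> (!!x. x : B ==> \<chi> (\<delta> x) = \<chi> x ^ (Q ^ i)) ==> w (\<delta> \<circ> g) = w g ^ (Q ^ i)"
 obtains y where "y : B" "!!g. g : Gal K ==> \<chi> (g y) = w g"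
proof -
 obtain a where a: "a : B" "!!\<sigma>. \<sigma> : Gal K ==> \<chi> (\<sigma> a) = (if \<sigma> : D then 1 else 0)" using ex_idempotent by metis
 define cl where "cl g = (%\<delta>. \<delta> \<circ> g) ` D" for g :: "'l => 'l"
 define rep where "rep g = (SOME x. x : cl g)" for g
 have rep: "rep g : cl g" for g unfolding rep_def by (rule someI[of _ "id \<circ> g"]) (unfold cl_def, rule imageI[OF D_id])
 have cl_eq: "cl h = cl g" if h: "h : cl g" for g h
 proof -
  obtain \<delta> where \<delta>: "\<delta> : D" "h = \<delta> \<circ> g" using h by (auto simp: cl_def)
  obtain \<epsilon> where \<epsilon>: "\<epsilon> : Gal K" "\<epsilon> \<circ> \<delta> = id" using Gal_inv[OF D_Gal[OF \<delta>(1)]] by metis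
  have \<epsilon>D: "\<epsilon> : D" by (rule D_inv[OF \<delta>(1) \<epsilon>])
  show ?thesis
  proof (intro subset_antisym subsetI)
  fix x assume "x : cl h"
  then obtain \<theta> where "\<theta> : D" "x = \<theta> \<circ> (\<delta> \<circ> g)" using \<delta> by (auto simp: cl_def)
  thus "x : cl g" unfolding cl_def o_assoc using D_comp[OF _ \<delta>(1)] by blast
  next
  fix x assume "x : cl g"
  then obtain \<theta> where t: "\<theta> : D" "x = \<theta> \<circ> g" by (auto simp: cl_def)
  have "x = (\<theta> \<circ> \<epsilon>) \<circ> h" unfolding t \<delta> using \<epsilon>(2) by (metis comp_id o_assoc)
  thus "x : cl h" unfolding cl_def using D_comp[OF t(1) \<epsilon>D] by blast
  qed
 qed
 define T where "T = rep ` Gal K"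
 have finT: "finite T" using finite_Gal by (simp add: T_def)
 have TG: "t : Gal K" if tT: "t : T" for t
 proof -
  obtain g where g: "g : Gal K" "t = rep g" using tT by (auto simp: T_def)
  then obtain \<delta> where "\<delta> : D" "t = \<delta> \<circ> g" using rep[of g] by (auto simp: cl_def)
  thus ?thesis using Gal_comp[OF D_Gal g(1)] by simp
 qed
 have "ALL t. EX t'. t : T --> t' : Gal K & t \<circ> t' = id & t' \<circ> t = id" using Gal_inv TG by metis
 then obtain it where it: "!!t. t : T ==> it t : Gal K & t \<circ> it t = id & it t \<circ> t = id" by metis
 have "ALL t. EX b. t : T --> b : B & \<chi> b = w t" using w TG unfolding E_def by (metis imageE)
 then obtain b where b: "!!t. t : T ==> b t : B & \<chi> (b t) = w t" by metis
 define y where "y = (\<Sum>t\<in>T. it t (a * b t))"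
 have abB: "a * b t : B" if "t : T" for t using B_closed(3)[OF a(1)] b[OF that] by blast
 have yB: "y : B" unfolding y_def by (intro B_closed(11)) (use Gal_B it abB in blast)
 have "\<chi> (g y) = w g" if g: "g : Gal K" for g
 proof -
  have gt: "g \<circ> it t : Gal K" if "t : T" for t by (rule Gal_comp[OF g]) (use it that in blast)
  \<comment> \<open>The term of t contributes to the residue of g y only if g t^-1 lies in
    \<open>D\<close>, that is, if t represents the coset of g.\<close>
  have trm: "\<chi> ((g \<circ> it t) (a * b t)) = (if t = rep g then w g else 0)" if t: "t : T" for t
  proof -
  have e: "\<chi> ((g \<circ> it t) (a * b t)) = (if g \<circ> it t : D then 1 else 0) * \<chi> ((g \<circ> it t) (b t))"
   using a(2)[OF gt[OF t]] b[OF t] by (simp only: GalD(2)[OF gt[OF t]] \<chi>_mult Gal_B[OF gt[OF t]] a(1))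
  show ?thesis
  proof (cases "t = rep g")
   case True
   then obtain \<delta> where \<delta>: "\<delta> : D" "t = \<delta> \<circ> g" using rep[of g] by (auto simp: cl_def)
   have "\<delta> \<circ> (g \<circ> it t) = id" using it[OF t] \<delta>(2) by (simp add: o_assoc)
   moreover obtain \<epsilon> where \<epsilon>: "\<epsilon> : Gal K" "\<delta> \<circ> \<epsilon> = id" "\<epsilon> \<circ> \<delta> = id" using Gal_inv[OF D_Gal[OF \<delta>(1)]] by metis
   ultimately have "g \<circ> it t = \<epsilon>" by (metis comp_id id_comp o_assoc)
   hence gD: "g \<circ> it t : D" using D_inv[OF \<delta>(1) \<epsilon>(1,3)] by simp
   obtain i where i: "!!x. x : B ==> \<chi> ((g \<circ> it t) x) = \<chi> x ^ (Q ^ i)" using decomposition_acts[OF gD] by metis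
   have "w g = w ((g \<circ> it t) \<circ> t)" using it[OF t] by (metis comp_id o_assoc)
   also have "... = \<chi> ((g \<circ> it t) (b t))" 
   proof -
    have bt: "b t : B" "\<chi> (b t) = w t" using b[OF t] by simp_all
    show ?thesis by (simp only: comp[OF TG[OF t] gD i] i[OF bt(1)] bt(2))
   qed
   finally show ?thesis using True gD e by simp
  next
   case False
   have "g \<circ> it t ~: D"
   proof
    assume gD: "g \<circ> it t : D"
    have "g = (g \<circ> it t) \<circ> t" using it[OF t] by (metis comp_id o_assoc)
    hence "g : cl t" unfolding cl_def using gD by blast
    hence "cl g = cl t" by (rule cl_eq)
    moreover obtain g' where "t = rep g'" using t by (auto simp: T_def)
    hence "cl t = cl g'" using cl_eq[OF rep] by simp
    ultimately have "rep g = rep g'" by (simp add: rep_def)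
    thus False using False `t = rep g'` by simp
   qed
   thus ?thesis using e False by simp
  qed
  qed
  have "\<chi> (g y) = (\<Sum>t\<in>T. \<chi> ((g \<circ> it t) (a * b t)))"
  unfolding y_def GalD(10)[OF g] using Gal_B[OF gt] abB by (subst \<chi>_sum) auto
  also have "... = (\<Sum>t\<in>T. if t = rep g then w g else 0)" by (rule sum.cong) (simp_all only: trm)
  also have "... = w g" using finT g by (simp add: T_def)
  finally show ?thesis .
 qed
 thus ?thesis using that yB by blast
qed

section \<open>The ideal pB and its nilpotents\<close>

definition I0 :: "'l set" where "I0 = Idl\<^bsub>B_ring\<^esub> p"

lemma I0_ideal: "ideal I0 ((ring_on B))" and p_I0: "p <= I0"
  and I0_min: "ideal J ((ring_on B)) ==> p <= J ==> I0 <= J"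
proof -
 interpret Br: cring "(ring_on B)" by (rule cring_subring[OF subring_B])
 have "p <= carrier ((ring_on B))" using p_sub A_subset_B by auto
 note pc = this
 show "ideal I0 ((ring_on B))" unfolding I0_def ring_eq(2) by (rule Br.genideal_ideal[OF pc])
 show "p <= I0" unfolding I0_def ring_eq(2) by (rule Br.genideal_self[OF pc])
 show "ideal J ((ring_on B)) ==> p <= J ==> I0 <= J"
  unfolding I0_def ring_eq(2) by (rule Br.genideal_minimal)
qed

lemmas Ic = ideal_closed[OF subring_B I0_ideal]

lemma p_fixed: "\<sigma> : Gal K ==> x : p ==> \<sigma> x = x"
 using p_sub(2) by (auto intro: GalD(7) simp: A_def)

lemma I0_P: "x : I0 ==> \<sigma> : Gal K ==> \<chi> (\<sigma> x) = 0"
proof -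
 have "ideal {x : B. ALL \<sigma>:Gal K. \<sigma> x : P} ((ring_on B))"
  by (rule ideal_subset[OF subring_B]) (auto simp: GalD intro: B_closed(1) B_closed(3) B_closed(5) Pc(1) Pc(4) Pc(6) Gal_B)
 moreover have "p <= {x : B. ALL \<sigma>:Gal K. \<sigma> x : P}"
 proof
  fix x assume x: "x : p"
  hence "\<sigma> x : P" if "\<sigma> : Gal K" for \<sigma> unfolding p_fixed[OF that x] using p_sub by blast
  thus "x : {x : B. ALL \<sigma>:Gal K. \<sigma> x : P}" using x p_sub AB by blast
 qed
 ultimately have "I0 <= {x : B. ALL \<sigma>:Gal K. \<sigma> x : P}" by (rule I0_min)
 thus "x : I0 ==> \<sigma> : Gal K ==> \<chi> (\<sigma> x) = 0" using \<chi>_0_iff Gal_B by blast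
qed

lemma I0_Gal: "x : I0 ==> \<sigma> : Gal K ==> \<sigma> x : I0"
proof -
 have "ideal {x : B. ALL \<sigma>:Gal K. \<sigma> x : I0} ((ring_on B))"
  by (rule ideal_subset[OF subring_B]) (auto simp: GalD intro: B_closed(1) B_closed(3) B_closed(5) Ic(2-4) Gal_B)
 moreover have "p <= {x : B. ALL \<sigma>:Gal K. \<sigma> x : I0}"
 proof
  fix x assume x: "x : p"
  hence "\<sigma> x : I0" if "\<sigma> : Gal K" for \<sigma> unfolding p_fixed[OF that x] using p_I0 by blast
  thus "x : {x : B. ALL \<sigma>:Gal K. \<sigma> x : I0}" using x p_sub AB by blast
 qed
 ultimately have "I0 <= {x : B. ALL \<sigma>:Gal K. \<sigma> x : I0}" by (rule I0_min)
 thus "x : I0 ==> \<sigma> : Gal K ==> \<sigma> x : I0" by blast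
qed

lemma finite_mod_I0: "finite (cs I0 ` B)"
proof -
 obtain u where u: "u ~= 0" "ev u : p" using max_contains_ev[OF p] by metis
 obtain \<pi> where \<pi>: "irr \<pi>" "ev \<pi> : p" using ev_prime[OF subring_A max_prime_of[OF p] u] by metis
 obtain X where X: "finite X" "X <= B" "!!x. x : B ==> EX y:X. EX c:B. x - y = ev \<pi> * c"
  using finite_reps[OF subring_B \<pi>(1)] by metis
 have "cs I0 ` B <= cs I0 ` X"
 proof
  fix C assume "C : cs I0 ` B"
  then obtain x where x: "x : B" "C = cs I0 x" by auto
  obtain y c where y: "y : X" "c : B" "x - y = ev \<pi> * c" using X(3)[OF x(1)] by blast
  hence "x - y : I0" using Ic(4)[of c "ev \<pi>"] \<pi>(2) p_I0 by (auto simp: mult.commute)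
  thus "C : cs I0 ` X" using Ic(6)[of x y] x y(1) by auto
 qed
 thus ?thesis using X(1) finite_surj by blast
qed

lemma coeff_prod_prime:
 assumes "!!i. i : X ==> a i : P" "j < card X" "finite X"
 shows "pcoeff (\<Prod>i\<in>X. [:- a i, 1:]) j : P"
 using assms(3,1,2)
proof (induction X arbitrary: j rule: finite_induct)
 case (insert i X)
 have e: "pcoeff (\<Prod>i\<in>insert i X. [:- a i, 1:]) j =
  - a i * pcoeff (\<Prod>i\<in>X. [:- a i, 1:]) j + (case j of 0 => 0 | Suc j => pcoeff (\<Prod>i\<in>X. [:- a i, 1:]) j)"
  using insert(1,2) by (simp add: coeff_pCons split: nat.splits)
 have "pcoeff (\<Prod>i\<in>X. [:- a i, 1:]) j : B"
  by (rule coeff_prod_closed[OF subring_B]) (use insert.prems Pc(3) in auto)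
 hence a1: "- a i * pcoeff (\<Prod>i\<in>X. [:- a i, 1:]) j : P" by (rule Pc(5)) (use insert.prems Pc(9) in auto)
 have a2: "(case j of 0 => 0 | Suc j => pcoeff (\<Prod>i\<in>X. [:- a i, 1:]) j) : P"
  using insert Pc(6) by (auto split: nat.splits)
 show ?case unfolding e by (rule Pc(1)[OF a1 a2])
qed simp

text \<open>If all conjugates of x lie in \<open>P\<close>, the polynomial with these roots is X^N
  modulo p, with N the order of the group, so x^N lies in pB. The exponent is enlarged to a power of
  q, to be an iterate of the q-power map.\<close>

lemma nilpotent_mod_I0:
 assumes x: "x : B" and \<chi>x: "!!\<sigma>. \<sigma> : Gal K ==> \<chi> (\<sigma> x) = 0"
 shows "x ^ (q ^ card (Gal K)) : I0"
proof -
 let ?N = "card (Gal K)" and ?o = "orbit_poly x"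
 have sP: "\<sigma> x : P" if "\<sigma> : Gal K" for \<sigma> using \<chi>x[OF that] \<chi>_0_iff[OF Gal_B[OF that x]] by simp
 have cI: "pcoeff ?o j : I0" if "j < ?N" for j
 proof -
  have "pcoeff ?o j : P" unfolding orbit_poly_def
  by (rule coeff_prod_prime[of "Gal K" "%\<sigma>. \<sigma> x" j]) (use sP that finite_Gal in auto)
  hence "pcoeff ?o j : p" using orbit_poly(1)[OF x, of j] P_A by blast
  thus ?thesis using p_I0 by blast
 qed
 have "0 = (\<Sum>j\<le>?N. pcoeff ?o j * x ^ j)"
  using orbit_poly(2)[OF x] by (simp add: poly_altdef orbit_poly(3)[OF x])
 also have "... = (\<Sum>j<?N. pcoeff ?o j * x ^ j) + x ^ ?N"
  using orbit_poly(3,4)[OF x] by (simp add: lessThan_Suc_atMost[symmetric])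
 finally have "x ^ ?N = - (\<Sum>j<?N. pcoeff ?o j * x ^ j)" by (simp add: eq_neg_iff_add_eq_0 add.commute)
 also have "... = (\<Sum>j<?N. (- (x ^ j)) * pcoeff ?o j)" by (simp add: sum_negf[symmetric] mult.commute)
 also have "... : I0"
 proof -
  have s: "sum h X : I0" if "!!j. j : X ==> h j : I0" for h and X :: "nat set"
  using that by (induction X rule: infinite_finite_induct) (auto intro: Ic(2,3))
  show ?thesis by (intro s Ic(4)) (auto intro: B_closed(9) B_closed(10)[OF x] cI)
 qed
 finally have xN: "x ^ ?N : I0" .
 have "?N <= q ^ ?N" using em.q_ge by (meson less_exp less_imp_le order_trans power_mono zero_le)
 hence "x ^ (q ^ ?N) = x ^ (q ^ ?N - ?N) * x ^ ?N" by (simp flip: power_add)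
 thus ?thesis using Ic(4)[OF B_closed(10)[OF x] xN] by simp
qed

end

section \<open>Spaces of homomorphisms into tensor powers of the Carlitz module\<close>

lemma finite_carrier_vec: "finite (UNIV :: 'f set) ==> finite (carrier_vec m :: 'f vec set)"
proof -
 assume fin: "finite (UNIV :: 'f set)"
 have "carrier_vec m <= (%g. vec m g) ` ({..<m} \<rightarrow>\<^sub>E (UNIV :: 'f set))"
 proof
  fix v :: "'f vec" assume "v : carrier_vec m"
  hence "vec m (\<lambda>i\<in>{..<m}. v $ i) = v" by (intro eq_vecI) simp_all
  moreover have "(\<lambda>i\<in>{..<m}. v $ i) : {..<m} \<rightarrow>\<^sub>E (UNIV :: 'f set)" by simp
  ultimately show "v : (%g. vec m g) ` ({..<m} \<rightarrow>\<^sub>E (UNIV :: 'f set))" by (metis imageI)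
 qed
 thus ?thesis using fin by (meson finite_PiE finite_lessThan finite_surj)
qed

lemma coords_finite:
 assumes "coords (M :: ('f::field, 'm) module) n T" "finite (UNIV :: 'f set)"
 shows "finite (carrier M)"
proof -
 have "bij_betw T (carrier M) (carrier_vec n)" using assms(1) by (simp add: coords_def)
 thus ?thesis using bij_betw_finite finite_carrier_vec[OF assms(2)] by blast
qed

lemma finite_extension_finite:
 fixes iF :: "'k::{field,finite} => 'f::field"
 assumes "finite_extension (range iF) UNIV"
 shows "finite (UNIV :: 'f set)"
proof -
 note rr = class_ring.ring_axioms[where ?'a = 'f]
 let ?R = "class_ring :: 'f ring"
 have sf: "subfield (range iF) ?R" and "ring.finite_dimension ?R (range iF) UNIV"
  using assms by (auto simp: finite_extension_def)
 then obtain n where dim: "ring.dimension ?R n (range iF) UNIV" by (auto simp: ring.finite_dimension_def[OF rr])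
 obtain us where us: "ring.Span ?R (range iF) us = UNIV" using ring.exists_base[OF rr sf dim] by blast
 have "UNIV <= (%Ks. ring.combine ?R Ks us) ` {Ks. set Ks <= range iF & length Ks = length us}"
 proof
  fix x :: 'f
  have "x : ring.Span ?R (range iF) us" using us by simp
  moreover have "(x : ring.Span ?R (range iF) us) =
   (EX Ks. set Ks <= range iF & length Ks = length us & x = ring.combine ?R Ks us)"
  by (rule ring.Span_mem_iff_length_version[OF rr sf]) simp
  ultimately show "x : (%Ks. ring.combine ?R Ks us) ` {Ks. set Ks <= range iF & length Ks = length us}" by blast
 qed
 moreover have "finite {Ks. set Ks <= range iF & length Ks = length us}" by (rule finite_lists_length_eq) simp
 ultimately show ?thesis by (meson finite_surj)
qed

locale hom_setting =
 fixes iF :: "'k => 'f::field" and G :: "'g set" and V :: "('f, 'v) module" and \<rho> :: "'g => 'v => 'v"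
 assumes V: "vectorspace class_ring V" and finV: "finite (carrier V)"
  and \<rho>: "!!g v. g : G ==> v : carrier V ==> \<rho> g v : carrier V"
  "!!g a v. g : G ==> v : carrier V ==> \<rho> g (a \<odot>\<^bsub>V\<^esub> v) = a \<odot>\<^bsub>V\<^esub> \<rho> g v"
  "!!g v w. g : G ==> v : carrier V ==> w : carrier V ==> \<rho> g (v \<oplus>\<^bsub>V\<^esub> w) = \<rho> g v \<oplus>\<^bsub>V\<^esub> \<rho> g w"
begin

sublocale V: vectorspace class_ring V by (rule V)

lemma V_closed: "v : carrier V ==> w : carrier V ==> v \<oplus>\<^bsub>V\<^esub> w : carrier V" "v : carrier V ==> a \<odot>\<^bsub>V\<^esub> v : carrier V"
 using V.a_closed[of v w] V.smult_closed[of a v] by (simp_all add: class_ring_simps)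

abbreviation hs where "hs M act \<equiv> hom_space iF G V \<rho> M act"

text \<open>The conditions under which the space of equivariant maps into M is a finite vector space
  and so has coordinates, see \<open>hs_coords\<close>.\<close>

definition target :: "('k, 'm) module => ('g => 'm => 'm) => bool" where
 "target M act \<longleftrightarrow> abelian_group M & finite (carrier M) & (ALL c. ALL x:carrier M. c \<odot>\<^bsub>M\<^esub> x : carrier M) \<and>
  (ALL c. ALL x:carrier M. ALL y:carrier M. c \<odot>\<^bsub>M\<^esub> (x \<oplus>\<^bsub>M\<^esub> y) = c \<odot>\<^bsub>M\<^esub> x \<oplus>\<^bsub>M\<^esub> c \<odot>\<^bsub>M\<^esub> y) \<and>
  (ALL g:G. ALL x:carrier M. act g x : carrier M) \<and>
  (ALL g:G. ALL x:carrier M. ALL y:carrier M. act g (x \<oplus>\<^bsub>M\<^esub> y) = act g x \<oplus>\<^bsub>M\<^esub> act g y)"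

lemma hs_coords: "target M act ==> EX N T. coords (hs M act) N T"
proof -
 assume t: "target M act"
 have vs: "vectorspace class_ring (hs M act)"
  by (rule hom_space_vectorspace[OF V \<rho>(1,2)]) (use t in \<open>simp_all add: target_def\<close>)
 have "carrier (hs M act) <= carrier V \<rightarrow>\<^sub>E carrier M" by (auto simp: hom_space_def)
 hence "finite (carrier (hs M act))"
  by (rule finite_subset) (use t in \<open>auto intro!: finite_PiE finV simp: target_def\<close>)
 from coords_exists[OF vs finite_vectorspace_fin_dim[OF vs this]] show ?thesis by metis
qed

definition equi :: "('k, 'm) module => ('g => 'm => 'm) => ('k, 'n) module => ('g => 'n => 'n) => ('m => 'n) => bool" where
 "equi M act N act' \<tau> \<longleftrightarrow> (ALL x:carrier M. \<tau> x : carrier N) \<and>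
  (ALL x:carrier M. ALL y:carrier M. \<tau> (x \<oplus>\<^bsub>M\<^esub> y) = \<tau> x \<oplus>\<^bsub>N\<^esub> \<tau> y) \<and>
  (ALL c. ALL x:carrier M. \<tau> (c \<odot>\<^bsub>M\<^esub> x) = c \<odot>\<^bsub>N\<^esub> \<tau> x) & (ALL g:G. ALL x:carrier M. \<tau> (act g x) = act' g (\<tau> x))"

definition post :: "('m => 'n) => ('v => 'm) => 'v => 'n" where "post \<tau> h = (\<lambda>v\<in>carrier V. \<tau> (h v))"

lemma hsD:
 assumes "h : carrier (hs M act)"
 shows "h : carrier V \<rightarrow>\<^sub>E carrier M" "v : carrier V ==> h v : carrier M"
  "v : carrier V ==> w : carrier V ==> h (v \<oplus>\<^bsub>V\<^esub> w) = h v \<oplus>\<^bsub>M\<^esub> h w"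
  "v : carrier V ==> h (iF c \<odot>\<^bsub>V\<^esub> v) = c \<odot>\<^bsub>M\<^esub> h v"
  "g : G ==> v : carrier V ==> h (\<rho> g v) = act g (h v)"
 using assms by (auto simp: hom_space_def)

lemma hs_ops: "h \<oplus>\<^bsub>hs M act\<^esub> k = (\<lambda>v\<in>carrier V. h v \<oplus>\<^bsub>M\<^esub> k v)" "a \<odot>\<^bsub>hs M act\<^esub> h = (\<lambda>v\<in>carrier V. h (a \<odot>\<^bsub>V\<^esub> v))"
  "\<zero>\<^bsub>hs M act\<^esub> = (\<lambda>v\<in>carrier V. \<zero>\<^bsub>M\<^esub>)"
 by (simp_all add: hom_space_def)

lemma post_closed:
 assumes e: "equi M act N act' \<tau>" and h: "h : carrier (hs M act)"
 shows "post \<tau> h : carrier (hs N act')"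
 using e hsD[OF h] V_closed \<rho>(1) unfolding hom_space_def post_def equi_def by simp

lemma post_mat:
 assumes e: "equi M act N act' \<tau>" and c: "coords (hs M act) a T" and c': "coords (hs N act') b T'"
 shows "EX A:carrier_mat b a. ALL h:carrier (hs M act). T' (post \<tau> h) = A *\<^sub>v T h"
proof (rule coords_linear_ex[OF c c'])
 show "post \<tau> (x \<oplus>\<^bsub>hs M act\<^esub> y) = post \<tau> x \<oplus>\<^bsub>hs N act'\<^esub> post \<tau> y"
  if "x : carrier (hs M act)" "y : carrier (hs M act)" for x y
  using e hsD(2)[OF that(1)] hsD(2)[OF that(2)] unfolding hs_ops post_def equi_def by (intro restrict_ext) simp
 show "post \<tau> (k \<odot>\<^bsub>hs M act\<^esub> x) = k \<odot>\<^bsub>hs N act'\<^esub> post \<tau> x" for k x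
  unfolding hs_ops post_def by (intro restrict_ext) (simp add: V_closed)
qed (rule post_closed[OF e])

end

text \<open>\<open>S\<close> will be B/pB, with \<open>s\<close> its k-algebra structure. It may
  have nilpotents and zero divisors; additivity of its q-power map is a hypothesis here and is later
  inherited from L.\<close>

locale carlitz_hom = hom_setting iF G V \<rho> for iF :: "'k::{field,finite} => 'f::field" and G :: "'g set" and V :: "('f, 'v) module" and \<rho> +
 fixes S :: "'s ring" and s :: "'k => 's" and act :: "'g => 's => 's" and \<zeta> :: 's and q :: nat
 assumes S: "cring S" and finS: "finite (carrier S)" and s: "!!c. s c : carrier S" "!!c. s c [^]\<^bsub>S\<^esub> q = s c"
  and act: "!!g x. g : G ==> x : carrier S ==> act g x : carrier S"
  "!!g x y. g : G ==> x : carrier S ==> y : carrier S ==> act g (x \<oplus>\<^bsub>S\<^esub> y) = act g x \<oplus>\<^bsub>S\<^esub> act g y"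
  "!!g x y. g : G ==> x : carrier S ==> y : carrier S ==> act g (x \<otimes>\<^bsub>S\<^esub> y) = act g x \<otimes>\<^bsub>S\<^esub> act g y"
  "!!g. g : G ==> act g \<one>\<^bsub>S\<^esub> = \<one>\<^bsub>S\<^esub>" "!!g. g : G ==> act g \<zero>\<^bsub>S\<^esub> = \<zero>\<^bsub>S\<^esub>" "!!g. g : G ==> act g \<zeta> = \<zeta>"
  and \<zeta>: "\<zeta> : carrier S"
  and q_add: "!!x y. x : carrier S ==> y : carrier S ==> (x \<oplus>\<^bsub>S\<^esub> y) [^]\<^bsub>S\<^esub> q = x [^]\<^bsub>S\<^esub> q \<oplus>\<^bsub>S\<^esub> y [^]\<^bsub>S\<^esub> q"
begin

sublocale S: cring S by (rule S)

definition M :: "('k, 's) module" where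
 "M = \<lparr>carrier = carrier S, monoid.mult = monoid.mult S, one = one S, zero = zero S, add = add S, module.smult = (%c x. s c \<otimes>\<^bsub>S\<^esub> x)\<rparr>"

lemma M_simps [simp]: "carrier M = carrier S" "\<zero>\<^bsub>M\<^esub> = \<zero>\<^bsub>S\<^esub>" "x \<oplus>\<^bsub>M\<^esub> y = x \<oplus>\<^bsub>S\<^esub> y" "c \<odot>\<^bsub>M\<^esub> x = s c \<otimes>\<^bsub>S\<^esub> x"
 by (simp_all add: M_def)

abbreviation Mn where "Mn n \<equiv> power_module M n"
definition actn :: "nat => 'g => (nat => 's) => nat => 's" where "actn n g x = (\<lambda>i\<in>{1..n}. act g (x i))"

lemma Mn_simps [simp]: "carrier (Mn n) = {1..n} \<rightarrow>\<^sub>E carrier S" "\<zero>\<^bsub>Mn n\<^esub> = (\<lambda>i\<in>{1..n}. \<zero>\<^bsub>S\<^esub>)"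
 "x \<oplus>\<^bsub>Mn n\<^esub> y = (\<lambda>i\<in>{1..n}. x i \<oplus>\<^bsub>S\<^esub> y i)" "c \<odot>\<^bsub>Mn n\<^esub> x = (\<lambda>i\<in>{1..n}. s c \<otimes>\<^bsub>S\<^esub> x i)"
 by (simp_all add: power_module_def)

lemma target_M: "target M act"
 unfolding target_def
proof (intro conjI)
 show "abelian_group M"
 proof (rule abelian_groupI)
  show "x \<oplus>\<^bsub>M\<^esub> y = y \<oplus>\<^bsub>M\<^esub> x" if "x : carrier M" "y : carrier M" for x y using that by (simp add: S.a_comm)
  show "EX y:carrier M. y \<oplus>\<^bsub>M\<^esub> x = \<zero>\<^bsub>M\<^esub>" if "x : carrier M" for x
  using that by (intro bexI[of _ "\<ominus>\<^bsub>S\<^esub> x"]) (simp_all add: S.l_neg)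
 qed (simp_all add: S.a_assoc)
qed (use act s finS in \<open>auto simp: S.r_distr\<close>)

lemma PiE_in: "x : {1..n} \<rightarrow>\<^sub>E carrier S ==> 1 <= i ==> i <= n ==> x i : carrier S" by (auto simp: PiE_iff)

lemma PiE_restrict: "x : {1..n} \<rightarrow>\<^sub>E C ==> (\<lambda>i\<in>{1..n}. x i) = x"
 by (simp add: PiE_def extensional_restrict)

lemma target_Mn: "target (Mn n) (actn n)"
 unfolding target_def
proof (intro conjI)
 show "abelian_group (Mn n)"
 proof (rule abelian_groupI)
  fix x y z assume x: "x : carrier (Mn n)" and y: "y : carrier (Mn n)" and z: "z : carrier (Mn n)"
  show "x \<oplus>\<^bsub>Mn n\<^esub> y \<oplus>\<^bsub>Mn n\<^esub> z = x \<oplus>\<^bsub>Mn n\<^esub> (y \<oplus>\<^bsub>Mn n\<^esub> z)"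
  using x y z by (auto simp: S.a_assoc PiE_in)
 next
  fix x y assume x: "x : carrier (Mn n)" and y: "y : carrier (Mn n)"
  show "x \<oplus>\<^bsub>Mn n\<^esub> y = y \<oplus>\<^bsub>Mn n\<^esub> x" using x y by (auto simp: S.a_comm PiE_in)
  show "x \<oplus>\<^bsub>Mn n\<^esub> y : carrier (Mn n)" using x y by (auto simp: PiE_in)
 next
  fix x assume x: "x : carrier (Mn n)"
  have "(\<lambda>i\<in>{1..n}. \<zero>\<^bsub>S\<^esub> \<oplus>\<^bsub>S\<^esub> x i) = (\<lambda>i\<in>{1..n}. x i)" using x by (intro restrict_ext) (simp add: PiE_in)
  thus "\<zero>\<^bsub>Mn n\<^esub> \<oplus>\<^bsub>Mn n\<^esub> x = x" using PiE_restrict[of x n "carrier S"] x by (simp cong: restrict_cong)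
  show "EX y:carrier (Mn n). y \<oplus>\<^bsub>Mn n\<^esub> x = \<zero>\<^bsub>Mn n\<^esub>"
  using x by (intro bexI[of _ "\<lambda>i\<in>{1..n}. \<ominus>\<^bsub>S\<^esub> x i"]) (auto simp: PiE_in S.l_neg)
 qed auto
 show "finite (carrier (Mn n))" using finS by (simp add: finite_PiE)
qed (use act s in \<open>auto simp: S.r_distr PiE_in actn_def\<close>)

definition \<iota>f :: "nat => nat => 's => nat => 's" where "\<iota>f n i x = (\<lambda>j\<in>{1..n}. if j = i then x else \<zero>\<^bsub>S\<^esub>)"

text \<open>The q-power map is k-linear because it fixes the image of k, and it commutes with the
  group because the group acts by ring homomorphisms. Each of these maps therefore induces an
  F-linear map between spaces of homomorphisms.\<close>

lemma equis:
 assumes n: "n >= 1"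
 shows "equi M act M act (%x. \<zeta> \<otimes>\<^bsub>S\<^esub> x)" "equi M act M act (%x. x [^]\<^bsub>S\<^esub> q)"
  "equi M act (Mn n) (actn n) (\<iota>f n i)" "equi (Mn n) (actn n) M act (%x. x 1)"
  "equi (Mn n) (actn n) (Mn n) (actn n) (lie_carlitz_t S \<zeta> n)" "equi (Mn n) (actn n) (Mn n) (actn n) (carlitz_t S \<zeta> q n)"
proof -
 have act_pow: "act g (x [^]\<^bsub>S\<^esub> k) = act g x [^]\<^bsub>S\<^esub> k" if "g : G" "x : carrier S" for g x and k :: nat
  using that by (induction k) (simp_all add: act)
 have sq: "(s c \<otimes>\<^bsub>S\<^esub> x) [^]\<^bsub>S\<^esub> q = s c \<otimes>\<^bsub>S\<^esub> x [^]\<^bsub>S\<^esub> q" if "x : carrier S" for c x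
  using that s by (simp add: S.nat_pow_distrib)
 have lc: "\<zeta> \<otimes>\<^bsub>S\<^esub> (s c \<otimes>\<^bsub>S\<^esub> x) = s c \<otimes>\<^bsub>S\<^esub> (\<zeta> \<otimes>\<^bsub>S\<^esub> x)" if "x : carrier S" for c x
  using that s \<zeta> by (simp add: S.m_lcomm)
 have ac4: "(a \<oplus>\<^bsub>S\<^esub> b) \<oplus>\<^bsub>S\<^esub> (c \<oplus>\<^bsub>S\<^esub> e) = (a \<oplus>\<^bsub>S\<^esub> c) \<oplus>\<^bsub>S\<^esub> (b \<oplus>\<^bsub>S\<^esub> e)"
  if "a : carrier S" "b : carrier S" "c : carrier S" "e : carrier S" for a b c e
  using that by (simp add: S.a_ac)
 show "equi M act M act (%x. \<zeta> \<otimes>\<^bsub>S\<^esub> x)" unfolding equi_def using \<zeta> by (auto simp: S.r_distr act lc)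
 show "equi M act M act (%x. x [^]\<^bsub>S\<^esub> q)" unfolding equi_def by (auto simp: act_pow sq q_add)
 show "equi M act (Mn n) (actn n) (\<iota>f n i)"
  unfolding equi_def \<iota>f_def actn_def using s by (auto intro!: restrict_ext simp: act)
 show "equi (Mn n) (actn n) M act (%x. x 1)" unfolding equi_def actn_def using n by (auto simp: PiE_in)
 show "equi (Mn n) (actn n) (Mn n) (actn n) (lie_carlitz_t S \<zeta> n)"
  unfolding equi_def lie_carlitz_t_def actn_def using s \<zeta>
  by (auto intro!: restrict_ext simp: PiE_in act lc S.r_distr ac4)
 show "equi (Mn n) (actn n) (Mn n) (actn n) (carlitz_t S \<zeta> q n)"
  unfolding equi_def carlitz_t_def actn_def using s \<zeta> n
  by (auto intro!: restrict_ext simp: PiE_in act lc S.r_distr ac4 act_pow sq q_add)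
qed

text \<open>On Hom(V, S^n) the two actions of t differ by a map through a single copy of Hom(V, S),
  as in \<open>det_carlitz\<close>. In the quotient the powers of t and the determinant of the
  linear part cancel.\<close>

theorem carlitz_quotient:
 assumes n: "n >= 1" and c: "coords (hs M act) N TT"
 obtains Z T where "Z : carrier_mat N N" "T : carrier_mat N N"
  "!!h. h : carrier (hs M act) ==> TT (post (%x. \<zeta> \<otimes>\<^bsub>S\<^esub> x) h) = Z *\<^sub>v TT h"
  "!!h. h : carrier (hs M act) ==> TT (post (%x. x [^]\<^bsub>S\<^esub> q) h) = T *\<^sub>v TT h"
  "at_t (hom_char_poly iF G V \<rho> (Mn n) (actn n) (lie_carlitz_t S \<zeta> n)) /
  at_t (hom_char_poly iF G V \<rho> (Mn n) (actn n) (carlitz_t S \<zeta> q n)) =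
  inverse (fps_to_fls (mdet (1\<^sub>m N - fps_X ^ n \<cdot>\<^sub>m twist n Z T)))"
proof -
 note e = equis[OF n]
 let ?H = "hs M act" and ?Hn = "hs (Mn n) (actn n)"
 obtain b Tn where cn: "coords ?Hn b Tn" using hs_coords[OF target_Mn] by metis
 note D = coordsD[OF c] and Dn = coordsD[OF cn]
 obtain Z where Z: "Z : carrier_mat N N" "!!h. h : carrier ?H ==> TT (post (%x. \<zeta> \<otimes>\<^bsub>S\<^esub> x) h) = Z *\<^sub>v TT h"
  using post_mat[OF e(1) c c] by blast
 obtain T where T: "T : carrier_mat N N" "!!h. h : carrier ?H ==> TT (post (%x. x [^]\<^bsub>S\<^esub> q) h) = T *\<^sub>v TT h"
  using post_mat[OF e(2) c c] by blast
 have "ALL i. EX A:carrier_mat b N. ALL h:carrier ?H. Tn (post (\<iota>f n i) h) = A *\<^sub>v TT h"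
  using post_mat[OF e(3) c cn] by blast
 then obtain \<iota> where \<iota>: "!!i. \<iota> i : carrier_mat b N" "!!i h. h : carrier ?H ==> Tn (post (\<iota>f n i) h) = \<iota> i *\<^sub>v TT h"
  by metis
 obtain pr where pr: "pr : carrier_mat N b" "!!h. h : carrier ?Hn ==> TT (post (%x. x 1) h) = pr *\<^sub>v Tn h"
  using post_mat[OF e(4) cn c] by blast
 obtain Lie where Lie: "Lie : carrier_mat b b" "!!h. h : carrier ?Hn ==> Tn (post (lie_carlitz_t S \<zeta> n) h) = Lie *\<^sub>v Tn h"
  using post_mat[OF e(5) cn cn] by blast
 obtain Ca where Ca: "Ca : carrier_mat b b" "!!h. h : carrier ?Hn ==> Tn (post (carlitz_t S \<zeta> q n) h) = Ca *\<^sub>v Tn h"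
  using post_mat[OF e(6) cn cn] by blast
 note cl = post_closed[OF e(1)] post_closed[OF e(2)] post_closed[OF e(3)] post_closed[OF e(4)] post_closed[OF e(5)]
 have hS: "h v : carrier S" if "h : carrier ?H" "v : carrier V" for h v using hsD(2)[OF that] by simp
 have hSn: "h v : {1..n} \<rightarrow>\<^sub>E carrier S" if "h : carrier ?Hn" "v : carrier V" for h v using hsD(2)[OF that] by simp
 have mv: "(X * Y) *\<^sub>v x = X *\<^sub>v (Y *\<^sub>v x)" if "X : carrier_mat i j" "Y : carrier_mat j l" "x : carrier_vec l"
  for X Y :: "'f mat" and x i j l using assoc_mult_mat_vec[OF that] .
 have pr\<iota>: "pr * \<iota> i = (if i = 1 then 1\<^sub>m N else 0\<^sub>m N N)" if i: "i : {1..n}" for i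
 proof (rule coords_mat_eqI[OF c])
  fix h assume h: "h : carrier ?H"
  have "pr * \<iota> i *\<^sub>v TT h = TT (post (%x. x 1) (post (\<iota>f n i) h))"
  unfolding mv[OF pr(1) \<iota>(1) D(3)[OF h]] using pr(2)[OF cl(3)[OF h]] \<iota>(2)[OF h] by simp
  also have "post (%x. x 1) (post (\<iota>f n i) h) = (if i = 1 then h else \<zero>\<^bsub>?H\<^esub>)"
  proof -
  have "(\<lambda>v\<in>carrier V. h v) = h" using hsD(1)[OF h] by (simp add: PiE_def extensional_restrict)
  thus ?thesis using n unfolding post_def \<iota>f_def hs_ops by (auto cong: restrict_cong)
  qed
  finally show "pr * \<iota> i *\<^sub>v TT h = (if i = 1 then 1\<^sub>m N else 0\<^sub>m N N) *\<^sub>v TT h"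
  using D(2) D(3)[OF h] by (auto intro!: eq_vecI split: if_splits)
 qed (use pr \<iota> in \<open>auto intro: mult_carrier_mat\<close>)
 have Lie1: "Lie * \<iota> 1 = \<iota> 1 * Z"
 proof (rule coords_mat_eqI[OF c])
  fix h assume h: "h : carrier ?H"
  have "Lie * \<iota> 1 *\<^sub>v TT h = Tn (post (lie_carlitz_t S \<zeta> n) (post (\<iota>f n 1) h))"
  unfolding mv[OF Lie(1) \<iota>(1) D(3)[OF h]] using Lie(2)[OF cl(3)[OF h]] \<iota>(2)[OF h] by simp
  also have "post (lie_carlitz_t S \<zeta> n) (post (\<iota>f n 1) h) = post (\<iota>f n 1) (post (%x. \<zeta> \<otimes>\<^bsub>S\<^esub> x) h)"
  unfolding post_def lie_carlitz_t_def \<iota>f_def using hS[OF h] \<zeta> by (auto intro!: restrict_ext)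
  also have "Tn ... = \<iota> 1 * Z *\<^sub>v TT h"
  unfolding mv[OF \<iota>(1) Z(1) D(3)[OF h]] using \<iota>(2)[OF cl(1)[OF h]] Z(2)[OF h] by simp
  finally show "Lie * \<iota> 1 *\<^sub>v TT h = \<iota> 1 * Z *\<^sub>v TT h" .
 qed (rule mult_carrier_mat[OF Lie(1) \<iota>(1)], rule mult_carrier_mat[OF \<iota>(1) Z(1)])
 have LieS: "Lie * \<iota> (Suc i) = \<iota> (Suc i) * Z + \<iota> i" if i: "1 <= i" "i < n" for i
 proof (rule coords_mat_eqI[OF c])
  fix h assume h: "h : carrier ?H"
  have "Lie * \<iota> (Suc i) *\<^sub>v TT h = Tn (post (lie_carlitz_t S \<zeta> n) (post (\<iota>f n (Suc i)) h))"
  unfolding mv[OF Lie(1) \<iota>(1) D(3)[OF h]] using Lie(2)[OF cl(3)[OF h]] \<iota>(2)[OF h] by simp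
  also have "post (lie_carlitz_t S \<zeta> n) (post (\<iota>f n (Suc i)) h) =
   post (\<iota>f n (Suc i)) (post (%x. \<zeta> \<otimes>\<^bsub>S\<^esub> x) h) \<oplus>\<^bsub>?Hn\<^esub> post (\<iota>f n i) h"
  unfolding hs_ops post_def lie_carlitz_t_def \<iota>f_def using hS[OF h] \<zeta> i by (auto intro!: restrict_ext)
  also have "Tn ... = \<iota> (Suc i) * Z *\<^sub>v TT h + \<iota> i *\<^sub>v TT h"
  unfolding mv[OF \<iota>(1) Z(1) D(3)[OF h]] using \<iota>(2)[OF cl(1)[OF h]] \<iota>(2)[OF h] Z(2)[OF h]
  by (simp add: Dn(5)[OF cl(3)[OF cl(1)[OF h]] cl(3)[OF h]])
  also have "... = (\<iota> (Suc i) * Z + \<iota> i) *\<^sub>v TT h"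
  by (rule add_mult_distrib_mat_vec[OF mult_carrier_mat[OF \<iota>(1) Z(1)] \<iota>(1) D(3)[OF h], symmetric])
  finally show "Lie * \<iota> (Suc i) *\<^sub>v TT h = (\<iota> (Suc i) * Z + \<iota> i) *\<^sub>v TT h" .
 qed (rule mult_carrier_mat[OF Lie(1) \<iota>(1)], rule add_carrier_mat[OF \<iota>(1)])
 have prc: "\<iota> n * T * pr : carrier_mat b b" by (rule mult_carrier_mat[OF mult_carrier_mat[OF \<iota>(1) T(1)] pr(1)])
 \<comment> \<open>The Carlitz action adds the q-power of the first coordinate to the last
   one.\<close>
 have CaE: "Ca = Lie + \<iota> n * T * pr"
 proof (rule coords_mat_eqI[OF cn Ca(1)])
  fix h assume h: "h : carrier ?Hn"
  have "Ca *\<^sub>v Tn h = Tn (post (carlitz_t S \<zeta> q n) h)" using Ca(2)[OF h] by simp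
  also have "post (carlitz_t S \<zeta> q n) h =
   post (lie_carlitz_t S \<zeta> n) h \<oplus>\<^bsub>?Hn\<^esub> post (\<iota>f n n) (post (%x. x [^]\<^bsub>S\<^esub> q) (post (%x. x 1) h))"
  proof -
  have h1: "h v i : carrier S" if "v : carrier V" "1 <= i" "i <= n" for v i using PiE_in[OF hSn[OF h]] that by blast
  show ?thesis
   unfolding hs_ops post_def lie_carlitz_t_def carlitz_t_def \<iota>f_def using h1 n \<zeta> by (auto intro!: restrict_ext)
  qed
  also have "Tn ... = Lie *\<^sub>v Tn h + \<iota> n * T * pr *\<^sub>v Tn h"
  proof -
  have "\<iota> n * T * pr *\<^sub>v Tn h = \<iota> n *\<^sub>v (T *\<^sub>v (pr *\<^sub>v Tn h))"
   using mv[OF mult_carrier_mat[OF \<iota>(1) T(1)] pr(1) Dn(3)[OF h]]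
    mv[OF \<iota>(1) T(1) mult_mat_vec_carrier[OF pr(1) Dn(3)[OF h]]] by simp
  also have "... = Tn (post (\<iota>f n n) (post (%x. x [^]\<^bsub>S\<^esub> q) (post (%x. x 1) h)))"
   using pr(2)[OF h] T(2)[OF cl(4)[OF h]] \<iota>(2)[OF cl(2)[OF cl(4)[OF h]]] by simp
  finally show ?thesis using Lie(2)[OF h] Dn(5)[OF cl(5)[OF h] cl(3)[OF cl(2)[OF cl(4)[OF h]]]] by simp
  qed
  also have "... = (Lie + \<iota> n * T * pr) *\<^sub>v Tn h"
  by (rule add_mult_distrib_mat_vec[OF Lie(1) prc Dn(3)[OF h], symmetric])
  finally show "Ca *\<^sub>v Tn h = (Lie + \<iota> n * T * pr) *\<^sub>v Tn h" .
 qed (rule add_carrier_mat[OF prc])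
 have det: "mdet (1\<^sub>m b - fps_X \<cdot>\<^sub>m cmat Ca) =
  mdet (1\<^sub>m b - fps_X \<cdot>\<^sub>m cmat Lie) * mdet (1\<^sub>m N - fps_X ^ n \<cdot>\<^sub>m twist n Z T)"
  unfolding CaE by (rule det_carlitz[OF Z(1) T(1) Lie(1) pr(1) \<iota>(1) n pr\<iota> Lie1 LieS])
 have l: "mod_char_poly ?Hn (post (lie_carlitz_t S \<zeta> n)) = char_poly Lie"
  by (rule mod_char_poly_coords[where \<phi> = "post (lie_carlitz_t S \<zeta> n)", OF cn cl(5) Lie])
 have k: "mod_char_poly ?Hn (post (carlitz_t S \<zeta> q n)) = char_poly Ca"
  by (rule mod_char_poly_coords[where \<phi> = "post (carlitz_t S \<zeta> q n)", OF cn post_closed[OF e(6)] Ca])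
 interpret h: comm_ring_hom "fps_to_fls :: 'f fps => _" by (rule fps_to_fls_hom)
 define u where "u = fps_to_fls (mdet (1\<^sub>m b - fps_X \<cdot>\<^sub>m cmat Lie))"
 define w where "w = fps_to_fls (mdet (1\<^sub>m N - fps_X ^ n \<cdot>\<^sub>m twist n Z T))"
 have "fps_nth (mdet (1\<^sub>m b - (fps_X ^ 1 * 1) \<cdot>\<^sub>m cmat Lie)) 0 = 1"
  using unit_mod_nth[OF unit_mod_det[OF Lie(1), of 1 1], of 0] by simp
 hence u0: "u ~= 0" unfolding u_def by auto
 have x0: "(fls_X_inv :: 'f fls) ^ b ~= 0" by simp
 have "at_t (char_poly Lie) / at_t (char_poly Ca) = inverse w"
  unfolding at_t_char_poly[OF Lie(1)] at_t_char_poly[OF Ca(1)] det h.hom_mult u_def[symmetric] w_def[symmetric]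
  using u0 x0 by (simp add: field_simps)
 thus ?thesis
  using that[OF Z(1) T(1) Z(2) T(2)] l k unfolding hom_char_poly_def post_def w_def by simp
qed

end

section \<open>The characteristic polynomial of the residue field\<close>

context prime_above
begin

lemma quot_space_simps:
 assumes I: "ideal I ((ring_on C))" and C: "subring_of C"
 defines "M \<equiv> quot_space iL ((ring_on C)) I"
 shows "carrier M = cs I ` C" "\<zero>\<^bsub>M\<^esub> = cs I 0" "x : C ==> y : C ==> cs I x \<oplus>\<^bsub>M\<^esub> cs I y = cs I (x + y)"
  "x : C ==> c \<odot>\<^bsub>M\<^esub> cs I x = cs I (iL c * x)"
 unfolding M_def quot_space_def using quot_cs[OF I] subring_ofD(8)[OF C] by simp_all

lemma quot_space_vectorspace:
 assumes I: "ideal I ((ring_on C))" and C: "subring_of C"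
 shows "vectorspace class_ring (quot_space iL ((ring_on C)) I)"
proof -
 define M where "M = quot_space iL ((ring_on C)) I"
 note S = quot_space_simps[OF I C, folded M_def] and Cc = subring_ofD[OF C]
 show ?thesis unfolding M_def[symmetric]
 proof (rule vs_criteria)
  show "field (class_ring :: 'k ring)" by (rule class_field)
  show "ALL v:carrier M. EX w:carrier M. v \<oplus>\<^bsub>M\<^esub> w = \<zero>\<^bsub>M\<^esub>"
  proof
  fix v assume "v : carrier M"
  then obtain x where x: "x : C" "v = cs I x" by (auto simp: S)
  thus "EX w:carrier M. v \<oplus>\<^bsub>M\<^esub> w = \<zero>\<^bsub>M\<^esub>" using Cc(9)[OF x(1)] by (intro bexI[of _ "cs I (- x)"]) (simp_all add: S)
  qed
 qed (use Cc(1,3,5,8) in \<open>auto simp: S iL.hom_add iL.hom_mult algebra_simps\<close>)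
qed

text \<open>Over the algebraic closure, multiplication by z on the residue field is diagonalised by
  the d embeddings over k, which are the powers x^(q^l), so its eigenvalues are the conjugates of
  the residue of z.\<close>

lemma residue_poly:
 "map_poly to_ac (residue_char_poly iL z A_ring p) = (\<Prod>i<d. [:- (\<chi> z ^ (q ^ i)), 1:])"
proof -
 let ?M = "quot_space iL A_ring p"
 note S = quot_space_simps[OF p_ideal subring_A, folded ring_eq(1)]
 have vs: "vectorspace class_ring ?M" using quot_space_vectorspace[OF p_ideal subring_A] by (simp only: ring_eq(1))
 have cardM: "card (carrier ?M) = q ^ d"
  unfolding S(1) using card_residue_field[unfolded ring_eq quot_cs(2)[OF p_ideal] Q_def] .
 hence "finite (carrier ?M)" using em.q_pos by (metis card.infinite)
 from coords_exists[OF vs finite_vectorspace_fin_dim[OF vs this]] obtain n T where c0: "coords ?M n T" by metis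
 have "q ^ n = q ^ d" using coords_card(2)[OF c0] cardM by (simp add: q_def)
 hence "n = d" using em.q_ge by simp
 hence c: "coords ?M d T" using c0 by simp
 note Tc = coordsD[OF c]
 have TT: "T (cs p x) : carrier_vec d" if "x : A" for x using that by (intro Tc(3)) (simp add: S)
 have "ALL j. EX x. j < d --> x : A & T (cs p x) = unit_vec d j"
  using Tc(9)[OF unit_vec_carrier] unfolding S by blast
 then obtain e where e: "!!j. j < d ==> e j : A" "!!j. j < d ==> T (cs p (e j)) = unit_vec d j" by metis
 have expand: "\<chi> x = (\<Sum>j<d. to_ac (T (cs p x) $ j) * \<chi> (e j))" if x: "x : A" for x
 proof -
  define co where "co j = T (cs p x) $ j" for j
  have cl: "(\<Sum>j<k. iL (co j) * e j) : A" if "k <= d" for k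
  using that e(1) by (intro A_closed(11) A_closed(3) A_closed(8)) auto
  have "T (cs p (\<Sum>j<k. iL (co j) * e j)) = vec d (%i. if i < k then co i else 0)" if "k <= d" for k
  using that
  proof (induction k)
  case 0
  show ?case using Tc(2) by (auto simp: S intro!: eq_vecI)
  next
  case (Suc k)
  have kA: "e k : A" "iL (co k) * e k : A" using e(1)[of k] Suc.prems A_closed(3)[OF A_closed(8)] by auto
  have "cs p (\<Sum>j<Suc k. iL (co j) * e j) = cs p (\<Sum>j<k. iL (co j) * e j) \<oplus>\<^bsub>?M\<^esub> (co k \<odot>\<^bsub>?M\<^esub> cs p (e k))"
   using cl[of k] kA Suc.prems by (simp add: S)
  hence "T (cs p (\<Sum>j<Suc k. iL (co j) * e j)) = T (cs p (\<Sum>j<k. iL (co j) * e j)) + co k \<cdot>\<^sub>v T (cs p (e k))"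
   using cl[of k] kA Suc.prems Tc(5)[of "cs p (\<Sum>j<k. iL (co j) * e j)" "co k \<odot>\<^bsub>?M\<^esub> cs p (e k)"] Tc(7)[of "cs p (e k)" "co k"]
   by (simp add: S)
  thus ?case using Suc e(2)[of k] by (auto intro!: eq_vecI simp: less_Suc_eq)
  qed
  from this[of d] have "T (cs p (\<Sum>j<d. iL (co j) * e j)) = T (cs p x)"
  using TT[OF x] by (auto intro!: eq_vecI simp: co_def)
  hence "cs p (\<Sum>j<d. iL (co j) * e j) = cs p x" using cl[of d] x by (intro Tc(8)) (simp_all add: S)
  hence "(\<Sum>j<d. iL (co j) * e j) - x : p" using ideal_closed(6)[OF subring_A p_ideal] by blast
  hence "\<chi> (\<Sum>j<d. iL (co j) * e j) = \<chi> x" using \<chi>_eq_iff[OF AB[OF cl[of d]] AB[OF x]] p_sub(1) by auto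
  moreover have "\<chi> (\<Sum>j<d. iL (co j) * e j) = (\<Sum>j<d. to_ac (co j) * \<chi> (e j))"
  using AB[OF e(1)] B_closed(8) by (subst \<chi>_sum) (auto intro!: B_closed(3) sum.cong simp: \<chi>_mult \<chi>_iL)
  ultimately show ?thesis by (simp add: co_def)
 qed
 let ?\<phi> = "%x. (p +>\<^bsub>A_ring\<^esub> z) \<otimes>\<^bsub>A_ring Quot p\<^esub> x"
 have \<phi>: "?\<phi> (cs p x) = cs p (z * x)" if "x : A" for x
  using quot_cs(1,4)[OF p_ideal] A_closed(7) that unfolding ring_eq(1) by simp
 have \<phi>c: "?\<phi> x : carrier ?M" if "x : carrier ?M" for x
  using that A_closed(3)[OF A_closed(7)] \<phi> unfolding S by auto
 have "EX Z:carrier_mat d d. ALL x:carrier ?M. T (?\<phi> x) = Z *\<^sub>v T x"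
 proof (rule coords_linear_ex[OF c c \<phi>c])
  fix x y a assume "x : carrier ?M"
  then obtain u where u: "u : A" "x = cs p u" by (auto simp: S)
  have uz: "z * u : A" "iL a * u : A" using u A_closed(3) A_closed(7,8) by auto
  show "?\<phi> (a \<odot>\<^bsub>?M\<^esub> x) = a \<odot>\<^bsub>?M\<^esub> ?\<phi> x" using u uz by (simp add: S \<phi> mult.left_commute)
  assume "y : carrier ?M"
  then obtain v where v: "v : A" "y = cs p v" by (auto simp: S)
  thus "?\<phi> (x \<oplus>\<^bsub>?M\<^esub> y) = ?\<phi> x \<oplus>\<^bsub>?M\<^esub> ?\<phi> y"
  using u uz A_closed(3)[OF A_closed(7) v(1)] A_closed(1)[OF u(1) v(1)] by (simp add: S \<phi> distrib_left)
 qed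
 then obtain Z where Z: "Z : carrier_mat d d" "!!x. x : carrier ?M ==> T (?\<phi> x) = Z *\<^sub>v T x" by blast
 have rc: "residue_char_poly iL z A_ring p = char_poly Z"
  unfolding residue_char_poly_def by (rule mod_char_poly_coords[where \<phi> = ?\<phi>, OF c \<phi>c Z])
 have Ze: "\<chi> z * \<chi> (e j) = (\<Sum>i<d. to_ac (Z $$ (i, j)) * \<chi> (e i))" if j: "j < d" for j
 proof -
  have "T (cs p (z * e j)) = Z *\<^sub>v unit_vec d j"
  using Z(2)[of "cs p (e j)"] e[OF j] by (simp add: S \<phi>)
  moreover have "(Z *\<^sub>v unit_vec d j) $ i = Z $$ (i, j)" if "i < d" for i
  using Z(1) that j by (simp add: scalar_prod_right_unit)
  ultimately show ?thesis
  using expand[of "z * e j"] A_closed(3)[OF A_closed(7) e(1)[OF j]] \<chi>_mult[OF AB[OF A_closed(7)] AB[OF e(1)[OF j]]] by simp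
 qed
 \<comment> \<open>The Moore matrix of a k-basis of the residue field: row l holds the q^l-th powers
   of the basis.\<close>
 define Mo where "Mo = mat d d (%(l, j). \<chi> (e j) ^ (q ^ l))"
 define Dg where "Dg = mat d d (%(l, j). if l = j then \<chi> z ^ (q ^ l) else 0)"
 have Mc: "Mo : carrier_mat d d" and Dc: "Dg : carrier_mat d d" by (simp_all add: Mo_def Dg_def)
 define Y where "Y = map_mat to_ac Z"
 have Yc: "Y : carrier_mat d d" using Z(1) by (simp add: Y_def)
 have MZ: "Mo * Y = Dg * Mo"
 proof (rule eq_matI)
  fix l j assume "l < dim_row (Dg * Mo)" "j < dim_col (Dg * Mo)"
  hence lj: "l < d" "j < d" using Mc Dc by auto
  have "(Mo * Y) $$ (l, j) = (\<Sum>i<d. \<chi> (e i) ^ (q ^ l) * to_ac (Z $$ (i, j)))"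
  using lj Z(1) by (simp add: Mo_def Y_def scalar_prod_def atLeast0LessThan)
  also have "... = (\<Sum>i<d. to_ac (Z $$ (i, j)) * \<chi> (e i)) ^ (q ^ l)"
  unfolding em.q_power_sum by (rule sum.cong) (simp_all only: power_mult_distrib em.q_power_em mult.commute)
  also have "... = (\<chi> z * \<chi> (e j)) ^ (q ^ l)" unfolding Ze[OF lj(2)] ..
  also have "... = (\<Sum>i<d. if i = l then \<chi> z ^ (q ^ l) * \<chi> (e j) ^ (q ^ l) else 0)"
  using lj by (simp add: power_mult_distrib)
  also have "... = (Dg * Mo) $$ (l, j)"
  proof -
  have "(Dg * Mo) $$ (l, j) = (\<Sum>i<d. (if l = i then \<chi> z ^ (q ^ l) else 0) * \<chi> (e j) ^ (q ^ i))"
   using lj by (simp add: Dg_def Mo_def scalar_prod_def atLeast0LessThan)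
  also have "... = (\<Sum>i<d. if i = l then \<chi> z ^ (q ^ l) * \<chi> (e j) ^ (q ^ l) else 0)"
   by (rule sum.cong) auto
  finally show ?thesis by simp
  qed
  finally show "(Mo * Y) $$ (l, j) = (Dg * Mo) $$ (l, j)" .
 qed (use Mc Dc Yc in auto)
 \<comment> \<open>A relation between the rows of the Moore matrix would be a nonzero polynomial of
   degree at most q^(d - 1) that vanishes on all q^d residues.\<close>
 have detM: "mdet Mo ~= 0"
 proof
  assume "mdet Mo = 0"
  hence "mdet (transpose_mat Mo) = 0" using det_transpose[OF Mc] by simp
  then obtain v where v: "v : carrier_vec d" "v ~= 0\<^sub>v d" "transpose_mat Mo *\<^sub>v v = 0\<^sub>v d"
  using det_0_iff_vec_prod_zero[of "transpose_mat Mo" d] Mc by auto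
  have ve: "(\<Sum>l<d. v $ l * \<chi> (e j) ^ (q ^ l)) = 0" if j: "j < d" for j
  proof -
  have "(transpose_mat Mo *\<^sub>v v) $ j = (\<Sum>l<d. \<chi> (e j) ^ (q ^ l) * v $ l)"
   using j v(1) by (simp add: Mo_def scalar_prod_def atLeast0LessThan)
  thus ?thesis using v(3) j by (simp add: mult.commute)
  qed
  define F where "F = (\<Sum>l<d. Polynomial.monom (v $ l) (q ^ l))"
  have pF: "poly F x = (\<Sum>l<d. v $ l * x ^ (q ^ l))" for x by (simp add: F_def poly_sum poly_monom)
  have coF: "pcoeff F (q ^ l) = v $ l" if "l < d" for l
  proof -
  have "pcoeff F (q ^ l) = (\<Sum>i<d. if i = l then v $ l else 0)"
   unfolding F_def coeff_sum coeff_monom using em.q_ge by (intro sum.cong) auto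
  thus ?thesis using that by simp
  qed
  have "F ~= 0"
  proof
  assume "F = 0"
  hence "v = 0\<^sub>v d" using coF v(1) by (intro eq_vecI) auto
  thus False using v(2) by simp
  qed
  moreover have "degree F <= q ^ (d - 1)"
  unfolding F_def using em.q_ge
  by (intro degree_sum_le order_trans[OF degree_monom_le] power_increasing) auto
  moreover have "\<kappa> <= {x. poly F x = 0}"
  proof
  fix w assume "w : \<kappa>"
  then obtain x where x: "x : A" "w = \<chi> x" by (auto simp: \<kappa>_def)
  have "poly F w = (\<Sum>l<d. v $ l * (\<Sum>j<d. to_ac (T (cs p x) $ j) * \<chi> (e j) ^ (q ^ l)))"
   unfolding pF x(2) by (subst (1) expand[OF x(1)]) (simp add: em.q_power_sum power_mult_distrib em.q_power_em)
  also have "... = (\<Sum>j<d. to_ac (T (cs p x) $ j) * (\<Sum>l<d. v $ l * \<chi> (e j) ^ (q ^ l)))"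
   unfolding sum_distrib_left by (subst sum.swap) (simp add: mult_ac)
  also have "... = 0" by (simp add: ve)
  finally show "w : {x. poly F x = 0}" by simp
  qed
  moreover have "finite {x. poly F x = 0}" using `F ~= 0` by (rule poly_roots_finite)
  ultimately have "q ^ d <= q ^ (d - 1)"
  using card_mono[of "{x. poly F x = 0}" \<kappa>] d_props(3) card_poly_roots_bound[of F] by linarith
  thus False using em.q_ge d_props(1) by simp
 qed
 hence "Mo : Units (ring_mat TYPE('k alg_closure) d ())" by (rule det_non_zero_imp_unit[OF Mc])
 then obtain N where N: "N : carrier_mat d d" "N * Mo = 1\<^sub>m d" "Mo * N = 1\<^sub>m d"
  unfolding Units_def ring_mat_def by auto
 have "Y = N * Dg * Mo"
  using MZ N Mc Dc Yc assoc_mult_mat[OF N(1) Dc Mc] assoc_mult_mat[OF N(1) Mc Yc] by simp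
 hence "similar_mat Y Dg"
  using N Mc Dc Yc unfolding similar_mat_def similar_mat_wit_def by (intro exI[of _ N] exI[of _ Mo]) (auto simp: Let_def)
 hence "char_poly Y = char_poly Dg" by (rule char_poly_similar)
 also have "... = (\<Prod>a\<leftarrow>diag_mat Dg. [:- a, 1:])"
  by (rule char_poly_upper_triangular[OF Dc]) (simp add: upper_triangular_def Dg_def)
 also have "... = prod_list (map (%i. [:- (\<chi> z ^ (q ^ i)), 1:]) [0..<d])"
  unfolding diag_mat_def map_map by (rule arg_cong[where f = prod_list], rule map_cong) (simp_all add: Dg_def)
 also have "... = (\<Prod>i<d. [:- (\<chi> z ^ (q ^ i)), 1:])"
  by (simp add: prod.distinct_set_conv_list[symmetric] atLeast0LessThan)
 finally show ?thesis unfolding rc Y_def using em.em.char_poly_hom[OF Z(1)] by simp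
qed

lemma reflect_poly_map_inj: "(!!x. h x = 0 \<longleftrightarrow> x = 0) ==> reflect_poly (map_poly h g) = map_poly h (reflect_poly g)"
 by (rule poly_eqI) (simp add: coeff_reflect_poly coeff_map_poly degree_map_poly)

text \<open>The reversed polynomial has constant term 1 and is the form in 1/t that
  \<open>lfac_scalar\<close> expects.\<close>

lemma residue_poly_reflect:
 "map_poly to_ac (reflect_poly (residue_char_poly iL z A_ring p)) = (\<Prod>i<d. [:1, - (\<chi> z ^ (q ^ i)):])"
 "degree (residue_char_poly iL z A_ring p) = d"
proof -
 have "map_poly to_ac (reflect_poly (residue_char_poly iL z A_ring p)) =
  reflect_poly (\<Prod>i<d. [:- (\<chi> z ^ (q ^ i)), 1:])"
  unfolding residue_poly[symmetric] by (rule reflect_poly_map_inj[symmetric]) simp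
 also have "... = (\<Prod>i<d. reflect_poly [:- (\<chi> z ^ (q ^ i)), 1:])" by (rule reflect_poly_prod)
 also have "... = (\<Prod>i<d. [:1, - (\<chi> z ^ (q ^ i)):])" by (rule prod.cong) (simp_all add: reflect_poly_def)
 finally show "map_poly to_ac (reflect_poly (residue_char_poly iL z A_ring p)) = (\<Prod>i<d. [:1, - (\<chi> z ^ (q ^ i)):])" .
 have "degree (map_poly to_ac (residue_char_poly iL z A_ring p) :: 'k alg_closure poly) = d"
  unfolding residue_poly by (subst degree_prod_eq_sum_degree) auto
 thus "degree (residue_char_poly iL z A_ring p) = d" by (simp add: degree_map_poly)
qed

end

section \<open>Quotients of vector spaces\<close>

text \<open>Scalar multiplication of a coset is defined as a union over its elements; stability of U
  under scalars makes all members of the union the same coset.\<close>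

lemma quotient_module_facts:
 fixes V :: "('f::field, 'v) module"
 assumes V: "vectorspace class_ring V" and U: "U <= carrier V" "\<zero>\<^bsub>V\<^esub> : U" "!!x y. x : U ==> y : U ==> x \<oplus>\<^bsub>V\<^esub> y : U"
  "!!a x. x : U ==> a \<odot>\<^bsub>V\<^esub> x : U"
 defines "W \<equiv> quotient_module V U" and "cst \<equiv> %v. U +>\<^bsub>V\<^esub> v"
 shows "carrier W = cst ` carrier V" "\<zero>\<^bsub>W\<^esub> = cst \<zero>\<^bsub>V\<^esub>"
  "!!v w. v : carrier V ==> w : carrier V ==> cst v \<oplus>\<^bsub>W\<^esub> cst w = cst (v \<oplus>\<^bsub>V\<^esub> w)"
  "!!a v. v : carrier V ==> a \<odot>\<^bsub>W\<^esub> cst v = cst (a \<odot>\<^bsub>V\<^esub> v)"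
  "!!v w. v : carrier V ==> w : carrier V ==> cst v = cst w \<longleftrightarrow> v \<ominus>\<^bsub>V\<^esub> w : U"
  "vectorspace class_ring W"
proof -
 interpret V: vectorspace class_ring V by (rule V)
 note m = V.module_axioms
 have neg: "\<ominus>\<^bsub>V\<^esub> x : U" if "x : U" for x
 proof -
  have xV: "x : carrier V" using that U(1) by blast
  have "x \<oplus>\<^bsub>V\<^esub> (- 1) \<odot>\<^bsub>V\<^esub> x = (1 + (- 1)) \<odot>\<^bsub>V\<^esub> x"
  using V.smult_l_distr[of 1 "- 1" x] V.smult_one[OF xV] xV by (simp add: class_ring_simps)
  also have "... = \<zero>\<^bsub>V\<^esub>" using V.smult_l_null[OF xV] by (simp add: class_ring_simps)
  finally have "\<ominus>\<^bsub>V\<^esub> x = (- 1) \<odot>\<^bsub>V\<^esub> x"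
  using V.minus_equality[of "(- 1) \<odot>\<^bsub>V\<^esub> x" x] xV V.smult_closed[of "- 1" x] by (simp add: V.a_comm class_ring_simps)
  thus ?thesis using U(4)[OF that] by simp
 qed
 have as: "additive_subgroup U V"
  by (rule additive_subgroup.intro, rule V.add.subgroupI)
  (use U neg in \<open>auto simp: a_inv_def[symmetric]\<close>)
 interpret U: abelian_subgroup U V by (rule abelian_subgroupI3[OF as V.abelian_group_axioms])
 show carr: "carrier W = cst ` carrier V" unfolding W_def quotient_module_def cst_def A_RCOSETS_def' by auto
 have "cst \<zero>\<^bsub>V\<^esub> = U" unfolding cst_def a_r_coset_def' using U(1) by (auto simp: subset_iff)
 thus z: "\<zero>\<^bsub>W\<^esub> = cst \<zero>\<^bsub>V\<^esub>" unfolding W_def quotient_module_def by simp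
 show add: "cst v \<oplus>\<^bsub>W\<^esub> cst w = cst (v \<oplus>\<^bsub>V\<^esub> w)" if "v : carrier V" "w : carrier V" for v w
  unfolding W_def quotient_module_def cst_def using U.a_rcos_sum[OF that] by simp
 have mem: "x : cst v \<longleftrightarrow> x \<ominus>\<^bsub>V\<^esub> v : U" if "v : carrier V" "x : carrier V" for x v
  unfolding cst_def a_minus_def by (rule U.a_rcos_module[OF that])
 show eq: "cst v = cst w \<longleftrightarrow> v \<ominus>\<^bsub>V\<^esub> w : U" if "v : carrier V" "w : carrier V" for v w
 proof
  assume "cst v = cst w"
  hence "v : cst w" using U.a_rcos_self[OF that(1)] by (simp add: cst_def)
  thus "v \<ominus>\<^bsub>V\<^esub> w : U" using mem[OF that(2,1)] by simp
 next
  assume "v \<ominus>\<^bsub>V\<^esub> w : U"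
  hence "v : cst w" using mem[OF that(2,1)] by simp
  thus "cst v = cst w" unfolding cst_def using V.a_repr_independence[OF _ that(2) additive_subgroup.a_subgroup[OF as]] by metis
 qed
 show sm: "a \<odot>\<^bsub>W\<^esub> cst v = cst (a \<odot>\<^bsub>V\<^esub> v)" if v: "v : carrier V" for a v
 proof -
  have sc: "a \<odot>\<^bsub>V\<^esub> x : carrier V" if "x : carrier V" for x using V.smult_closed[of a x] that by (simp add: class_ring_simps)
  have "cst (a \<odot>\<^bsub>V\<^esub> x) = cst (a \<odot>\<^bsub>V\<^esub> v)" if x: "x : cst v" for x
  proof -
  have xV: "x : carrier V" using x v U(1) unfolding cst_def a_r_coset_def' by auto
  have "a \<odot>\<^bsub>V\<^esub> x \<ominus>\<^bsub>V\<^esub> a \<odot>\<^bsub>V\<^esub> v = a \<odot>\<^bsub>V\<^esub> (x \<ominus>\<^bsub>V\<^esub> v)"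
   using V.smult_r_distr[of a x "\<ominus>\<^bsub>V\<^esub> v"] V.smult_r_minus[of a v] xV v by (simp add: a_minus_def class_ring_simps)
  thus ?thesis using eq[OF sc[OF xV] sc[OF v]] mem[OF v xV] x U(4) by simp
  qed
  hence "(\<Union>x\<in>cst v. cst (a \<odot>\<^bsub>V\<^esub> x)) = cst (a \<odot>\<^bsub>V\<^esub> v)"
  using U.a_rcos_self[OF v] unfolding cst_def by blast
  thus ?thesis unfolding W_def quotient_module_def cst_def by simp
 qed
 show "vectorspace class_ring W"
 proof (rule vs_criteria)
  show "field (class_ring :: 'f ring)" by (rule class_field)
  show "ALL v:carrier W. EX w:carrier W. v \<oplus>\<^bsub>W\<^esub> w = \<zero>\<^bsub>W\<^esub>"
  proof
  fix v assume "v : carrier W"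
  then obtain x where x: "x : carrier V" "v = cst x" by (auto simp: carr)
  have "v \<oplus>\<^bsub>W\<^esub> cst (\<ominus>\<^bsub>V\<^esub> x) = \<zero>\<^bsub>W\<^esub>" using x by (simp add: add z V.r_neg)
  thus "EX w:carrier W. v \<oplus>\<^bsub>W\<^esub> w = \<zero>\<^bsub>W\<^esub>" using x by (intro bexI[of _ "cst (\<ominus>\<^bsub>V\<^esub> x)"]) (auto simp: carr)
  qed
  show "ALL v w. v : carrier W & w : carrier W --> v \<oplus>\<^bsub>W\<^esub> w = w \<oplus>\<^bsub>W\<^esub> v"
  by (auto simp: carr add V.a_comm)
  have one: "1 \<odot>\<^bsub>V\<^esub> v = v" if "v : carrier V" for v using V.smult_one[OF that] by (simp add: class_ring_simps)
  have sc: "a \<odot>\<^bsub>V\<^esub> v : carrier V" if "v : carrier V" for a v using V.smult_closed[of a v] that by (simp add: class_ring_simps)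
  have l: "(a + b) \<odot>\<^bsub>V\<^esub> v = a \<odot>\<^bsub>V\<^esub> v \<oplus>\<^bsub>V\<^esub> b \<odot>\<^bsub>V\<^esub> v" "(a * b) \<odot>\<^bsub>V\<^esub> v = a \<odot>\<^bsub>V\<^esub> (b \<odot>\<^bsub>V\<^esub> v)" if "v : carrier V" for a b v
  using V.smult_l_distr[of a b v] V.smult_assoc1[of a b v] that by (simp_all add: class_ring_simps)
  have r: "a \<odot>\<^bsub>V\<^esub> (v \<oplus>\<^bsub>V\<^esub> w) = a \<odot>\<^bsub>V\<^esub> v \<oplus>\<^bsub>V\<^esub> a \<odot>\<^bsub>V\<^esub> w" if "v : carrier V" "w : carrier V" for a v w
  using V.smult_r_distr[of a v w] that by (simp add: class_ring_simps)
  show "ALL a v w. a : carrier (class_ring :: 'f ring) & v : carrier W & w : carrier W -->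
  a \<odot>\<^bsub>W\<^esub> (v \<oplus>\<^bsub>W\<^esub> w) = a \<odot>\<^bsub>W\<^esub> v \<oplus>\<^bsub>W\<^esub> a \<odot>\<^bsub>W\<^esub> w" by (auto simp: carr add sm sc r)
  show "ALL a b v. a : carrier (class_ring :: 'f ring) & b : carrier (class_ring :: 'f ring) & v : carrier W -->
  (a \<oplus>\<^bsub>class_ring\<^esub> b) \<odot>\<^bsub>W\<^esub> v = a \<odot>\<^bsub>W\<^esub> v \<oplus>\<^bsub>W\<^esub> b \<odot>\<^bsub>W\<^esub> v" by (auto simp: carr add sm sc l class_ring_simps)
  show "ALL a b v. a : carrier (class_ring :: 'f ring) & b : carrier (class_ring :: 'f ring) & v : carrier W -->
  (a \<otimes>\<^bsub>class_ring\<^esub> b) \<odot>\<^bsub>W\<^esub> v = a \<odot>\<^bsub>W\<^esub> (b \<odot>\<^bsub>W\<^esub> v)" by (auto simp: carr add sm sc l class_ring_simps)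
  show "ALL v:carrier W. \<one>\<^bsub>class_ring :: 'f ring\<^esub> \<odot>\<^bsub>W\<^esub> v = v" by (auto simp: carr sm one class_ring_simps)
  show "ALL v w x. v : carrier W & w : carrier W & x : carrier W --> v \<oplus>\<^bsub>W\<^esub> w \<oplus>\<^bsub>W\<^esub> x = v \<oplus>\<^bsub>W\<^esub> (w \<oplus>\<^bsub>W\<^esub> x)"
  by (auto simp: carr add V.a_assoc)
 qed (auto simp: carr z add sm V.smult_closed class_ring_simps)
qed

section \<open>Local factors\<close>

locale prime_rep = prime_above iL z K p P for iL :: "'k::{field,finite} => 'l::field" and z K p P +
 fixes iF :: "'k => 'f::field" and V :: "('f, 'v) module" and \<rho> :: "('l => 'l) => 'v => 'v"
 assumes iF: "field_hom iF" and finF: "finite (UNIV :: 'f set)" and Vv: "vectorspace class_ring V"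
  and finV: "finite (carrier V)" and rep: "representation (Gal K) V \<rho>"
begin

lemma rep_closed: "g : Gal K ==> v : carrier V ==> \<rho> g v : carrier V"
 and rep_add: "g : Gal K ==> v : carrier V ==> w : carrier V ==> \<rho> g (v \<oplus>\<^bsub>V\<^esub> w) = \<rho> g v \<oplus>\<^bsub>V\<^esub> \<rho> g w"
 and rep_smult: "g : Gal K ==> v : carrier V ==> \<rho> g (a \<odot>\<^bsub>V\<^esub> v) = a \<odot>\<^bsub>V\<^esub> \<rho> g v"
 and rep_id: "v : carrier V ==> \<rho> id v = v"
 and rep_comp: "g : Gal K ==> h : Gal K ==> v : carrier V ==> \<rho> (g \<circ> h) v = \<rho> g (\<rho> h v)"
 using rep unfolding representation_def LinearCombinations.module_hom_def by (auto simp: class_ring_simps)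

sublocale hs: hom_setting iF "Gal K" V \<rho>
 by (rule hom_setting.intro, rule Vv, rule finV, erule (1) rep_closed, erule (1) rep_smult, erule (2) rep_add)

lemmas V_closed = hs.V_closed

definition U :: "'v set" where "U = augmentation V \<rho> D In"
definition W :: "('f, 'v set) module" where "W = coinvariants V \<rho> D In"

lemma U_min:
 assumes "N <= carrier V" "\<zero>\<^bsub>V\<^esub> : N" "!!v w. v : N ==> w : N ==> v \<oplus>\<^bsub>V\<^esub> w : N" "!!a v. v : N ==> a \<odot>\<^bsub>V\<^esub> v : N"
  "!!\<sigma> v. \<sigma> : D ==> v : N ==> \<rho> \<sigma> v : N" "!!\<tau> v. \<tau> : In ==> v : carrier V ==> \<rho> \<tau> v \<ominus>\<^bsub>V\<^esub> v : N"
 shows "U <= N"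
proof -
 have "LinearCombinations.submodule class_ring N V"
  unfolding LinearCombinations.submodule_def using assms(1-4) hs.V.module_axioms by auto
 thus ?thesis unfolding U_def augmentation_def generated_submodule_def using assms(5,6) by (intro Inter_lower) auto
qed

lemma U_props: "U <= carrier V" "\<zero>\<^bsub>V\<^esub> : U" "!!v w. v : U ==> w : U ==> v \<oplus>\<^bsub>V\<^esub> w : U" "!!a v. v : U ==> a \<odot>\<^bsub>V\<^esub> v : U"
  "!!\<sigma> v. \<sigma> : D ==> v : U ==> \<rho> \<sigma> v : U" "!!\<tau> v. \<tau> : In ==> v : carrier V ==> \<rho> \<tau> v \<ominus>\<^bsub>V\<^esub> v : U"
proof -
 have In_Gal: "\<tau> : In ==> \<tau> : Gal K" for \<tau> using D_Gal by (auto simp: In_iff)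
 show "U <= carrier V"
  by (rule U_min) (auto simp: V_closed rep_closed D_Gal In_Gal)
 show "\<zero>\<^bsub>V\<^esub> : U" "!!v w. v : U ==> w : U ==> v \<oplus>\<^bsub>V\<^esub> w : U" "!!a v. v : U ==> a \<odot>\<^bsub>V\<^esub> v : U"
  unfolding U_def augmentation_def generated_submodule_def LinearCombinations.submodule_def
  by (auto simp: class_ring_simps)
 show "!!\<sigma> v. \<sigma> : D ==> v : U ==> \<rho> \<sigma> v : U"
  unfolding U_def augmentation_def generated_submodule_def by blast
 show "!!\<tau> v. \<tau> : In ==> v : carrier V ==> \<rho> \<tau> v \<ominus>\<^bsub>V\<^esub> v : U"
  unfolding U_def augmentation_def generated_submodule_def by blast
qed

definition cst :: "'v => 'v set" where "cst v = U +>\<^bsub>V\<^esub> v"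

lemma W_eq: "W = quotient_module V U" by (simp add: W_def coinvariants_def U_def)

lemma Wf: "carrier W = cst ` carrier V" "\<zero>\<^bsub>W\<^esub> = cst \<zero>\<^bsub>V\<^esub>"
  "v : carrier V ==> w : carrier V ==> cst v \<oplus>\<^bsub>W\<^esub> cst w = cst (v \<oplus>\<^bsub>V\<^esub> w)"
  "v : carrier V ==> a \<odot>\<^bsub>W\<^esub> cst v = cst (a \<odot>\<^bsub>V\<^esub> v)"
  "v : carrier V ==> w : carrier V ==> cst v = cst w \<longleftrightarrow> v \<ominus>\<^bsub>V\<^esub> w : U"
  "vectorspace class_ring W"
proof -
 note q = quotient_module_facts[OF Vv U_props(1-4)]
 have c: "cst = (%v. U +>\<^bsub>V\<^esub> v)" by (rule ext) (rule cst_def)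
 show "carrier W = cst ` carrier V" unfolding W_eq c by (rule q(1))
 show "\<zero>\<^bsub>W\<^esub> = cst \<zero>\<^bsub>V\<^esub>" unfolding W_eq c by (rule q(2))
 show "v : carrier V ==> w : carrier V ==> cst v \<oplus>\<^bsub>W\<^esub> cst w = cst (v \<oplus>\<^bsub>V\<^esub> w)" unfolding W_eq c by (rule q(3))
 show "v : carrier V ==> a \<odot>\<^bsub>W\<^esub> cst v = cst (a \<odot>\<^bsub>V\<^esub> v)" unfolding W_eq c by (rule q(4))
 show "v : carrier V ==> w : carrier V ==> cst v = cst w \<longleftrightarrow> v \<ominus>\<^bsub>V\<^esub> w : U" unfolding c by (rule q(5))
 show "vectorspace class_ring W" unfolding W_eq by (rule q(6))
qed

lemma coords_W_ex: "EX mT. coords W (fst mT) (snd mT)"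
proof -
 have "finite (carrier W)" unfolding Wf(1) using finV by simp
 from coords_exists[OF Wf(6) finite_vectorspace_fin_dim[OF Wf(6) this]] show ?thesis by (metis fst_conv snd_conv)
qed

definition m :: nat where "m = fst (SOME mT. coords W (fst mT) (snd mT))"
definition TW :: "'v set => 'f vec" where "TW = snd (SOME mT. coords W (fst mT) (snd mT))"

lemma coords_W: "coords W m TW" unfolding m_def TW_def by (rule someI_ex[OF coords_W_ex])

lemmas TWc = coordsD[OF coords_W]

text \<open>The projection of V onto its coinvariants under inertia, in coordinates.\<close>

definition pr :: "'v => 'f vec" where "pr v = TW (cst v)"

lemma cst_W: "v : carrier V ==> cst v : carrier W" unfolding Wf(1) by (rule imageI)

lemma pr_closed: "v : carrier V ==> pr v : carrier_vec m"
 and pr_add: "v : carrier V ==> w : carrier V ==> pr (v \<oplus>\<^bsub>V\<^esub> w) = pr v + pr w"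
 and pr_smult: "v : carrier V ==> pr (a \<odot>\<^bsub>V\<^esub> v) = a \<cdot>\<^sub>v pr v"
 and pr_eq: "v : carrier V ==> w : carrier V ==> pr v = pr w \<longleftrightarrow> v \<ominus>\<^bsub>V\<^esub> w : U"
proof -
 show "v : carrier V ==> pr v : carrier_vec m" unfolding pr_def by (rule TWc(3)[OF cst_W])
 show "v : carrier V ==> w : carrier V ==> pr (v \<oplus>\<^bsub>V\<^esub> w) = pr v + pr w"
  using TWc(5)[OF cst_W cst_W, of v w] Wf(3)[of v w] by (simp add: pr_def)
 show "v : carrier V ==> pr (a \<odot>\<^bsub>V\<^esub> v) = a \<cdot>\<^sub>v pr v"
  using TWc(7)[OF cst_W, of v a] Wf(4)[of v a] by (simp add: pr_def)
 show "v : carrier V ==> w : carrier V ==> pr v = pr w \<longleftrightarrow> v \<ominus>\<^bsub>V\<^esub> w : U"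
  using TWc(8)[OF cst_W cst_W, of v w] Wf(5)[of v w] unfolding pr_def by metis
qed

lemma pr_surj: "x : carrier_vec m ==> EX v:carrier V. pr v = x"
proof -
 assume "x : carrier_vec m"
 then obtain X where X: "X : carrier W" "TW X = x" using TWc(9) by blast
 then obtain v where "v : carrier V" "X = cst v" unfolding Wf(1) by blast
 thus ?thesis using X(2) by (auto simp: pr_def)
qed

lemma pr_inertia: "\<tau> : In ==> v : carrier V ==> pr (\<rho> \<tau> v) = pr v"
 using pr_eq[of "\<rho> \<tau> v" v] U_props(6) rep_closed[of \<tau> v] D_Gal by (simp add: In_iff)

text \<open>\<rho> \<sigma> maps \<open>U\<close> onto itself, the inverse of \<sigma> being in
  \<open>D\<close> too; so the action on coinvariants by images of cosets, as in
  \<open>coinv_factor\<close>, agrees with the action on representatives.\<close>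

lemma image_cst:
 assumes s: "\<sigma> : D" and v: "v : carrier V"
 shows "\<rho> \<sigma> ` cst v = cst (\<rho> \<sigma> v)"
proof -
 note sG = D_Gal[OF s]
 obtain \<tau> where t: "\<tau> : Gal K" "\<sigma> \<circ> \<tau> = id" "\<tau> \<circ> \<sigma> = id" using Gal_inv[OF sG] by metis
 have tD: "\<tau> : D" by (rule D_inv[OF s t(1,3)])
 have im: "\<rho> \<sigma> ` U = U"
 proof
  show "\<rho> \<sigma> ` U <= U" using U_props(5)[OF s] by blast
  show "U <= \<rho> \<sigma> ` U"
  proof
  fix x assume x: "x : U"
  hence xV: "x : carrier V" using U_props(1) by blast
  have "\<rho> \<sigma> (\<rho> \<tau> x) = x" using rep_comp[OF sG t(1) xV] rep_id[OF xV] t(2) by simp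
  thus "x : \<rho> \<sigma> ` U" using U_props(5)[OF tD x] by (metis imageI)
  qed
 qed
 have "\<rho> \<sigma> ` cst v = (%h. \<rho> \<sigma> h \<oplus>\<^bsub>V\<^esub> \<rho> \<sigma> v) ` U"
 proof -
  have "cst v = (%h. h \<oplus>\<^bsub>V\<^esub> v) ` U" unfolding cst_def a_r_coset_def' by auto
  thus ?thesis using rep_add[OF sG _ v] U_props(1) by (auto simp: image_image subset_iff intro!: image_cong)
 qed
 also have "... = (%h. h \<oplus>\<^bsub>V\<^esub> \<rho> \<sigma> v) ` (\<rho> \<sigma> ` U)" by (simp only: image_image)
 also have "... = cst (\<rho> \<sigma> v)" unfolding im cst_def a_r_coset_def' by auto
 finally show ?thesis .
qed

lemma A_ex: "EX A. A : carrier_mat m m & (ALL X:carrier W. TW (\<rho> \<phi> ` X) = A *\<^sub>v TW X)"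
proof -
 note fG = D_Gal[OF \<phi>(1)]
 have "EX A:carrier_mat m m. ALL X:carrier W. TW (\<rho> \<phi> ` X) = A *\<^sub>v TW X"
 proof (rule coords_linear_ex[OF coords_W coords_W])
  fix X Y a assume "X : carrier W"
  then obtain v where v: "v : carrier V" "X = cst v" unfolding Wf(1) by blast
  show "\<rho> \<phi> ` X : carrier W" using v cst_W rep_closed[OF fG] by (simp add: image_cst[OF \<phi>(1)])
  show "\<rho> \<phi> ` (a \<odot>\<^bsub>W\<^esub> X) = a \<odot>\<^bsub>W\<^esub> \<rho> \<phi> ` X"
  using v V_closed rep_closed[OF fG] by (simp add: image_cst[OF \<phi>(1)] Wf(4) rep_smult[OF fG])
  assume "Y : carrier W"
  then obtain w where w: "w : carrier V" "Y = cst w" unfolding Wf(1) by blast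
  show "\<rho> \<phi> ` (X \<oplus>\<^bsub>W\<^esub> Y) = \<rho> \<phi> ` X \<oplus>\<^bsub>W\<^esub> \<rho> \<phi> ` Y"
  using v w V_closed rep_closed[OF fG] by (simp add: image_cst[OF \<phi>(1)] Wf(3) rep_add[OF fG])
 qed
 thus ?thesis by blast
qed

definition Fr :: "'f mat" where "Fr = (SOME A. A : carrier_mat m m & (ALL X:carrier W. TW (\<rho> \<phi> ` X) = A *\<^sub>v TW X))"

lemma Fr: "Fr : carrier_mat m m" "X : carrier W ==> TW (\<rho> \<phi> ` X) = Fr *\<^sub>v TW X"
 using someI_ex[OF A_ex, folded Fr_def] by blast+

lemma pr_pow: "v : carrier V ==> pr (\<rho> (\<phi> ^^ i) v) = Fr ^\<^sub>m i *\<^sub>v pr v"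
proof (induction i arbitrary: v)
 case 0
 show ?case unfolding funpow.simps(1) rep_id[OF 0] using pr_closed[OF 0] Fr(1) by simp
next
 case (Suc i)
 note fG = D_Gal[OF \<phi>(1)] and iG = D_Gal[OF \<phi>_pow(1)[of i]]
 have c: "\<phi> ^^ Suc i = (\<phi> ^^ i) \<circ> \<phi>" by (rule funpow_Suc_right)
 have r: "\<rho> \<phi> v : carrier V" by (rule rep_closed[OF fG Suc.prems])
 have "pr (\<rho> (\<phi> ^^ Suc i) v) = Fr ^\<^sub>m i *\<^sub>v pr (\<rho> \<phi> v)"
  unfolding c rep_comp[OF iG fG Suc.prems] by (rule Suc.IH[OF r])
 also have "pr (\<rho> \<phi> v) = Fr *\<^sub>v pr v"
  using Fr(2)[OF cst_W[OF Suc.prems]] image_cst[OF \<phi>(1) Suc.prems] by (simp add: pr_def)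
 also have "Fr ^\<^sub>m i *\<^sub>v (Fr *\<^sub>v pr v) = Fr ^\<^sub>m Suc i *\<^sub>v pr v"
  using assoc_mult_mat_vec[OF pow_carrier_mat[OF Fr(1)] Fr(1) pr_closed[OF Suc.prems], of i] by simp
 finally show ?case .
qed

text \<open>The f-th power of \<phi> acts trivially on the residue field, so it lies in inertia and
  acts trivially on coinvariants.\<close>

lemma Fr_f: "Fr ^\<^sub>m f = 1\<^sub>m m"
proof (rule coords_mat_eqI[OF coords_W pow_carrier_mat[OF Fr(1)] one_carrier_mat])
 fix X assume "X : carrier W"
 then obtain v where v: "v : carrier V" "X = cst v" unfolding Wf(1) by blast
 have "Fr ^\<^sub>m f *\<^sub>v pr v = pr v" using pr_pow[OF v(1), of f] pr_inertia[OF \<phi>_f v(1)] by simp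
 thus "Fr ^\<^sub>m f *\<^sub>v TW X = 1\<^sub>m m *\<^sub>v TW X" using pr_closed[OF v(1)] v(2) by (simp add: pr_def)
qed

text \<open>Inertia disappears in the coinvariants, so an element of \<open>D\<close> acts there as
  the power of Frobenius that it induces on residues.\<close>

lemma pr_decomposition:
 assumes s: "\<sigma> : D" and i: "!!x. x : B ==> \<chi> (\<sigma> x) = \<chi> x ^ (Q ^ i)" and v: "v : carrier V"
 shows "pr (\<rho> \<sigma> v) = Fr ^\<^sub>m i *\<^sub>v pr v"
proof -
 obtain \<tau> where t: "\<tau> : In" "\<sigma> = (\<phi> ^^ i) \<circ> \<tau>" using decomposition_factor[OF s i] by metis
 have tG: "\<tau> : Gal K" using t(1) D_Gal by (simp add: In_iff)
 have "pr (\<rho> \<sigma> v) = Fr ^\<^sub>m i *\<^sub>v pr (\<rho> \<tau> v)"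
  unfolding t(2) rep_comp[OF D_Gal[OF \<phi>_pow(1)] tG v] by (rule pr_pow[OF rep_closed[OF tG v]])
 thus ?thesis using pr_inertia[OF t(1) v] by simp
qed

sublocale eqm: equivariant_maps "to_ac :: 'k => 'k alg_closure" q iF Fr m d f r
proof -
 have c: "card {x::'k alg_closure. x ^ (q ^ r) = x} = q ^ r" using r_props(3) unfolding r_props(2) .
 show "equivariant_maps (to_ac :: 'k => 'k alg_closure) q iF Fr m d f r"
  by (rule equivariant_maps.intro[OF em.finite_field_ext_axioms], rule equivariant_maps_axioms.intro;
  fact iF finF Fr(1) Fr_f d_props(1) rdf c)
qed

lemma eqm_E: "eqm.E = E" unfolding eqm.E_def r_props(2) ..

interpretation Lq: finite_field_ext iL q by standard (simp_all add: q_def)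

definition SR :: "'l set ring" where "SR = class_ring\<lparr>carrier := B\<rparr> Quot I0"

lemmas S_cs = quot_cs[OF I0_ideal, folded SR_def]

lemma S_pow: "x : B ==> cs I0 x [^]\<^bsub>SR\<^esub> k = cs I0 (x ^ k)" for k :: nat
 by (induction k) (simp_all add: nat_pow_def S_cs B_closed(10) mult.commute)

lemma image_cs: "\<sigma> : Gal K ==> \<sigma> ` cs I0 x = cs I0 (\<sigma> x)"
proof -
 assume s: "\<sigma> : Gal K"
 obtain \<tau> where t: "\<tau> : Gal K" "\<sigma> \<circ> \<tau> = id" using Gal_inv[OF s] by metis
 have "\<sigma> ` I0 = I0"
 proof
  show "\<sigma> ` I0 <= I0" using I0_Gal[OF _ s] by blast
  show "I0 <= \<sigma> ` I0"
  proof
  fix y assume y: "y : I0"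
  have "\<sigma> (\<tau> y) = y" using t(2) by (simp add: fun_eq_iff)
  thus "y : \<sigma> ` I0" using I0_Gal[OF y t(1)] by (metis imageI)
  qed
 qed
 hence "cs I0 (\<sigma> x) = (%h. h + \<sigma> x) ` (\<sigma> ` I0)" by (simp add: cs_def)
 thus ?thesis unfolding cs_def image_image by (simp add: GalD(1)[OF s])
qed

sublocale C: carlitz_hom iF "Gal K" V \<rho> SR "%c. cs I0 (iL c)" "%\<sigma> X. \<sigma> ` X" "cs I0 z" q
proof -
 have elt: "EX x:B. X = cs I0 x" if "X : carrier SR" for X using that unfolding S_cs by blast
 show "carlitz_hom (Gal K) V \<rho> SR (%c. cs I0 (iL c)) (%\<sigma> X. \<sigma> ` X) (cs I0 z) q"
 proof (rule carlitz_hom.intro[OF hs.hom_setting_axioms], rule carlitz_hom_axioms.intro)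
  show "cring SR" unfolding SR_def by (rule ideal.quotient_is_cring[OF I0_ideal cring_subring[OF subring_B]])
  show "finite (carrier SR)" unfolding S_cs by (rule finite_mod_I0)
  show "cs I0 (iL c) : carrier SR" for c unfolding S_cs by (rule imageI[OF B_closed(8)])
  show "cs I0 (iL c) [^]\<^bsub>SR\<^esub> q = cs I0 (iL c)" for c
  using S_pow[OF B_closed(8)] Lq.q_power_em[of c 1] by simp
  show "cs I0 z : carrier SR" unfolding S_cs by (rule imageI[OF B_closed(7)])
  show "g ` \<one>\<^bsub>SR\<^esub> = \<one>\<^bsub>SR\<^esub>" "g ` \<zero>\<^bsub>SR\<^esub> = \<zero>\<^bsub>SR\<^esub>" "g ` cs I0 z = cs I0 z" if g: "g : Gal K" for g
  unfolding S_cs image_cs[OF g] GalD(4,5,13)[OF g] by (rule refl)+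
  show "g ` X : carrier SR" if g: "g : Gal K" and X: "X : carrier SR" for g X
  proof -
  obtain x where x: "x : B" "X = cs I0 x" using elt[OF X] by blast
  show ?thesis unfolding x(2) image_cs[OF g] S_cs by (rule imageI[OF Gal_B[OF g x(1)]])
  qed
  show "g ` (X \<oplus>\<^bsub>SR\<^esub> Y) = g ` X \<oplus>\<^bsub>SR\<^esub> g ` Y" "g ` (X \<otimes>\<^bsub>SR\<^esub> Y) = g ` X \<otimes>\<^bsub>SR\<^esub> g ` Y"
  if g: "g : Gal K" and X: "X : carrier SR" and Y: "Y : carrier SR" for g X Y
  proof -
  obtain x y where x: "x : B" "X = cs I0 x" and y: "y : B" "Y = cs I0 y" using elt[OF X] elt[OF Y] by blast
  show "g ` (X \<oplus>\<^bsub>SR\<^esub> Y) = g ` X \<oplus>\<^bsub>SR\<^esub> g ` Y" "g ` (X \<otimes>\<^bsub>SR\<^esub> Y) = g ` X \<otimes>\<^bsub>SR\<^esub> g ` Y"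
   using x y Gal_B[OF g] by (simp_all add: S_cs image_cs[OF g] GalD(1,2)[OF g])
  qed
  show "(X \<oplus>\<^bsub>SR\<^esub> Y) [^]\<^bsub>SR\<^esub> q = X [^]\<^bsub>SR\<^esub> q \<oplus>\<^bsub>SR\<^esub> Y [^]\<^bsub>SR\<^esub> q" if X: "X : carrier SR" and Y: "Y : carrier SR" for X Y
  proof -
  obtain x y where x: "x : B" "X = cs I0 x" and y: "y : B" "Y = cs I0 y" using elt[OF X] elt[OF Y] by blast
  show ?thesis
   using x y B_closed(1)[OF x(1) y(1)] B_closed(10) Lq.q_power_add[of x y 1] by (simp add: S_cs S_pow)
  qed
 qed
qed

section \<open>From B/pB to the residue field, and back up to a power of Frobenius\<close>

abbreviation HU where "HU \<equiv> hs.hs C.M (%\<sigma> X. \<sigma> ` X)"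

lemma carlitz_M: "C.M = quot_space iL (class_ring\<lparr>carrier := B\<rparr>) I0"
 unfolding C.M_def unfolding quot_space_def S_cs(1) SR_def[symmetric] ..

lemma carlitz_factor_eq:
 "carlitz_factor iF iL z K V \<rho> n p =
  at_t (hom_char_poly iF (Gal K) V \<rho> (power_module C.M n) (C.actn n) (lie_carlitz_t SR (cs I0 z) n)) /
  at_t (hom_char_poly iF (Gal K) V \<rho> (power_module C.M n) (C.actn n) (carlitz_t SR (cs I0 z) q n))"
proof -
 have e: "C.actn n = coset_act n" by (intro ext) (simp add: C.actn_def coset_act_def)
 show ?thesis
  unfolding carlitz_factor_def Let_def I0_def[symmetric] unfolding ring_eq(2)
  unfolding carlitz_M[symmetric] S_cs(1) SR_def[symmetric] q_def[symmetric] e ..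
qed

text \<open>The residue at \<open>P\<close> of a coset of pB; every representative gives the same
  value because pB is contained in \<open>P\<close>.\<close>

definition bar :: "'l set => 'k alg_closure" where "bar X = \<chi> (SOME x. x : B & X = cs I0 x)"

lemma bar: "x : B ==> bar (cs I0 x) = \<chi> x"
proof -
 assume x: "x : B"
 define y where "y = (SOME y. y : B & cs I0 x = cs I0 y)"
 have y: "y : B & cs I0 x = cs I0 y" unfolding y_def by (rule someI[of _ x]) (simp add: x)
 hence "x - y : I0" using Ic(6) by blast
 hence "\<chi> (x - y) = 0" using I0_P[OF _ Gal_id] by simp
 thus ?thesis using \<chi>_diff[OF x, of y] y unfolding bar_def y_def[symmetric] by simp
qed

lemma HU_rep: "h : carrier HU ==> v : carrier V ==> EX x:B. h v = cs I0 x"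
 using hs.hsD(2)[of h C.M _ v] unfolding C.M_simps S_cs by blast

lemma bar_add: "X : carrier SR ==> Y : carrier SR ==> bar (X \<oplus>\<^bsub>SR\<^esub> Y) = bar X + bar Y"
 unfolding S_cs(2) by (auto simp: S_cs bar \<chi>_add B_closed(1))

lemma HU_S: "h : carrier HU ==> v : carrier V ==> h v : carrier SR"
 using hs.hsD(2)[of h C.M _ v] by simp

text \<open>For \<tau> in inertia, h(\<rho> \<tau> v) = \<tau> h(v) has the same residue at
  \<open>P\<close> as h(v), and elements of \<open>D\<close> preserve \<open>P\<close>. So the
  residue of h vanishes on the submodule generated by the differences \<rho> \<tau> v - v.\<close>

lemma bar_U:
 assumes h: "h : carrier HU" and u: "u : U"
 shows "bar (h u) = 0"
proof -
 note hD = hs.hsD[OF h]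
 have bact: "bar (h (\<rho> \<sigma> v)) = \<chi> (\<sigma> x)" if "\<sigma> : Gal K" "v : carrier V" "x : B" "h v = cs I0 x" for \<sigma> v x
  using hD(5)[OF that(1,2)] that Gal_B[OF that(1,3)] by (simp add: image_cs bar)
 have b0: "bar (h \<zero>\<^bsub>V\<^esub>) = 0"
 proof -
  have "h \<zero>\<^bsub>V\<^esub> = h (\<zero>\<^bsub>V\<^esub> \<oplus>\<^bsub>V\<^esub> \<zero>\<^bsub>V\<^esub>)" by simp
  also have "... = h \<zero>\<^bsub>V\<^esub> \<oplus>\<^bsub>SR\<^esub> h \<zero>\<^bsub>V\<^esub>" using hD(3)[of "\<zero>\<^bsub>V\<^esub>" "\<zero>\<^bsub>V\<^esub>"] by simp
  finally have "bar (h \<zero>\<^bsub>V\<^esub>) = bar (h \<zero>\<^bsub>V\<^esub> \<oplus>\<^bsub>SR\<^esub> h \<zero>\<^bsub>V\<^esub>)" by (rule arg_cong)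
  also have "... = bar (h \<zero>\<^bsub>V\<^esub>) + bar (h \<zero>\<^bsub>V\<^esub>)" by (rule bar_add[OF HU_S[OF h] HU_S[OF h]]) simp_all
  finally have "bar (h \<zero>\<^bsub>V\<^esub>) + bar (h \<zero>\<^bsub>V\<^esub>) = bar (h \<zero>\<^bsub>V\<^esub>) + 0" by (simp only: add_0_right)
  thus ?thesis by (simp only: add_left_cancel)
 qed
 have z0: "a \<odot>\<^bsub>V\<^esub> \<zero>\<^bsub>V\<^esub> = \<zero>\<^bsub>V\<^esub>" for a using hs.V.smult_r_null[of a] by (simp add: class_ring_simps)
 have r: "a \<odot>\<^bsub>V\<^esub> (v \<oplus>\<^bsub>V\<^esub> w) = a \<odot>\<^bsub>V\<^esub> v \<oplus>\<^bsub>V\<^esub> a \<odot>\<^bsub>V\<^esub> w" if "v : carrier V" "w : carrier V" for a v w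
  using hs.V.smult_r_distr[of a v w] that by (simp add: class_ring_simps)
 have as: "a \<odot>\<^bsub>V\<^esub> (b \<odot>\<^bsub>V\<^esub> v) = (a * b) \<odot>\<^bsub>V\<^esub> v" if "v : carrier V" for a b v
  using hs.V.smult_assoc1[of a b v] that by (simp add: class_ring_simps)
 \<comment> \<open>h is linear over k only; demanding the vanishing on all F-multiples of v makes
   \<open>N\<close> an F-subspace.\<close>
 define N where "N = {v : carrier V. ALL a. bar (h (a \<odot>\<^bsub>V\<^esub> v)) = 0}"
 have hadd: "bar (h (v \<oplus>\<^bsub>V\<^esub> w)) = bar (h v) + bar (h w)" if "v : carrier V" "w : carrier V" for v w
  using hD(3)[OF that] bar_add[OF HU_S[OF h that(1)] HU_S[OF h that(2)]] by simp
 have "U <= N"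
 proof (rule U_min)
  show "N <= carrier V" "\<zero>\<^bsub>V\<^esub> : N" by (auto simp: N_def z0 b0)
  show "v \<oplus>\<^bsub>V\<^esub> w : N" if "v : N" "w : N" for v w using that by (auto simp: N_def r hadd V_closed)
  show "a \<odot>\<^bsub>V\<^esub> v : N" if "v : N" for a v using that by (auto simp: N_def as V_closed)
  show "\<rho> \<sigma> v : N" if s: "\<sigma> : D" and v: "v : N" for \<sigma> v
  proof -
  have vV: "v : carrier V" and b: "!!a. bar (h (a \<odot>\<^bsub>V\<^esub> v)) = 0" using v by (auto simp: N_def)
  have "bar (h (a \<odot>\<^bsub>V\<^esub> \<rho> \<sigma> v)) = 0" for a
  proof -
   obtain x where x: "x : B" "h (a \<odot>\<^bsub>V\<^esub> v) = cs I0 x" using HU_rep[OF h V_closed(2)[OF vV]] by blast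
   have "\<chi> x = 0" using b[of a] bar[OF x(1)] x(2) by simp
   hence "x : P" using \<chi>_0_iff[OF x(1)] by simp
   hence "\<chi> (\<sigma> x) = 0" using D_P[OF s] \<chi>_0_iff[OF Gal_B[OF D_Gal[OF s] x(1)]] by simp
   thus ?thesis using bact[OF D_Gal[OF s] V_closed(2)[OF vV] x] rep_smult[OF D_Gal[OF s] vV] by simp
  qed
  thus ?thesis using rep_closed[OF D_Gal[OF s] vV] by (simp add: N_def)
  qed
  show "\<rho> \<tau> v \<ominus>\<^bsub>V\<^esub> v : N" if t: "\<tau> : In" and v: "v : carrier V" for \<tau> v
  proof -
  have tG: "\<tau> : Gal K" and \<chi>t: "!!x. x : B ==> \<chi> (\<tau> x) = \<chi> x" using t D_Gal by (auto simp: In_iff)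
  have tv: "\<rho> \<tau> v : carrier V" by (rule rep_closed[OF tG v])
  have dV: "\<rho> \<tau> v \<ominus>\<^bsub>V\<^esub> v : carrier V" using tv v by simp
  have "bar (h (a \<odot>\<^bsub>V\<^esub> (\<rho> \<tau> v \<ominus>\<^bsub>V\<^esub> v))) = 0" for a
  proof -
   have "(\<rho> \<tau> v \<ominus>\<^bsub>V\<^esub> v) \<oplus>\<^bsub>V\<^esub> v = \<rho> \<tau> v" using tv v by (simp add: a_minus_def hs.V.a_assoc hs.V.l_neg)
   hence "\<rho> \<tau> (a \<odot>\<^bsub>V\<^esub> v) = a \<odot>\<^bsub>V\<^esub> (\<rho> \<tau> v \<ominus>\<^bsub>V\<^esub> v) \<oplus>\<^bsub>V\<^esub> a \<odot>\<^bsub>V\<^esub> v"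
    using r[OF dV v, of a] rep_smult[OF tG v] by simp
   hence e: "bar (h (\<rho> \<tau> (a \<odot>\<^bsub>V\<^esub> v))) = bar (h (a \<odot>\<^bsub>V\<^esub> (\<rho> \<tau> v \<ominus>\<^bsub>V\<^esub> v))) + bar (h (a \<odot>\<^bsub>V\<^esub> v))"
    using hadd[OF V_closed(2)[OF dV] V_closed(2)[OF v]] by simp
   obtain x where x: "x : B" "h (a \<odot>\<^bsub>V\<^esub> v) = cs I0 x" using HU_rep[OF h V_closed(2)[OF v]] by blast
   have "bar (h (\<rho> \<tau> (a \<odot>\<^bsub>V\<^esub> v))) = bar (h (a \<odot>\<^bsub>V\<^esub> v))"
    using bact[OF tG V_closed(2)[OF v] x] \<chi>t[OF x(1)] bar[OF x(1)] x(2) by simp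
   thus ?thesis using e by simp
  qed
  thus ?thesis using dV by (simp add: N_def)
  qed
 qed
 hence uN: "u : N" using u by blast
 moreover have "1 \<odot>\<^bsub>V\<^esub> u = u" using hs.V.smult_one[of u] uN by (simp add: N_def class_ring_simps)
 ultimately show ?thesis by (auto simp: N_def dest: spec[of _ 1])
qed

lemma bar_pr:
 assumes h: "h : carrier HU" and vw: "v : carrier V" "w : carrier V" "pr v = pr w"
 shows "bar (h v) = bar (h w)"
proof -
 have u: "v \<ominus>\<^bsub>V\<^esub> w : U" using pr_eq[OF vw(1,2)] vw(3) by simp
 hence uV: "v \<ominus>\<^bsub>V\<^esub> w : carrier V" using U_props(1) by blast
 have "(v \<ominus>\<^bsub>V\<^esub> w) \<oplus>\<^bsub>V\<^esub> w = v" using vw by (simp add: a_minus_def hs.V.a_assoc hs.V.l_neg)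
 hence "h v = h (v \<ominus>\<^bsub>V\<^esub> w) \<oplus>\<^bsub>SR\<^esub> h w" using hs.hsD(3)[OF h uV vw(2)] by simp
 thus ?thesis using bar_add[OF HU_S[OF h uV] HU_S[OF h vw(2)]] bar_U[OF h u] by simp
qed

definition lift :: "'f vec => 'v" where "lift w = (SOME v. v : carrier V & pr v = w)"

lemma lift: "w : carrier_vec m ==> lift w : carrier V & pr (lift w) = w"
 unfolding lift_def using pr_surj[of w] by (intro someI_ex[of "%v. v : carrier V & pr v = w"]) blast

text \<open>The map on coinvariants induced by the residue of h; by \<open>bar_pr\<close> the choice
  in \<open>lift\<close> does not matter.\<close>

definition Pi :: "('v => 'l set) => 'f vec => 'k alg_closure" where
 "Pi h = (\<lambda>w\<in>carrier_vec m. bar (h (lift w)))"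

lemma Pi_pr: "h : carrier HU ==> v : carrier V ==> Pi h (pr v) = bar (h v)"
 using lift[OF pr_closed[of v]] bar_pr[of h "lift (pr v)" v] pr_closed[of v] by (simp add: Pi_def)

lemma vecE: "w : carrier_vec m ==> (!!v. v : carrier V ==> w = pr v ==> thesis) ==> thesis"
 using pr_surj by blast

text \<open>The Frobenius \<phi> acts as \<open>Fr\<close> on coinvariants and as the
  \<open>Q\<close>-power on residues, which is the condition h(A v) = h(v)^(q^d).\<close>

lemma Pi_H:
 assumes h: "h : carrier HU"
 shows "Pi h : carrier eqm.H"
 unfolding eqm.carrier_H eqm_E
proof (intro conjI ballI allI)
 note hD = hs.hsD[OF h]
 have bE: "bar (h v) : E" if "v : carrier V" for v
  using HU_rep[OF h that] bar by (auto simp: E_def)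
 show "Pi h : carrier_vec m \<rightarrow>\<^sub>E E" using bE lift by (auto simp: Pi_def)
 fix v w :: "'f vec" and c assume v: "v : carrier_vec m"
 obtain v' where v': "v' : carrier V" "v = pr v'" using v by (rule vecE)
 obtain x where x: "x : B" "h v' = cs I0 x" using HU_rep[OF h v'(1)] by blast
 show "Pi h (iF c \<cdot>\<^sub>v v) = to_ac c * Pi h v"
  using Pi_pr[OF h V_closed(2)[OF v'(1)], of "iF c"] Pi_pr[OF h v'(1)] pr_smult[OF v'(1), of "iF c"] hD(4)[OF v'(1), of c]
  x B_closed(8)[of c] B_closed(3)[OF B_closed(8) x(1), of c] by (simp add: v'(2) S_cs bar \<chi>_mult \<chi>_iL)
 show "Pi h (Fr *\<^sub>v v) = Pi h v ^ (q ^ d)"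
 proof -
  note fG = D_Gal[OF \<phi>(1)]
  have "Fr *\<^sub>v v = pr (\<rho> \<phi> v')" using pr_pow[OF v'(1), of 1] v'(2) Fr(1) by simp
  hence "Pi h (Fr *\<^sub>v v) = bar (\<phi> ` h v')"
  using Pi_pr[OF h rep_closed[OF fG v'(1)]] hD(5)[OF fG v'(1)] by simp
  thus ?thesis using Pi_pr[OF h v'(1)] x Gal_B[OF fG x(1)] \<phi>(2)[OF x(1)] v'(2)
  by (simp add: image_cs[OF fG] bar Q_def)
 qed
 assume w: "w : carrier_vec m"
 obtain w' where w': "w' : carrier V" "w = pr w'" using w by (rule vecE)
 show "Pi h (v + w) = Pi h v + Pi h w"
  using Pi_pr[OF h V_closed(1)[OF v'(1) w'(1)]] Pi_pr[OF h v'(1)] Pi_pr[OF h w'(1)] pr_add[OF v'(1) w'(1)] hD(3)[OF v'(1) w'(1)]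
  bar_add[OF HU_S[OF h v'(1)] HU_S[OF h w'(1)]] v'(2) w'(2) by simp
qed

text \<open>Equivariance prescribes the value at v of a map into B/pB not only modulo
  \<open>P\<close> but modulo all conjugates of \<open>P\<close>; hence the condition on every g
  y.\<close>

definition lifts :: "('f vec => 'k alg_closure) => 'v => 'l => bool" where
 "lifts h v y \<longleftrightarrow> y : B & (ALL g:Gal K. \<chi> (g y) = h (pr (\<rho> g v)))"

text \<open>Along a coset of \<open>D\<close> the prescribed residues are related by
  \<open>Q\<close>-powers, by \<open>pr_decomposition\<close> and the condition defining
  \<open>eqm.H\<close>; this is the compatibility that \<open>crt\<close> requires.\<close>

lemma lifts_exists:
 assumes h: "h : carrier eqm.H" and v: "v : carrier V"
 shows "EX y. lifts h v y"
proof -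
 have hA: "h (Fr ^\<^sub>m i *\<^sub>v w) = h w ^ (Q ^ i)" if "w : carrier_vec m" for w i
  using that
 proof (induction i arbitrary: w)
  case (Suc i)
  have Fw: "Fr *\<^sub>v w : carrier_vec m" using Fr(1) Suc.prems by simp
  have "Fr ^\<^sub>m Suc i *\<^sub>v w = Fr ^\<^sub>m i *\<^sub>v (Fr *\<^sub>v w)"
  using assoc_mult_mat_vec[OF pow_carrier_mat[OF Fr(1)] Fr(1) Suc.prems, of i] by simp
  hence "h (Fr ^\<^sub>m Suc i *\<^sub>v w) = (h w ^ Q) ^ (Q ^ i)"
  using Suc.IH[OF Fw] h Suc.prems by (simp add: eqm.carrier_H Q_def)
  thus ?case by (simp add: power_mult[symmetric])
 qed (use Fr(1) in simp)
 define w where "w g = h (pr (\<rho> g v))" for g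
 obtain y where "y : B" "!!g. g : Gal K ==> \<chi> (g y) = w g"
 proof (rule crt[of w])
  fix y assume "y : B" "!!g. g : Gal K ==> \<chi> (g y) = w g"
  thus thesis by (rule that)
 next
  show "w g : E" if "g : Gal K" for g
  using h pr_closed[OF rep_closed[OF that v]] unfolding w_def eqm.carrier_H eqm_E by auto
  show "w (\<delta> \<circ> g) = w g ^ (Q ^ i)" if g: "g : Gal K" and \<delta>: "\<delta> : D" and i: "!!x. x : B ==> \<chi> (\<delta> x) = \<chi> x ^ (Q ^ i)" for g \<delta> i
  proof -
  have e: "pr (\<rho> \<delta> (\<rho> g v)) = Fr ^\<^sub>m i *\<^sub>v pr (\<rho> g v)"
   by (rule pr_decomposition) (use i \<delta> rep_closed[OF g v] in simp_all)
  show ?thesis unfolding w_def rep_comp[OF D_Gal[OF \<delta>] g v] e by (rule hA[OF pr_closed[OF rep_closed[OF g v]]])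
  qed
 qed
 thus ?thesis by (auto simp: lifts_def w_def)
qed

text \<open>A power of the characteristic, as \<open>det_twist_shift_equivalent\<close> requires,
  and at least the order of the group, so that the q^\<open>M0\<close>-power kills the nilpotent
  difference of two lifts.\<close>

definition M0 :: nat where "M0 = CHAR('f) ^ card (Gal K)"

definition Sec :: "('f vec => 'k alg_closure) => 'v => 'l set" where
 "Sec h = (\<lambda>v\<in>carrier V. cs I0 ((SOME y. lifts h v y) ^ (q ^ M0)))"

text \<open>Two lifts differ by an element all of whose conjugates lie in \<open>P\<close>; its
  q^\<open>M0\<close>-th power lies in pB by \<open>nilpotent_mod_I0\<close>, and taking this power
  is additive.\<close>

lemma Sec:
 assumes y: "lifts h v y" and v: "v : carrier V"
 shows "Sec h v = cs I0 (y ^ (q ^ M0))"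
proof -
 define y' where "y' = (SOME y. lifts h v y)"
 have y': "lifts h v y'" unfolding y'_def by (rule someI[of _ y]) (rule y)
 have B: "y : B" "y' : B" using y y' by (simp_all add: lifts_def)
 have "\<chi> (g (y' - y)) = 0" if g: "g : Gal K" for g
  using y y' g \<chi>_diff[OF Gal_B[OF g B(2)] Gal_B[OF g B(1)]] by (simp add: lifts_def GalD(3)[OF g])
 hence "(y' - y) ^ (q ^ card (Gal K)) : I0" by (rule nilpotent_mod_I0[OF B_closed(2)[OF B(2,1)]])
 moreover have "(y' - y) ^ (q ^ M0) = (y' - y) ^ (q ^ M0 - q ^ card (Gal K)) * (y' - y) ^ (q ^ card (Gal K))"
 proof -
  have "prime CHAR('f)" using eqm.iF.field_hom_axioms CHAR_field_hom[OF iF] prime_CHAR_finite_field[where ?'k = 'k] by simp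
  hence "card (Gal K) <= M0" unfolding M0_def
  using less_exp[of "card (Gal K)"] power_mono[of 2 "CHAR('f)" "card (Gal K)"] prime_ge_2_nat[of "CHAR('f)"] by linarith
  hence "q ^ card (Gal K) <= q ^ M0" using em.q_ge by (intro power_increasing) auto
  thus ?thesis by (simp flip: power_add)
 qed
 ultimately have "(y' - y) ^ (q ^ M0) : I0" using Ic(4)[OF B_closed(10)[OF B_closed(2)[OF B(2,1)]]] by simp
 hence "y' ^ (q ^ M0) - y ^ (q ^ M0) : I0" unfolding Lq.q_power_diff .
 hence "cs I0 (y' ^ (q ^ M0)) = cs I0 (y ^ (q ^ M0))" by (simp only: Ic(6))
 moreover have "Sec h v = cs I0 (y' ^ (q ^ M0))" using v by (simp add: Sec_def y'_def)
 ultimately show ?thesis by (simp only:)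
qed

text \<open>Since any lift may be used, sums, k-multiples and Galois conjugates of lifts serve as
  lifts, and the q^\<open>M0\<close>-power respects these operations.\<close>

lemma Sec_HU:
 assumes h: "h : carrier eqm.H"
 shows "Sec h : carrier HU"
proof -
 have ex: "EX y. lifts h v y" if "v : carrier V" for v by (rule lifts_exists[OF h that])
 have yB: "lifts h v y ==> y : B" for v y by (simp add: lifts_def)
 have hadd: "h (a + b) = h a + h b" if "a : carrier_vec m" "b : carrier_vec m" for a b using h that by (simp add: eqm.carrier_H)
 have hsm: "h (iF c \<cdot>\<^sub>v a) = to_ac c * h a" if "a : carrier_vec m" for a c using h that by (simp add: eqm.carrier_H)
 have 1: "Sec h v : cs I0 ` B" if v: "v : carrier V" for v
  using ex[OF v] Sec[OF _ v] yB B_closed(10) by (metis imageI)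
 have 2: "Sec h (v \<oplus>\<^bsub>V\<^esub> w) = Sec h v \<oplus>\<^bsub>SR\<^esub> Sec h w" if v: "v : carrier V" and w: "w : carrier V" for v w
 proof -
  obtain y y' where y: "lifts h v y" and y': "lifts h w y'" using ex v w by blast
  note B = yB[OF y] yB[OF y']
  have "lifts h (v \<oplus>\<^bsub>V\<^esub> w) (y + y')"
  unfolding lifts_def
  proof (intro conjI ballI B_closed(1)[OF B])
  fix g assume g: "g : Gal K"
  show "\<chi> (g (y + y')) = h (pr (\<rho> g (v \<oplus>\<^bsub>V\<^esub> w)))"
   using y y' g \<chi>_add[OF Gal_B[OF g B(1)] Gal_B[OF g B(2)]] hadd[OF pr_closed[OF rep_closed[OF g v]] pr_closed[OF rep_closed[OF g w]]]
   by (simp add: lifts_def GalD(1)[OF g] rep_add[OF g v w] pr_add[OF rep_closed[OF g v] rep_closed[OF g w]])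
  qed
  from Sec[OF this V_closed(1)[OF v w]] show ?thesis
  using Sec[OF y v] Sec[OF y' w] B_closed(10)[OF B(1)] B_closed(10)[OF B(2)] by (simp add: S_cs Lq.q_power_add)
 qed
 have 3: "Sec h (iF c \<odot>\<^bsub>V\<^esub> v) = cs I0 (iL c) \<otimes>\<^bsub>SR\<^esub> Sec h v" if v: "v : carrier V" for v c
 proof -
  obtain y where y: "lifts h v y" using ex v by blast
  note B = yB[OF y]
  have "lifts h (iF c \<odot>\<^bsub>V\<^esub> v) (iL c * y)"
  unfolding lifts_def
  proof (intro conjI ballI B_closed(3)[OF B_closed(8) B])
  fix g assume g: "g : Gal K"
  show "\<chi> (g (iL c * y)) = h (pr (\<rho> g (iF c \<odot>\<^bsub>V\<^esub> v)))"
   using y g \<chi>_mult[OF B_closed(8) Gal_B[OF g B]] hsm[OF pr_closed[OF rep_closed[OF g v]]]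
   by (simp add: lifts_def GalD(2,12)[OF g] \<chi>_iL rep_smult[OF g v] pr_smult[OF rep_closed[OF g v]])
  qed
  from Sec[OF this V_closed(2)[OF v]] show ?thesis
  using Sec[OF y v] B_closed(10)[OF B] B_closed(8) by (simp add: S_cs power_mult_distrib Lq.q_power_em)
 qed
 have 4: "Sec h (\<rho> \<gamma> v) = \<gamma> ` Sec h v" if v: "v : carrier V" and \<gamma>: "\<gamma> : Gal K" for v \<gamma>
 proof -
  obtain y where y: "lifts h v y" using ex v by blast
  note B = yB[OF y]
  have "lifts h (\<rho> \<gamma> v) (\<gamma> y)"
  unfolding lifts_def
  proof (intro conjI ballI Gal_B[OF \<gamma> B])
  fix g assume g: "g : Gal K"
  show "\<chi> (g (\<gamma> y)) = h (pr (\<rho> g (\<rho> \<gamma> v)))"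
   using y Gal_comp[OF g \<gamma>] rep_comp[OF g \<gamma> v] by (auto simp: lifts_def dest!: bspec)
  qed
  from Sec[OF this rep_closed[OF \<gamma> v]] show ?thesis
  using Sec[OF y v] by (simp add: image_cs[OF \<gamma>] GalD(9)[OF \<gamma>])
 qed
 show ?thesis
  unfolding hom_space_def using 1 2 3 4 by (auto simp: S_cs(2) Sec_def[of h, THEN arg_cong[where f = "%k. k x" for x]] PiE_def extensional_def Sec_def)
qed

lemma Sec_add: "h : carrier eqm.H ==> k : carrier eqm.H ==> Sec (h \<oplus>\<^bsub>eqm.H\<^esub> k) = Sec h \<oplus>\<^bsub>HU\<^esub> Sec k"
 and Sec_smult: "h : carrier eqm.H ==> Sec (a \<odot>\<^bsub>eqm.H\<^esub> h) = a \<odot>\<^bsub>HU\<^esub> Sec h"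
proof -
 have ext: "F = G" if "F : carrier V \<rightarrow>\<^sub>E UNIV" "G : carrier V \<rightarrow>\<^sub>E UNIV" "!!v. v : carrier V ==> F v = G v" for F G :: "'v => 'l set"
  by (rule PiE_ext[OF that])
 have S_ext: "Sec h : carrier V \<rightarrow>\<^sub>E UNIV" for h by (simp add: Sec_def)
 show "Sec (h \<oplus>\<^bsub>eqm.H\<^esub> k) = Sec h \<oplus>\<^bsub>HU\<^esub> Sec k" if h: "h : carrier eqm.H" and k: "k : carrier eqm.H" for h k
 proof (rule ext[OF S_ext])
  show "Sec h \<oplus>\<^bsub>HU\<^esub> Sec k : carrier V \<rightarrow>\<^sub>E UNIV" by (simp add: hs.hs_ops)
  fix v assume v: "v : carrier V"
  obtain y y' where y: "lifts h v y" and y': "lifts k v y'" using lifts_exists[OF _ v] h k by blast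
  have B: "y : B" "y' : B" using y y' by (auto simp: lifts_def)
  have "lifts (h \<oplus>\<^bsub>eqm.H\<^esub> k) v (y + y')"
  unfolding lifts_def
  proof (intro conjI ballI B_closed(1)[OF B])
  fix g assume g: "g : Gal K"
  show "\<chi> (g (y + y')) = (h \<oplus>\<^bsub>eqm.H\<^esub> k) (pr (\<rho> g v))"
   using y y' g \<chi>_add[OF Gal_B[OF g B(1)] Gal_B[OF g B(2)]] pr_closed[OF rep_closed[OF g v]]
   by (simp add: lifts_def GalD(1)[OF g] eqm.ops_H)
  qed
  from Sec[OF this v] show "Sec (h \<oplus>\<^bsub>eqm.H\<^esub> k) v = (Sec h \<oplus>\<^bsub>HU\<^esub> Sec k) v"
  using Sec[OF y v] Sec[OF y' v] B_closed(10)[OF B(1)] B_closed(10)[OF B(2)] v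
  by (simp add: hs.hs_ops S_cs Lq.q_power_add)
 qed
 show "Sec (a \<odot>\<^bsub>eqm.H\<^esub> h) = a \<odot>\<^bsub>HU\<^esub> Sec h" if h: "h : carrier eqm.H" for h
 proof (rule ext[OF S_ext])
  show "a \<odot>\<^bsub>HU\<^esub> Sec h : carrier V \<rightarrow>\<^sub>E UNIV" by (simp add: hs.hs_ops)
  fix v assume v: "v : carrier V"
  \<comment> \<open>F acts through V, so a lift for h at a v is a lift for a h at v.\<close>
  obtain y where y: "lifts h (a \<odot>\<^bsub>V\<^esub> v) y" using lifts_exists[OF h V_closed(2)[OF v]] by blast
  have "lifts (a \<odot>\<^bsub>eqm.H\<^esub> h) v y"
  using y unfolding lifts_def
  by (auto simp: eqm.ops_H rep_smult[OF _ v] pr_smult[OF rep_closed[OF _ v]] pr_closed[OF rep_closed[OF _ v]])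
  from Sec[OF this v] show "Sec (a \<odot>\<^bsub>eqm.H\<^esub> h) v = (a \<odot>\<^bsub>HU\<^esub> Sec h) v"
  using Sec[OF y V_closed(2)[OF v]] v by (simp add: hs.hs_ops)
 qed
qed

text \<open>The matrices of \<open>Pi\<close> and \<open>Sec\<close> compose in either order to the
  \<open>M0\<close>-th power of the q-power map, so \<open>det_twist_shift_equivalent\<close>
  carries the determinant from Hom(V, B/pB) to the equivariant maps on coinvariants, where
  \<open>det_equivariant_maps\<close> evaluates it.\<close>

theorem carlitz_eq_coinv:
 assumes n: "n >= 1"
 shows "carlitz_factor iF iL z K V \<rho> n p = inverse (fps_to_fls (mdet (1\<^sub>m m -
  (fps_X ^ (n * d) * inverse (fps_of_poly (map_poly iF (reflect_poly (residue_char_poly iL z A_ring p))) ^ n)) \<cdot>\<^sub>m cmat Fr)))"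
proof -
 obtain N TT where c: "coords HU N TT" using hs.hs_coords[OF C.target_M] by metis
 note D = coordsD[OF c]
 obtain Z T where Z: "Z : carrier_mat N N" "!!h. h : carrier HU ==> TT (hs.post (%x. cs I0 z \<otimes>\<^bsub>SR\<^esub> x) h) = Z *\<^sub>v TT h"
  and T: "T : carrier_mat N N" "!!h. h : carrier HU ==> TT (hs.post (%x. x [^]\<^bsub>SR\<^esub> q) h) = T *\<^sub>v TT h"
  and quot: "at_t (hom_char_poly iF (Gal K) V \<rho> (power_module C.M n) (C.actn n) (lie_carlitz_t SR (cs I0 z) n)) /
  at_t (hom_char_poly iF (Gal K) V \<rho> (power_module C.M n) (C.actn n) (carlitz_t SR (cs I0 z) q n)) =
  inverse (fps_to_fls (mdet (1\<^sub>m N - fps_X ^ n \<cdot>\<^sub>m twist n Z T)))"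
  using C.carlitz_quotient[OF n c] by metis
 note zc = hs.post_closed[OF C.equis(1)[OF n]] and qc = hs.post_closed[OF C.equis(2)[OF n]]
 have hext: "F = G" if "F : carrier HU" "G : carrier HU" "!!v. v : carrier V ==> F v = G v" for F G
  by (rule PiE_ext[OF hs.hsD(1)[OF that(1)] hs.hsD(1)[OF that(2)] that(3)])
 \<comment> \<open>Matrix powers are followed on representatives of cosets:
   \<open>T ^\<^sub>m j\<close> raises them to the q^j, and in \<open>Zk\<close> the matrix
   \<open>Z ^\<^sub>m j\<close> multiplies them by z^j.\<close>
 have Tk: "EX k. k : carrier HU & TT k = T ^\<^sub>m j *\<^sub>v TT h & (ALL v:carrier V. ALL x:B. h v = cs I0 x --> k v = cs I0 (x ^ (q ^ j)))"
  if h: "h : carrier HU" for h j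
 proof (induction j)
  case 0
  show ?case using h D(3)[OF h] T(1) by (intro exI[of _ h]) simp
 next
  case (Suc j)
  then obtain k where k: "k : carrier HU" "TT k = T ^\<^sub>m j *\<^sub>v TT h" "ALL v:carrier V. ALL x:B. h v = cs I0 x --> k v = cs I0 (x ^ (q ^ j))" by blast
  have TS: "T ^\<^sub>m Suc j *\<^sub>v TT h = T *\<^sub>v (T ^\<^sub>m j *\<^sub>v TT h)"
  proof -
  have "T ^\<^sub>m Suc j = T * T ^\<^sub>m j" using mat_pow_Suc'[of T j] T(1) by simp
  thus ?thesis using assoc_mult_mat_vec[OF T(1) pow_carrier_mat[OF T(1)] D(3)[OF h], of j] by simp
  qed
  show ?case
  proof (intro exI[of _ "hs.post (%x. x [^]\<^bsub>SR\<^esub> q) k"] conjI ballI impI)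
  show "hs.post (%x. x [^]\<^bsub>SR\<^esub> q) k : carrier HU" by (rule qc[OF k(1)])
  show "TT (hs.post (%x. x [^]\<^bsub>SR\<^esub> q) k) = T ^\<^sub>m Suc j *\<^sub>v TT h" unfolding TS using T(2)[OF k(1)] k(2) by simp
  fix v x assume v: "v : carrier V" and x: "x : B" "h v = cs I0 x"
  have "k v = cs I0 (x ^ (q ^ j))" using k(3) v x by blast
  thus "hs.post (%x. x [^]\<^bsub>SR\<^esub> q) k v = cs I0 (x ^ (q ^ Suc j))"
   using v S_pow[OF B_closed(10)[OF x(1)], of "q ^ j" q] by (simp add: hs.post_def power_mult[symmetric] mult.commute)
  qed
 qed
 have Zk: "EX k. k : carrier HU & TT k = Z ^\<^sub>m j *\<^sub>v TT h & (ALL v:carrier V. ALL x:B. h v = cs I0 x --> k v = cs I0 (z ^ j * x))"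
  if h: "h : carrier HU" for h j
 proof (induction j)
  case 0
  show ?case using h D(3)[OF h] Z(1) by (intro exI[of _ h]) simp
 next
  case (Suc j)
  then obtain k where k: "k : carrier HU" "TT k = Z ^\<^sub>m j *\<^sub>v TT h" "ALL v:carrier V. ALL x:B. h v = cs I0 x --> k v = cs I0 (z ^ j * x)" by blast
  have ZS: "Z ^\<^sub>m Suc j *\<^sub>v TT h = Z *\<^sub>v (Z ^\<^sub>m j *\<^sub>v TT h)"
  proof -
  have "Z ^\<^sub>m Suc j = Z * Z ^\<^sub>m j" using mat_pow_Suc'[of Z j] Z(1) by simp
  thus ?thesis using assoc_mult_mat_vec[OF Z(1) pow_carrier_mat[OF Z(1)] D(3)[OF h], of j] by simp
  qed
  show ?case
  proof (intro exI[of _ "hs.post (%x. cs I0 z \<otimes>\<^bsub>SR\<^esub> x) k"] conjI ballI impI)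
  show "hs.post (%x. cs I0 z \<otimes>\<^bsub>SR\<^esub> x) k : carrier HU" by (rule zc[OF k(1)])
  show "TT (hs.post (%x. cs I0 z \<otimes>\<^bsub>SR\<^esub> x) k) = Z ^\<^sub>m Suc j *\<^sub>v TT h" unfolding ZS using Z(2)[OF k(1)] k(2) by simp
  fix v x assume v: "v : carrier V" and x: "x : B" "h v = cs I0 x"
  have "k v = cs I0 (z ^ j * x)" using k(3) v x by blast
  thus "hs.post (%x. cs I0 z \<otimes>\<^bsub>SR\<^esub> x) k v = cs I0 (z ^ Suc j * x)"
   using v S_cs(4)[OF B_closed(7) B_closed(3)[OF B_closed(10)[OF B_closed(7)] x(1)], of j] by (simp add: hs.post_def mult.assoc)
  qed
 qed
 have TZ: "T * Z = Z ^\<^sub>m q * T"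
 proof (rule coords_mat_eqI[OF c mult_carrier_mat[OF T(1) Z(1)] mult_carrier_mat[OF pow_carrier_mat[OF Z(1)] T(1)]])
  fix h assume h: "h : carrier HU"
  let ?zh = "hs.post (%x. cs I0 z \<otimes>\<^bsub>SR\<^esub> x) h" and ?qh = "hs.post (%x. x [^]\<^bsub>SR\<^esub> q) h"
  obtain k where k: "k : carrier HU" "TT k = Z ^\<^sub>m q *\<^sub>v TT ?qh" "ALL v:carrier V. ALL x:B. ?qh v = cs I0 x --> k v = cs I0 (z ^ q * x)"
  using Zk[OF qc[OF h], of q] by blast
  have "hs.post (%x. x [^]\<^bsub>SR\<^esub> q) ?zh = k"
  proof (rule hext[OF qc[OF zc[OF h]] k(1)])
  fix v assume v: "v : carrier V"
  obtain x where x: "x : B" "h v = cs I0 x" using HU_rep[OF h v] by blast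
  have "?qh v = cs I0 (x ^ q)" using v x(2) S_pow[OF x(1), of q] by (simp add: hs.post_def)
  hence "k v = cs I0 (z ^ q * x ^ q)" using k(3) v B_closed(10)[OF x(1)] by blast
  thus "hs.post (%x. x [^]\<^bsub>SR\<^esub> q) ?zh v = k v"
   using v x(2) S_cs(4)[OF B_closed(7) x(1)] S_pow[OF B_closed(3)[OF B_closed(7) x(1)], of q] by (simp add: hs.post_def power_mult_distrib)
  qed
  hence "T *\<^sub>v (Z *\<^sub>v TT h) = Z ^\<^sub>m q *\<^sub>v (T *\<^sub>v TT h)"
  using T(2)[OF zc[OF h]] Z(2)[OF h] k(2) T(2)[OF h] by simp
  thus "T * Z *\<^sub>v TT h = Z ^\<^sub>m q * T *\<^sub>v TT h"
  using assoc_mult_mat_vec[OF T(1) Z(1) D(3)[OF h]] assoc_mult_mat_vec[OF pow_carrier_mat[OF Z(1)] T(1) D(3)[OF h], of q] by simp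
 qed
 obtain N' T' where c': "coords eqm.H N' T'"
  using coords_exists[OF eqm.vectorspace_H finite_vectorspace_fin_dim[OF eqm.vectorspace_H eqm.finite_H]] by metis
 note D' = coordsD[OF c']
 have \<zeta>: "\<chi> z ^ (q ^ d) = \<chi> z" using \<chi>_A[OF A_closed(7)] by (simp add: Q_def)
 have "EX M:carrier_mat N' N'. ALL h:carrier eqm.H. T' (eqm.scale (\<chi> z) h) = M *\<^sub>v T' h"
  by (rule coords_linear_ex[OF c' c' eqm.scale_closed[OF \<zeta>]])
  (auto simp: eqm.scale_def eqm.ops_H distrib_left intro!: restrict_ext)
 then obtain W' where W': "W' : carrier_mat N' N'" "!!h. h : carrier eqm.H ==> T' (eqm.scale (\<chi> z) h) = W' *\<^sub>v T' h" by blast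
 have "EX M:carrier_mat N' N'. ALL h:carrier eqm.H. T' (eqm.frob 1 h) = M *\<^sub>v T' h"
  by (rule coords_linear_ex[OF c' c' eqm.frob_closed])
  (auto simp: eqm.frob_def eqm.ops_H em.q_power_add[of _ _ 1, simplified] power_mult_distrib intro!: restrict_ext)
 then obtain U' where U': "U' : carrier_mat N' N'" "!!h. h : carrier eqm.H ==> T' (eqm.frob 1 h) = U' *\<^sub>v T' h" by blast
 note det = eqm.det_equivariant_maps[OF c' W'(1) U'(1) W'(2) U'(2) \<zeta> residue_poly_reflect(1)]
 have Uk: "T' (eqm.frob j h) = U' ^\<^sub>m j *\<^sub>v T' h" if h: "h : carrier eqm.H" for j h
  using h
 proof (induction j arbitrary: h)
  case 0
  have "eqm.frob 0 h = h" using 0 by (intro eqm.H_eqI eqm.frob_closed) (auto simp: eqm.frob_def)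
  thus ?case using D'(3)[OF 0] U'(1) by simp
 next
  case (Suc j)
  have "eqm.frob (Suc j) h = eqm.frob j (eqm.frob 1 h)" using Suc.prems by (simp add: eqm.frob_frob)
  thus ?case
  using Suc.IH[OF eqm.frob_closed[OF Suc.prems]] U'(2)[OF Suc.prems]
   assoc_mult_mat_vec[OF pow_carrier_mat[OF U'(1)] U'(1) D'(3)[OF Suc.prems], of j] by simp
 qed
 have "EX M:carrier_mat N' N. ALL h:carrier HU. T' (Pi h) = M *\<^sub>v TT h"
 proof (rule coords_linear_ex[OF c c' Pi_H])
  fix h k a assume h: "h : carrier HU"
  show "Pi (a \<odot>\<^bsub>HU\<^esub> h) = a \<odot>\<^bsub>eqm.H\<^esub> Pi h"
  proof (rule eqm.H_eqI[OF Pi_H[OF D(6)[OF h]] D'(6)[OF Pi_H[OF h]]])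
  fix w :: "'f vec" assume "w : carrier_vec m"
  then obtain v where v: "v : carrier V" "w = pr v" by (rule vecE)
  show "Pi (a \<odot>\<^bsub>HU\<^esub> h) w = (a \<odot>\<^bsub>eqm.H\<^esub> Pi h) w"
   using Pi_pr[OF D(6)[OF h] v(1), of a] Pi_pr[OF h V_closed(2)[OF v(1)], of a] v pr_closed[OF v(1)] pr_smult[OF v(1), of a]
   by (simp add: hs.hs_ops eqm.ops_H)
  qed
  assume k: "k : carrier HU"
  show "Pi (h \<oplus>\<^bsub>HU\<^esub> k) = Pi h \<oplus>\<^bsub>eqm.H\<^esub> Pi k"
  proof (rule eqm.H_eqI[OF Pi_H[OF D(4)[OF h k]] D'(4)[OF Pi_H[OF h] Pi_H[OF k]]])
  fix w :: "'f vec" assume "w : carrier_vec m"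
  then obtain v where v: "v : carrier V" "w = pr v" by (rule vecE)
  show "Pi (h \<oplus>\<^bsub>HU\<^esub> k) w = (Pi h \<oplus>\<^bsub>eqm.H\<^esub> Pi k) w"
   using Pi_pr[OF D(4)[OF h k] v(1)] Pi_pr[OF h v(1)] Pi_pr[OF k v(1)] v pr_closed[OF v(1)]
    bar_add[OF HU_S[OF h v(1)] HU_S[OF k v(1)]] by (simp add: hs.hs_ops eqm.ops_H)
  qed
 qed
 then obtain PM where PM: "PM : carrier_mat N' N" "!!h. h : carrier HU ==> T' (Pi h) = PM *\<^sub>v TT h" by blast
 have "EX M:carrier_mat N N'. ALL h:carrier eqm.H. TT (Sec h) = M *\<^sub>v T' h"
  by (rule coords_linear_ex[OF c' c]; (rule Sec_HU Sec_add Sec_smult); assumption)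
 then obtain SM where SM: "SM : carrier_mat N N'" "!!h. h : carrier eqm.H ==> TT (Sec h) = SM *\<^sub>v T' h" by blast
 have PZ: "PM * Z = W' * PM"
 proof (rule coords_mat_eqI[OF c mult_carrier_mat[OF PM(1) Z(1)] mult_carrier_mat[OF W'(1) PM(1)]])
  fix h assume h: "h : carrier HU"
  let ?zh = "hs.post (%x. cs I0 z \<otimes>\<^bsub>SR\<^esub> x) h"
  have "Pi ?zh = eqm.scale (\<chi> z) (Pi h)"
  proof (rule eqm.H_eqI[OF Pi_H[OF zc[OF h]] eqm.scale_closed[OF \<zeta> Pi_H[OF h]]])
  fix w :: "'f vec" assume "w : carrier_vec m"
  then obtain v where v: "v : carrier V" "w = pr v" by (rule vecE)
  obtain x where x: "x : B" "h v = cs I0 x" using HU_rep[OF h v(1)] by blast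
  show "Pi ?zh w = eqm.scale (\<chi> z) (Pi h) w"
   using Pi_pr[OF zc[OF h] v(1)] Pi_pr[OF h v(1)] v pr_closed[OF v(1)] x S_cs(4)[OF B_closed(7) x(1)]
    bar[OF B_closed(3)[OF B_closed(7) x(1)]] bar[OF x(1)] \<chi>_mult[OF B_closed(7) x(1)]
   by (simp add: hs.post_def eqm.scale_def)
  qed
  thus "PM * Z *\<^sub>v TT h = W' * PM *\<^sub>v TT h"
  using PM(2)[OF zc[OF h]] Z(2)[OF h] W'(2)[OF Pi_H[OF h]] PM(2)[OF h]
   assoc_mult_mat_vec[OF PM(1) Z(1) D(3)[OF h]] assoc_mult_mat_vec[OF W'(1) PM(1) D(3)[OF h]] by simp
 qed
 \<comment> \<open>A representative of h(v) is itself a lift for \<open>Pi h\<close> at v, so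
   \<open>Sec\<close> returns its q^\<open>M0\<close>-th power.\<close>
 have SP: "SM * PM = T ^\<^sub>m M0"
 proof (rule coords_mat_eqI[OF c mult_carrier_mat[OF SM(1) PM(1)] pow_carrier_mat[OF T(1)]])
  fix h assume h: "h : carrier HU"
  obtain k where k: "k : carrier HU" "TT k = T ^\<^sub>m M0 *\<^sub>v TT h" "ALL v:carrier V. ALL x:B. h v = cs I0 x --> k v = cs I0 (x ^ (q ^ M0))"
  using Tk[OF h, of M0] by blast
  have "Sec (Pi h) = k"
  proof (rule hext[OF Sec_HU[OF Pi_H[OF h]] k(1)])
  fix v assume v: "v : carrier V"
  obtain x where x: "x : B" "h v = cs I0 x" using HU_rep[OF h v] by blast
  have "lifts (Pi h) v x"
   unfolding lifts_def
  proof (intro conjI ballI x(1))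
   fix g assume g: "g : Gal K"
   show "\<chi> (g x) = Pi h (pr (\<rho> g v))"
    using Pi_pr[OF h rep_closed[OF g v]] hs.hsD(5)[OF h g v] x(2) bar[OF Gal_B[OF g x(1)]] by (simp add: image_cs[OF g])
  qed
  thus "Sec (Pi h) v = k v" using Sec[OF _ v] k(3) v x by simp
  qed
  thus "SM * PM *\<^sub>v TT h = T ^\<^sub>m M0 *\<^sub>v TT h"
  using SM(2)[OF Pi_H[OF h]] PM(2)[OF h] k(2) assoc_mult_mat_vec[OF SM(1) PM(1) D(3)[OF h]] by simp
 qed
 \<comment> \<open>A lift has residue h at \<open>P\<close> itself, by the condition at g = id; the
   power taken in \<open>Sec\<close> turns it into a Frobenius iterate.\<close>
 have PS: "PM * SM = U' ^\<^sub>m M0"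
 proof (rule coords_mat_eqI[OF c' mult_carrier_mat[OF PM(1) SM(1)] pow_carrier_mat[OF U'(1)]])
  fix h assume h: "h : carrier eqm.H"
  have "Pi (Sec h) = eqm.frob M0 h"
  proof (rule eqm.H_eqI[OF Pi_H[OF Sec_HU[OF h]] eqm.frob_closed[OF h]])
  fix w :: "'f vec" assume "w : carrier_vec m"
  then obtain v where v: "v : carrier V" "w = pr v" by (rule vecE)
  obtain y where y: "lifts h v y" using lifts_exists[OF h v(1)] by blast
  have yB: "y : B" using y by (simp add: lifts_def)
  have "\<chi> y = h (pr v)" using y Gal_id rep_id[OF v(1)] by (auto simp: lifts_def dest!: bspec)
  thus "Pi (Sec h) w = eqm.frob M0 h w"
   using Pi_pr[OF Sec_HU[OF h] v(1)] Sec[OF y v(1)] bar[OF B_closed(10)[OF yB]] \<chi>_power[OF yB] v pr_closed[OF v(1)]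
   by (simp add: eqm.frob_def)
  qed
  thus "PM * SM *\<^sub>v T' h = U' ^\<^sub>m M0 *\<^sub>v T' h"
  using PM(2)[OF Sec_HU[OF h]] SM(2)[OF h] Uk[OF h] assoc_mult_mat_vec[OF PM(1) SM(1) D'(3)[OF h]] by simp
 qed
 have pF: "prime CHAR('f)"
  using CHAR_field_hom[OF iF] prime_CHAR_finite_field[where ?'k = 'k] by simp
 have "mdet (1\<^sub>m N - fps_X ^ n \<cdot>\<^sub>m twist n Z T) = mdet (1\<^sub>m N' - fps_X ^ n \<cdot>\<^sub>m twist n W' U')"
  by (rule det_twist_shift_equivalent[OF Z(1) T(1) TZ W'(1) U'(1) det(2) PM(1) SM(1) PZ SP PS M0_def pF])
 thus ?thesis unfolding carlitz_factor_eq quot using det(1)[of "fps_X ^ n" n] by (simp add: power_mult)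
qed

end

section \<open>Comparison of the Euler products\<close>

context prime_rep
begin

abbreviation rp :: "'k poly" where "rp \<equiv> residue_char_poly iL z A_ring p"

definition g0 :: "'f fps" where "g0 = fps_of_poly (map_poly iF (reflect_poly rp))"

text \<open>The reversed residue polynomial has constant term 1 by its factorisation over the
  closure, so the residue polynomial is t^d times a unit of F[[1/t]].\<close>

lemma at_t_residue: "at_t (map_poly iF rp) = fls_X_inv ^ d * fps_to_fls g0"
 and g0_unit: "inverse g0 * g0 = 1" and at_t_residue_nz: "at_t (map_poly iF rp) ~= 0"
proof -
 have deg: "degree (map_poly iF rp) = d" using residue_poly_reflect(2) by (simp add: degree_map_poly)
 have r: "reflect_poly (map_poly iF rp) = map_poly iF (reflect_poly rp)" by (rule reflect_poly_map_inj) simp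
 show a: "at_t (map_poly iF rp) = fls_X_inv ^ d * fps_to_fls g0" unfolding at_t_reflect deg r g0_def ..
 have "poly (map_poly to_ac (reflect_poly rp) :: 'k alg_closure poly) 0 = 1" unfolding residue_poly_reflect(1) poly_prod by simp
 hence "(to_ac (pcoeff (reflect_poly rp) 0) :: 'k alg_closure) = to_ac 1"
  by (simp only: poly_0_coeff_0 coeff_map_poly to_ac_0 to_ac_1)
 hence "pcoeff (reflect_poly rp) 0 = 1" by (simp only: to_ac_eq_iff)
 hence "fps_nth g0 0 = 1" by (simp add: g0_def coeff_map_poly)
 thus "inverse g0 * g0 = 1" by (intro inverse_mult_eq_1) simp
 hence "g0 ~= 0" by auto
 thus "at_t (map_poly iF rp) ~= 0" unfolding a by simp
qed

lemma inverse_at_t: "inverse (at_t (map_poly iF rp) ^ n) = fps_to_fls (fps_X ^ (n * d) * inverse (g0 ^ n))"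
proof -
 interpret h: comm_ring_hom "fps_to_fls :: 'f fps => _" by (rule fps_to_fls_hom)
 have "fps_to_fls (inverse g0) * fps_to_fls g0 = 1" using g0_unit by (simp add: h.hom_mult[symmetric])
 hence i: "fps_to_fls (inverse g0) = inverse (fps_to_fls g0)" by (metis inverse_unique mult.commute)
 have p: "fps_to_fls (inverse (g0 ^ n)) = inverse (fps_to_fls g0 ^ n)"
  by (simp only: fps_inverse_power h.hom_power i power_inverse)
 have x: "fls_X = inverse (fls_X_inv :: 'f fls)" using fls_X_inv_X(1) by (metis inverse_unique)
 show ?thesis unfolding at_t_residue h.hom_mult fps_inverse_power[symmetric] h.hom_power i
  by (simp add: power_mult_distrib power_mult[symmetric] mult.commute x power_inverse p)
qed

text \<open>The Euler determinant as a power series in 1/t: the inverse n-th power of the residue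
  polynomial is (1/t)^(n d) times the inverse of \<open>g0 ^ n\<close>.\<close>

definition det_fps :: "nat => 'f mat => 'f fps" where
 "det_fps n N = mdet (1\<^sub>m (dim_row N) - (fps_X ^ (n * d) * inverse (g0 ^ n)) \<cdot>\<^sub>m cmat N)"

lemma det_fps_fls:
 assumes N: "N : carrier_mat a a"
 shows "mdet (1\<^sub>m a - inverse (at_t (map_poly iF rp) ^ n) \<cdot>\<^sub>m map_mat fls_const N) = fps_to_fls (det_fps n N)"
  "unit_mod (n * d) (det_fps n N)"
proof -
 interpret h: comm_ring_hom "fps_to_fls :: 'f fps => _" by (rule fps_to_fls_hom)
 let ?c = "fps_X ^ (n * d) * inverse (g0 ^ n)"
 have "map_mat fps_to_fls (1\<^sub>m a - ?c \<cdot>\<^sub>m cmat N) = 1\<^sub>m a - fps_to_fls ?c \<cdot>\<^sub>m map_mat fls_const N"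
  using N by (intro eq_matI) (auto simp: h.hom_minus h.hom_mult)
 thus "mdet (1\<^sub>m a - inverse (at_t (map_poly iF rp) ^ n) \<cdot>\<^sub>m map_mat fls_const N) = fps_to_fls (det_fps n N)"
  using N unfolding det_fps_def inverse_at_t by (simp add: h.hom_det[symmetric])
 show "unit_mod (n * d) (det_fps n N)" using unit_mod_det[OF N] N unfolding det_fps_def by simp
qed

lemma fls_inverse_unit:
 assumes "unit_mod w F" "w >= 1"
 shows "inverse (fps_to_fls F) = fps_to_fls (inverse F)"
proof -
 have "fps_to_fls (inverse F) * fps_to_fls F = 1" using unit_mod_inverse(2)[OF assms] by (simp add: fls_times_fps_to_fls[symmetric])
 thus ?thesis by (metis inverse_unique mult.commute)
qed

text \<open>The matrix is arbitrary so that the result serves both Euler products: \<open>Fr\<close>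
  for coinvariants and the matrix of \<open>inv_factor_mat\<close> for invariants.\<close>

lemma inverse_det_factor:
 assumes N: "N : carrier_mat a a" and n: "n >= 1"
 shows "inverse (mdet (1\<^sub>m a - inverse (at_t (map_poly iF rp) ^ n) \<cdot>\<^sub>m map_mat fls_const N)) =
  fps_to_fls (inverse (det_fps n N))" "unit_mod (n * d) (inverse (det_fps n N))"
  "fps_to_fls (inverse (det_fps n N)) : nonzero_ratfuns" "fps_to_fls (inverse (det_fps n N)) ~= 0"
proof -
 interpret a: comm_ring_hom "at_t :: 'f poly => _" by (rule at_t_hom)
 have nd: "n * d >= 1" using n d_props(1) by simp
 note u = det_fps_fls(2)[OF N, of n]
 show e: "inverse (mdet (1\<^sub>m a - inverse (at_t (map_poly iF rp) ^ n) \<cdot>\<^sub>m map_mat fls_const N)) =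
  fps_to_fls (inverse (det_fps n N))"
  unfolding det_fps_fls(1)[OF N] by (rule fls_inverse_unit[OF u nd])
 show "unit_mod (n * d) (inverse (det_fps n N))" by (rule unit_mod_inverse(1)[OF u nd])
 have u1: "inverse (det_fps n N) * det_fps n N = 1" by (rule unit_mod_inverse(2)[OF u nd])
 have nz1: "inverse (det_fps n N) ~= 0" using u1 by (metis mult_zero_left zero_neq_one)
 have nz: "det_fps n N ~= 0" using u1 by (metis mult_zero_right zero_neq_one)
 show "fps_to_fls (inverse (det_fps n N)) ~= 0" using nz1 by simp
 have P: "at_t (map_poly iF rp ^ n) ~= 0" using at_t_residue_nz by (simp add: a.hom_power)
 have "mdet (1\<^sub>m a - inverse (at_t (map_poly iF rp ^ n)) \<cdot>\<^sub>m map_mat fls_const N) : nonzero_ratfuns"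
  by (rule det_ratfun[OF N P]) (use det_fps_fls(1)[OF N, of n] nz in \<open>simp add: a.hom_power\<close>)
 thus "fps_to_fls (inverse (det_fps n N)) : nonzero_ratfuns"
  using nonzero_ratfuns_inverse e by (metis a.hom_power)
qed

lemma coinv_factor_eq:
 assumes PP: "PP' p = P"
 shows "coinv_factor iF iL z K V \<rho> PP' n p = inverse (mdet (1\<^sub>m m - inverse (at_t (map_poly iF rp) ^ n) \<cdot>\<^sub>m map_mat fls_const Fr))"
proof -
 have cl: "\<rho> \<phi> ` X : carrier W" if "X : carrier W" for X
 proof -
  obtain v where v: "v : carrier V" "X = cst v" using `X : carrier W` unfolding Wf(1) by blast
  thus ?thesis using cst_W[OF rep_closed[OF D_Gal[OF \<phi>(1)] v(1)]] by (simp add: image_cst[OF \<phi>(1)])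
 qed
 have "det_one_minus c W (%X. \<rho> \<phi> ` X) = mdet (1\<^sub>m m - c \<cdot>\<^sub>m map_mat fls_const Fr)" for c
  by (rule det_one_minus_coords[where \<phi> = "%X. \<rho> \<phi> ` X", OF coords_W cl Fr])
 thus ?thesis unfolding coinv_factor_def Let_def PP D_def[symmetric] In_def[symmetric] W_def[symmetric] \<phi>_def[symmetric] by simp
qed

lemma carlitz_coinv:
 assumes "PP' p = P" "n >= 1"
 shows "carlitz_factor iF iL z K V \<rho> n p = coinv_factor iF iL z K V \<rho> PP' n p"
 unfolding carlitz_eq_coinv[OF assms(2)] coinv_factor_eq[where PP' = PP', OF assms(1)] det_fps_fls(1)[OF Fr(1)] det_fps_def g0_def
 using Fr(1) by simp

text \<open>For the invariants it is enough that the factor comes from some square matrix over F,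
  and \<open>endo_mat\<close> has square shape by its definition.\<close>

lemma inv_factor_mat:
 assumes PP: "PP' p = P"
 shows "EX a N. N : carrier_mat a a & inv_factor iF iL z K V \<rho> PP' n p =
  inverse (mdet (1\<^sub>m a - inverse (at_t (map_poly iF rp) ^ n) \<cdot>\<^sub>m map_mat fls_const (N :: 'f mat)))"
proof -
 define N where "N = endo_mat (invariants V \<rho> (inertia_group B_ring K P)) (\<rho> \<phi>)"
 have c: "N : carrier_mat (dim_row N) (dim_row N)" unfolding N_def endo_mat_def endo_mat_wrt_def by (simp add: Let_def)
 have "inv_factor iF iL z K V \<rho> PP' n p =
  inverse (mdet (1\<^sub>m (dim_row N) - inverse (at_t (map_poly iF rp) ^ n) \<cdot>\<^sub>m map_mat fls_const N))"
  unfolding inv_factor_def Let_def PP det_one_minus_def \<phi>_def[symmetric] N_def[symmetric] by simp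
 thus ?thesis using c by blast
qed

text \<open>With trivial inertia \<open>U\<close> is zero, so invariants and coinvariants are both
  V, and \<open>pr\<close> is a coordinate map on V itself.\<close>

lemma unramified_factor:
 assumes PP: "PP' p = P" and In: "In = {id}"
 shows "inv_factor iF iL z K V \<rho> PP' n p = coinv_factor iF iL z K V \<rho> PP' n p"
proof -
 have V: "invariants V \<rho> {id} = V"
 proof -
  have "{v : carrier V. ALL g:{id}. \<rho> g v = v} = carrier V" using rep_id by auto
  thus ?thesis unfolding invariants_def by simp
 qed
 have "U <= {\<zero>\<^bsub>V\<^esub>}"
 proof (rule U_min)
  show "\<rho> \<sigma> v : {\<zero>\<^bsub>V\<^esub>}" if "\<sigma> : D" "v : {\<zero>\<^bsub>V\<^esub>}" for \<sigma> v
  proof -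
  have z: "0 \<odot>\<^bsub>V\<^esub> w = \<zero>\<^bsub>V\<^esub>" if "w : carrier V" for w using hs.V.smult_l_null[of w] that by (simp add: class_ring_simps)
  have "\<rho> \<sigma> \<zero>\<^bsub>V\<^esub> = \<rho> \<sigma> (0 \<odot>\<^bsub>V\<^esub> \<zero>\<^bsub>V\<^esub>)" using z[of "\<zero>\<^bsub>V\<^esub>"] by simp
  also have "... = 0 \<odot>\<^bsub>V\<^esub> \<rho> \<sigma> \<zero>\<^bsub>V\<^esub>" by (rule rep_smult[OF D_Gal[OF that(1)]]) simp
  also have "... = \<zero>\<^bsub>V\<^esub>" by (rule z[OF rep_closed[OF D_Gal[OF that(1)]]]) simp
  finally show ?thesis using that(2) by simp
  qed
  show "\<rho> \<tau> v \<ominus>\<^bsub>V\<^esub> v : {\<zero>\<^bsub>V\<^esub>}" if "\<tau> : In" "v : carrier V" for \<tau> v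
  using that In rep_id by (simp add: a_minus_def hs.V.r_neg)
  show "a \<odot>\<^bsub>V\<^esub> v : {\<zero>\<^bsub>V\<^esub>}" if "v : {\<zero>\<^bsub>V\<^esub>}" for a v
  using hs.V.smult_r_null[of a] that by (simp add: class_ring_simps)
 qed auto
 hence U0: "U = {\<zero>\<^bsub>V\<^esub>}" using U_props(2) by blast
 have "coords V m pr"
  unfolding coords_def
 proof (intro conjI ballI allI)
  have inj: "inj_on pr (carrier V)"
  proof (rule inj_onI)
  fix v w assume vw: "v : carrier V" "w : carrier V" "pr v = pr w"
  hence "v \<ominus>\<^bsub>V\<^esub> w = \<zero>\<^bsub>V\<^esub>" using pr_eq[OF vw(1,2)] U0 by simp
  moreover have "(v \<ominus>\<^bsub>V\<^esub> w) \<oplus>\<^bsub>V\<^esub> w = v" using vw by (simp add: a_minus_def hs.V.a_assoc hs.V.l_neg)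
  ultimately show "v = w" using vw(2) by simp
  qed
  have "pr ` carrier V = carrier_vec m" using pr_closed pr_surj by (auto simp: image_iff)
  thus "bij_betw pr (carrier V) (carrier_vec m)" using inj by (simp add: bij_betw_def)
  have "pr (\<zero>\<^bsub>V\<^esub> \<oplus>\<^bsub>V\<^esub> \<zero>\<^bsub>V\<^esub>) = pr \<zero>\<^bsub>V\<^esub> + pr \<zero>\<^bsub>V\<^esub>" by (rule pr_add) simp_all
  hence e: "pr \<zero>\<^bsub>V\<^esub> = pr \<zero>\<^bsub>V\<^esub> + pr \<zero>\<^bsub>V\<^esub>" by simp
  have c: "pr \<zero>\<^bsub>V\<^esub> : carrier_vec m" by (rule pr_closed) simp
  show "pr \<zero>\<^bsub>V\<^esub> = 0\<^sub>v m"
  proof (rule eq_vecI)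
  fix i assume i: "i < dim_vec (0\<^sub>v m :: 'f vec)"
  have "pr \<zero>\<^bsub>V\<^esub> $ i = (pr \<zero>\<^bsub>V\<^esub> + pr \<zero>\<^bsub>V\<^esub>) $ i" by (rule arg_cong[OF e, of "%v. v $ i"])
  also have "(pr \<zero>\<^bsub>V\<^esub> + pr \<zero>\<^bsub>V\<^esub>) $ i = pr \<zero>\<^bsub>V\<^esub> $ i + pr \<zero>\<^bsub>V\<^esub> $ i" by (rule index_add_vec(1)) (use c i in simp)
  finally have "pr \<zero>\<^bsub>V\<^esub> $ i = 0" by (simp only: add_cancel_right_right)
  thus "pr \<zero>\<^bsub>V\<^esub> $ i = 0\<^sub>v m $ i" using i by simp
  qed (use c in simp)
 qed (use V_closed pr_add pr_smult in auto)
 moreover have "pr (\<rho> \<phi> v) = Fr *\<^sub>v pr v" if "v : carrier V" for v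
  using pr_pow[OF that, of 1] Fr(1) by simp
 ultimately have "det_one_minus c V (\<rho> \<phi>) = mdet (1\<^sub>m m - c \<cdot>\<^sub>m map_mat fls_const Fr)" for c
  by (intro det_one_minus_coords[where T = pr]) (auto simp: rep_closed[OF D_Gal[OF \<phi>(1)]] Fr(1))
 thus ?thesis
  unfolding coinv_factor_eq[where PP' = PP', OF PP] inv_factor_def Let_def PP In_def[symmetric] \<phi>_def[symmetric] In V by simp
qed

end

theorem lemma1p5:
  fixes iF :: "'k::{field, finite} \<Rightarrow> 'f::field"
    and iL :: "'k \<Rightarrow> 'l::field"
    and z :: 'l
    and K :: "'l set"
    and PP :: "'l set \<Rightarrow> 'l set"
    and V :: "('f, 'v) module"
    and \<rho> :: "('l \<Rightarrow> 'l) \<Rightarrow> 'v \<Rightarrow> 'v"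
    and n :: nat
  assumes "field_hom iF" and "finite_extension (range iF) UNIV"
    and "field_hom iL" and "\<And>a. eval_at iL z a = 0 \<Longrightarrow> a = 0"
    and "finite_extension (ratfun_image iL z) K"
    and "finite_galois K"
    and "\<And>p. p \<in> max_ideals (ints iL z K) \<Longrightarrow>
           PP p \<in> primes_above (ints iL z K) (ints iL z UNIV) p"
    and "vectorspace class_ring V" and "vectorspace.fin_dim class_ring V"
    and "representation (Gal K) V \<rho>"
    and "n \<ge> 1"
  shows "uprod_convergent (carlitz_factor iF iL z K V \<rho> n) (max_ideals (ints iL z K)) \<and>
         uprod_convergent (coinv_factor iF iL z K V \<rho> PP n) (max_ideals (ints iL z K)) \<and>
         uprod_convergent (inv_factor iF iL z K V \<rho> PP n) (max_ideals (ints iL z K)) \<and>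
         L_carlitz iF iL z K V \<rho> n =
             uprod (coinv_factor iF iL z K V \<rho> PP n) (max_ideals (ints iL z K)) \<and>
         L_carlitz iF iL z K V \<rho> n \<in> one_units \<and>
         L_value iF iL z K V \<rho> PP n / L_carlitz iF iL z K V \<rho> n \<in> nonzero_ratfuns"
proof -
 interpret ff: function_field iL z K by (intro function_field.intro assms(3-6))
 let ?A = "max_ideals (ints iL z K)"
 have finF: "finite (UNIV :: 'f set)" by (rule finite_extension_finite[OF assms(2)])
 obtain b T0 where "coords V b T0" using coords_exists[OF assms(8,9)] by metis
 \<comment> \<open>F is finite over the finite field k, hence V is a finite set; the spaces of
   homomorphisms are finite for this reason.\<close>
 hence finV: "finite (carrier V)" using coords_finite finF by blast
 have pa: "prime_above iL z K p (PP p)" if "p : ?A" for p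
  by (rule prime_above.intro[OF ff.function_field_axioms], rule prime_above_axioms.intro) (use that assms(7) in auto)
 have pr: "prime_rep iL z K p (PP p) iF V \<rho>" if "p : ?A" for p
  by (rule prime_rep.intro[OF pa[OF that]], rule prime_rep_axioms.intro) (use assms(1,8,10) finF finV in auto)
 define deg where "deg p = prime_above.d iL z K (PP p)" for p
 \<comment> \<open>The factor at p involves the matrix only with a multiple of (1/t)^(n deg p) in
   front, so it agrees with 1 up to that order.\<close>
 define w where "w p = n * deg p" for p
 have deg1: "deg p >= 1" if "p : ?A" for p unfolding deg_def by (rule prime_above.d_props(1)[OF pa[OF that]])
 have fin_w: "finite {p : ?A. w p <= c}" for c
 proof -
  \<comment> \<open>The polynomial X^(q^e) - X. Its value at z lies in every p with residue field of
    degree e, and for e \<ge> 1 it is nonzero, so only finitely many primes contain it.\<close>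
  define u :: "nat => 'k poly" where "u e = [:0, 1:] ^ (card (UNIV :: 'k set) ^ e) - [:0, 1:]" for e
  have u0: "u e ~= 0" if "e >= 1" for e
  proof
  assume "u e = 0"
  hence "degree ([:0, 1 :: 'k:] ^ (card (UNIV :: 'k set) ^ e)) = degree [:0, 1 :: 'k:]" by (simp add: u_def)
  hence "card (UNIV :: 'k set) ^ e = 1" by (simp add: degree_power_eq)
  thus False using card_finite_field_ge_2[where ?'k = 'k] that by simp
  qed
  have "p : (\<Union>e\<in>{1..c}. {P. ff.prime_of ff.A P & eval_at iL z (u e) : P})" if p: "p : ?A" "w p <= c" for p
  proof -
  interpret pa: prime_above iL z K p "PP p" by (rule pa[OF p(1)])
  have d: "deg p = pa.d" by (simp add: deg_def)
  have le: "pa.d <= n * pa.d" using assms(11) by simp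
  have "n * pa.d <= c" using p(2) by (simp add: w_def d)
  with le have "pa.d <= c" by (rule order_trans)
  with pa.d_props(1) have e: "pa.d : {1..c}" by simp
  have uA: "eval_at iL z (u pa.d) = z ^ pa.Q - z"
   by (simp add: u_def ff.ev.hom_minus ff.ev.hom_power ff.ev_X pa.Q_def pa.q_def)
  have zA: "z ^ pa.Q - z : ff.A" by (intro ff.A_closed(2) ff.A_closed(10) ff.A_closed(7))
  have "pa.\<chi> (z ^ pa.Q) = pa.\<chi> z" using pa.\<chi>_A[OF ff.A_closed(7)] pa.\<chi>_power[OF ff.B_closed(7)] by simp
  hence "z ^ pa.Q - z : PP p" using pa.\<chi>_eq_iff[OF ff.B_closed(10)[OF ff.B_closed(7)] ff.B_closed(7)] by blast
  hence "eval_at iL z (u pa.d) : p" using pa.P_A zA uA by auto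
  thus ?thesis using ff.max_prime_of[OF p(1)] e by blast
  qed
  hence "{p : ?A. w p <= c} <= (\<Union>e\<in>{1..c}. {P. ff.prime_of ff.A P & eval_at iL z (u e) : P})" by blast
  moreover have "finite (\<Union>e\<in>{1..c}. {P. ff.prime_of ff.A P & eval_at iL z (u e) : P})"
  using ff.finite_primes[OF ff.subring_A] u0 by auto
  ultimately show ?thesis by (rule finite_subset)
 qed
 interpret uf: unit_family ?A w
  by unfold_locales (use deg1 assms(11) fin_w in \<open>auto simp: w_def\<close>)
 define Fc where "Fc p = inverse (prime_rep.det_fps iL z K p (PP p) iF n (prime_rep.Fr iL z K p (PP p) V \<rho>))" for p
 have coinv: "coinv_factor iF iL z K V \<rho> PP n p = fps_to_fls (Fc p)" "unit_mod (w p) (Fc p)"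
  "fps_to_fls (Fc p) : nonzero_ratfuns" "carlitz_factor iF iL z K V \<rho> n p = coinv_factor iF iL z K V \<rho> PP n p"
  if p: "p : ?A" for p
 proof -
  interpret pr: prime_rep iL z K p "PP p" iF V \<rho> by (rule pr[OF p])
  note e = pr.inverse_det_factor[OF pr.Fr(1) assms(11)]
  show "coinv_factor iF iL z K V \<rho> PP n p = fps_to_fls (Fc p)"
  unfolding pr.coinv_factor_eq[where PP' = PP, OF refl] e(1) Fc_def ..
  show "unit_mod (w p) (Fc p)" using e(2) by (simp add: Fc_def w_def deg_def)
  show "fps_to_fls (Fc p) : nonzero_ratfuns" using e(3) by (simp add: Fc_def)
  show "carlitz_factor iF iL z K V \<rho> n p = coinv_factor iF iL z K V \<rho> PP n p"
  by (rule pr.carlitz_coinv[where PP' = PP, OF refl assms(11)])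
 qed
 have "EX F. inv_factor iF iL z K V \<rho> PP n p = fps_to_fls F & unit_mod (w p) F & fps_to_fls F : nonzero_ratfuns"
  if p: "p : ?A" for p
 proof -
  interpret pr: prime_rep iL z K p "PP p" iF V \<rho> by (rule pr[OF p])
  obtain a A where A: "A : carrier_mat a a" and i: "inv_factor iF iL z K V \<rho> PP n p =
   inverse (mdet (1\<^sub>m a - inverse (at_t (map_poly iF (residue_char_poly iL z (ints iL z K) p)) ^ n) \<cdot>\<^sub>m map_mat fls_const A))"
  using pr.inv_factor_mat[where PP' = PP and n = n, OF refl] by blast
  note e = pr.inverse_det_factor[OF A assms(11)]
  show ?thesis using i e by (intro exI[of _ "inverse (pr.det_fps n A)"]) (simp add: w_def deg_def)
 qed
 then obtain Fi where inv: "!!p. p : ?A ==> inv_factor iF iL z K V \<rho> PP n p = fps_to_fls (Fi p)"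
  "!!p. p : ?A ==> unit_mod (w p) (Fi p)" "!!p. p : ?A ==> fps_to_fls (Fi p) : nonzero_ratfuns" by metis
 define Ram where "Ram = {p : ?A. inertia_group (ints iL z UNIV) K (PP p) ~= {id}}"
 have finRam: "finite Ram"
 proof -
  \<comment> \<open>This bounds ramification in place of a discriminant. For \<sigma> not the
    identity, an integral y is moved by \<sigma>; some nonzero u in k[z] makes u/(\<sigma> y - y)
    integral, and then u lies in every p whose chosen prime has \<sigma> in its inertia
    group.\<close>
  have "ALL \<sigma>. EX u. \<sigma> : Gal K & \<sigma> ~= id --> u ~= 0 & (ALL p:?A. (ALL x:ff.B. \<sigma> x - x : PP p) --> eval_at iL z u : p)"
  proof (intro allI)
  fix \<sigma>
  show "EX u. \<sigma> : Gal K & \<sigma> ~= id --> u ~= 0 & (ALL p:?A. (ALL x:ff.B. \<sigma> x - x : PP p) --> eval_at iL z u : p)"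
  proof (cases "\<sigma> : Gal K & \<sigma> ~= id")
   case True
   hence s: "\<sigma> : Gal K" by simp
   obtain x where x: "\<sigma> x ~= x" using True by (auto simp: fun_eq_iff)
   obtain v where v: "v ~= 0" "ff.integral (eval_at iL z v * x)" using ff.integral_multiple by metis
   define y where "y = eval_at iL z v * x"
   have y: "y : ff.B" using v(2) by (simp add: ff.B_def y_def)
   have "\<sigma> y - y = eval_at iL z v * (\<sigma> x - x)" by (simp add: y_def ff.GalD(2,8)[OF s] right_diff_distrib)
   hence b0: "\<sigma> y - y ~= 0" using v(1) x by simp
   obtain u where u: "u ~= 0" "ff.integral (eval_at iL z u * inverse (\<sigma> y - y))" using ff.integral_multiple by metis
   have "eval_at iL z u : p" if p: "p : ?A" and a: "ALL x:ff.B. \<sigma> x - x : PP p" for p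
   proof -
    interpret pa: prime_above iL z K p "PP p" by (rule pa[OF p])
    have "eval_at iL z u * inverse (\<sigma> y - y) : ff.B" using u(2) by (simp add: ff.B_def)
    hence "eval_at iL z u * inverse (\<sigma> y - y) * (\<sigma> y - y) : PP p" using a y by (intro pa.Pc(4)) auto
    hence "eval_at iL z u : PP p" using b0 by (simp add: mult.assoc)
    thus ?thesis using pa.P_A ff.A_closed(4)[of u] by blast
   qed
   thus ?thesis using u(1) by blast
   next
    case False
    thus ?thesis by (intro exI[of _ 0]) blast
   qed
  qed
  then obtain u where u: "!!\<sigma>. \<sigma> : Gal K ==> \<sigma> ~= id ==> u \<sigma> ~= 0"
  "!!\<sigma> p. \<sigma> : Gal K ==> \<sigma> ~= id ==> p : ?A ==> ALL x:ff.B. \<sigma> x - x : PP p ==> eval_at iL z (u \<sigma>) : p" by metis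
  have "p : (\<Union>\<sigma>\<in>Gal K - {id}. {P. ff.prime_of ff.A P & eval_at iL z (u \<sigma>) : P})" if p: "p : Ram" for p
  proof -
  have pA: "p : ?A" using p by (simp add: Ram_def)
  interpret pa: prime_above iL z K p "PP p" by (rule pa[OF pA])
  have "id : pa.In" using pa.D_id by (simp add: pa.In_iff)
  then obtain \<sigma> where s: "\<sigma> : pa.In" "\<sigma> ~= id" using p by (auto simp: Ram_def pa.In_def)
  hence sG: "\<sigma> : Gal K" and "ALL x:ff.B. \<sigma> x - x : PP p"
   using pa.D_Gal by (auto simp: pa.In_def inertia_group_def pa.D_def)
  hence "eval_at iL z (u \<sigma>) : p" using u(2) s(2) pA by blast
  thus ?thesis using sG s(2) ff.max_prime_of[OF pA] by blast
  qed
  hence "Ram <= (\<Union>\<sigma>\<in>Gal K - {id}. {P. ff.prime_of ff.A P & eval_at iL z (u \<sigma>) : P})" by blast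
  moreover have "finite (\<Union>\<sigma>\<in>Gal K - {id}. {P. ff.prime_of ff.A P & eval_at iL z (u \<sigma>) : P})"
  using ff.finite_primes[OF ff.subring_A] u(1) ff.finite_Gal by auto
  ultimately show ?thesis by (rule finite_subset)
 qed
 have Ram_A: "Ram <= ?A" by (auto simp: Ram_def)
 have unram: "Fi p = Fc p" if p: "p : ?A - Ram" for p
 proof -
  have pA: "p : ?A" using p by simp
  interpret pr: prime_rep iL z K p "PP p" iF V \<rho> by (rule pr[OF pA])
  have "pr.In = {id}" using p by (simp add: Ram_def pr.In_def)
  from pr.unramified_factor[where PP' = PP and n = n, OF refl this] have "fps_to_fls (Fi p) = fps_to_fls (Fc p)"
  using inv(1)[OF pA] coinv(1)[OF pA] by simp
  thus ?thesis by simp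
 qed
 note uc = uf.uprod_plim[of Fc "coinv_factor iF iL z K V \<rho> PP n", OF coinv(2,1)]
 note ui = uf.uprod_plim[of Fi "inv_factor iF iL z K V \<rho> PP n", OF inv(2,1)]
 note ul = uf.uprod_plim[of Fc "carlitz_factor iF iL z K V \<rho> n", OF coinv(2) trans[OF coinv(4) coinv(1)]]
 have L: "L_carlitz iF iL z K V \<rho> n = fps_to_fls (uf.plim Fc)" unfolding L_carlitz_def by (rule ul(2))
 have Lv: "L_value iF iL z K V \<rho> PP n = fps_to_fls (uf.plim Fi)" unfolding L_value_def by (rule ui(2))
 interpret h: comm_ring_hom "fps_to_fls :: 'f fps => _" by (rule fps_to_fls_hom)
 \<comment> \<open>Both products have the same factors off \<open>Ram\<close>, so their ratio is a
   finite product of local ratios, each of them a rational function.\<close>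
 have "uf.plim Fi * prod Fc Ram = uf.plim Fc * prod Fi Ram"
  by (rule uf.plim_finite_change[OF inv(2) coinv(2) finRam Ram_A unram])
 hence e: "fps_to_fls (uf.plim Fi) * (\<Prod>p\<in>Ram. fps_to_fls (Fc p)) = fps_to_fls (uf.plim Fc) * (\<Prod>p\<in>Ram. fps_to_fls (Fi p))"
  by (simp only: h.hom_mult[symmetric] h.hom_prod[symmetric])
 have nz: "fps_to_fls (uf.plim Fc) ~= 0"
  using unit_mod_inverse(2)[OF uc(3)] by (auto simp: fps_to_fls_eq_0_iff)
 have nzc: "(\<Prod>p\<in>Ram. fps_to_fls (Fc p)) ~= 0"
 proof -
  have "fps_to_fls (Fc p) ~= 0" if "p : Ram" for p
  proof -
  have pA: "p : ?A" using that Ram_A by blast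
  have "w p >= 1" using deg1[OF pA] assms(11) by (simp add: w_def)
  thus ?thesis using unit_mod_inverse(2)[OF coinv(2)[OF pA]] by auto
  qed
  thus ?thesis using finRam by simp
 qed
 have "fps_to_fls (uf.plim Fi) / fps_to_fls (uf.plim Fc) =
  (\<Prod>p\<in>Ram. fps_to_fls (Fi p)) * inverse (\<Prod>p\<in>Ram. fps_to_fls (Fc p))"
  using e nz nzc by (simp add: field_simps)
 also have "... : nonzero_ratfuns"
  using inv(3) coinv(3) Ram_A by (intro nonzero_ratfuns_mult nonzero_ratfuns_inverse nonzero_ratfuns_prod) auto
 finally have ratio: "L_value iF iL z K V \<rho> PP n / L_carlitz iF iL z K V \<rho> n : nonzero_ratfuns" unfolding L Lv .
 have "L_carlitz iF iL z K V \<rho> n = uprod (coinv_factor iF iL z K V \<rho> PP n) ?A" unfolding L by (rule uc(2)[symmetric])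
 moreover have "L_carlitz iF iL z K V \<rho> n : one_units" unfolding L_carlitz_def by (rule ul(4))
 ultimately show ?thesis using ul(1) uc(1) ui(1) ratio by blast
qed

end
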